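(* Let $T>0$, $L>0$ and $\alpha\in(0,2)$. For any $(w_0,w_1)\in L^2(0,L)\times H_\alpha^*(0,L)$ and any $\theta\in L^2(0,T)$, the system $$\begin{cases} w_{tt}-(x^\alpha w_x)_x=0, & (x,t)\in (0,L)\times(0,T),\\ w(0,t)=0 \ \text{ if } 0<\alpha<1,\qquad (x^\alpha w_x)(0,t)=0\ \text{ if } \alpha\ge 1, & t\in(0,T),\\ w(L,t)=\theta(t), & t\in(0,T),\\ w(x,0)=w_0(x),\quad w_t(x,0)=w_1(x), & x\in(0,L),\end{cases}$$ admits a unique solution $w$ in the sense of transposition, and $w\in\mathscr{K}:=C([0,T];L^2(0,L))\cap C^1([0,T];H_\alpha^*(0,L))$. Moreover, there is a constant $C>0$, independent of $w_0,w_1,\theta$, such that $$\|w\|_{\mathscr{K}}\le C\big(\|w_0\|_{L^2(0,L)}+\|w_1\|_{H_\alpha^*(0,L)}+\|\theta\|_{L^2(0,T)}\big).$$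
   Context: Put $Q=(0,L)\times(0,T)$. All functions are real-valued. Space $H^1_\alpha(0,L)$. If $0<\alpha<1$, it is the set of $u\in L^2(0,L)$ that are absolutely continuous on $[0,L]$ with $x^{\alpha/2}u_x\in L^2(0,L)$ and $u(0)=u(L)=0$. If $\alpha\ge1$, it is the set of $u\in L^2(0,L)$ that are locally absolutely continuous on $(0,L]$ with $x^{\alpha/2}u_x\in L^2(0,L)$ and $u(L)=0$. It is a Hilbert space with inner product $(u,v)=\int_0^L(uv+x^\alpha u_xv_x)\,dx$; its norm is taken as $\|u\|_{H^1_\alpha(0,L)}=\|u\|_{L^2(0,L)}+\|x^{\alpha/2}u_x\|_{L^2(0,L)}$. $H_\alpha^*(0,L)$ is its dual space with the dual norm, and $L^2(0,L)$ is regarded as a subspace of $H^*_\alpha(0,L)$ in the usual way. Weak solutions. For $f\in L^1(0,T;L^2(0,L))$ and $(y_0,y_1)\in H^1_\alpha(0,L)\times L^2(0,L)$, a weak solution of $y_{tt}-(x^\alpha y_x)_x=f$ in $Q$, with boundary conditions $y(0,t)=0$ (if $0<\alpha<1$) or $(x^\alpha y_x)(0,t)=0$ (if $\alpha\ge1$), $y(L,t)=0$, and initial data $y(\cdot,0)=y_0$, $y_t(\cdot,0)=y_1$, is a function $y\in C([0,T];H^1_\alpha(0,L))\cap C^1([0,T];L^2(0,L))$ with $y(\cdot,0)=y_0$ and $$\int_Q(-y_t\varphi_t+x^\alpha y_x\varphi_x)\,dx\,dt-\int_0^Ly_1\varphi(x,0)\,dx=\int_Qf\varphi\,dx\,dt$$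 for all $\varphi\in L^2(0,T;H^1_\alpha(0,L))$ with $\varphi_t\in L^2(Q)$ and $\varphi(\cdot,T)=0$. Weak solutions of the problem with data prescribed at $t=T$ are defined by reversing time. Boundary trace. For a weak solution $v$ with right-hand side $f$, the trace $v_x(L,\cdot)$ is understood in the weak sense: it is the function $g\in L^2(0,T)$ such that $\int_Q(-v_t\varphi_t+x^\alpha v_x\varphi_x)\,dx\,dt-\int_Qf\varphi\,dx\,dt=L^\alpha\int_0^Tg(t)\varphi(L,t)\,dt$ for every smooth $\varphi$ with compact support in $(0,L]\times(0,T)$. Solution in the sense of transposition. A function $w\in C([0,T];L^2(0,L))$ is a solution of the controlled system in the sense of transposition if for every $\xi\in L^1(0,T;L^2(0,L))$, $$\int_Qw\xi\,dx\,dt=\langle w_1,v(0)\rangle_{H_\alpha^*(0,L),H_\alpha^1(0,L)}-\int_0^Lw_0v_t(0)\,dx-L^\alpha\int_0^T\theta(t)v_x(L,t)\,dt,$$ where $v$ is the weak solution of $v_{tt}-(x^\alpha v_x)_x=\xi$ in $Q$, with $v(0,t)=0$ if $0<\alpha<1$ or $(x^\alpha v_x)(0,t)=0$ if $\alpha\ge1$, $v(L,t)=0$, and $v(x,T)=v_t(x,T)=0$. The norm on $\mathscr{K}$ is $\|w\|_{\mathscr K}=\max_{t\in[0,T]}\|w(t)\|_{L^2(0,L)}+\max_{t\in[0,T]}\|w_t(t)\|_{H^*_\alpha(0,L)}$. *)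

theory Defs
  imports "HOL-Analysis.Analysis"
begin

text \<open>
  Elements of the function spaces are represented by functions on the whole line; values outside
  the relevant interval are irrelevant, and spaces of classes are equipped with seminorms, so
  equality of elements is equality almost everywhere.  Functions on \<open>Q\<close> are curried with the time
  variable first, \<open>y t x\<close>, so that \<open>y t\<close> is the spatial profile at time \<open>t\<close>; integrals over
  \<open>Q\<close> are iterated integrals, which do not depend on the representatives chosen at each time.
\<close>

section \<open>Spaces on an interval\<close>

definition L2_space :: "real \<Rightarrow> (real \<Rightarrow> real) set" where
  "L2_space L = {u. u \<in> borel_measurable (lebesgue_on {0<..<L}) \<and>
                    integrable (lebesgue_on {0<..<L}) (\<lambda>x. (u x)\<^sup>2)}"

definition L2_norm :: "real \<Rightarrow> (real \<Rightarrow> real) \<Rightarrow> real" where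
  "L2_norm L u = sqrt (LINT x|lebesgue_on {0<..<L}. (u x)\<^sup>2)"

definition abs_cont_on :: "real \<Rightarrow> real \<Rightarrow> (real \<Rightarrow> real) \<Rightarrow> bool" where
  "abs_cont_on a b u \<longleftrightarrow>
     (\<forall>\<epsilon>>0. \<exists>\<delta>>0. \<forall>D :: (real \<times> real) set.
        finite D \<and> (\<forall>(c, d)\<in>D. a \<le> c \<and> c \<le> d \<and> d \<le> b) \<and>
        pairwise (\<lambda>p q. {fst p<..<snd p} \<inter> {fst q<..<snd q} = {}) D \<and>
        (\<Sum>(c, d)\<in>D. d - c) < \<delta> \<longrightarrow>
        (\<Sum>(c, d)\<in>D. \<bar>u d - u c\<bar>) < \<epsilon>)"

text \<open>
  The derivative \<open>u_x\<close> of a (locally) absolutely continuous function exists almost everywhere and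
  is rendered by \<^const>\<open>deriv\<close>.
\<close>

definition H1_space :: "real \<Rightarrow> real \<Rightarrow> (real \<Rightarrow> real) set" where
  "H1_space \<alpha> L =
     {u. u \<in> L2_space L \<and> (\<lambda>x. x powr (\<alpha> / 2) * deriv u x) \<in> L2_space L \<and> u L = 0 \<and>
         (if \<alpha> < 1 then abs_cont_on 0 L u \<and> u 0 = 0
          else (\<forall>a. 0 < a \<and> a < L \<longrightarrow> abs_cont_on a L u))}"

definition H1_norm :: "real \<Rightarrow> real \<Rightarrow> (real \<Rightarrow> real) \<Rightarrow> real" where
  "H1_norm \<alpha> L u = L2_norm L u + L2_norm L (\<lambda>x. x powr (\<alpha> / 2) * deriv u x)"

text \<open>
  The dual space: functionals are defined on all functions, but only their values on
  \<^term>\<open>H1_space \<alpha> L\<close> matter.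
\<close>

definition Hdual_space :: "real \<Rightarrow> real \<Rightarrow> ((real \<Rightarrow> real) \<Rightarrow> real) set" where
  "Hdual_space \<alpha> L =
     {F. (\<forall>u\<in>H1_space \<alpha> L. \<forall>v\<in>H1_space \<alpha> L. F (\<lambda>x. u x + v x) = F u + F v) \<and>
         (\<forall>c. \<forall>u\<in>H1_space \<alpha> L. F (\<lambda>x. c * u x) = c * F u) \<and>
         (\<exists>B. \<forall>u\<in>H1_space \<alpha> L. \<bar>F u\<bar> \<le> B * H1_norm \<alpha> L u)}"

definition Hdual_norm :: "real \<Rightarrow> real \<Rightarrow> ((real \<Rightarrow> real) \<Rightarrow> real) \<Rightarrow> real" where
  "Hdual_norm \<alpha> L F = (SUP u\<in>{u \<in> H1_space \<alpha> L. H1_norm \<alpha> L u \<le> 1}. \<bar>F u\<bar>)"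

definition L2_embed :: "real \<Rightarrow> (real \<Rightarrow> real) \<Rightarrow> (real \<Rightarrow> real) \<Rightarrow> real" where
  "L2_embed L z = (\<lambda>u. LINT x|lebesgue_on {0<..<L}. z x * u x)"

section \<open>Vector-valued functions of time\<close>

text \<open>
  Below, \<open>V\<close> is a space of real functions (on the line, or functionals) and \<open>N\<close> its seminorm.
\<close>

definition cont_into ::
  "('a \<Rightarrow> real) set \<Rightarrow> (('a \<Rightarrow> real) \<Rightarrow> real) \<Rightarrow> real \<Rightarrow> (real \<Rightarrow> 'a \<Rightarrow> real) \<Rightarrow> bool" where
  "cont_into V N T y \<longleftrightarrow>
     (\<forall>t\<in>{0..T}. y t \<in> V \<and> ((\<lambda>s. N (\<lambda>x. y s x - y t x)) \<longlongrightarrow> 0) (at t within {0..T}))"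

definition has_time_deriv ::
  "(('a \<Rightarrow> real) \<Rightarrow> real) \<Rightarrow> real \<Rightarrow> (real \<Rightarrow> 'a \<Rightarrow> real) \<Rightarrow> (real \<Rightarrow> 'a \<Rightarrow> real) \<Rightarrow> bool" where
  "has_time_deriv N T y y' \<longleftrightarrow>
     (\<forall>t\<in>{0..T}. ((\<lambda>s. N (\<lambda>x. (y s x - y t x) / (s - t) - y' t x)) \<longlongrightarrow> 0)
                    (at t within {0..T}))"

definition strongly_measurable_into ::
  "('a \<Rightarrow> real) set \<Rightarrow> (('a \<Rightarrow> real) \<Rightarrow> real) \<Rightarrow> real \<Rightarrow> (real \<Rightarrow> 'a \<Rightarrow> real) \<Rightarrow> bool" where
  "strongly_measurable_into V N T f \<longleftrightarrow>
     (\<exists>s :: nat \<Rightarrow> real \<Rightarrow> 'a \<Rightarrow> real.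
        (\<forall>n. finite (s n ` {0<..<T}) \<and> s n ` {0<..<T} \<subseteq> V \<and>
             (\<forall>v. {t \<in> {0<..<T}. s n t = v} \<in> sets lebesgue)) \<and>
        (AE t in lebesgue_on {0<..<T}. (\<lambda>n. N (\<lambda>x. s n t x - f t x)) \<longlonglongrightarrow> 0))"

text \<open>The Bochner space \<open>L^p(0,T;V)\<close>; \<open>L^2(0,T;L^2(0,L))\<close> is identified with \<open>L^2(Q)\<close>.\<close>

definition Bochner_Lp ::
  "nat \<Rightarrow> ('a \<Rightarrow> real) set \<Rightarrow> (('a \<Rightarrow> real) \<Rightarrow> real) \<Rightarrow> real \<Rightarrow> (real \<Rightarrow> 'a \<Rightarrow> real) set" where
  "Bochner_Lp p V N T =
     {f. strongly_measurable_into V N T f \<and> (AE t in lebesgue_on {0<..<T}. f t \<in> V) \<and>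
         integrable (lebesgue_on {0<..<T}) (\<lambda>t. N (f t) ^ p)}"

definition integral_Q :: "real \<Rightarrow> real \<Rightarrow> (real \<Rightarrow> real \<Rightarrow> real) \<Rightarrow> real" where
  "integral_Q L T g = (LINT t|lebesgue_on {0<..<T}. LINT x|lebesgue_on {0<..<L}. g t x)"

section \<open>Smooth functions of time and space\<close>

text \<open>\<open>D i j\<close> is the partial derivative of order \<open>i\<close> in time and \<open>j\<close> in space.\<close>

definition smooth2 :: "(real \<Rightarrow> real \<Rightarrow> real) \<Rightarrow> bool" where
  "smooth2 \<phi> \<longleftrightarrow>
     (\<exists>D :: nat \<Rightarrow> nat \<Rightarrow> real \<Rightarrow> real \<Rightarrow> real. D 0 0 = \<phi> \<and>
        (\<forall>i j. continuous_on UNIV (\<lambda>(t, x). D i j t x) \<and>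
           (\<forall>t x. ((\<lambda>s. D i j s x) has_real_derivative D (Suc i) j t x) (at t) \<and>
                  ((\<lambda>z. D i j t z) has_real_derivative D i (Suc j) t x) (at x))))"

text \<open>
  The support is taken relative to \<open>S\<close>: for \<open>S = (0,T) \<times> (0,L]\<close> these are the functions smooth up
  to the lateral boundary \<open>x = L\<close>, given as restrictions of smooth functions on the plane.
\<close>

definition smooth_compact_support_in :: "(real \<times> real) set \<Rightarrow> (real \<Rightarrow> real \<Rightarrow> real) \<Rightarrow> bool" where
  "smooth_compact_support_in S \<phi> \<longleftrightarrow>
     smooth2 \<phi> \<and> compact (closure {(t, x) \<in> S. \<phi> t x \<noteq> 0}) \<and>
     closure {(t, x) \<in> S. \<phi> t x \<noteq> 0} \<subseteq> S"

section \<open>Weak solutions and boundary traces\<close>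

text \<open>\<open>\<phi>' = \<phi>_t\<close> in the sense of distributions on \<open>Q\<close>.\<close>

definition weak_time_deriv ::
  "real \<Rightarrow> real \<Rightarrow> (real \<Rightarrow> real \<Rightarrow> real) \<Rightarrow> (real \<Rightarrow> real \<Rightarrow> real) \<Rightarrow> bool" where
  "weak_time_deriv L T \<phi> \<phi>' \<longleftrightarrow>
     (\<forall>\<eta>. smooth_compact_support_in ({0<..<T} \<times> {0<..<L}) \<eta> \<longrightarrow>
        integral_Q L T (\<lambda>t x. \<phi> t x * deriv (\<lambda>s. \<eta> s x) t) =
        - integral_Q L T (\<lambda>t x. \<phi>' t x * \<eta> t x))"

text \<open>
  Test functions \<open>\<phi>\<close> together with \<open>\<phi>' = \<phi>_t\<close>.  Since \<open>\<phi>\<close> and \<open>\<phi>_t\<close> lie in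
  \<open>L^2(0,T;L^2(0,L))\<close>, the class of \<open>\<phi>\<close> has a representative in \<open>C([0,T];L^2(0,L))\<close>; \<open>\<phi>\<close> is taken
  to be that representative, which gives \<open>\<phi>(\<cdot>,T)\<close> and \<open>\<phi>(\<cdot>,0)\<close> their meaning.
\<close>

definition test_function ::
  "real \<Rightarrow> real \<Rightarrow> real \<Rightarrow> (real \<Rightarrow> real \<Rightarrow> real) \<Rightarrow> (real \<Rightarrow> real \<Rightarrow> real) \<Rightarrow> bool" where
  "test_function \<alpha> L T \<phi> \<phi>' \<longleftrightarrow>
     \<phi> \<in> Bochner_Lp 2 (H1_space \<alpha> L) (H1_norm \<alpha> L) T \<and>
     \<phi>' \<in> Bochner_Lp 2 (L2_space L) (L2_norm L) T \<and>
     weak_time_deriv L T \<phi> \<phi>' \<and>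
     cont_into (L2_space L) (L2_norm L) T \<phi> \<and>
     (AE x in lebesgue_on {0<..<L}. \<phi> T x = 0)"

text \<open>
  \<open>y'\<close> is the time derivative \<open>y_t\<close>, which is determined by \<open>y\<close> as a curve in \<open>L^2(0,L)\<close>.  The
  boundary conditions are part of \<^const>\<open>H1_space\<close> and of the weak formulation.
\<close>

definition weak_solution ::
  "real \<Rightarrow> real \<Rightarrow> real \<Rightarrow> (real \<Rightarrow> real \<Rightarrow> real) \<Rightarrow> (real \<Rightarrow> real) \<Rightarrow> (real \<Rightarrow> real) \<Rightarrow>
   (real \<Rightarrow> real \<Rightarrow> real) \<Rightarrow> (real \<Rightarrow> real \<Rightarrow> real) \<Rightarrow> bool" where
  "weak_solution \<alpha> L T f y0 y1 y y' \<longleftrightarrow>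
     cont_into (H1_space \<alpha> L) (H1_norm \<alpha> L) T y \<and>
     has_time_deriv (L2_norm L) T y y' \<and>
     cont_into (L2_space L) (L2_norm L) T y' \<and>
     (AE x in lebesgue_on {0<..<L}. y 0 x = y0 x) \<and>
     (\<forall>\<phi> \<phi>'. test_function \<alpha> L T \<phi> \<phi>' \<longrightarrow>
        integral_Q L T (\<lambda>t x. - y' t x * \<phi>' t x + x powr \<alpha> * deriv (y t) x * deriv (\<phi> t) x)
        - (LINT x|lebesgue_on {0<..<L}. y1 x * \<phi> 0 x)
        = integral_Q L T (\<lambda>t x. f t x * \<phi> t x))"

text \<open>
  Data \<open>z0, z1\<close> prescribed at \<open>t = T\<close>: under \<open>t \<mapsto> T - t\<close> the time derivative changes sign.
\<close>

definition backward_weak_solution ::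
  "real \<Rightarrow> real \<Rightarrow> real \<Rightarrow> (real \<Rightarrow> real \<Rightarrow> real) \<Rightarrow> (real \<Rightarrow> real) \<Rightarrow> (real \<Rightarrow> real) \<Rightarrow>
   (real \<Rightarrow> real \<Rightarrow> real) \<Rightarrow> (real \<Rightarrow> real \<Rightarrow> real) \<Rightarrow> bool" where
  "backward_weak_solution \<alpha> L T f z0 z1 v v' \<longleftrightarrow>
     weak_solution \<alpha> L T (\<lambda>t. f (T - t)) z0 (\<lambda>x. - z1 x)
       (\<lambda>t. v (T - t)) (\<lambda>t x. - v' (T - t) x)"

text \<open>\<open>g\<close> is the weak trace \<open>v_x(L,\<cdot>)\<close> of a weak solution \<open>v\<close> with right-hand side \<open>f\<close>.\<close>

definition is_boundary_trace ::
  "real \<Rightarrow> real \<Rightarrow> real \<Rightarrow> (real \<Rightarrow> real \<Rightarrow> real) \<Rightarrow>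
   (real \<Rightarrow> real \<Rightarrow> real) \<Rightarrow> (real \<Rightarrow> real \<Rightarrow> real) \<Rightarrow> (real \<Rightarrow> real) \<Rightarrow> bool" where
  "is_boundary_trace \<alpha> L T f v v' g \<longleftrightarrow>
     g \<in> L2_space T \<and>
     (\<forall>\<phi>. smooth_compact_support_in ({0<..<T} \<times> {0<..L}) \<phi> \<longrightarrow>
        integral_Q L T (\<lambda>t x. - v' t x * deriv (\<lambda>s. \<phi> s x) t
                              + x powr \<alpha> * deriv (v t) x * deriv (\<phi> t) x)
        - integral_Q L T (\<lambda>t x. f t x * \<phi> t x)
        = L powr \<alpha> * (LINT t|lebesgue_on {0<..<T}. g t * \<phi> t L))"

section \<open>Solutions in the sense of transposition\<close>

text \<open>
  ``The weak solution \<open>v\<close>'' with source \<open>\<xi>\<close>, zero data at \<open>t = T\<close> and trace \<open>g = v_x(L,\<cdot>)\<close> is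
  read as a definite description: such \<open>v\<close> and \<open>g\<close> exist, and the identity holds for them however
  they are represented.
\<close>

definition transposition_solution ::
  "real \<Rightarrow> real \<Rightarrow> real \<Rightarrow> (real \<Rightarrow> real) \<Rightarrow> ((real \<Rightarrow> real) \<Rightarrow> real) \<Rightarrow> (real \<Rightarrow> real) \<Rightarrow>
   (real \<Rightarrow> real \<Rightarrow> real) \<Rightarrow> bool" where
  "transposition_solution \<alpha> L T w0 w1 \<theta> w \<longleftrightarrow>
     cont_into (L2_space L) (L2_norm L) T w \<and>
     (\<forall>\<xi> \<in> Bochner_Lp 1 (L2_space L) (L2_norm L) T.
        (\<exists>v v' g. backward_weak_solution \<alpha> L T \<xi> (\<lambda>x. 0) (\<lambda>x. 0) v v' \<and>
                  is_boundary_trace \<alpha> L T \<xi> v v' g) \<and>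
        (\<forall>v v' g. backward_weak_solution \<alpha> L T \<xi> (\<lambda>x. 0) (\<lambda>x. 0) v v' \<and>
                  is_boundary_trace \<alpha> L T \<xi> v v' g \<longrightarrow>
           integral_Q L T (\<lambda>t x. w t x * \<xi> t x) =
             w1 (v 0) - (LINT x|lebesgue_on {0<..<L}. w0 x * v' 0 x)
             - L powr \<alpha> * (LINT t|lebesgue_on {0<..<T}. \<theta> t * g t)))"

text \<open>
  \<open>w\<close> belongs to \<open>C([0,T];L^2(0,L)) \<inter> C^1([0,T];H_\<alpha>^*(0,L))\<close> with time derivative \<open>w'\<close>.
\<close>

definition in_K ::
  "real \<Rightarrow> real \<Rightarrow> real \<Rightarrow> (real \<Rightarrow> real \<Rightarrow> real) \<Rightarrow> (real \<Rightarrow> (real \<Rightarrow> real) \<Rightarrow> real) \<Rightarrow> bool" where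
  "in_K \<alpha> L T w w' \<longleftrightarrow>
     cont_into (L2_space L) (L2_norm L) T w \<and>
     has_time_deriv (Hdual_norm \<alpha> L) T (\<lambda>t. L2_embed L (w t)) w' \<and>
     cont_into (Hdual_space \<alpha> L) (Hdual_norm \<alpha> L) T w'"

text \<open>The suprema are maxima, by continuity of \<open>w\<close> and \<open>w'\<close> on \<open>[0,T]\<close>.\<close>

definition K_norm ::
  "real \<Rightarrow> real \<Rightarrow> real \<Rightarrow> (real \<Rightarrow> real \<Rightarrow> real) \<Rightarrow> (real \<Rightarrow> (real \<Rightarrow> real) \<Rightarrow> real) \<Rightarrow> real" where
  "K_norm \<alpha> L T w w' =
     (SUP t\<in>{0..T}. L2_norm L (w t)) + (SUP t\<in>{0..T}. Hdual_norm \<alpha> L (w' t))"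

end

theory Submission
  imports Defs "HOL-Complex_Analysis.Great_Picard" "HOL-Real_Asymp.Real_Asymp"
begin

text \<open>
  The operator \<open>u \<mapsto> -(x\<^sup>\<alpha> u')'\<close> with its boundary conditions has the inverse \<open>R R\<^sup>*\<close>, where \<open>R q (x)\<close> is minus the
  integral of \<open>s powr (-\<alpha>/2) * q s\<close> over \<open>(x, L)\<close> (restricted to \<open>q\<close> orthogonal to \<open>s powr (-\<alpha>/2)\<close> when
  \<open>\<alpha> < 1\<close>, which is the condition \<open>u 0 = 0\<close>). \<open>R\<close> maps onto \<open>H\<^sup>1\<^sub>\<alpha>\<close> and is compact, by Arzela--Ascoli for
  \<open>x * R q (x)\<close>. The spectral theorem gives an orthonormal eigenbasis \<open>e\<^sub>n\<close> with frequencies \<open>\<omega>\<^sub>n\<close>, and all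
  spaces and equations become statements about coefficients of independent oscillators.

  For finite sums of modes, a multiplier supported in \<open>[L/2, L]\<close> bounds the boundary trace in \<open>L\<^sup>2(0,T)\<close> by the
  energy, uniformly in the number of modes; this gives the trace of weak solutions, and by duality it bounds
  the response to the boundary control \<open>\<theta>\<close>. Continuity in time is proved in the rotating frame, where the
  curves are primitives, and is carried back by the rotation.

  Testing the weak formulation with \<open>\<eta>(t) e\<^sub>n(x)\<close> shows that the modes of every weak solution solve the scalar
  oscillator equation. Hence the transposition identity may be checked mode by mode, and it determines \<open>w\<close>
  because \<open>\<xi>(t,x) = q(t) e\<^sub>n(x)\<close> is an admissible source.
\<close>

text \<open>The equation degenerates at x = 0, so everything is routed through the weighted
  gradient, which lives in plain L2 and determines u by integration from x = L. Factoring the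
  inverse operator also makes the flux of an eigenfunction a primitive, hence continuous up to x =
  L; this gives a pointwise meaning to the boundary derivative of a mode. The energy space is
  phrased with epsilon-delta absolute continuity and \<open>deriv\<close>; identifying it with the
  range of R therefore rests on the fact that absolutely continuous functions are primitives,
  obtained from Radon-Nikodym. The multiplier stays away from 0 so that only interior regularity
  enters. The frequencies are unbounded, so \<open>cos (om n * t)\<close> is not equicontinuous over
  n; increments of the rotating coordinates are integrals over [s,t] and escape this difficulty, and
  the rotation itself needs only dominated convergence at each fixed time. For a source that is
  merely L1 in time the trace is not estimated directly: its tail is paired with a control and
  becomes the response to that control.\<close>

type_synonym rfun = "real => real"
abbreviation leb :: "real => real measure" where "leb T \<equiv> lebesgue_on {0<..<T}"
abbreviation AI :: "(real => real) => real set => bool" (infixr "AI" 46) where "f AI S \<equiv> f absolutely_integrable_on S"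
abbreviation disj_intervals :: "(real \<times> real) set => bool" where
 "disj_intervals \<equiv> pairwise (\<lambda>p q. {fst p<..<snd p} \<inter> {fst q<..<snd q} = {})"
abbreviation cont :: "real => (real => 'a::topological_space) => bool" where "cont T \<equiv> continuous_on {0..T}"
abbreviation meas :: "real => (real => real) set" where "meas T \<equiv> borel_measurable (leb T)"
abbreviation has_der :: "rfun => real => real filter => bool" (infix "has'_der" 50) where
 "f has_der D \<equiv> f has_real_derivative D"
lemmas hk = set_lebesgue_integral_eq_integral(1)
lemmas hk_able_diff = Henstock_Kurzweil_Integration.integrable_diff
lemmas hk_able_reflect_real = Henstock_Kurzweil_Integration.integrable_reflect_real
lemmas hk_add = Henstock_Kurzweil_Integration.integral_add
lemmas hk_combine = Henstock_Kurzweil_Integration.integral_combine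
lemmas hk_diff = Henstock_Kurzweil_Integration.integral_diff
lemmas hk_neg = Henstock_Kurzweil_Integration.integral_neg
lemmas hk_nonneg = Henstock_Kurzweil_Integration.integral_nonneg
lemmas hk_reflect_real = Henstock_Kurzweil_Integration.integral_reflect_real
lemmas LINT_able_add = Bochner_Integration.integrable_add
lemmas LINT_able_bound = Bochner_Integration.integrable_bound
lemmas LINT_able_cong = Bochner_Integration.integrable_cong
lemmas LINT_able_diff = Bochner_Integration.integrable_diff
lemmas LINT_add = Bochner_Integration.integral_add
lemmas LINT_cong = Bochner_Integration.integral_cong
lemmas LINT_diff = Bochner_Integration.integral_diff
lemmas LINT_nonneg = Bochner_Integration.integral_nonneg
lemmas LINT_sum = Bochner_Integration.integral_sum

section \<open>Absolutely continuous functions\<close>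

text \<open>Lebesgue differentiation for primitives. The averages over \<open>{x..x + h}\<close>
  with \<open>h > 0\<close> give right derivatives only; the left ones come from the reflected
  function, so the exceptional set is \<open>N\<close> together with the mirror image of
  \<open>N'\<close>.\<close>

lemma negligible_not_derivable:
 fixes f :: rfun
 assumes f: "f integrable_on {a..b}"
 shows "negligible {x \<in> {a<..<b}. \<not> ((\<lambda>x. integral {a..x} f) has_der f x) (at x)}"
proof -
 define g where "g \<equiv> \<lambda>x. if x \<in> {a..b} then f x else 0"
 have g: "g integrable_on {c..d}" for c d
  using integrable_on_subinterval[of g UNIV c d] f integrable_restrict_UNIV[of "{a..b}" f] unfolding g_def by blast
 obtain N where N: "negligible N" "\<And>x e. x \<notin> N ==> 0 < e ==>
   \<exists>d>0. \<forall>h. 0 < h \<and> h < d --> \<bar>integral {x..x + h} g / h - g x\<bar> < e"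
  using integrable_ccontinuous_explicit[of g] g by (auto simp: divide_inverse_commute)
 have g': "(\<lambda>x. g (- x)) integrable_on {c..d}" for c d
  using g[of "- d" "- c"] hk_able_reflect_real[of g "- c" "- d"] by simp
 obtain N' where N': "negligible N'" "\<And>x e. x \<notin> N' ==> 0 < e ==>
   \<exists>d>0. \<forall>h. 0 < h \<and> h < d --> \<bar>integral {x..x + h} (\<lambda>x. g (- x)) / h - g (- x)\<bar> < e"
  using integrable_ccontinuous_explicit[of "\<lambda>x. g (- x)"] g' by (auto simp: divide_inverse_commute)
 have "((\<lambda>x. integral {a..x} f) has_der f x) (at x)" if x: "x \<in> {a<..<b}" "x \<notin> N" "- x \<notin> N'" for x
  unfolding DERIV_def LIM_eq
 proof (intro allI impI)
  fix e :: real assume e: "0 < e"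
  obtain d d' where d: "d > 0" "\<And>h. 0 < h ==> h < d ==> \<bar>integral {x..x + h} g / h - g x\<bar> < e"
   and d': "d' > 0" "\<And>h. 0 < h ==> h < d' ==> \<bar>integral {- x..- x + h} (\<lambda>x. g (- x)) / h - g x\<bar> < e"
   using N(2)[OF x(2) e] N'(2)[OF x(3) e] by auto
  have FI: "integral {a..v} f - integral {a..u} f = integral {u..v} g" if "a \<le> u" "u \<le> v" "v \<le> b" for u v
   using hk_combine[of a u v f] integrable_subinterval_real[OF f, of a v] that
    integral_cong[of "{u..v}" g f] by (auto simp: g_def)
  show "\<exists>s>0. \<forall>h. h \<noteq> 0 \<and> norm (h - 0) < s --> norm ((integral {a..x + h} f - integral {a..x} f) / h - f x) < e"
  proof (intro exI[of _ "min (min d d') (min (x - a) (b - x))"] conjI allI impI)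
   fix h :: real assume h: "h \<noteq> 0 \<and> norm (h - 0) < min (min d d') (min (x - a) (b - x))"
   consider "h > 0" | "h < 0" using h by linarith
   thus "norm ((integral {a..x + h} f - integral {a..x} f) / h - f x) < e"
   proof cases
    case 1
    thus ?thesis using d(2)[of h] h x FI[of x "x + h"] by (auto simp: g_def)
   next
    case 2
    have "integral {- x..- x + - h} (\<lambda>x. g (- x)) = integral {a..x} f - integral {a..x + h} f"
     using FI[of "x + h" x] hk_reflect_real[of x "x + h" g] h 2 x by simp
    thus ?thesis using d'(2)[of "- h"] h 2 x by (simp add: g_def minus_divide_left)
   qed
  qed (use d d' x in auto)
 qed
 moreover have "x \<in> uminus ` N'" if "- x \<in> N'" for x using image_eqI[of x uminus "- x" N'] that by simp
 ultimately have "{x \<in> {a<..<b}. \<not> ((\<lambda>x. integral {a..x} f) has_der f x) (at x)} \<subseteq> N \<union> uminus ` N'" by blast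
 moreover have "negligible (uminus ` N')"
  by (rule negligible_differentiable_image_negligible[OF order_refl N'(1)]) (auto intro!: derivative_intros)
 ultimately show ?thesis using negligible_Un[OF N(1)] negligible_subset by blast
qed

section \<open>Families of nonoverlapping intervals and their increments\<close>

definition nonoverlapping :: "(real \<times> real) set => bool" where
 "nonoverlapping D \<longleftrightarrow> finite D \<and> (\<forall>(x, y)\<in>D. x < y) \<and>
   disj_intervals D"

definition family_in :: "real => real => (real \<times> real) set => bool" where
 "family_in c d D \<longleftrightarrow> nonoverlapping D \<and> (\<forall>(x, y)\<in>D. c \<le> x \<and> y \<le> d)"

definition increments :: "rfun => (real \<times> real) set => real" where
 "increments u D = (\<Sum>(x, y)\<in>D. \<bar>u y - u x\<bar>)"

definition lengths :: "(real \<times> real) set => real" where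
 "lengths D = (\<Sum>(x, y)\<in>D. y - x)"

lemma lengths_le_measure:
 assumes D: "nonoverlapping D" and S: "(\<Union>(x, y)\<in>D. {x<..<y}) \<subseteq> S" "S \<in> lmeasurable"
 shows "lengths D \<le> measure lebesgue S"
proof -
 have fin: "finite D" using D by (simp add: nonoverlapping_def)
 have "lengths D = (\<Sum>p\<in>D. measure lebesgue {fst p<..<snd p})"
  unfolding lengths_def using D by (intro sum.cong) (auto simp: nonoverlapping_def)
 also have "\<dots> = measure lebesgue (\<Union>p\<in>D. {fst p<..<snd p})" by (rule measure_finite_Union[symmetric])
   (use D in \<open>auto simp: nonoverlapping_def disjoint_family_on_def pairwise_def fin\<close>)
 also have "\<dots> \<le> measure lebesgue S"
  by (rule measure_mono_fmeasurable) (use S fin in \<open>auto simp: case_prod_beta\<close>)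
 finally show ?thesis .
qed

lemma lengths_family_in: "family_in c d D ==> c \<le> d ==> lengths D \<le> d - c"
 using lengths_le_measure[of D "{c..d}"] unfolding family_in_def by fastforce

lemma abs_cont_onD:
 assumes "abs_cont_on a b u" "e > 0"
 obtains d where "d > 0" "\<And>D. family_in a b D ==> lengths D < d ==> increments u D < e"
proof -
 obtain d where d: "d > 0" "\<And>D. finite D \<and> (\<forall>(c, d)\<in>D. a \<le> c \<and> c \<le> d \<and> d \<le> b) \<and>
    disj_intervals D \<and>
    (\<Sum>(c, d)\<in>D. d - c) < d --> (\<Sum>(c, d)\<in>D. \<bar>u d - u c\<bar>) < e"
  using assms unfolding abs_cont_on_def by meson
 show thesis by (rule that[OF d(1)], unfold increments_def, rule d(2)[rule_format])
   (auto simp: family_in_def nonoverlapping_def lengths_def)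
qed

text \<open>Intervals that straddle \<open>m\<close> are cut there, and the triangle inequality
  accounts for the inequality of increments. The truncations are injective because nondegenerate
  nonoverlapping intervals share neither a left nor a right endpoint.\<close>

lemma family_in_split:
 assumes D: "family_in c d D" and m: "c \<le> m" "m \<le> d"
 obtains D1 D2 where "family_in c m D1" "family_in m d D2" "increments u D \<le> increments u D1 + increments u D2"
proof -
 let ?A = "{p\<in>D. fst p < m}" and ?B = "{p\<in>D. m < snd p}"
 define f g where "f \<equiv> \<lambda>p::real\<times>real. (fst p, min (snd p) m)" and "g \<equiv> \<lambda>p::real\<times>real. (max (fst p) m, snd p)"
 have fin: "finite D" and lt: "\<And>p. p \<in> D ==> fst p < snd p" and cd: "\<And>p. p \<in> D ==> c \<le> fst p \<and> snd p \<le> d"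
  and pw: "\<And>p q. p \<in> D ==> q \<in> D ==> p \<noteq> q ==> {fst p<..<snd p} \<inter> {fst q<..<snd q} = {}"
  using D by (auto simp: family_in_def nonoverlapping_def pairwise_def)
 have ne: "fst p \<noteq> fst q" "snd p \<noteq> snd q" if "p \<in> D" "q \<in> D" "p \<noteq> q" for p q
 proof -
  \<comment> \<open>If two left or two right endpoints coincided, this midpoint would lie in both
    open intervals.\<close>
  have "(max (fst p) (fst q) + min (snd p) (snd q)) / 2 \<notin> {fst p<..<snd p} \<inter> {fst q<..<snd q}"
   using pw[OF that] by blast
  thus "fst p \<noteq> fst q" "snd p \<noteq> snd q" using lt[OF that(1)] lt[OF that(2)]
   by (auto simp: max_def min_def split: if_splits)
 qed
 have injf: "inj_on f ?A"
 proof (rule inj_onI, rule ccontr)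
  fix p q assume "p \<in> ?A" "q \<in> ?A" "f p = f q" "p \<noteq> q"
  thus False using ne(1)[of p q] by (simp add: f_def)
 qed
 have injg: "inj_on g ?B"
 proof (rule inj_onI, rule ccontr)
  fix p q assume "p \<in> ?B" "q \<in> ?B" "g p = g q" "p \<noteq> q"
  thus False using ne(2)[of p q] by (simp add: g_def)
 qed
 have 1: "family_in c m (f ` ?A)" unfolding family_in_def nonoverlapping_def
 proof (intro conjI)
  show "disj_intervals (f ` ?A)"
  proof (rule pairwiseI)
   fix x y assume "x \<in> f ` ?A" "y \<in> f ` ?A" "x \<noteq> y"
   then obtain p q where "p \<in> D" "q \<in> D" "p \<noteq> q" "x = f p" "y = f q" by blast
   thus "{fst x<..<snd x} \<inter> {fst y<..<snd y} = {}" using pw[of p q] by (auto simp: f_def)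
  qed
 qed (use fin lt cd in \<open>auto simp: f_def\<close>)
 have 2: "family_in m d (g ` ?B)" unfolding family_in_def nonoverlapping_def
 proof (intro conjI)
  show "disj_intervals (g ` ?B)"
  proof (rule pairwiseI)
   fix x y assume "x \<in> g ` ?B" "y \<in> g ` ?B" "x \<noteq> y"
   then obtain p q where "p \<in> D" "q \<in> D" "p \<noteq> q" "x = g p" "y = g q" by blast
   thus "{fst x<..<snd x} \<inter> {fst y<..<snd y} = {}" using pw[of p q] by (auto simp: g_def)
  qed
 qed (use fin lt cd in \<open>auto simp: g_def\<close>)
 have "increments u D = (\<Sum>p\<in>D. \<bar>u (snd p) - u (fst p)\<bar>)" by (simp add: increments_def case_prod_beta)
 also have "\<dots> \<le> (\<Sum>p\<in>D. (if fst p < m then \<bar>u (snd (f p)) - u (fst (f p))\<bar> else 0)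
   + (if m < snd p then \<bar>u (snd (g p)) - u (fst (g p))\<bar> else 0))"
  by (rule sum_mono) (use lt in \<open>fastforce simp: f_def g_def min_def max_def\<close>)
 also have "\<dots> = (\<Sum>p\<in>?A. \<bar>u (snd (f p)) - u (fst (f p))\<bar>) + (\<Sum>p\<in>?B. \<bar>u (snd (g p)) - u (fst (g p))\<bar>)"
  using fin by (simp add: sum.distrib sum.inter_filter)
 also have "\<dots> = increments u (f ` ?A) + increments u (g ` ?B)" unfolding increments_def case_prod_beta
  by (simp add: sum.reindex[OF injf] sum.reindex[OF injg])
 finally show thesis using that 1 2 by simp
qed

text \<open>Pieces of length \<open>d / 2\<close> are split off from the right; by absolute
  continuity with epsilon 1 each of them contributes less than 1, so the number of pieces bounds the
  variation.\<close>

lemma abs_cont_on_bounded_variation: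
 assumes "abs_cont_on a b u"
 obtains B where "\<And>D. family_in a b D ==> increments u D \<le> B"
proof -
 obtain d where d: "d > 0" "\<And>D. family_in a b D ==> lengths D < d ==> increments u D < 1"
  using abs_cont_onD[OF assms, of 1] by auto
 have "increments u D \<le> real n" if "a \<le> x" "x \<le> b" "x - a \<le> real n * (d / 2)" "family_in a x D" for n x D
  using that
 proof (induction n arbitrary: x D)
  case 0
  hence "D = {}" by (force simp: family_in_def nonoverlapping_def)
  thus ?case by (simp add: increments_def)
 next
  case (Suc n)
  let ?m = "max a (x - d / 2)"
  obtain D1 D2 where D: "family_in a ?m D1" "family_in ?m x D2" "increments u D \<le> increments u D1 + increments u D2"
   using family_in_split[OF Suc.prems(4), of ?m u] Suc.prems(1) d(1) by auto
  have "increments u D1 \<le> real n"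
   by (rule Suc.IH[OF _ _ _ D(1)]) (use Suc.prems d(1) in \<open>auto simp: algebra_simps max_def\<close>)
  moreover have "lengths D2 \<le> d / 2" using lengths_family_in[OF D(2)] Suc.prems(1) d(1)
   by (cases "a \<le> x - d / 2") (auto simp: max_def)
  moreover have "family_in a b D2" using D(2) Suc.prems(2) by (fastforce simp: family_in_def)
  ultimately show ?case using d(2)[of D2] d(1) D(3) by simp
 qed
 moreover obtain n where n: "b - a \<le> real n * (d / 2)"
  using d(1) ex_less_of_nat_mult[of "d/2" "b - a"] less_imp_le half_gt_zero by metis
 ultimately have "increments u D \<le> real n" if "family_in a b D" for D
 proof (cases "a \<le> b")
  case False
  hence "D = {}" using that by (force simp: family_in_def nonoverlapping_def)
  thus ?thesis by (simp add: increments_def)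
 qed (use that n in blast)
 thus thesis using that by blast
qed

text \<open>Absolute continuity of a monotone function says that its Stieltjes measure vanishes on
  Lebesgue null sets. The Radon-Nikodym density is then the derivative sought.\<close>

lemma mono_abs_cont_integral:
 fixes W :: rfun
 assumes ab: "a \<le> b" and mono: "\<And>x y. a \<le> x ==> x \<le> y ==> y \<le> b ==> W x \<le> W y"
  and ac: "\<And>e. e > 0 ==> \<exists>d>0. \<forall>D. family_in a b D --> lengths D < d --> increments W D < e"
 obtains g where "g AI {a..b}" "\<And>x. x \<in> {a..b} ==> W x - W a = integral {a..x} g"
proof -
 \<comment> \<open>The constant extension makes the function monotone and continuous on the whole
   line, as the Stieltjes measure requires.\<close>
 define G where "G \<equiv> \<lambda>x. W (max a (min x b))"
 have Gmono: "G x \<le> G y" if "x \<le> y" for x y unfolding G_def by (rule mono) (use that ab in auto)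
 have GW: "G x = W x" if "x \<in> {a..b}" for x using that by (simp add: G_def max_def min_def)
 have Gcont: "continuous_on UNIV G"
 proof (rule continuous_on_iff[THEN iffD2], intro ballI allI impI)
  fix x e :: real assume "e > 0"
  then obtain d where d: "d > 0" "\<And>D. family_in a b D ==> lengths D < d ==> increments W D < e" using ac by meson
  have "dist (G y) (G x) < e" if "dist y x < d" for y
  proof -
   define X Y where "X = max a (min x b)" and "Y = max a (min y b)"
   have XY: "a \<le> X" "X \<le> b" "a \<le> Y" "Y \<le> b" using ab by (auto simp: X_def Y_def)
   have le: "\<bar>X - Y\<bar> \<le> \<bar>x - y\<bar>" unfolding X_def Y_def by (auto simp: max_def min_def)
   have G: "G x = W X" "G y = W Y" by (auto simp: G_def X_def Y_def)
   show ?thesis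
   proof (cases "X = Y")
    case True thus ?thesis using \<open>e > 0\<close> G by simp
   next
    case False
    have "increments W {p} < e" if "p = (X, Y) \<and> X < Y \<or> p = (Y, X) \<and> Y < X" for p
    proof (rule d(2))
     show "family_in a b {p}" using that XY by (auto simp: family_in_def nonoverlapping_def)
     show "lengths {p} < d" using that le \<open>dist y x < d\<close> by (auto simp: lengths_def dist_real_def)
    qed
    from this[of "(X, Y)"] this[of "(Y, X)"] False show ?thesis
     by (cases "X < Y") (auto simp: increments_def G dist_real_def abs_minus_commute)
   qed
  qed
  thus "\<exists>d>0. \<forall>x'\<in>UNIV. dist x' x < d --> dist (G x') (G x) < e" using d(1) by blast
 qed
 have Grc: "continuous (at_right x) G" for x
  using Gcont by (metis UNIV_I continuous_at_imp_continuous_within continuous_on_eq_continuous_at open_UNIV)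
 let ?M = "interval_measure G"
 have Icc: "emeasure ?M {x..y} = ennreal (G y - G x)" if "x \<le> y" for x y
  by (rule emeasure_interval_measure_Icc[OF that Gmono Gcont])
 have Ioc: "emeasure ?M {x<..y} = ennreal (G y - G x)" if "x \<le> y" for x y
  by (rule emeasure_interval_measure_Ioc[OF that Gmono Grc])
 have "absolutely_continuous lborel ?M" unfolding absolutely_continuous_def
 proof
  fix N :: "real set" assume N: "N \<in> null_sets lborel"
  have Ns: "N \<in> sets borel" using N by (auto simp: null_sets_def)
  have "emeasure ?M (N \<inter> {a..b}) \<le> ennreal e" if e: "e > 0" for e
  proof -
   obtain d where d: "d > 0" "\<And>D. family_in a b D ==> lengths D < d ==> increments W D < e" using ac[OF e] by meson
   have neg: "negligible (N \<inter> {a..b})" by (metis N negligible_Int negligible_iff_null_sets null_sets_completionI)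
   hence lm: "N \<inter> {a..b} \<in> lmeasurable" "measure lebesgue (N \<inter> {a..b}) = 0"
    by (auto simp: negligible_imp_measurable negligible_imp_measure0)
   \<comment> \<open>A cover by nonoverlapping closed intervals of total measure at most
     \<open>d / 2\<close>: every finite subfamily meets the condition on \<open>d\<close>, and its
     Stieltjes measure is at most a sum of increments of \<open>W\<close>. The bound then passes to
     the countable union.\<close>
   obtain \<D> where cD: "countable \<D>" and DK: "\<And>K. K \<in> \<D> ==> K \<subseteq> cbox a b \<and> K \<noteq> {} \<and> (\<exists>c d. K = cbox c d)"
    and pD: "pairwise (\<lambda>A B. interior A \<inter> interior B = {}) \<D>"
    and cov: "N \<inter> {a..b} \<subseteq> \<Union>\<D>" "\<Union>\<D> \<in> lmeasurable" "measure lebesgue (\<Union>\<D>) \<le> measure lebesgue (N \<inter> {a..b}) + d / 2"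
    by (rule measurable_outer_intervals_bounded[OF lm(1), of a b "d / 2"]) (use d(1) in auto)
   have KI: "K = {Inf K..Sup K}" "Inf K \<le> Sup K" "a \<le> Inf K" "Sup K \<le> b" if "K \<in> \<D>" for K
    using DK[OF that] by auto
   have bo: "K \<in> sets borel" if "K \<in> \<D>" for K using DK[OF that] by auto
   have fin: "emeasure ?M (\<Union>F) \<le> ennreal e" if F: "finite F" "F \<subseteq> \<D>" for F
   proof -
    let ?F = "{K\<in>F. Inf K < Sup K}"
    define h where "h \<equiv> \<lambda>K::real set. (Inf K, Sup K)"
    have int: "interior K = {Inf K<..<Sup K}" if "K \<in> \<D>" for K
     using KI(1)[OF that] interior_atLeastAtMost_real by metis
    have inj: "inj_on h ?F" using KI(1) F by (auto simp: inj_on_def h_def) (metis subsetD)+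
    have no: "nonoverlapping (h ` ?F)" unfolding nonoverlapping_def
    proof (intro conjI)
     show "disj_intervals (h ` ?F)"
     proof (rule pairwiseI)
      fix x y assume "x \<in> h ` ?F" "y \<in> h ` ?F" "x \<noteq> y"
      then obtain K K' where K: "K \<in> \<D>" "K' \<in> \<D>" "K \<noteq> K'" "x = h K" "y = h K'" using F(2) by blast
      hence "interior K \<inter> interior K' = {}" using pD by (auto simp: pairwise_def)
      thus "{fst x<..<snd x} \<inter> {fst y<..<snd y} = {}" using K int by (simp add: h_def)
     qed
    qed (use F in \<open>auto simp: h_def\<close>)
    have fam: "family_in a b (h ` ?F)" using no KI F by (auto simp: family_in_def h_def)
    have "lengths (h ` ?F) \<le> measure lebesgue (\<Union>\<D>)"
    proof (rule lengths_le_measure[OF no _ cov(2)])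
     show "(\<Union>(x, y)\<in>h ` ?F. {x<..<y}) \<subseteq> \<Union>\<D>"
     proof
      fix x assume "x \<in> (\<Union>(x, y)\<in>h ` ?F. {x<..<y})"
      then obtain K where K: "K \<in> F" "Inf K < x" "x < Sup K" by (auto simp: h_def)
      hence "x \<in> {Inf K..Sup K}" by simp
      thus "x \<in> \<Union>\<D>" using F(2) KI(1)[of K] K(1) by blast
     qed
    qed
    hence "increments W (h ` ?F) < e" using d fam cov(3) lm(2) by (intro d(2)) auto
    moreover have "increments W (h ` ?F) = (\<Sum>K\<in>?F. G (Sup K) - G (Inf K))" unfolding increments_def
    proof (subst sum.reindex[OF inj], rule sum.cong[OF refl])
     fix K assume K: "K \<in> ?F"
     hence "a \<le> Inf K" "Inf K < Sup K" "Sup K \<le> b" using KI[of K] F by auto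
     thus "((\<lambda>(x, y). \<bar>W y - W x\<bar>) \<circ> h) K = G (Sup K) - G (Inf K)"
      using Gmono[of "Inf K" "Sup K"] by (simp add: h_def GW)
    qed
    moreover have "(\<Sum>K\<in>F. G (Sup K) - G (Inf K)) = (\<Sum>K\<in>?F. G (Sup K) - G (Inf K))"
    proof (rule sum.mono_neutral_right)
     show "\<forall>i\<in>F - ?F. G (Sup i) - G (Inf i) = 0"
     proof
      fix K assume "K \<in> F - ?F"
      hence "Inf K = Sup K" using KI(2)[of K] F(2) by auto
      thus "G (Sup K) - G (Inf K) = 0" by simp
     qed
    qed (use F(1) in auto)
    ultimately have "(\<Sum>K\<in>F. G (Sup K) - G (Inf K)) \<le> e" by simp
    moreover have "emeasure ?M (\<Union>F) \<le> (\<Sum>K\<in>F. emeasure ?M K)"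
    proof -
     have "emeasure ?M (\<Union>K\<in>F. K) \<le> (\<Sum>K\<in>F. emeasure ?M K)"
      by (rule emeasure_subadditive_finite) (use F bo in auto)
     thus ?thesis by simp
    qed
    moreover have "(\<Sum>K\<in>F. emeasure ?M K) = (\<Sum>K\<in>F. ennreal (G (Sup K) - G (Inf K)))"
     by (intro sum.cong refl) (metis F(2) Icc KI(1) KI(2) subsetD)
    moreover have "\<dots> = ennreal (\<Sum>K\<in>F. G (Sup K) - G (Inf K))"
     by (rule sum_ennreal) (use F KI Gmono in \<open>auto simp: subset_eq\<close>)
    ultimately show ?thesis by (simp add: ennreal_leI order_trans)
   qed
   have fm: "K \<in> fmeasurable ?M" if "K \<in> \<D>" for K
    using Icc[OF KI(2)[OF that]] KI(1)[OF that] bo[OF that] by (intro fmeasurableI) auto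
   have mF: "measure ?M (\<Union>K\<in>F. K) \<le> e" if "F \<subseteq> \<D>" "finite F" for F
    using fin[OF that(2,1)] e by (simp add: measure_def enn2real_leI)
   have "(\<Union>K\<in>\<D>. K) \<in> fmeasurable ?M" "measure ?M (\<Union>K\<in>\<D>. K) \<le> e"
    by (rule fmeasurable_UN_bound[where A="\<lambda>K. K", OF cD fm mF], assumption+)
     (rule measure_UN_bound[where A="\<lambda>K. K", OF cD fm mF])
   hence "\<Union>\<D> \<in> fmeasurable ?M" "emeasure ?M (\<Union>\<D>) \<le> ennreal e" by (simp_all add: emeasure_eq_measure2 ennreal_leI)
   thus ?thesis using emeasure_mono[OF cov(1) fmeasurableD, of ?M] by (meson order.trans)
  qed
  hence "emeasure ?M (N \<inter> {a..b}) \<le> 0" by (metis ennreal_le_epsilon add_0)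
  hence 1: "N \<inter> {a..b} \<in> null_sets ?M" using Ns by (auto simp: null_sets_def)
  \<comment> \<open>\<open>G\<close> is constant on either side of [a,b], so no mass lies
    there.\<close>
  have 2: "(\<Union>n. {b<..b + real n}) \<in> null_sets ?M"
   by (rule null_sets_UN) (use ab in \<open>auto simp: null_sets_def Ioc, auto simp: G_def\<close>)
  have 3: "(\<Union>n. {a - real n<..a}) \<in> null_sets ?M"
   by (rule null_sets_UN) (use ab in \<open>auto simp: null_sets_def Ioc, auto simp: G_def max_def min_def\<close>)
  have "N \<subseteq> (N \<inter> {a..b}) \<union> ((\<Union>n. {b<..b + real n}) \<union> (\<Union>n. {a - real n<..a}))"
  proof
   fix x assume x: "x \<in> N"
   obtain n where "\<bar>x\<bar> + \<bar>a\<bar> + \<bar>b\<bar> < real n" using reals_Archimedean2 by blast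
   hence "x \<in> {a..b} \<or> x \<in> {b<..b + real n} \<or> x \<in> {a - real n<..a}" by auto
   thus "x \<in> (N \<inter> {a..b}) \<union> ((\<Union>n. {b<..b + real n}) \<union> (\<Union>n. {a - real n<..a}))" using x by blast
  qed
  thus "N \<in> null_sets ?M" by (rule null_sets_subset[rotated 2]) (use 1 2 3 Ns in auto)
 qed
 then obtain f where f: "f \<in> borel_measurable lborel" "density lborel f = ?M"
  using sigma_finite_measure.Radon_Nikodym[OF lborel.sigma_finite_measure_axioms, of ?M] by auto
 have nn: "(\<integral>\<^sup>+t\<in>{a..x}. f t \<partial>lborel) = ennreal (W x - W a)" if "x \<in> {a..b}" for x
 proof -
  have "(\<integral>\<^sup>+t\<in>{a..x}. f t \<partial>lborel) = emeasure (density lborel f) {a..x}"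
   using f(1) by (simp add: emeasure_density)
  thus ?thesis using that ab by (simp add: f(2) Icc GW)
 qed
 \<comment> \<open>The density takes extended real values; it is finite almost everywhere on [a,b]
   because its integral there is finite.\<close>
 define g where "g \<equiv> \<lambda>t. enn2real (f t)"
 have gm: "g \<in> borel_measurable lborel" using f(1) by (simp add: g_def)
 have fin: "AE t in lborel. indicator {a..b} t * f t \<noteq> \<infinity>"
  by (rule nn_integral_noteq_infinite) (use f(1) nn[of b] ab in \<open>auto simp: mult.commute\<close>)
 have nn2: "(\<integral>\<^sup>+t. ennreal (indicator {a..x} t * g t) \<partial>lborel) = ennreal (W x - W a)" if "x \<in> {a..b}" for x
 proof -
  have "(\<integral>\<^sup>+t. ennreal (indicator {a..x} t * g t) \<partial>lborel) = (\<integral>\<^sup>+t\<in>{a..x}. f t \<partial>lborel)"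
  proof (rule nn_integral_cong_AE, use fin in eventually_elim)
   case (elim t)
   thus ?case using that by (auto simp: g_def indicator_def less_top split: if_splits)
  qed
  thus ?thesis using nn[OF that] by simp
 qed
 have hi: "(g has_integral (W x - W a)) {a..x}" if x: "x \<in> {a..b}" for x
 proof -
  have "((\<lambda>t. indicator {a..x} t * g t) has_integral (W x - W a)) UNIV"
  proof (rule has_integral_iff_nn_integral_lebesgue[THEN iffD2])
   show "\<And>t. 0 \<le> indicator {a..x} t * g t" by (simp add: g_def)
   show "(\<lambda>t. indicator {a..x} t * g t) \<in> borel_measurable lebesgue \<and>
     (\<integral>\<^sup>+ t. ennreal (indicator {a..x} t * g t) \<partial>lebesgue) = ennreal (W x - W a) \<and> 0 \<le> W x - W a"
    using gm nn2[OF x] mono[of a x] x by (auto simp: nn_integral_completion intro!: measurable_completion)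
  qed
  moreover have "(\<lambda>t. indicator {a..x} t * g t) = (\<lambda>t. if t \<in> {a..x} then g t else 0)" by auto
  ultimately show ?thesis by (simp only: has_integral_restrict_UNIV)
 qed
 have "g AI {a..b}" using hi[of b] ab by (subst absolutely_integrable_on_iff_nonneg) (auto simp: g_def)
 thus thesis by (rule that) (rule integral_unique[OF hi, symmetric])
qed

text \<open>Jordan decomposition: with the variation \<open>V\<close> both \<open>V\<close> and
  \<open>V - u\<close> are nondecreasing and inherit absolute continuity, so the monotone case
  applies to each and the two densities are subtracted.\<close>

lemma abs_cont_on_imp_integral:
 assumes ac: "abs_cont_on a b u" and ab: "a \<le> b"
 obtains g where "g AI {a..b}" "\<And>x. x \<in> {a..b} ==> u x = u a + integral {a..x} g"
proof -
 define V where "V \<equiv> \<lambda>x. SUP D\<in>{D. family_in a x D}. increments u D"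
 have V_eq: "V x = (SUP D\<in>{D. family_in a x D}. increments u D)" for x by (simp add: V_def)
 obtain B where B: "\<And>D. family_in a b D ==> increments u D \<le> B" using abs_cont_on_bounded_variation[OF ac] by blast
 have emp: "family_in c d {}" for c d by (simp add: family_in_def nonoverlapping_def)
 have fam_mono: "family_in c' d' D" if "family_in c d D" "c' \<le> c" "d \<le> d'" for c c' d d' D
  using that by (fastforce simp: family_in_def)
 have bdd: "bdd_above (increments u ` {D. family_in a x D})" if "x \<le> b" for x
  using fam_mono[of a _ _ a b] that B by (intro bdd_aboveI[of _ B]) auto
 have Vub: "increments u D \<le> V x" if "family_in a x D" "x \<le> b" for x D
  unfolding V_def by (rule cSUP_upper) (use that bdd in auto)
 have Vle: "V y \<le> V x + s" if xy: "a \<le> x" "x \<le> y" "y \<le> b" and s: "\<And>D. family_in x y D ==> increments u D \<le> s" for x y s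
  unfolding V_eq[of y]
 proof (rule cSUP_least)
  show "{D. family_in a y D} \<noteq> {}" using emp by blast
  fix D assume "D \<in> {D. family_in a y D}"
  then obtain D1 D2 where D: "family_in a x D1" "family_in x y D2" "increments u D \<le> increments u D1 + increments u D2"
   using family_in_split xy by blast
  thus "increments u D \<le> V x + s" using Vub[OF D(1)] s[OF D(2)] xy by simp
 qed
 have Vge: "V x + \<bar>u y - u x\<bar> \<le> V y" if xy: "a \<le> x" "x \<le> y" "y \<le> b" for x y
 proof (cases "x = y")
  case False
  have "V x \<le> V y - \<bar>u y - u x\<bar>" unfolding V_eq[of x]
  proof (rule cSUP_least)
   show "{D. family_in a x D} \<noteq> {}" using emp by blast
   fix D assume "D \<in> {D. family_in a x D}"
   hence D: "family_in a x D" by simp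
   have fin: "finite D" using D by (simp add: family_in_def nonoverlapping_def)
   have le: "snd p \<le> x" "fst p < snd p" if "p \<in> D" for p using D that by (auto simp: family_in_def nonoverlapping_def)
   have "disj_intervals (insert (x, y) D)" unfolding pairwise_insert
   proof (intro conjI allI impI)
    show "disj_intervals D" using D by (simp add: family_in_def nonoverlapping_def)
   next
    fix p assume "p \<in> D \<and> p \<noteq> (x, y)"
    hence "snd p \<le> x" using le by blast
    thus "{fst (x, y)<..<snd (x, y)} \<inter> {fst p<..<snd p} = {}" "{fst p<..<snd p} \<inter> {fst (x, y)<..<snd (x, y)} = {}"
     by auto
   qed
   hence "family_in a y (insert (x, y) D)" using D xy False fin unfolding family_in_def nonoverlapping_def by auto
   moreover have "(x, y) \<notin> D" using le False xy by fastforce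
   ultimately show "increments u D \<le> V y - \<bar>u y - u x\<bar>"
    using Vub[of y "insert (x, y) D"] xy fin by (simp add: increments_def)
  qed
  thus ?thesis by simp
 qed simp
 have Vac: "\<exists>d>0. \<forall>D. family_in a b D --> lengths D < d --> increments V D \<le> e" if e: "e > 0" for e
 proof -
  obtain d where d: "d > 0" "\<And>D. family_in a b D ==> lengths D < d ==> increments u D < e / 2"
   using abs_cont_onD[OF ac, of "e / 2"] e by auto
  have "increments V D \<le> e" if D: "family_in a b D" and len: "lengths D < d" for D
  proof -
   have fin: "finite D" and lt: "\<And>p. p \<in> D ==> a \<le> fst p \<and> fst p < snd p \<and> snd p \<le> b"
    and pw: "\<And>p q. p \<in> D ==> q \<in> D ==> p \<noteq> q ==> {fst p<..<snd p} \<inter> {fst q<..<snd q} = {}"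
    using D by (auto simp: family_in_def nonoverlapping_def pairwise_def)
   \<comment> \<open>The loss allowed on each interval when its variation is approximated by the
     increments of a finite family; all losses together stay below \<open>e / 2\<close>. The
     families, placed inside disjoint intervals, form one family for \<open>u\<close>.\<close>
   define n where "n = e / (2 * (real (card D) + 1))"
   have n: "n > 0" "real (card D) * n \<le> e / 2" using e by (auto simp: n_def field_simps)
   have "\<exists>D'. family_in (fst p) (snd p) D' \<and> V (snd p) - V (fst p) \<le> increments u D' + n" if p: "p \<in> D" for p
   proof (rule ccontr)
    assume "\<not> ?thesis"
    hence "increments u D' \<le> V (snd p) - V (fst p) - n" if "family_in (fst p) (snd p) D'" for D' using that by force
    from Vle[OF _ _ _ this, of "fst p" "snd p"] lt[OF p] n(1) show False by auto
   qed
   then obtain \<Phi> where \<Phi>: "\<And>p. p \<in> D ==> family_in (fst p) (snd p) (\<Phi> p)"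
    "\<And>p. p \<in> D ==> V (snd p) - V (fst p) \<le> increments u (\<Phi> p) + n" by metis
   let ?U = "\<Union>p\<in>D. \<Phi> p"
   have \<Phi>in: "fst p \<le> fst q \<and> fst q < snd q \<and> snd q \<le> snd p" if "p \<in> D" "q \<in> \<Phi> p" for p q
    using \<Phi>(1)[OF that(1)] that(2) by (auto simp: family_in_def nonoverlapping_def)
   have sep: "{fst q<..<snd q} \<inter> {fst q'<..<snd q'} = {}" if q: "p \<in> D" "p' \<in> D" "p \<noteq> p'" "q \<in> \<Phi> p" "q' \<in> \<Phi> p'" for p p' q q'
   proof -
    have "{fst q<..<snd q} \<subseteq> {fst p<..<snd p}" "{fst q'<..<snd q'} \<subseteq> {fst p'<..<snd p'}"
     using \<Phi>in[of p q] \<Phi>in[of p' q'] q by auto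
    thus ?thesis using pw[of p p'] q by blast
   qed
   have fin\<Phi>: "finite (\<Phi> p)" if "p \<in> D" for p using \<Phi>(1)[OF that] by (simp add: family_in_def nonoverlapping_def)
   have disj: "\<Phi> p \<inter> \<Phi> p' = {}" if "p \<in> D" "p' \<in> D" "p \<noteq> p'" for p p'
   proof (rule ccontr)
    assume "\<Phi> p \<inter> \<Phi> p' \<noteq> {}"
    then obtain q where q: "q \<in> \<Phi> p" "q \<in> \<Phi> p'" by blast
    hence "{fst q<..<snd q} = {}" using sep[OF that q] by blast
    thus False using \<Phi>in[OF that(1) q(1)] by simp
   qed
   have "disj_intervals ?U"
   proof (rule pairwiseI)
    fix q q' assume "q \<in> ?U" "q' \<in> ?U" and ne: "q \<noteq> q'"
    then obtain p p' where p: "p \<in> D" "q \<in> \<Phi> p" "p' \<in> D" "q' \<in> \<Phi> p'" by blast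
    show "{fst q<..<snd q} \<inter> {fst q'<..<snd q'} = {}"
    proof (cases "p = p'")
     case True
     have "disj_intervals (\<Phi> p)" using \<Phi>(1)[OF p(1)] by (simp add: family_in_def nonoverlapping_def)
     thus ?thesis using ne p True by (auto simp: pairwise_def)
    qed (use sep p in blast)
   qed
   moreover have bnd: "\<forall>(x, y)\<in>?U. x < y \<and> a \<le> x \<and> y \<le> b" using \<Phi>in lt by fastforce
   ultimately have fam: "family_in a b ?U" using fin fin\<Phi> by (auto simp: family_in_def nonoverlapping_def)
   have sumU: "sum f ?U = (\<Sum>p\<in>D. sum f (\<Phi> p))" for f :: "real \<times> real => real"
    by (rule sum.UNION_disjoint) (use fin fin\<Phi> disj in auto)
   have "lengths ?U \<le> (\<Sum>p\<in>D. snd p - fst p)" unfolding lengths_def sumU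
   proof (rule sum_mono)
    fix p assume p: "p \<in> D"
    show "(\<Sum>(x, y)\<in>\<Phi> p. y - x) \<le> snd p - fst p"
     using lengths_family_in[OF \<Phi>(1)[OF p]] lt[OF p] by (simp add: lengths_def)
   qed
   hence "lengths ?U < d" using len by (simp add: lengths_def case_prod_beta)
   hence "increments u ?U < e / 2" using d(2) fam by blast
   moreover have "increments V D \<le> (\<Sum>p\<in>D. increments u (\<Phi> p) + n)"
    unfolding increments_def[of V] case_prod_beta
   proof (rule sum_mono)
    fix p assume p: "p \<in> D"
    thus "\<bar>V (snd p) - V (fst p)\<bar> \<le> increments u (\<Phi> p) + n"
     using \<Phi>(2)[OF p] Vge[of "fst p" "snd p"] lt[OF p] by auto
   qed
   moreover have "(\<Sum>p\<in>D. increments u (\<Phi> p) + n) = increments u ?U + real (card D) * n"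
    by (simp add: sum.distrib increments_def sumU)
   ultimately show ?thesis using n(2) by simp
  qed
  thus ?thesis using d(1) by blast
 qed
 \<comment> \<open>The factor 2 covers \<open>W = V - u\<close>, whose increments are bounded by
   those of \<open>V\<close> plus those of \<open>u\<close>.\<close>
 have VWac: "\<exists>d>0. \<forall>D. family_in a b D --> lengths D < d --> increments W D < e"
  if e: "e > 0" and W: "\<And>x y. a \<le> x ==> x \<le> y ==> y \<le> b ==> \<bar>W y - W x\<bar> \<le> 2 * (V y - V x)" for W :: rfun and e :: real
 proof -
  obtain d where d: "d > 0" "\<And>D. family_in a b D ==> lengths D < d ==> increments V D \<le> e / 3"
   using Vac[of "e / 3"] e by auto
  have "increments W D < e" if D: "family_in a b D" "lengths D < d" for D
  proof -
   have "increments W D \<le> (\<Sum>(x, y)\<in>D. 2 * \<bar>V y - V x\<bar>)" unfolding increments_def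
   proof (rule sum_mono, clarify)
    fix x y assume "(x, y) \<in> D"
    hence "a \<le> x" "x < y" "y \<le> b" using D by (auto simp: family_in_def nonoverlapping_def)
    thus "\<bar>W y - W x\<bar> \<le> 2 * \<bar>V y - V x\<bar>" using W[of x y] Vge[of x y] by linarith
   qed
   also have "\<dots> = 2 * increments V D" by (simp add: increments_def sum_distrib_left case_prod_beta)
   also have "\<dots> < e" using d(2)[OF D] e by simp
   finally show ?thesis .
  qed
  thus ?thesis using d(1) by blast
 qed
 obtain g1 where g1: "g1 AI {a..b}" "\<And>x. x \<in> {a..b} ==> V x - V a = integral {a..x} g1"
 proof (rule mono_abs_cont_integral[OF ab, of V])
  show "V x \<le> V y" if "a \<le> x" "x \<le> y" "y \<le> b" for x y using Vge[OF that] by linarith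
  show "\<exists>d>0. \<forall>D. family_in a b D --> lengths D < d --> increments V D < e" if "e > 0" for e
   by (rule VWac[OF that]) (use Vge in fastforce)
 qed auto
 obtain g2 where g2: "g2 AI {a..b}" "\<And>x. x \<in> {a..b} ==> (V x - u x) - (V a - u a) = integral {a..x} g2"
 proof (rule mono_abs_cont_integral[OF ab, of "\<lambda>x. V x - u x"])
  show "V x - u x \<le> V y - u y" if "a \<le> x" "x \<le> y" "y \<le> b" for x y using Vge[OF that] by linarith
  show "\<exists>d>0. \<forall>D. family_in a b D --> lengths D < d --> increments (\<lambda>x. V x - u x) D < e" if "e > 0" for e
  proof (rule VWac[OF that])
   fix x y assume "a \<le> x" "x \<le> y" "y \<le> b"
   from Vge[OF this] show "\<bar>V y - u y - (V x - u x)\<bar> \<le> 2 * (V y - V x)" by (auto simp: abs_if split: if_splits)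
  qed
 qed auto
 show thesis
 proof (rule that[of "\<lambda>x. g1 x - g2 x"])
  show "(\<lambda>x. g1 x - g2 x) AI {a..b}" using g1(1) g2(1) by (rule set_integral_diff)
  fix x assume x: "x \<in> {a..b}"
  have "g1 integrable_on {a..x}" "g2 integrable_on {a..x}" using integrable_on_subinterval[of _ "{a..b}" a x] hk[OF g1(1)]
    hk[OF g2(1)] x by auto
  thus "u x = u a + integral {a..x} (\<lambda>x. g1 x - g2 x)" using g1(2)[OF x] g2(2)[OF x] by (simp add: hk_diff)
 qed
qed

text \<open>Ties the two notions of derivative together: \<open>deriv u\<close> agrees almost
  everywhere with the density of \<open>u\<close>, so conditions phrased with \<open>deriv\<close>
  become conditions on an integrand.\<close>

lemma abs_cont_on_deriv:
 assumes ac: "abs_cont_on a b u" and ab: "a \<le> b"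
 shows "negligible {x \<in> {a<..<b}. \<not> (u has_der deriv u x) (at x)}"
  and "deriv u AI {a..b}"
  and "\<And>x y. a \<le> x ==> x \<le> y ==> y \<le> b ==> u y - u x = integral {x..y} (deriv u)"
proof -
 obtain g where g: "g AI {a..b}" "\<And>x. x \<in> {a..b} ==> u x = u a + integral {a..x} g"
  using abs_cont_on_imp_integral[OF ac ab] by blast
 have gi: "g integrable_on {a..b}" by (rule hk[OF g(1)])
 let ?N = "{x \<in> {a<..<b}. \<not> ((\<lambda>x. integral {a..x} g) has_der g x) (at x)}"
 have N: "negligible ?N" by (rule negligible_not_derivable[OF gi])
 have D: "(u has_der g x) (at x)" if "x \<in> {a<..<b}" "x \<notin> ?N" for x
 proof -
  have "((\<lambda>x. u a + integral {a..x} g) has_der 0 + g x) (at x)"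
   by (rule DERIV_add[OF DERIV_const]) (use that in blast)
  moreover have "u a + integral {a..y} g = u y" if "y \<in> {a<..<b}" for y by (rule g(2)[symmetric]) (use that in auto)
  ultimately have "(u has_der 0 + g x) (at x)"
   by (rule has_field_derivative_transform_within_open[OF _ open_greaterThanLessThan that(1)])
  thus ?thesis by simp
 qed
 have dg: "deriv u x = g x" if "x \<in> {a<..<b}" "x \<notin> ?N" for x using D[OF that] by (rule DERIV_imp_deriv)
 show "negligible {x \<in> {a<..<b}. \<not> (u has_der deriv u x) (at x)}"
  by (rule negligible_subset[OF N]) (use D dg in auto)
 have N': "negligible (?N \<union> {a, b})" using N by simp
 have eq: "deriv u x = g x" if "x \<in> {a..b} - (?N \<union> {a, b})" for x by (rule dg) (use that in auto)
 show "deriv u AI {a..b}" by (rule absolutely_integrable_spike[OF g(1) N']) (use eq in auto)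
 fix x y assume xy: "a \<le> x" "x \<le> y" "y \<le> b"
 have "integral {a..x} g + integral {x..y} g = integral {a..y} g" by (rule hk_combine)
   (use xy integrable_on_subinterval[OF gi, of a y] in auto)
 moreover have "integral {x..y} (deriv u) = integral {x..y} g" by (rule integral_spike[OF N']) (use eq xy in auto)
 ultimately show "u y - u x = integral {x..y} (deriv u)" using g(2)[of x] g(2)[of y] xy by simp
qed

text \<open>Split the absolute value of \<open>g\<close> at height n. The excess \<open>k n\<close>
  has small integral by dominated convergence, and the bounded part contributes at most n times the
  total length.\<close>

lemma abs_cont_on_integral:
 assumes g: "g AI {a..b}"
 shows "abs_cont_on a b (\<lambda>x. c + integral {a..x} g)" unfolding abs_cont_on_def
proof (intro allI impI)
 fix e :: real assume e: "e > 0"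
 define h where "h \<equiv> \<lambda>x. \<bar>g x\<bar>"
 have h: "h AI {a..b}" using g by (auto simp: h_def intro: set_integrable_abs)
 define k where "k \<equiv> \<lambda>(n::nat) x. h x - min (h x) (real n)"
 have cst: "(\<lambda>x. real n) AI {a..b}" for n by (intro absolutely_integrable_continuous_real continuous_intros)
 have k: "k n AI {a..b}" for n unfolding k_def by (intro set_integral_diff absolutely_integrable_min_1 h cst)
 have "(\<lambda>n. integral {a..b} (k n)) \<longlonglongrightarrow> integral {a..b} (\<lambda>x. 0)"
 proof (rule dominated_convergence(2))
  show "k n integrable_on {a..b}" for n by (rule hk[OF k])
  show "h integrable_on {a..b}" by (rule hk[OF h])
  show "norm (k n x) \<le> h x" for n x by (auto simp: k_def h_def min_def)
  show "(\<lambda>n. k n x) \<longlonglongrightarrow> 0" for x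
  proof (rule tendsto_eventually)
   obtain N where "h x < real N" using reals_Archimedean2 by blast
   thus "\<forall>\<^sub>F n in sequentially. k n x = 0"
    unfolding eventually_sequentially by (intro exI[of _ N]) (auto simp: k_def min_def)
  qed
 qed
 hence "\<forall>\<^sub>F n in sequentially. integral {a..b} (k n) < e / 2" using e by (intro order_tendstoD(2)) auto
 then obtain n where n: "integral {a..b} (k n) < e / 2" by (auto simp: eventually_sequentially)
 have "(\<Sum>(x, y)\<in>D. \<bar>(c + integral {a..y} g) - (c + integral {a..x} g)\<bar>) < e"
  if D: "finite D" "\<forall>(x, y)\<in>D. a \<le> x \<and> x \<le> y \<and> y \<le> b"
   "disj_intervals D"
   "(\<Sum>(x, y)\<in>D. y - x) < e / (2 * (real n + 1))" for D
 proof -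
  have in1: "f integrable_on {x..y}" if "f AI {a..b}" "a \<le> x" "y \<le> b" for f :: rfun and x y
   using integrable_on_subinterval[OF hk[OF that(1)]] that by auto
  have "(\<Sum>(x, y)\<in>D. \<bar>(c + integral {a..y} g) - (c + integral {a..x} g)\<bar>)
    \<le> (\<Sum>(x, y)\<in>D. integral {x..y} (k n) + real n * (y - x))"
  proof (rule sum_mono, clarify)
   fix x y assume "(x, y) \<in> D"
   hence xy: "a \<le> x" "x \<le> y" "y \<le> b" using D(2) by auto
   have "integral {a..x} g + integral {x..y} g = integral {a..y} g" by (rule hk_combine) (use xy in1[OF g, of a y] in auto)
   hence "\<bar>(c + integral {a..y} g) - (c + integral {a..x} g)\<bar> = norm (integral {x..y} g)" by simp
   also have "\<dots> \<le> integral {x..y} (\<lambda>t. k n t + real n)"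
    by (rule integral_norm_bound_integral) (use in1[OF g] in1[OF k] xy in \<open>auto simp: k_def h_def min_def intro!: integrable_add\<close>)
   also have "\<dots> = integral {x..y} (k n) + real n * (y - x)" using xy by (subst hk_add) (use in1[OF k] in auto)
   finally show "\<bar>(c + integral {a..y} g) - (c + integral {a..x} g)\<bar> \<le> integral {x..y} (k n) + real n * (y - x)" .
  qed
  also have "\<dots> = (\<Sum>(x, y)\<in>D. integral {x..y} (k n)) + real n * (\<Sum>(x, y)\<in>D. y - x)"
   by (simp add: case_prod_beta sum.distrib sum_distrib_left)
  also have "(\<Sum>(x, y)\<in>D. integral {x..y} (k n)) \<le> integral {a..b} (k n)"
  proof -
   have "(k n has_integral (\<Sum>p\<in>D. integral {fst p<..<snd p} (k n))) (\<Union>p\<in>D. {fst p<..<snd p})"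
   proof (rule has_integral_UN[OF D(1)])
    fix p assume "p \<in> D"
    hence "k n integrable_on {fst p..snd p}" using D(2) by (intro in1[OF k]) auto
    thus "(k n has_integral integral {fst p<..<snd p} (k n)) {fst p<..<snd p}"
     by (intro integrable_integral) (simp add: integrable_on_open_interval_real)
   qed (use D(3) in \<open>auto simp: pairwise_def\<close>)
   hence "(\<Sum>p\<in>D. integral {fst p<..<snd p} (k n)) \<le> integral {a..b} (k n)"
    by (rule has_integral_subset_le[rotated, OF _ integrable_integral])
     (use D(2) in1[OF k, of a b] in \<open>auto simp: k_def dest!: bspec\<close>)
   thus ?thesis by (simp add: integral_open_interval_real case_prod_beta)
  qed
  also have "real n * (\<Sum>(x, y)\<in>D. y - x) \<le> real n * (e / (2 * (real n + 1)))"
   by (rule mult_left_mono) (use D(4) in auto)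
  also have "\<dots> \<le> e / 2" using e by (simp add: field_simps)
  finally show ?thesis using n by linarith
 qed
 thus "\<exists>\<delta>>0. \<forall>D. finite D \<and> (\<forall>(x, y)\<in>D. a \<le> x \<and> x \<le> y \<and> y \<le> b) \<and>
   disj_intervals D \<and> (\<Sum>(x, y)\<in>D. y - x) < \<delta> -->
   (\<Sum>(x, y)\<in>D. \<bar>c + integral {a..y} g - (c + integral {a..x} g)\<bar>) < e"
  using e by (intro exI[of _ "e / (2 * (real n + 1))"]) (simp add: add_nonneg_pos)
qed

lemma abs_cont_on_mult:
 assumes u: "abs_cont_on a b u" and v: "abs_cont_on a b v" and c: "continuous_on {a..b} u" "continuous_on {a..b} v"
 shows "abs_cont_on a b (\<lambda>x. u x * v x)" unfolding abs_cont_on_def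
proof (intro allI impI)
 fix e :: real assume e: "e > 0"
 have "bounded (u ` {a..b} \<union> v ` {a..b})" by (intro bounded_Un[THEN iffD2] conjI compact_imp_bounded compact_continuous_image c) auto
 then obtain B where B: "B > 0" "\<And>x. x \<in> {a..b} ==> \<bar>u x\<bar> \<le> B \<and> \<bar>v x\<bar> \<le> B" unfolding bounded_pos by auto
 let ?A = "\<lambda>w D. \<Sum>(c, d)\<in>D. \<bar>w d - w c\<bar>"
 let ?D = "\<lambda>D \<delta>. finite D \<and> (\<forall>(c, d)\<in>D. a \<le> c \<and> c \<le> d \<and> d \<le> b) \<and>
   disj_intervals D \<and> (\<Sum>(c, d)\<in>D. d - c) < \<delta>"
 have e': "e / (2 * B) > 0" using e B by simp
 obtain d1 d2 where d: "d1 > 0" "d2 > 0" "\<And>D. ?D D d1 ==> ?A u D < e / (2 * B)" "\<And>D. ?D D d2 ==> ?A v D < e / (2 * B)"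
  using u[unfolded abs_cont_on_def, rule_format, OF e'] v[unfolded abs_cont_on_def, rule_format, OF e'] by blast
 have "?A (\<lambda>x. u x * v x) D < e" if D: "?D D (min d1 d2)" for D
 proof -
  have "?A (\<lambda>x. u x * v x) D \<le> (\<Sum>(c, d)\<in>D. B * \<bar>u d - u c\<bar> + B * \<bar>v d - v c\<bar>)"
  proof (rule sum_mono, clarify)
   fix c d assume "(c, d) \<in> D"
   hence cd: "c \<in> {a..b}" "d \<in> {a..b}" using D by auto
   have "u d * v d - u c * v c = v d * (u d - u c) + u c * (v d - v c)" by (simp add: algebra_simps)
   hence "\<bar>u d * v d - u c * v c\<bar> \<le> \<bar>v d\<bar> * \<bar>u d - u c\<bar> + \<bar>u c\<bar> * \<bar>v d - v c\<bar>" by (metis abs_triangle_ineq abs_mult)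
   also have "\<dots> \<le> B * \<bar>u d - u c\<bar> + B * \<bar>v d - v c\<bar>" using B(2) cd by (intro add_mono mult_right_mono) auto
   finally show "\<bar>u d * v d - u c * v c\<bar> \<le> B * \<bar>u d - u c\<bar> + B * \<bar>v d - v c\<bar>" .
  qed
  also have "\<dots> = B * ?A u D + B * ?A v D" by (simp add: case_prod_beta sum.distrib sum_distrib_left)
  also have "\<dots> < B * (e / (2 * B)) + B * (e / (2 * B))" using d(3,4)[of D] D B by (intro add_strict_mono mult_strict_left_mono) auto
  finally show ?thesis using B by simp
 qed
 thus "\<exists>\<delta>>0. \<forall>D. ?D D \<delta> --> ?A (\<lambda>x. u x * v x) D < e" using d(1,2) by (intro exI[of _ "min d1 d2"]) auto
qed

section \<open>The Hilbert space of square integrable functions\<close>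

definition square_integrable :: "rfun set" where
 "square_integrable = {f \<in> borel_measurable lebesgue. integrable lebesgue (\<lambda>x. (f x)\<^sup>2)}"

lemma square_integrableI:
 "f \<in> borel_measurable lebesgue ==> integrable lebesgue (\<lambda>x. (f x)\<^sup>2) ==> f \<in> square_integrable"
 by (simp add: square_integrable_def)

lemma square_integrable_mult:
 assumes "f \<in> square_integrable" "g \<in> square_integrable"
 shows "integrable lebesgue (\<lambda>x. f x * g x)"
proof (rule LINT_able_bound)
 show "integrable lebesgue (\<lambda>x. (f x)\<^sup>2 + (g x)\<^sup>2)" using assms by (auto simp: square_integrable_def)
 show "(\<lambda>x. f x * g x) \<in> borel_measurable lebesgue" using assms by (auto simp: square_integrable_def)
 have "\<bar>a * b\<bar> \<le> \<bar>a\<^sup>2 + b\<^sup>2\<bar>" for a b :: real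
 proof -
  have "2 * (\<bar>a\<bar> * \<bar>b\<bar>) \<le> a\<^sup>2 + b\<^sup>2" using sum_squares_bound[of "\<bar>a\<bar>" "\<bar>b\<bar>"] by simp
  moreover have "0 \<le> \<bar>a\<bar> * \<bar>b\<bar>" by simp
  ultimately show ?thesis unfolding abs_mult by linarith
 qed
 thus "AE x in lebesgue. norm (f x * g x) \<le> norm ((f x)\<^sup>2 + (g x)\<^sup>2)" by simp
qed

lemma square_integrable_cmult: "f \<in> square_integrable ==> (\<lambda>x. c * f x) \<in> square_integrable"
 by (auto simp: square_integrable_def power_mult_distrib)

lemma square_integrable_add:
 assumes "f \<in> square_integrable" "g \<in> square_integrable"
 shows "(\<lambda>x. f x + g x) \<in> square_integrable"
proof (rule square_integrableI)
 have "integrable lebesgue (\<lambda>x. (f x)\<^sup>2 + (g x)\<^sup>2 + 2 * (f x * g x))"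
  using assms square_integrable_mult[OF assms] by (auto simp: square_integrable_def)
 thus "integrable lebesgue (\<lambda>x. (f x + g x)\<^sup>2)" by (simp add: power2_sum mult.assoc)
qed (use assms in \<open>auto simp: square_integrable_def\<close>)

lemma square_integrable_zero [simp]: "(\<lambda>x. 0) \<in> square_integrable" by (simp add: square_integrable_def)

lemma square_integrable_uminus: "f \<in> square_integrable ==> (\<lambda>x. - f x) \<in> square_integrable"
 by (auto simp: square_integrable_def)

lemma square_integrable_diff:
 "f \<in> square_integrable ==> g \<in> square_integrable ==> (\<lambda>x. f x - g x) \<in> square_integrable"
 using square_integrable_add[of f "\<lambda>x. - g x"] square_integrable_uminus[of g] by simp

lemma square_integrable_abs: "f \<in> square_integrable ==> (\<lambda>x. \<bar>f x\<bar>) \<in> square_integrable"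
 by (auto simp: square_integrable_def)

lemma square_integrable_measurable: "f \<in> square_integrable ==> f \<in> borel_measurable lebesgue"
 by (simp add: square_integrable_def)

lemma square_integrable_bound:
 assumes g: "g \<in> square_integrable" and f: "f \<in> borel_measurable lebesgue" and le: "AE x in lebesgue. \<bar>f x\<bar> \<le> \<bar>g x\<bar>"
 shows "f \<in> square_integrable"
proof (rule square_integrableI[OF f], rule LINT_able_bound)
 show "integrable lebesgue (\<lambda>x. (g x)\<^sup>2)" using g by (simp add: square_integrable_def)
 show "(\<lambda>x. (f x)\<^sup>2) \<in> borel_measurable lebesgue" using f by simp
 show "AE x in lebesgue. norm ((f x)\<^sup>2) \<le> norm ((g x)\<^sup>2)"
  using le by eventually_elim (simp add: abs_le_square_iff)
qed

lemma square_integrable_integral_eq_0: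
 assumes f: "f \<in> square_integrable"
 shows "(LINT x|lebesgue. f x * f x) = 0 \<longleftrightarrow> (AE x in lebesgue. f x = 0)"
proof -
 have "(LINT x|lebesgue. f x * f x) = 0 \<longleftrightarrow> (AE x in lebesgue. f x * f x = 0)"
  by (rule integral_nonneg_eq_0_iff_AE[OF square_integrable_mult[OF f f]]) simp
 thus ?thesis by simp
qed

\<comment> \<open>A type of classes makes the instances \<open>real_inner\<close> and
  \<open>complete_space\<close> available. It consists of functions on the whole line, so that one
  type serves both (0,L) and (0,T), each embedded by extension with 0 (\<open>emb\<close>).\<close>
quotient_type l2 = "rfun" / partial:
 "\<lambda>f g. f \<in> square_integrable \<and> g \<in> square_integrable \<and> (AE x in lebesgue. f x = g x)"
proof (rule part_equivpI)
 show "\<exists>f. f \<in> square_integrable \<and> f \<in> square_integrable \<and> (AE x in lebesgue. f x = f x)"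
  by (rule exI[of _ "\<lambda>x. 0"]) simp
 show "symp (\<lambda>f g. f \<in> square_integrable \<and> g \<in> square_integrable \<and> (AE x in lebesgue. f x = g x))"
  by (rule sympI) (auto elim: eventually_mono)
 show "transp (\<lambda>f g. f \<in> square_integrable \<and> g \<in> square_integrable \<and> (AE x in lebesgue. f x = g x))"
  by (rule transpI) (auto elim: eventually_elim2)
qed

instantiation l2 :: real_inner
begin

lift_definition zero_l2 :: l2 is "\<lambda>x. 0" by simp

lift_definition plus_l2 :: "l2 => l2 => l2" is "\<lambda>f g x. f x + g x"
 by (auto intro: square_integrable_add elim: eventually_elim2)

lift_definition uminus_l2 :: "l2 => l2" is "\<lambda>f x. - f x"
 by (auto intro: square_integrable_uminus elim: eventually_mono)

lift_definition minus_l2 :: "l2 => l2 => l2" is "\<lambda>f g x. f x - g x"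
 by (auto intro: square_integrable_diff elim: eventually_elim2)

lift_definition scaleR_l2 :: "real => l2 => l2" is "\<lambda>c f x. c * f x"
 by (auto intro: square_integrable_cmult elim: eventually_mono)

lift_definition inner_l2 :: "l2 => l2 => real" is "\<lambda>f g. LINT x|lebesgue. f x * g x"
proof -
 fix f g h k :: rfun
 assume 1: "f \<in> square_integrable \<and> g \<in> square_integrable \<and> (AE x in lebesgue. f x = g x)"
  and 2: "h \<in> square_integrable \<and> k \<in> square_integrable \<and> (AE x in lebesgue. h x = k x)"
 show "(LINT x|lebesgue. f x * h x) = (LINT x|lebesgue. g x * k x)"
 proof (rule integral_cong_AE)
  show "AE x in lebesgue. f x * h x = g x * k x" using 1 2 by (auto elim: eventually_elim2)
 qed (use 1 2 in \<open>auto simp: square_integrable_def\<close>)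
qed

definition norm_l2 :: "l2 => real" where "norm_l2 x = sqrt (inner x x)"
definition dist_l2 :: "l2 => l2 => real" where "dist_l2 x y = norm (x - y)"
definition sgn_l2 :: "l2 => l2" where "sgn_l2 x = inverse (norm x) *\<^sub>R x"
definition uniformity_l2 :: "(l2 \<times> l2) filter"
 where "uniformity_l2 = (INF e\<in>{0<..}. principal {(x, y). dist x y < e})"
definition open_l2 :: "l2 set => bool"
 where "open_l2 U = (\<forall>x\<in>U. eventually (\<lambda>(x', y). x' = x --> y \<in> U) uniformity)"

instance
proof
 fix a b c :: l2 and r s :: real and U :: "l2 set"
 show "a + b + c = a + (b + c)" by transfer (auto simp: add.assoc intro!: square_integrable_add)
 show "a + b = b + a" by transfer (auto simp: add.commute intro!: square_integrable_add)
 show "0 + a = a" by transfer auto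
 show "- a + a = 0" by transfer auto
 show "a - b = a + - b" by transfer (auto intro: square_integrable_diff)
 show "r *\<^sub>R (a + b) = r *\<^sub>R a + r *\<^sub>R b"
  by transfer (auto simp: distrib_left intro!: square_integrable_add square_integrable_cmult)
 show "(r + s) *\<^sub>R a = r *\<^sub>R a + s *\<^sub>R a"
  by transfer (auto simp: distrib_right intro!: square_integrable_add square_integrable_cmult)
 show "r *\<^sub>R s *\<^sub>R a = (r * s) *\<^sub>R a" by transfer (auto simp: mult.assoc intro!: square_integrable_cmult)
 show "1 *\<^sub>R a = a" by transfer auto
 show "dist a b = norm (a - b)" by (simp add: dist_l2_def)
 show "sgn a = inverse (norm a) *\<^sub>R a" by (simp add: sgn_l2_def)
 show "(uniformity :: (l2 \<times> l2) filter) = (INF e\<in>{0<..}. principal {(x, y). dist x y < e})"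
  by (simp add: uniformity_l2_def)
 show "open U = (\<forall>x\<in>U. \<forall>\<^sub>F (x', y) in uniformity. x' = x --> y \<in> U)" by (simp add: open_l2_def)
 show "inner a b = inner b a" by transfer (simp add: mult.commute)
 show "inner (a + b) c = inner a c + inner b c"
  by transfer (auto simp: distrib_right intro!: LINT_add square_integrable_mult)
 show "inner (r *\<^sub>R a) b = r * inner a b" by transfer (simp add: mult.assoc)
 show "0 \<le> inner a a" by transfer simp
 show "inner a a = 0 \<longleftrightarrow> a = 0" by transfer (auto simp: square_integrable_integral_eq_0)
 show "norm a = sqrt (inner a a)" by (simp add: norm_l2_def)
qed

end

section \<open>Passing between functions and their classes; completeness\<close>

lemma rep_l2_square_integrable [simp]: "rep_l2 h \<in> square_integrable"
 using Quotient3_rep_reflp[OF Quotient3_l2, of h] by blast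

lemma abs_rep_l2 [simp]: "abs_l2 (rep_l2 h) = h" using Quotient3_abs_rep[OF Quotient3_l2] by blast

lemma abs_l2_eq_iff:
 "f \<in> square_integrable ==> g \<in> square_integrable ==> abs_l2 f = abs_l2 g \<longleftrightarrow> (AE x in lebesgue. f x = g x)"
 using Quotient3_rel[OF Quotient3_l2, of f g] by auto

lemma rep_abs_l2: "f \<in> square_integrable ==> AE x in lebesgue. rep_l2 (abs_l2 f) x = f x"
 using abs_l2_eq_iff[of "rep_l2 (abs_l2 f)" f] by simp

lemma abs_l2_add: "f \<in> square_integrable ==> g \<in> square_integrable ==> abs_l2 (\<lambda>x. f x + g x) = abs_l2 f + abs_l2 g"
 by (rule plus_l2.abs_eq[symmetric]) auto

lemma abs_l2_diff: "f \<in> square_integrable ==> g \<in> square_integrable ==> abs_l2 (\<lambda>x. f x - g x) = abs_l2 f - abs_l2 g"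
 by (rule minus_l2.abs_eq[symmetric]) auto

lemma abs_l2_scaleR: "f \<in> square_integrable ==> abs_l2 (\<lambda>x. c * f x) = c *\<^sub>R abs_l2 f"
 by (rule scaleR_l2.abs_eq[symmetric]) auto

lemma inner_abs_l2:
 "f \<in> square_integrable ==> g \<in> square_integrable ==> inner (abs_l2 f) (abs_l2 g) = (LINT x|lebesgue. f x * g x)"
 by (rule inner_l2.abs_eq) auto

lemma norm_abs_l2: "f \<in> square_integrable ==> (norm (abs_l2 f))\<^sup>2 = (LINT x|lebesgue. (f x)\<^sup>2)"
 by (simp add: power2_norm_eq_inner inner_abs_l2) (simp add: power2_eq_square)

lemma nn_integral_square_l2:
 "f \<in> square_integrable ==> (\<integral>\<^sup>+x. ennreal ((f x)\<^sup>2) \<partial>lebesgue) = ennreal ((norm (abs_l2 f))\<^sup>2)"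
 by (subst nn_integral_eq_integral) (auto simp: norm_abs_l2 square_integrable_def)

lemma Fatou_l2:
 assumes f: "\<And>m::nat. f m \<in> square_integrable" and lim: "AE x in lebesgue. (\<lambda>m. f m x) \<longlonglongrightarrow> g x"
  and g: "g \<in> borel_measurable lebesgue" and B: "\<And>m. norm (abs_l2 (f m)) \<le> B"
 shows "g \<in> square_integrable" "norm (abs_l2 g) \<le> B"
proof -
 have B0: "B \<ge> 0" using B[of 0] norm_ge_zero order_trans by blast
 have "(\<integral>\<^sup>+x. ennreal ((g x)\<^sup>2) \<partial>lebesgue) = (\<integral>\<^sup>+x. liminf (\<lambda>m. ennreal ((f m x)\<^sup>2)) \<partial>lebesgue)"
 proof (rule nn_integral_cong_AE, use lim in eventually_elim)
  case (elim x)
  hence "(\<lambda>m. ennreal ((f m x)\<^sup>2)) \<longlonglongrightarrow> ennreal ((g x)\<^sup>2)" by (intro tendsto_intros)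
  from lim_imp_Liminf[OF trivial_limit_sequentially this] show ?case by (rule sym)
 qed
 also have "\<dots> \<le> liminf (\<lambda>m. \<integral>\<^sup>+x. ennreal ((f m x)\<^sup>2) \<partial>lebesgue)"
  by (rule nn_integral_liminf) (use f square_integrable_measurable in auto)
 also have "\<dots> \<le> ennreal (B\<^sup>2)"
 proof -
  have "(\<integral>\<^sup>+x. ennreal ((f m x)\<^sup>2) \<partial>lebesgue) \<le> ennreal (B\<^sup>2)" for m
   unfolding nn_integral_square_l2[OF f] by (intro ennreal_leI power_mono B) auto
  hence "liminf (\<lambda>m. \<integral>\<^sup>+x. ennreal ((f m x)\<^sup>2) \<partial>lebesgue) \<le> liminf (\<lambda>m::nat. ennreal (B\<^sup>2))"
   by (intro Liminf_mono) auto
  thus ?thesis by (simp add: Liminf_const)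
 qed
 finally have le: "(\<integral>\<^sup>+x. ennreal ((g x)\<^sup>2) \<partial>lebesgue) \<le> ennreal (B\<^sup>2)" .
 hence "(\<integral>\<^sup>+x. ennreal ((g x)\<^sup>2) \<partial>lebesgue) < \<infinity>" using ennreal_less_top le_less_trans by fastforce
 thus gs: "g \<in> square_integrable" using g by (intro square_integrableI) (auto simp: integrable_iff_bounded)
 have "(norm (abs_l2 g))\<^sup>2 \<le> B\<^sup>2" using le unfolding nn_integral_square_l2[OF gs] by simp
 thus "norm (abs_l2 g) \<le> B" using B0 by (rule power2_le_imp_le)
qed

text \<open>Riesz-Fischer: a fast subsequence converges almost everywhere, and Fatou's lemma turns
  the pointwise limit into a limit in norm.\<close>

instance l2 :: complete_space
proof
 fix X :: "nat => l2" assume X: "Cauchy X"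
 have "\<exists>N. \<forall>m\<ge>N. \<forall>n\<ge>N. dist (X m) (X n) < (1/2)^k" for k :: nat
  using X unfolding Cauchy_def by (meson half_gt_zero_iff zero_less_one zero_less_power zero_less_divide_1_iff zero_less_numeral)
 then obtain N where N: "\<And>k m n. m \<ge> N k ==> n \<ge> N k ==> dist (X m) (X n) < (1/2)^k" by metis
 define r where "r \<equiv> rec_nat (N 0) (\<lambda>k p. max (Suc p) (N (Suc k)))"
 have r_Suc: "r (Suc k) = max (Suc (r k)) (N (Suc k))" for k by (simp add: r_def)
 have rN: "r k \<ge> N k" for k by (cases k) (auto simp: r_def)
 have sm: "strict_mono r" by (auto simp: strict_mono_Suc_iff r_Suc)
 have d: "norm (X (r j) - X (r k)) \<le> (1/2)^k" if "j \<ge> k" for j k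
 proof -
  have "r j \<ge> r k" using sm that by (simp add: strict_mono_less_eq)
  thus ?thesis using N[of k "r j" "r k"] rN[of k] by (simp add: dist_norm)
 qed
 define f where "f \<equiv> \<lambda>k. rep_l2 (X (r k))"
 have fs: "f k \<in> square_integrable" for k by (simp add: f_def)
 have Xf: "X (r k) = abs_l2 (f k)" for k by (simp add: f_def)
 \<comment> \<open>The weight \<open>2 ^ k\<close> allows work with squares only: twice a difference
   is at most \<open>q k\<close> plus \<open>(1/2) ^ k\<close>, while the integral of
   \<open>q k\<close> is at most \<open>2 ^ k\<close> times the square of \<open>(1/2) ^ k\<close>,
   which is again summable.\<close>
 define q where "q \<equiv> \<lambda>k x. 2 ^ k * (f (Suc k) x - f k x)\<^sup>2"
 have qm: "q k \<in> borel_measurable lebesgue" for k unfolding q_def using fs square_integrable_measurable by measurable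
 have q: "(\<integral>\<^sup>+x. ennreal (q k x) \<partial>lebesgue) \<le> ennreal ((1/2) ^ k)" for k
 proof -
  have "(\<integral>\<^sup>+x. ennreal (q k x) \<partial>lebesgue) = ennreal (2 ^ k) * (\<integral>\<^sup>+x. ennreal ((f (Suc k) x - f k x)\<^sup>2) \<partial>lebesgue)"
   unfolding q_def using fs square_integrable_measurable by (simp add: ennreal_mult nn_integral_cmult)
  also have "\<dots> = ennreal (2 ^ k * (norm (X (r (Suc k)) - X (r k)))\<^sup>2)"
   by (simp add: nn_integral_square_l2[OF square_integrable_diff[OF fs fs]] abs_l2_diff fs Xf ennreal_mult)
  also have "\<dots> \<le> ennreal (2 ^ k * ((1/2) ^ k)\<^sup>2)" by (intro ennreal_leI mult_left_mono power_mono d) auto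
  finally show ?thesis by (simp add: power2_eq_square flip: power_mult_distrib)
 qed
 have "(\<integral>\<^sup>+x. (\<Sum>k. ennreal (q k x)) \<partial>lebesgue) = (\<Sum>k. \<integral>\<^sup>+x. ennreal (q k x) \<partial>lebesgue)"
  using qm by (intro nn_integral_suminf) auto
 also have "\<dots> \<le> (\<Sum>k. ennreal ((1/2) ^ k))" by (intro suminf_le q) auto
 also have "\<dots> = ennreal (\<Sum>k. (1/2) ^ k)" by (intro suminf_ennreal2) auto
 finally have "(\<integral>\<^sup>+x. (\<Sum>k. ennreal (q k x)) \<partial>lebesgue) \<noteq> \<infinity>" by (auto simp: top_unique)
 hence "AE x in lebesgue. (\<Sum>k. ennreal (q k x)) \<noteq> \<infinity>"
  using qm by (intro nn_integral_noteq_infinite) auto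
 hence conv: "AE x in lebesgue. convergent (\<lambda>k. f k x)"
 proof eventually_elim
  case (elim x)
  hence "summable (\<lambda>k. q k x)" by (intro summable_suminf_not_top) (auto simp: q_def)
  hence "summable (\<lambda>k. q k x + (1/2) ^ k)" by (intro summable_add summable_geometric) auto
  moreover have "norm (f (Suc k) x - f k x) \<le> q k x + (1/2) ^ k" for k
  proof -
   have "0 \<le> (2 ^ k * \<bar>f (Suc k) x - f k x\<bar> - 1)\<^sup>2 / 2 ^ k" by simp
   also have "\<dots> = q k x + (1/2) ^ k - 2 * \<bar>f (Suc k) x - f k x\<bar>"
    by (simp add: q_def power2_diff power_mult_distrib field_simps) (simp add: power2_eq_square)
   finally have "2 * \<bar>f (Suc k) x - f k x\<bar> \<le> q k x + (1/2) ^ k" by simp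
   thus ?thesis by (rule order_trans[rotated]) simp
  qed
  ultimately have "summable (\<lambda>k. f (Suc k) x - f k x)" by (rule summable_comparison_test')
  hence "convergent (\<lambda>n. f n x - f 0 x)"
   by (simp only: summable_iff_convergent sum_lessThan_telescope[of "\<lambda>k. f k x"])
  thus ?case by (simp only: convergent_diff_const_right_iff)
 qed
 define F where "F \<equiv> \<lambda>x. lim (\<lambda>k. f k x)"
 have Fm: "F \<in> borel_measurable lebesgue"
  unfolding F_def by (rule borel_measurable_lim_metric) (use fs square_integrable_measurable in auto)
 have lim: "AE x in lebesgue. (\<lambda>k. f k x) \<longlonglongrightarrow> F x"
  using conv by eventually_elim (simp add: F_def convergent_LIMSEQ_iff)
 have diff: "(\<lambda>x. F x - f k x) \<in> square_integrable \<and> norm (abs_l2 (\<lambda>x. F x - f k x)) \<le> (1/2)^k" for k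
 proof -
  have a: "(\<lambda>x. f (m + k) x - f k x) \<in> square_integrable" for m by (intro square_integrable_diff fs)
  have b: "AE x in lebesgue. (\<lambda>m. f (m + k) x - f k x) \<longlonglongrightarrow> F x - f k x"
   using lim by eventually_elim (intro tendsto_intros LIMSEQ_ignore_initial_segment)
  have c: "norm (abs_l2 (\<lambda>x. f (m + k) x - f k x)) \<le> (1/2)^k" for m
   using d[of k "m + k"] by (simp add: abs_l2_diff fs Xf)
  show ?thesis using Fatou_l2[of "\<lambda>m x. f (m + k) x - f k x", OF a b _ c] Fm fs square_integrable_measurable by auto
 qed
 have Fs: "F \<in> square_integrable" using square_integrable_add[OF diff[of 0, THEN conjunct1] fs[of 0]] by simp
 have "(\<lambda>k. X (r k)) \<longlonglongrightarrow> abs_l2 F"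
 proof (rule LIM_zero_cancel, rule Lim_null_comparison)
  show "\<forall>\<^sub>F k in sequentially. norm (X (r k) - abs_l2 F) \<le> (1/2)^k"
   using diff by (simp add: Xf abs_l2_diff Fs fs norm_minus_commute)
  show "(\<lambda>k. (1/2)^k) \<longlonglongrightarrow> (0::real)" by (rule LIMSEQ_realpow_zero) auto
 qed
 hence "X \<longlonglongrightarrow> abs_l2 F" using Cauchy_converges_subseq[OF X sm] by (simp add: o_def)
 thus "convergent X" by (auto simp: convergent_def)
qed

section \<open>Compact positive operators\<close>

locale compact_positive_operator =
 fixes K :: "'a::real_inner => 'a"
 assumes lin: "bounded_linear K"
  and sym: "inner (K x) y = inner x (K y)"
  and pos: "0 \<le> inner (K x) x"
  and cpt: "(\<And>n::nat. norm (X n) \<le> 1) ==> \<exists>l r. strict_mono (r :: nat => nat) \<and> (\<lambda>n. K (X (r n))) \<longlonglongrightarrow> l"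
begin

interpretation K: bounded_linear K by (rule lin)

lemma Cauchy_Schwarz_form: "(inner (K x) y)\<^sup>2 \<le> inner (K x) x * inner (K y) y"
proof -
 let ?a = "inner (K x) x" and ?b = "inner (K x) y" and ?d = "inner (K y) y"
 have q: "0 \<le> ?a + 2 * t * ?b + t\<^sup>2 * ?d" for t
 proof -
  have "inner (K (x + t *\<^sub>R y)) (x + t *\<^sub>R y) = ?a + 2 * t * ?b + t\<^sup>2 * ?d"
   using sym[of x y] by (simp add: K.add K.scaleR inner_add inner_commute power2_eq_square algebra_simps)
  thus ?thesis using pos[of "x + t *\<^sub>R y"] by simp
 qed
 show ?thesis
 proof (cases "?d = 0")
  case True
  have "?b = 0"
  proof (rule ccontr)
   assume b: "?b \<noteq> 0"
   \<comment> \<open>At this t the affine polynomial takes the value -1.\<close>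
   from q[of "- (?a + 1) / (2 * ?b)"] True b show False by (simp add: field_simps)
  qed
  thus ?thesis using True by simp
 next
  case False
  hence d: "?d > 0" using pos[of y] by simp
  from q[of "- ?b / ?d"] d show ?thesis by (simp add: field_simps power2_eq_square)
 qed
qed

text \<open>Maximise the Rayleigh quotient on the unit sphere of \<open>M\<close>. Compactness makes
  the images of a maximising sequence converge along a subsequence, and since
  \<open>K F - \<mu> F\<close> tends to 0 with \<open>\<mu> > 0\<close>, the vectors themselves
  converge, to an eigenvector.\<close>

lemma eigenvector_in_invariant:
 assumes M: "subspace M" "closed M" and inv: "\<And>x. x \<in> M ==> K x \<in> M"
  and f0: "f0 \<in> M" "K f0 \<noteq> 0"
 obtains f \<mu> where "f \<in> M" "norm f = 1" "\<mu> > 0" "K f = \<mu> *\<^sub>R f"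
proof -
 obtain B where B: "\<And>x. norm (K x) \<le> norm x * B" using K.bounded by blast
 let ?Q = "(\<lambda>f. inner (K f) f) ` {f \<in> M. norm f = 1}"
 define \<mu> where "\<mu> = Sup ?Q"
 have QB: "inner (K f) f \<le> B" if "norm f = 1" for f
  using order_trans[OF norm_cauchy_schwarz[of "K f" f]] B[of f] that by simp
 have bdd: "bdd_above ?Q" using QB by (intro bdd_aboveI[of _ B]) auto
 have ub: "inner (K f) f \<le> \<mu>" if "f \<in> M" "norm f = 1" for f
  unfolding \<mu>_def by (rule cSup_upper[OF _ bdd]) (use that in auto)
 have ub': "inner (K f) f \<le> \<mu> * (norm f)\<^sup>2" if "f \<in> M" for f
 proof (cases "f = 0")
  case False
  have "inner (K (f /\<^sub>R norm f)) (f /\<^sub>R norm f) \<le> \<mu>"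
   using that False M(1) by (intro ub) (auto simp: subspace_scale)
  thus ?thesis using False by (simp add: K.scaleR field_simps power2_eq_square)
 qed simp
 have f0': "f0 \<noteq> 0" "inner (K f0) f0 > 0"
 proof -
  show "f0 \<noteq> 0" using f0(2) K.zero by blast
  have "inner (K f0) f0 \<noteq> 0"
  proof
   assume "inner (K f0) f0 = 0"
   hence "(inner (K f0) (K f0))\<^sup>2 \<le> 0" using Cauchy_Schwarz_form[of f0 "K f0"] by simp
   thus False using f0(2) by simp
  qed
  thus "inner (K f0) f0 > 0" using pos[of f0] by simp
 qed
 have \<mu>0: "\<mu> > 0"
 proof -
  have "0 < \<mu> * (norm f0)\<^sup>2" using ub'[OF f0(1)] f0'(2) by simp
  thus ?thesis by (simp add: zero_less_mult_iff)
 qed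
 have ne: "?Q \<noteq> {}"
 proof -
  have "f0 /\<^sub>R norm f0 \<in> {f \<in> M. norm f = 1}" using f0(1) f0'(1) M(1) by (auto simp: subspace_scale)
  thus ?thesis by blast
 qed
 have "\<exists>f\<in>M. norm f = 1 \<and> \<mu> - 1 / real (Suc n) < inner (K f) f" for n
 proof -
  have "\<mu> - 1 / real (Suc n) < Sup ?Q" by (simp add: \<mu>_def)
  thus ?thesis using less_cSup_iff[OF ne bdd] by auto
 qed
 then obtain F where F: "\<And>n. F n \<in> M" "\<And>n. norm (F n) = 1" "\<And>n. \<mu> - 1 / real (Suc n) < inner (K (F n)) (F n)"
  by metis
 obtain l r where r: "strict_mono r" and l: "(\<lambda>n. K (F (r n))) \<longlonglongrightarrow> l"
  using cpt[of F] F(2) by auto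
 \<comment> \<open>The form inequality with second argument \<open>K f\<close>, with the quotient of
   \<open>K f\<close> bounded by \<open>\<mu>\<close>, replaces the identity between operator norm
   and numerical radius.\<close>
 have Knorm: "(norm (K f))\<^sup>2 \<le> \<mu> * inner (K f) f" if f: "f \<in> M" for f
 proof (cases "K f = 0")
  case False
  have "((norm (K f))\<^sup>2)\<^sup>2 \<le> inner (K f) f * inner (K (K f)) (K f)"
   using Cauchy_Schwarz_form[of f "K f"] by (simp add: power2_norm_eq_inner)
  also have "\<dots> \<le> inner (K f) f * (\<mu> * (norm (K f))\<^sup>2)" by (intro mult_left_mono ub' inv f pos)
  finally have "(norm (K f))\<^sup>2 * (norm (K f))\<^sup>2 \<le> (\<mu> * inner (K f) f) * (norm (K f))\<^sup>2"
   by (simp add: power2_eq_square mult_ac)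
  thus ?thesis by (rule mult_right_le_imp_le) (use False in simp)
 qed (use pos \<mu>0 in auto)
 have "(\<lambda>n. norm (K (F (r n)) - \<mu> *\<^sub>R F (r n))) \<longlonglongrightarrow> 0"
 proof (rule Lim_null_comparison[of _ "\<lambda>n. sqrt (\<mu> * (1 / real (Suc (r n))))"])
  have "norm (K (F n) - \<mu> *\<^sub>R F n) \<le> sqrt (\<mu> * (1 / real (Suc n)))" for n
  proof (rule real_le_rsqrt)
   have "(norm (K (F n) - \<mu> *\<^sub>R F n))\<^sup>2 = (norm (K (F n)))\<^sup>2 - 2 * \<mu> * inner (K (F n)) (F n) + \<mu>\<^sup>2"
    using F(2)[of n] unfolding power2_norm_eq_inner
    by (simp add: inner_diff inner_commute power2_eq_square norm_eq_1 algebra_simps)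
   also have "\<dots> \<le> \<mu> * (\<mu> - inner (K (F n)) (F n))"
    using Knorm[OF F(1)[of n]] by (simp add: algebra_simps power2_eq_square)
   also have "\<dots> \<le> \<mu> * (1 / real (Suc n))" using F(3)[of n] \<mu>0 by (intro mult_left_mono) auto
   finally show "(norm (K (F n) - \<mu> *\<^sub>R F n))\<^sup>2 \<le> \<mu> * (1 / real (Suc n))" .
  qed
  thus "\<forall>\<^sub>F n in sequentially. norm (norm (K (F (r n)) - \<mu> *\<^sub>R F (r n))) \<le> sqrt (\<mu> * (1 / real (Suc (r n))))"
   by simp
  have "(\<lambda>n. sqrt (\<mu> * (1 / real (Suc n)))) \<longlonglongrightarrow> sqrt (\<mu> * 0)"
   by (intro tendsto_intros LIMSEQ_Suc lim_1_over_n)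
  thus "(\<lambda>n. sqrt (\<mu> * (1 / real (Suc (r n))))) \<longlonglongrightarrow> 0"
   using LIMSEQ_subseq_LIMSEQ[OF _ r, of "\<lambda>n. sqrt (\<mu> * (1 / real (Suc n)))" 0] by (simp add: o_def)
 qed
 hence "(\<lambda>n. K (F (r n)) - (K (F (r n)) - \<mu> *\<^sub>R F (r n))) \<longlonglongrightarrow> l - 0"
  by (rule tendsto_diff[OF l tendsto_norm_zero_cancel])
 hence "(\<lambda>n. (1 / \<mu>) *\<^sub>R (\<mu> *\<^sub>R F (r n))) \<longlonglongrightarrow> (1 / \<mu>) *\<^sub>R l"
  by (intro tendsto_scaleR tendsto_const) simp
 hence lim: "(\<lambda>n. F (r n)) \<longlonglongrightarrow> (1 / \<mu>) *\<^sub>R l" using \<mu>0 by simp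
 let ?f = "(1 / \<mu>) *\<^sub>R l"
 have "?f \<in> M" by (rule closed_sequentially[OF M(2) _ lim]) (rule F(1))
 moreover have "norm ?f = 1" using tendsto_norm[OF lim] unfolding F(2) by (rule LIMSEQ_unique[OF _ tendsto_const])
 moreover have "K ?f = \<mu> *\<^sub>R ?f"
 proof -
  have "(\<lambda>n. K (F (r n))) \<longlonglongrightarrow> K ?f" by (rule K.tendsto[OF lim])
  hence "K ?f = l" by (rule LIMSEQ_unique[OF _ l])
  thus ?thesis using \<mu>0 by simp
 qed
 ultimately show thesis using that \<mu>0 by blast
qed

text \<open>Take a maximal orthonormal set of eigenvectors with positive eigenvalue, by Zorn. Its
  orthogonal complement is closed and invariant; if \<open>K\<close> did not vanish on it, it would
  contain a further eigenvector. Countability comes from the finiteness of the eigenvectors above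
  each positive level.\<close>

theorem spectral:
 obtains E where "countable E" "\<And>e. e \<in> E ==> norm e = 1"
  "\<And>e e'. e \<in> E ==> e' \<in> E ==> e \<noteq> e' ==> inner e e' = 0"
  "\<And>e. e \<in> E ==> \<exists>\<mu>>0. K e = \<mu> *\<^sub>R e"
  "\<And>f. (\<And>e. e \<in> E ==> inner f e = 0) ==> K f = 0"
proof -
 define P where "P \<equiv> {E. (\<forall>e\<in>E. norm e = 1 \<and> (\<exists>\<mu>>0. K e = \<mu> *\<^sub>R e)) \<and> (\<forall>e\<in>E. \<forall>e'\<in>E. e \<noteq> e' --> inner e e' = 0)}"
 have "\<exists>E\<in>P. \<forall>X\<in>P. E \<subseteq> X --> X = E"
 proof (rule subset_Zorn')
  fix C assume C: "subset.chain P C"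
  have CP: "C \<subseteq> P" and tot: "\<And>X Y. X \<in> C ==> Y \<in> C ==> X \<subseteq> Y \<or> Y \<subseteq> X"
   using C by (auto simp: subset_chain_def)
  show "\<Union>C \<in> P" unfolding P_def mem_Collect_eq
  proof (intro conjI ballI impI)
   fix e e' assume "e \<in> \<Union>C" "e' \<in> \<Union>C" and ne: "e \<noteq> e'"
   then obtain X Y where XY: "X \<in> C" "e \<in> X" "Y \<in> C" "e' \<in> Y" by blast
   then obtain Z where "Z \<in> C" "e \<in> Z" "e' \<in> Z" using tot[of X Y] by blast
   thus "inner e e' = 0" using CP ne by (auto simp: P_def)
  qed (use CP in \<open>auto simp: P_def\<close>)
 qed
 then obtain E where E: "E \<in> P" and max: "\<And>X. X \<in> P ==> E \<subseteq> X ==> X = E" by blast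
 have n1: "norm e = 1" if "e \<in> E" for e using E that by (auto simp: P_def)
 have eig: "\<exists>\<mu>>0. K e = \<mu> *\<^sub>R e" if "e \<in> E" for e using E that by (auto simp: P_def)
 have orth: "inner e e' = 0" if "e \<in> E" "e' \<in> E" "e \<noteq> e'" for e e' using E that by (auto simp: P_def)
 have ker: "K f = 0" if f: "\<And>e. e \<in> E ==> inner f e = 0" for f
 proof (rule ccontr)
  assume nz: "K f \<noteq> 0"
  let ?M = "{f. \<forall>e\<in>E. inner f e = 0}"
  have "?M = (\<Inter>e\<in>E. {f. inner f e = 0})" by auto
  moreover have "closed {f. inner f e = 0}" for e :: 'a by (intro closed_Collect_eq continuous_intros)
  ultimately have cl: "closed ?M" by auto
  obtain g \<mu> where g: "g \<in> ?M" "norm g = 1" "\<mu> > 0" "K g = \<mu> *\<^sub>R g"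
  proof (rule eigenvector_in_invariant[of ?M f])
   show "subspace ?M" by (auto simp: subspace_def inner_add_left)
   show "closed ?M" by (rule cl)
   fix x assume x: "x \<in> ?M"
   show "K x \<in> ?M"
   proof (clarify)
    fix e assume e: "e \<in> E"
    then obtain \<mu> where "K e = \<mu> *\<^sub>R e" using eig by blast
    thus "inner (K x) e = 0" using x e by (simp add: sym)
   qed
  qed (use f nz in auto)
  have "insert g E \<in> P" using E g by (auto simp: P_def inner_commute)
  hence "g \<in> E" using max[of "insert g E"] by blast
  hence "inner g g = 0" using g(1) by blast
  thus False using g(2) by simp
 qed
 obtain m where m: "\<And>e. e \<in> E ==> m e > 0 \<and> K e = m e *\<^sub>R e" using eig by metis
 \<comment> \<open>The images of two distinct such eigenvectors are more than
   \<open>1 / Suc n\<close> apart, so an infinite set of them would contradict compactness.\<close>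
 have fin: "finite {e \<in> E. m e > 1 / real (Suc n)}" (is "finite ?A") for n
 proof (rule ccontr)
  assume "infinite ?A"
  then obtain X :: "nat => 'a" where X: "inj X" "range X \<subseteq> ?A" using infinite_countable_subset by blast
  have XE: "X i \<in> E" "m (X i) > 1 / real (Suc n)" for i using X(2) by auto
  obtain l r where r: "strict_mono r" and l: "(\<lambda>i. K (X (r i))) \<longlonglongrightarrow> l"
   using cpt[of X] n1 XE(1) by fastforce
  have "Cauchy (\<lambda>i. K (X (r i)))" using l LIMSEQ_imp_Cauchy by blast
  then obtain N where N: "\<And>i j. i \<ge> N ==> j \<ge> N ==> norm (K (X (r i)) - K (X (r j))) < 1 / real (Suc n)"
   unfolding Cauchy_iff by (metis of_nat_0_less_iff zero_less_Suc zero_less_divide_1_iff)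
  let ?x = "X (r N)" and ?y = "X (r (Suc N))"
  have "?x \<noteq> ?y" using X(1) r by (metis injD n_not_Suc_n strict_mono_eq)
  hence o: "inner ?x ?y = 0" using orth XE by blast
  have "(norm (K ?x - K ?y))\<^sup>2 = (m ?x)\<^sup>2 + (m ?y)\<^sup>2"
   using o m[OF XE(1)] n1[OF XE(1)] unfolding power2_norm_eq_inner
   by (simp add: inner_diff inner_commute norm_eq_1 power2_eq_square)
  hence "(m ?x)\<^sup>2 \<le> (norm (K ?x - K ?y))\<^sup>2" by simp
  hence "m ?x \<le> norm (K ?x - K ?y)" by (rule power2_le_imp_le) simp
  thus False using N[of N "Suc N"] XE(2)[of "r N"] by simp
 qed
 have E_eq: "E = (\<Union>n. {e \<in> E. m e > 1 / real (Suc n)})"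
 proof -
  have "\<exists>n. m e > 1 / real (Suc n)" if "e \<in> E" for e
   using reals_Archimedean[of "m e"] m[OF that] by (simp add: inverse_eq_divide)
  thus ?thesis by blast
 qed
 have "countable E" by (subst E_eq) (intro countable_UN countable_finite fin countableI_type)
 thus thesis using that n1 orth eig ker by blast
qed

end

section \<open>Square integrable functions on an interval\<close>

lemma LINT_on_eq: "(LINT x|leb L. f x) = (LINT x|lebesgue. indicator {0<..<L} x * f x)"
 for f :: rfun by (simp add: integral_restrict_space)

lemma integrable_on_eq:
 "integrable (leb L) f \<longleftrightarrow> integrable lebesgue (\<lambda>x. indicator {0<..<L} x * f x)"
 for f :: rfun by (simp add: integrable_restrict_space)

lemma measurable_on_eq:
 "f \<in> meas L \<longleftrightarrow> (\<lambda>x. indicator {0<..<L} x * f x) \<in> borel_measurable lebesgue"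
 for f :: rfun by (subst borel_measurable_restrict_space_iff) (auto simp: mult.commute)

lemma AE_on_eq: "(AE x in leb L. P x) \<longleftrightarrow> (AE x in lebesgue. x \<in> {0<..<L} --> P x)"
 for L :: real by (rule AE_restrict_space_iff) simp

lemma indicator_sq: "(indicator S x * c)\<^sup>2 = indicator S x * c\<^sup>2" for c :: real by (simp add: indicator_def)

lemma L2_space_iff: "u \<in> L2_space L \<longleftrightarrow> (\<lambda>x. indicator {0<..<L} x * u x) \<in> square_integrable"
 unfolding L2_space_def square_integrable_def mem_Collect_eq measurable_on_eq integrable_on_eq indicator_sq ..

definition emb :: "real => rfun => l2" where
 "emb L u = abs_l2 (\<lambda>x. indicator {0<..<L} x * u x)"

lemma L2_measurable: "u \<in> L2_space L ==> u \<in> meas L" by (simp add: L2_space_def)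

lemma L2_add: "u \<in> L2_space L ==> v \<in> L2_space L ==> (\<lambda>x. u x + v x) \<in> L2_space L"
 unfolding L2_space_iff distrib_left by (rule square_integrable_add)

lemma L2_diff: "u \<in> L2_space L ==> v \<in> L2_space L ==> (\<lambda>x. u x - v x) \<in> L2_space L"
 unfolding L2_space_iff right_diff_distrib by (rule square_integrable_diff)

lemma L2_cmult: "u \<in> L2_space L ==> (\<lambda>x. c * u x) \<in> L2_space L"
 unfolding L2_space_iff using square_integrable_cmult[of "\<lambda>x. indicator {0<..<L} x * u x" c]
 by (simp add: mult.left_commute)

lemma L2_zero [simp]: "(\<lambda>x. 0) \<in> L2_space L" by (simp add: L2_space_iff)

lemma L2_sum: "(\<And>i. i \<in> F ==> u i \<in> L2_space L) ==> (\<lambda>x. \<Sum>i\<in>F. u i x) \<in> L2_space L"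
 by (induction F rule: infinite_finite_induct) (auto intro: L2_add)

lemma emb_add: "u \<in> L2_space L ==> v \<in> L2_space L ==> emb L (\<lambda>x. u x + v x) = emb L u + emb L v"
 unfolding L2_space_iff emb_def distrib_left by (rule abs_l2_add)

lemma emb_diff: "u \<in> L2_space L ==> v \<in> L2_space L ==> emb L (\<lambda>x. u x - v x) = emb L u - emb L v"
 unfolding L2_space_iff emb_def right_diff_distrib by (rule abs_l2_diff)

lemma emb_cmult: "u \<in> L2_space L ==> emb L (\<lambda>x. c * u x) = c *\<^sub>R emb L u" unfolding L2_space_iff emb_def
 using abs_l2_scaleR[of "\<lambda>x. indicator {0<..<L} x * u x" c] by (simp add: mult.left_commute)

lemma L2_mult_integrable: "u \<in> L2_space L ==> v \<in> L2_space L ==> integrable (leb L) (\<lambda>x. u x * v x)"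
 unfolding integrable_on_eq L2_space_iff by (drule (1) square_integrable_mult, erule LINT_able_cong[THEN iffD1, rotated -1])
  (auto simp: indicator_def)

lemma inner_emb: "u \<in> L2_space L ==> v \<in> L2_space L ==> inner (emb L u) (emb L v) = (LINT x|leb L. u x * v x)"
 unfolding L2_space_iff emb_def LINT_on_eq by (subst inner_abs_l2) (auto intro!: LINT_cong simp: indicator_def)

lemma norm_emb: "u \<in> L2_space L ==> norm (emb L u) = L2_norm L u"
 by (simp add: norm_eq_sqrt_inner inner_emb L2_norm_def power2_eq_square)

lemma L2_norm_ge_0 [simp]: "L2_norm L u \<ge> 0" by (simp add: L2_norm_def)

lemma L2_norm_sq: "(L2_norm L u)\<^sup>2 = (LINT x|leb L. (u x)\<^sup>2)" by (simp add: L2_norm_def)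

lemma L2_norm_cmult: "u \<in> L2_space L ==> L2_norm L (\<lambda>x. c * u x) = \<bar>c\<bar> * L2_norm L u"
 by (simp add: norm_emb[symmetric] L2_cmult emb_cmult)

lemma L2_norm_zero [simp]: "L2_norm L (\<lambda>x. 0) = 0" by (simp add: L2_norm_def)

lemma L2_Cauchy_Schwarz:
 "u \<in> L2_space L ==> v \<in> L2_space L ==> \<bar>LINT x|leb L. u x * v x\<bar> \<le> L2_norm L u * L2_norm L v"
 using Cauchy_Schwarz_ineq2[of "emb L u" "emb L v"] by (simp add: inner_emb norm_emb)

lemma emb_eq_iff:
 "u \<in> L2_space L ==> v \<in> L2_space L ==> emb L u = emb L v \<longleftrightarrow> (AE x in leb L. u x = v x)"
 unfolding L2_space_iff emb_def AE_on_eq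
 by (subst abs_l2_eq_iff) (auto intro!: arg_cong[where f = "\<lambda>P. almost_everywhere lebesgue P"] simp: indicator_def)

lemma L2_cong_AE:
 assumes u: "u \<in> L2_space L" and ae: "AE x in leb L. u x = v x"
 shows "v \<in> L2_space L" "emb L v = emb L u"
proof -
 have ae': "AE x in lebesgue. indicator {0<..<L} x * u x = indicator {0<..<L} x * v x"
  using ae unfolding AE_on_eq by eventually_elim (auto simp: indicator_def)
 have us: "(\<lambda>x. indicator {0<..<L} x * u x) \<in> square_integrable" using u by (simp add: L2_space_iff)
 have m: "(\<lambda>x. indicator {0<..<L} x * v x) \<in> borel_measurable lebesgue"
  by (rule borel_measurable_AE[OF square_integrable_measurable[OF us] ae'])
 show v: "v \<in> L2_space L" unfolding L2_space_iff
 proof (rule square_integrable_bound[OF us m], use ae' in eventually_elim)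
  case (elim x)
  show ?case unfolding elim by (rule order_refl)
 qed
 show "emb L v = emb L u" using emb_eq_iff[OF v u] ae by (simp add: eq_commute)
qed

lemma emb_zero [simp]: "emb L (\<lambda>x. 0) = 0" by (simp add: emb_def zero_l2_def)

lemma rep_l2_L2 [simp]: "rep_l2 h \<in> L2_space L"
proof -
 have "(\<lambda>x. indicator {0<..<L} x * rep_l2 h x) \<in> borel_measurable lebesgue"
  by (intro borel_measurable_times square_integrable_measurable rep_l2_square_integrable borel_measurable_indicator) simp
 moreover have "\<bar>indicator {0<..<L} x * rep_l2 h x\<bar> \<le> \<bar>rep_l2 h x\<bar>" for x by (simp add: indicator_def)
 ultimately show ?thesis unfolding L2_space_iff using square_integrable_bound[OF rep_l2_square_integrable] by blast
qed

lemma rep_emb: "u \<in> L2_space L ==> AE x in leb L. rep_l2 (emb L u) x = u x"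
proof -
 assume "u \<in> L2_space L"
 hence "AE x in lebesgue. rep_l2 (emb L u) x = indicator {0<..<L} x * u x"
  unfolding L2_space_iff emb_def by (rule rep_abs_l2)
 thus ?thesis unfolding AE_on_eq by eventually_elim simp
qed

lemma emb_rep_emb [simp]: "u \<in> L2_space L ==> emb L (rep_l2 (emb L u)) = emb L u"
 using emb_eq_iff[of "rep_l2 (emb L u)" L u] rep_emb by simp

text \<open>This map is the orthogonal projection onto the classes carried by (0,L). It is written
  through representatives, which respect sums and multiples only almost everywhere.\<close>

lemma bounded_linear_emb_rep: "bounded_linear (\<lambda>h. emb L (rep_l2 h))"
proof (rule bounded_linear_intro[where K = 1])
 fix a b :: l2 and r :: real
 have "AE x in lebesgue. rep_l2 (a + b) x = rep_l2 a x + rep_l2 b x"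
  using rep_abs_l2[of "\<lambda>x. rep_l2 a x + rep_l2 b x"] by (simp add: abs_l2_add square_integrable_add)
 hence "emb L (rep_l2 (a + b)) = emb L (\<lambda>x. rep_l2 a x + rep_l2 b x)"
  by (subst emb_eq_iff) (auto simp: L2_add AE_on_eq elim: eventually_mono)
 thus "emb L (rep_l2 (a + b)) = emb L (rep_l2 a) + emb L (rep_l2 b)" by (simp add: emb_add)
 have "AE x in lebesgue. rep_l2 (r *\<^sub>R a) x = r * rep_l2 a x"
  using rep_abs_l2[of "\<lambda>x. r * rep_l2 a x"] by (simp add: abs_l2_scaleR square_integrable_cmult)
 hence "emb L (rep_l2 (r *\<^sub>R a)) = emb L (\<lambda>x. r * rep_l2 a x)"
  by (subst emb_eq_iff) (auto simp: L2_cmult AE_on_eq elim: eventually_mono)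
 thus "emb L (rep_l2 (r *\<^sub>R a)) = r *\<^sub>R emb L (rep_l2 a)" by (simp add: emb_cmult)
 have "(norm (emb L (rep_l2 a)))\<^sup>2 \<le> (norm a)\<^sup>2"
 proof -
  have 1: "(\<lambda>x. indicator {0<..<L} x * rep_l2 a x) \<in> square_integrable" using rep_l2_L2[of a L] by (simp only: L2_space_iff)
  have "(norm (emb L (rep_l2 a)))\<^sup>2 = (LINT x|lebesgue. (indicator {0<..<L} x * rep_l2 a x)\<^sup>2)"
   unfolding emb_def by (rule norm_abs_l2[OF 1])
  also have "\<dots> \<le> (LINT x|lebesgue. (rep_l2 a x)\<^sup>2)"
  proof (rule integral_mono)
   show "integrable lebesgue (\<lambda>x. (indicator {0<..<L} x * rep_l2 a x)\<^sup>2)" using 1 by (simp add: square_integrable_def)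
   show "integrable lebesgue (\<lambda>x. (rep_l2 a x)\<^sup>2)" using rep_l2_square_integrable[of a] by (simp add: square_integrable_def)
  qed (auto simp: indicator_def)
  also have "\<dots> = (norm a)\<^sup>2" using norm_abs_l2[of "rep_l2 a"] by simp
  finally show ?thesis .
 qed
 from power2_le_imp_le[OF this norm_ge_zero] show "norm (emb L (rep_l2 a)) \<le> norm a * 1" by simp
qed

lemma inner_emb_rep:
 "u \<in> L2_space L ==> inner (emb L (rep_l2 h)) (emb L u) = inner h (emb L u)"
proof -
 assume u: "u \<in> L2_space L"
 hence us: "(\<lambda>x. indicator {0<..<L} x * u x) \<in> square_integrable" by (simp add: L2_space_iff)
 have "inner (abs_l2 (rep_l2 h)) (emb L u) = (LINT x|lebesgue. rep_l2 h x * (indicator {0<..<L} x * u x))"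
  unfolding emb_def by (rule inner_abs_l2[OF _ us]) simp
 moreover have "inner (emb L (rep_l2 h)) (emb L u) = (LINT x|lebesgue. indicator {0<..<L} x * (rep_l2 h x * u x))"
  by (simp add: inner_emb u LINT_on_eq)
 ultimately show ?thesis by (simp add: mult.left_commute)
qed

lemma L2_complete:
 assumes u: "\<And>n::nat. u n \<in> L2_space L" and C: "Cauchy (\<lambda>n. emb L (u n))"
 obtains v where "v \<in> L2_space L" "(\<lambda>n. emb L (u n)) \<longlonglongrightarrow> emb L v"
proof -
 obtain h where h: "(\<lambda>n. emb L (u n)) \<longlonglongrightarrow> h" using Cauchy_convergent[OF C] unfolding convergent_def by blast
 have "(\<lambda>n. emb L (rep_l2 (emb L (u n)))) \<longlonglongrightarrow> emb L (rep_l2 h)"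
  by (rule bounded_linear.tendsto[OF bounded_linear_emb_rep h])
 hence "(\<lambda>n. emb L (u n)) \<longlonglongrightarrow> emb L (rep_l2 h)" using u by simp
 thus thesis using that[of "rep_l2 h"] by simp
qed

lemma L2_bounded_measurable:
 fixes L :: real
 assumes "u \<in> meas L" "\<And>x. x \<in> {0<..<L} ==> \<bar>u x\<bar> \<le> B"
 shows "u \<in> L2_space L"
proof -
 have fm: "finite_measure (leb L)" by (rule finite_measure_lebesgue_on) simp
 have "integrable (leb L) (\<lambda>x. (u x)\<^sup>2)"
 proof (rule finite_measure.integrable_const_bound[OF fm, of _ "B\<^sup>2"])
  show "AE x in leb L. norm ((u x)\<^sup>2) \<le> B\<^sup>2"
  proof (rule AE_I2)
   fix x assume "x \<in> space (leb L)"
   hence "\<bar>u x\<bar> \<le> B" using assms(2)[of x] by (simp only: space_lebesgue_on)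
   hence "\<bar>u x\<bar>\<^sup>2 \<le> B\<^sup>2" by (rule power_mono) (rule abs_ge_zero)
   thus "norm ((u x)\<^sup>2) \<le> B\<^sup>2" by (simp only: power2_abs real_norm_def abs_power2)
  qed
 qed (use assms(1) in simp)
 thus ?thesis using assms(1) by (simp add: L2_space_def)
qed

lemma L2_const [simp]: "(\<lambda>x. c) \<in> L2_space L" by (rule L2_bounded_measurable[of _ _ "\<bar>c\<bar>"]) auto

lemma L2_integrable: "u \<in> L2_space L ==> integrable (leb L) u" using L2_mult_integrable[of u L "\<lambda>x. 1"] by simp

lemma sigma_finite_lebesgue: "sigma_finite_measure (lebesgue :: real measure)"
proof
 have "(\<Union>n. {- real n..real n}) = UNIV"
 proof (rule equalityI[OF subset_UNIV], rule subsetI)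
  fix x :: real
  obtain n where "\<bar>x\<bar> < real n" using reals_Archimedean2 by blast
  hence "x \<in> {- real n..real n}" by auto
  thus "x \<in> (\<Union>n. {- real n..real n})" by blast
 qed
 thus "\<exists>A. countable A \<and> A \<subseteq> sets (lebesgue :: real measure) \<and> \<Union>A = space lebesgue \<and> (\<forall>a\<in>A. emeasure lebesgue a \<noteq> \<infinity>)"
  by (intro exI[of _ "range (\<lambda>n. {- real n..real n})"]) auto
qed

text \<open>Interchange over the triangle x < s. The hypothesis \<open>int\<close> is the absolute
  integrability for Fubini, with the inner integral taken in x, the order in which
  \<open>adjoint\<close> can verify it.\<close>

lemma fubini_triangle:
 fixes a b :: rfun
 assumes a: "integrable lebesgue a" and b: "b \<in> borel_measurable lebesgue"
  and int: "integrable lebesgue (\<lambda>s. \<bar>b s\<bar> * (LINT x|lebesgue. indicator {..<s} x * \<bar>a x\<bar>))"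
 shows "(LINT x|lebesgue. a x * (LINT s|lebesgue. indicator {x<..} s * b s))
    = (LINT s|lebesgue. b s * (LINT x|lebesgue. indicator {..<s} x * a x))"
proof -
 interpret sigma_finite_measure "lebesgue :: real measure" by (rule sigma_finite_lebesgue)
 interpret P: pair_sigma_finite "lebesgue :: real measure" "lebesgue :: real measure" ..
 let ?M = "(lebesgue :: real measure) \<Otimes>\<^sub>M (lebesgue :: real measure)"
 define F where "F \<equiv> \<lambda>s x. b s * (indicator {..<s} x * a x)"
 have id: "(\<lambda>x::real. x) \<in> lebesgue \<rightarrow>\<^sub>M borel" by (rule measurable_completion) simp
 have am: "(\<lambda>p. a (snd p)) \<in> borel_measurable ?M" using a by (auto intro: measurable_compose[OF measurable_snd])
 have bm: "(\<lambda>p. b (fst p)) \<in> borel_measurable ?M" using b by (auto intro: measurable_compose[OF measurable_fst])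
 have "{p \<in> space ?M. snd p < fst p} \<in> sets ?M"
  using measurable_compose[OF measurable_fst id, of lebesgue] measurable_compose[OF measurable_snd id, of lebesgue]
  by (intro borel_measurable_less) simp_all
 hence "(\<lambda>p. if snd p < fst p then 1 else 0 :: real) \<in> borel_measurable ?M" by (intro measurable_If) auto
 moreover have "(\<lambda>p::real \<times> real. if snd p < fst p then 1 else 0 :: real) = (\<lambda>p. indicator {..<fst p} (snd p))" by auto
 ultimately have Fm: "case_prod F \<in> borel_measurable ?M"
  unfolding F_def case_prod_beta using am bm by (intro borel_measurable_times) (simp_all only:)
 have ai: "integrable lebesgue (\<lambda>x. indicator {..<s} x * a x)" for s
  using integrable_mult_indicator[of "{..<s}" lebesgue a] a by auto
 have nF: "norm (F s x) = \<bar>b s\<bar> * (indicator {..<s} x * \<bar>a x\<bar>)" for s x by (simp add: F_def abs_mult)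
 have "integrable ?M (case_prod F)"
 proof (rule P.Fubini_integrable[OF Fm])
  show "AE x in lebesgue. integrable lebesgue (\<lambda>y. case (x, y) of (x, y) => F x y)"
   unfolding F_def prod.case by (intro AE_I2 integrable_mult_right ai)
  show "integrable lebesgue (\<lambda>x. LINT y|lebesgue. norm (case (x, y) of (x, y) => F x y))"
   unfolding prod.case nF using int by simp
 qed
 hence "(LINT y|lebesgue. LINT x|lebesgue. F x y) = (LINT x|lebesgue. LINT y|lebesgue. F x y)" by (rule P.Fubini_integral)
 moreover have "(\<lambda>s. F s x) = (\<lambda>s. a x * (indicator {x<..} s * b s))" for x by (auto simp: F_def indicator_def)
 ultimately show ?thesis by (simp add: F_def)
qed

section \<open>Orthonormal sequences\<close>

locale orthonormal_sequence =
 fixes e :: "nat => 'a::{real_inner, complete_space}"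
 assumes orthonormal: "inner (e m) (e n) = (if m = n then 1 else 0)"
begin

lemma norm_sum_sq: "finite F ==> (norm (\<Sum>n\<in>F. a n *\<^sub>R e n))\<^sup>2 = (\<Sum>n\<in>F. (a n)\<^sup>2)"
 unfolding power2_norm_eq_inner
 by (simp add: inner_sum_left inner_sum_right orthonormal if_distrib[of "\<lambda>x. _ * x"] sum.delta' power2_eq_square cong: if_cong)

lemma Bessel: "finite F ==> (\<Sum>n\<in>F. (inner x (e n))\<^sup>2) \<le> (norm x)\<^sup>2"
proof -
 assume F: "finite F"
 let ?p = "\<Sum>n\<in>F. inner x (e n) *\<^sub>R e n"
 have "inner x ?p = (\<Sum>n\<in>F. (inner x (e n))\<^sup>2)" by (simp add: inner_sum_right power2_eq_square)
 moreover have "0 \<le> (norm (x - ?p))\<^sup>2" by simp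
 moreover have "(norm (x - ?p))\<^sup>2 = (norm x)\<^sup>2 - 2 * inner x ?p + (norm ?p)\<^sup>2"
  unfolding power2_norm_eq_inner by (simp add: inner_diff inner_commute)
 ultimately show ?thesis using norm_sum_sq[OF F, of "\<lambda>n. inner x (e n)"] by simp
qed

lemma Bessel_summable: "summable (\<lambda>n. (inner x (e n))\<^sup>2)"
 by (rule summableI_nonneg_bounded[of _ "(norm x)\<^sup>2"]) (auto intro: Bessel)

lemma summable_series:
 assumes a: "summable (\<lambda>n. (a n)\<^sup>2)"
 shows "summable (\<lambda>n. a n *\<^sub>R e n)" unfolding summable_Cauchy'
proof -
 have "Cauchy (\<lambda>n. \<Sum>k<n. a k *\<^sub>R e k)" unfolding Cauchy_altdef2
 proof (intro allI impI)
  fix \<epsilon> :: real assume \<epsilon>: "\<epsilon> > 0"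
  have "Cauchy (\<lambda>n. \<Sum>k<n. (a k)\<^sup>2)" using a by (simp add: summable_iff_convergent convergent_Cauchy)
  then obtain N where N: "\<And>n. n \<ge> N ==> dist (\<Sum>k<n. (a k)\<^sup>2) (\<Sum>k<N. (a k)\<^sup>2) < \<epsilon>\<^sup>2"
   unfolding Cauchy_altdef2 using \<epsilon> by (metis zero_less_power)
  have "dist (\<Sum>k<n. a k *\<^sub>R e k) (\<Sum>k<N. a k *\<^sub>R e k) < \<epsilon>" if "n \<ge> N" for n
  proof -
   have "{..<n} = {..<N} \<union> {N..<n}" using that by auto
   hence s: "sum f {..<n} = sum f {..<N} + sum f {N..<n}" for f :: "nat => 'b::ab_group_add"
    by (simp add: sum.union_disjoint ivl_disj_int)
   have "(norm (\<Sum>k=N..<n. a k *\<^sub>R e k))\<^sup>2 < \<epsilon>\<^sup>2"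
    using N[OF that] s[of "\<lambda>k. (a k)\<^sup>2"] by (simp add: norm_sum_sq dist_real_def sum_nonneg)
   thus ?thesis using \<epsilon> s[of "\<lambda>k. a k *\<^sub>R e k"] by (simp add: dist_norm power_less_imp_less_base)
  qed
  thus "\<exists>N. \<forall>n\<ge>N. dist (\<Sum>k<n. a k *\<^sub>R e k) (\<Sum>k<N. a k *\<^sub>R e k) < \<epsilon>" by blast
 qed
 thus "summable (\<lambda>n. a n *\<^sub>R e n)" by (simp add: summable_iff_convergent Cauchy_convergent_iff)
qed

lemma inner_series:
 assumes a: "summable (\<lambda>n. (a n)\<^sup>2)"
 shows "inner (\<Sum>n. a n *\<^sub>R e n) (e m) = a m"
proof -
 have "(\<lambda>n. inner (a n *\<^sub>R e n) (e m)) sums inner (\<Sum>n. a n *\<^sub>R e n) (e m)"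
  by (rule bounded_linear.sums[OF bounded_linear_inner_left summable_sums[OF summable_series[OF a]]])
 moreover have "(\<lambda>n. inner (a n *\<^sub>R e n) (e m)) sums a m"
  using sums_If_finite_set[of "{m}" "\<lambda>n. a n"] by (simp add: orthonormal if_distrib cong: if_cong)
 ultimately show ?thesis by (rule sums_unique2)
qed

text \<open>Totality is required only inside a closed subspace: eigenfunctions and their gradients
  span ranges of projections, not the space over the whole line.\<close>

lemma expansion:
 assumes M: "subspace M" "closed M" and eM: "\<And>n. e n \<in> M"
  and total: "\<And>y. y \<in> M ==> (\<And>n. inner y (e n) = 0) ==> y = 0" and x: "x \<in> M"
 shows "(\<lambda>n. inner x (e n) *\<^sub>R e n) sums x"
proof -
 let ?s = "\<Sum>n. inner x (e n) *\<^sub>R e n"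
 have sm: "summable (\<lambda>n. inner x (e n) *\<^sub>R e n)" by (rule summable_series[OF Bessel_summable])
 have "?s \<in> M"
 proof (rule closed_sequentially[OF M(2) _ summable_LIMSEQ[OF sm]])
  show "(\<Sum>k<n. inner x (e k) *\<^sub>R e k) \<in> M" for n by (intro subspace_sum M subspace_scale eM)
 qed
 hence "x - ?s \<in> M" using x M(1) by (simp add: subspace_diff)
 moreover have "inner (x - ?s) (e n) = 0" for n by (simp add: inner_diff_left inner_series[OF Bessel_summable])
 ultimately have "x - ?s = 0" by (rule total)
 thus ?thesis using summable_sums[OF sm] by simp
qed

end

section \<open>Powers, bounded functions and almost-everywhere arguments\<close>

lemma inner_rep_abs: "f \<in> square_integrable ==> inner h (abs_l2 f) = (LINT x|lebesgue. rep_l2 h x * f x)"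
 using inner_abs_l2[of "rep_l2 h" f] by simp

lemma bounded_interval_square_integrable:
 fixes L :: real
 assumes m: "f \<in> borel_measurable lebesgue" and B: "\<And>x. x \<in> {0<..<L} ==> \<bar>f x\<bar> \<le> B" and z: "\<And>x. x \<notin> {0<..<L} ==> f x = 0"
 shows "f \<in> square_integrable"
proof (rule square_integrable_bound[OF _ m])
 show "(\<lambda>x. indicator {0<..<L} x * B) \<in> square_integrable" using L2_const[of B L] by (simp only: L2_space_iff)
 show "AE x in lebesgue. \<bar>f x\<bar> \<le> \<bar>indicator {0<..<L} x * B\<bar>"
 proof (rule AE_I2)
  fix x show "\<bar>f x\<bar> \<le> \<bar>indicator {0<..<L} x * B\<bar>"
   using B[of x] z[of x] by (cases "x \<in> {0<..<L}") auto
 qed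
qed

lemma measurable_powr: "(\<lambda>s::real. s powr c) \<in> borel_measurable lebesgue" by (rule measurable_completion) simp

lemma integrable_powr:
 fixes a L :: real
 assumes "a > -1" "L > 0"
 shows "integrable lebesgue (\<lambda>s. indicator {0<..<L} s * s powr a)"
proof -
 have "((\<lambda>s. s powr a) has_integral (L powr (a + 1) / (a + 1))) {0..L}"
  by (rule has_integral_powr_from_0) (use assms in auto)
 hence "(\<lambda>s. s powr a) AI {0..L}" by (intro nonnegative_absolutely_integrable_1) auto
 hence "(\<lambda>s. s powr a) AI {0<..<L}" by (rule set_integrable_subset) auto
 thus ?thesis by (simp add: set_integrable_def)
qed

lemma abs_cont_on_cong:
 assumes eq: "\<And>x. x \<in> {a..b} ==> u x = v x" and ac: "abs_cont_on a b u"
 shows "abs_cont_on a b v" unfolding abs_cont_on_def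
proof (intro allI impI)
 fix e :: real assume "e > 0"
 then obtain d where d: "d > 0" "\<And>D. finite D \<and> (\<forall>(x, y)\<in>D. a \<le> x \<and> x \<le> y \<and> y \<le> b) \<and>
   disj_intervals D \<and> (\<Sum>(x, y)\<in>D. y - x) < d -->
   (\<Sum>(x, y)\<in>D. \<bar>u y - u x\<bar>) < e" using ac unfolding abs_cont_on_def by meson
 have "(\<Sum>(x, y)\<in>D. \<bar>v y - v x\<bar>) < e"
  if D: "finite D \<and> (\<forall>(x, y)\<in>D. a \<le> x \<and> x \<le> y \<and> y \<le> b) \<and>
   disj_intervals D \<and> (\<Sum>(x, y)\<in>D. y - x) < d" for D
 proof -
  have "(\<Sum>(x, y)\<in>D. \<bar>v y - v x\<bar>) = (\<Sum>(x, y)\<in>D. \<bar>u y - u x\<bar>)"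
  proof (rule sum.cong[OF refl], clarify)
   fix x y assume "(x, y) \<in> D"
   hence "a \<le> x" "x \<le> y" "y \<le> b" using D by auto
   thus "\<bar>v y - v x\<bar> = \<bar>u y - u x\<bar>" using eq[of x] eq[of y] by simp
  qed
  thus ?thesis using d(2)[of D] D by simp
 qed
 thus "\<exists>d>0. \<forall>D. finite D \<and> (\<forall>(x, y)\<in>D. a \<le> x \<and> x \<le> y \<and> y \<le> b) \<and>
   disj_intervals D \<and> (\<Sum>(x, y)\<in>D. y - x) < d -->
   (\<Sum>(x, y)\<in>D. \<bar>v y - v x\<bar>) < e" using d(1) by blast
qed

lemma abs_cont_on_subinterval:
 assumes "abs_cont_on a b u" "a \<le> a'"
 shows "abs_cont_on a' b u" unfolding abs_cont_on_def
proof (intro allI impI)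
 fix e :: real assume "e > 0"
 then obtain d where d: "d > 0" "\<And>D. finite D \<and> (\<forall>(x, y)\<in>D. a \<le> x \<and> x \<le> y \<and> y \<le> b) \<and>
   disj_intervals D \<and> (\<Sum>(x, y)\<in>D. y - x) < d -->
   (\<Sum>(x, y)\<in>D. \<bar>u y - u x\<bar>) < e" using assms(1) unfolding abs_cont_on_def by meson
 show "\<exists>d>0. \<forall>D. finite D \<and> (\<forall>(x, y)\<in>D. a' \<le> x \<and> x \<le> y \<and> y \<le> b) \<and>
   disj_intervals D \<and> (\<Sum>(x, y)\<in>D. y - x) < d -->
   (\<Sum>(x, y)\<in>D. \<bar>u y - u x\<bar>) < e"
  by (rule exI[of _ d], intro conjI d(1) allI impI, rule d(2)[rule_format]) (use assms(2) in fastforce)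
qed

lemma AE_const_imp_const:
 fixes f :: rfun
 assumes "open S" "continuous_on S f" and ae: "AE x in lebesgue. x \<in> S --> f x = c" and x: "x \<in> S"
 shows "f x = c"
proof (rule ccontr)
 assume ne: "f x \<noteq> c"
 let ?U = "S \<inter> f -` (- {c})"
 have "open ?U" by (rule continuous_open_preimage[OF assms(2,1)]) auto
 moreover have "x \<in> ?U" using x ne by simp
 moreover have "negligible ?U"
 proof -
  have "AE x in lebesgue. x \<notin> ?U" using ae by eventually_elim auto
  thus ?thesis using \<open>open ?U\<close> by (simp add: negligible_iff_null_sets AE_iff_null_sets)
 qed
 ultimately show False using open_not_negligible by blast
qed

lemma negligible_AE: "negligible N ==> (\<And>x. x \<notin> N ==> P x) ==> AE x in lebesgue. P x"
 by (rule AE_I'[of N]) (auto simp: negligible_iff_null_sets)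

definition grad :: "real => rfun => rfun" where
 "grad \<alpha> u x = x powr (\<alpha> / 2) * deriv u x"

lemma H1_norm_eq: "H1_norm \<alpha> L u = L2_norm L u + L2_norm L (grad \<alpha> u)"
 by (simp add: H1_norm_def grad_def[abs_def])

lemma AE_negligible: "AE x in lebesgue. P x ==> negligible {x. \<not> P x}" for P :: "real => bool"
 by (auto simp: eventually_ae_filter negligible_iff_null_sets[symmetric] intro: negligible_subset)

lemma continuous_interval_L2:
 "continuous_on {0..L} f ==> f \<in> L2_space L"
proof -
 assume f: "continuous_on {0..L} f"
 hence "bounded (f ` {0..L})" by (intro compact_imp_bounded compact_continuous_image) auto
 then obtain B where "\<forall>y\<in>f ` {0..L}. norm y \<le> B" unfolding bounded_iff by blast
 hence B: "\<bar>f x\<bar> \<le> B" if "x \<in> {0..L}" for x using that by auto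
 show ?thesis by (rule L2_bounded_measurable[of _ _ B])
   (use f B in \<open>auto intro!: continuous_imp_measurable_on_sets_lebesgue continuous_on_subset[of _ f "{0<..<L}"]\<close>)
qed

lemma LINT_on_HK:
 fixes f :: rfun
 assumes "integrable (leb L) f" "(f has_integral I) {0..L}"
 shows "(LINT x|leb L. f x) = I" using lebesgue_integral_eq_integral[OF assms(1)] integral_unique[OF assms(2)]
 by (simp add: integral_open_interval_real)

section \<open>Integrals on an interval\<close>

lemma integrable_on_iff: "integrable (leb T) f \<longleftrightarrow> f AI {0..T}"
 for f :: rfun
proof -
 have "integrable (leb T) f \<longleftrightarrow> f AI {0<..<T}" by (simp add: integrable_on_eq set_integrable_def)
 also have "\<dots> \<longleftrightarrow> f AI {0..T}"
  by (rule absolutely_integrable_spike_set_eq) (auto intro: negligible_subset[of "{0, T}"])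
 finally show ?thesis .
qed

lemma LINT_eq_integral: "integrable (leb T) f ==> (LINT x|leb T. f x) = integral {0..T} f"
 for f :: rfun using lebesgue_integral_eq_integral[of "{0<..<T}" f] by (simp add: integral_open_interval_real)

lemma abs_int_mult_continuous:
 fixes f g :: rfun
 assumes f: "f AI {a..b}" and g: "continuous_on {a..b} g"
 shows "(\<lambda>x. f x * g x) AI {a..b}" "(\<lambda>x. g x * f x) AI {a..b}"
proof -
 have "(\<lambda>x. g x * f x) AI {a..b}"
 proof (rule absolutely_integrable_bounded_measurable_product_real[OF _ _ _ f])
  show "g \<in> borel_measurable (lebesgue_on {a..b})" by (intro continuous_imp_measurable_on_sets_lebesgue g) auto
  show "bounded (g ` {a..b})" by (intro compact_imp_bounded compact_continuous_image g) auto
 qed auto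
 thus "(\<lambda>x. f x * g x) AI {a..b}" "(\<lambda>x. g x * f x) AI {a..b}" by (simp_all add: mult.commute)
qed

lemma indefinite_continuous: "f AI {0..T} ==> cont T (\<lambda>t. integral {0..t} f)"
 for f :: rfun by (rule indefinite_integral_continuous_1) (rule hk)

lemma abs_int_sub: "f AI {0..T} ==> 0 \<le> s ==> t \<le> T ==> f AI {s..t}"
 for f :: rfun by (rule set_integrable_subset[of _ "{0..T}"]) auto

text \<open>Both factors are given as primitives of integrable functions, the form in which the
  modes satisfy their equations. The product is absolutely continuous and obeys the product rule off
  a null set.\<close>

lemma integral_parts:
 fixes f g :: rfun
 assumes f: "f AI {0..T}" and g: "g AI {0..T}"
  and F: "\<And>t. t \<in> {0..T} ==> F t = F 0 + integral {0..t} f"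
  and G: "\<And>t. t \<in> {0..T} ==> G t = G 0 + integral {0..t} g" and t: "t \<in> {0..T}"
 shows "integral {0..t} (\<lambda>s. f s * G s + F s * g s) = F t * G t - F 0 * G 0"
  "(\<lambda>s. f s * G s + F s * g s) AI {0..T}"
  "cont T F" "cont T G"
proof -
 \<comment> \<open>\<open>F\<close> and \<open>G\<close> are known on [0,T] only; these formulas
   agree with them there and are what the differentiation theorem speaks about.\<close>
 define u w where "u x = F 0 + integral {0..x} f" and "w x = G 0 + integral {0..x} g" for x
 have cu: "cont T u" "cont T w" unfolding u_def w_def by (intro continuous_intros indefinite_continuous f g)+
 have eq: "u s = F s" "w s = G s" if "s \<in> {0..T}" for s using F[OF that] G[OF that] by (simp_all add: u_def w_def)
 show cF: "cont T F" by (rule continuous_on_eq[OF cu(1) eq(1)])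
 show cG: "cont T G" by (rule continuous_on_eq[OF cu(2) eq(2)])
 show "(\<lambda>s. f s * G s + F s * g s) AI {0..T}" by (intro set_integral_add abs_int_mult_continuous f g cF cG)
 have "abs_cont_on 0 T u" "abs_cont_on 0 T w"
  unfolding u_def w_def by (rule abs_cont_on_integral[OF f], rule abs_cont_on_integral[OF g])
 hence uw: "abs_cont_on 0 T (\<lambda>x. u x * w x)" by (rule abs_cont_on_mult) (rule cu)+
 define N where "N h = {x \<in> {0<..<T}. \<not> ((\<lambda>x. integral {0..x} h) has_der h x) (at x)}" for h :: rfun
 have "negligible (N f \<union> N g \<union> {0, T})"
  unfolding N_def by (intro negligible_Un negligible_not_derivable hk f g) auto
 moreover have "f x * G x + F x * g x = deriv (\<lambda>x. u x * w x) x" if "x \<in> {0..t} - (N f \<union> N g \<union> {0, T})" for x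
 proof -
  have "(u has_der 0 + f x) (at x)" "(w has_der 0 + g x) (at x)"
   unfolding u_def w_def using that t by (intro DERIV_add DERIV_const; auto simp: N_def)+
  from DERIV_mult[OF this] eq[of x] that t show ?thesis by (subst DERIV_imp_deriv) (auto simp: mult.commute)
 qed
 ultimately have "integral {0..t} (\<lambda>s. f s * G s + F s * g s) = integral {0..t} (deriv (\<lambda>x. u x * w x))"
  by (rule integral_spike[symmetric])
 also have "\<dots> = u t * w t - u 0 * w 0" by (rule abs_cont_on_deriv(3)[OF uw, symmetric]) (use t in auto)
 finally show "integral {0..t} (\<lambda>s. f s * G s + F s * g s) = F t * G t - F 0 * G 0" using eq t by simp
qed

lemma deriv_imp_integral:
 fixes F f :: rfun
 assumes "\<And>t. t \<in> {0..T} ==> (F has_der f t) (at t within {0..T})" and t: "t \<in> {0..T}"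
 shows "F t = F 0 + integral {0..t} f"
proof -
 have "(f has_integral (F t - F 0)) {0..t}"
 proof (rule fundamental_theorem_of_calculus)
  fix x assume "x \<in> {0..t}"
  hence "(F has_der f x) (at x within {0..t})" using assms(1)[of x] t DERIV_subset by fastforce
  thus "(F has_vector_derivative f x) (at x within {0..t})" by (simp only: has_real_derivative_iff_has_vector_derivative)
 qed (use t in simp)
 thus ?thesis by (simp add: integral_unique)
qed

section \<open>Smooth functions\<close>

definition smooth1 :: "rfun => bool" where
 "smooth1 f \<longleftrightarrow> (\<exists>D :: nat => rfun. D 0 = f \<and> (\<forall>i x. (D i has_der D (Suc i) x) (at x)))"

text \<open>Membership in any class closed under differentiation suffices; this replaces explicit
  formulas for higher derivatives.\<close>

lemma smooth1I:
 assumes S: "\<And>g. g \<in> S ==> \<exists>g'\<in>S. \<forall>x. (g has_der g' x) (at x)" and f: "f \<in> S"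
 shows "smooth1 f"
proof -
 obtain d where d: "\<And>g. g \<in> S ==> d g \<in> S \<and> (\<forall>x. (g has_der d g x) (at x))" using S by metis
 define D where "D \<equiv> \<lambda>i. (d ^^ i) f"
 have DS: "D i \<in> S" for i by (induction i) (use d f in \<open>auto simp: D_def\<close>)
 show ?thesis unfolding smooth1_def by (intro exI[of _ D] conjI allI) (use d[OF DS] in \<open>auto simp: D_def\<close>)
qed

lemma smooth1_deriv:
 assumes "smooth1 f"
 obtains f' where "smooth1 f'" "\<And>x. (f has_der f' x) (at x)"
proof -
 obtain D where D: "D 0 = f" "\<And>i x. (D i has_der D (Suc i) x) (at x)" using assms unfolding smooth1_def by metis
 have "smooth1 (D (Suc 0))" unfolding smooth1_def by (intro exI[of _ "\<lambda>i. D (Suc i)"]) (use D in auto)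
 thus thesis using that[of "D (Suc 0)"] D(2)[of 0] D(1) by auto
qed

lemma smooth1_of_deriv:
 assumes "smooth1 f'" "\<And>x. (f has_der f' x) (at x)"
 shows "smooth1 f"
proof -
 obtain D where D: "D 0 = f'" "\<And>i x. (D i has_der D (Suc i) x) (at x)" using assms unfolding smooth1_def by metis
 show ?thesis unfolding smooth1_def
  by (rule exI[of _ "\<lambda>i. case i of 0 => f | Suc j => D j"]) (use D assms(2) in \<open>auto split: nat.split\<close>)
qed

lemma smooth1_continuous: "smooth1 f ==> continuous_on S f"
 by (metis DERIV_isCont continuous_at_imp_continuous_on smooth1_deriv)

text \<open>Sums of products form a class that the Leibniz rule does not leave, so smoothness of a
  product needs no binomial formula.\<close>

inductive_set mult_span :: "rfun set => rfun set => rfun set" for A B where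
 prod: "f \<in> A ==> g \<in> B ==> (\<lambda>x. f x * g x) \<in> mult_span A B"
| add: "f \<in> mult_span A B ==> g \<in> mult_span A B ==> (\<lambda>x. f x + g x) \<in> mult_span A B"

lemma smooth1_mult:
 assumes "smooth1 f" "smooth1 g"
 shows "smooth1 (\<lambda>x. f x * g x)"
proof (rule smooth1I)
 show "(\<lambda>x. f x * g x) \<in> mult_span {f. smooth1 f} {g. smooth1 g}" by (rule mult_span.prod) (use assms in auto)
 fix h assume "h \<in> mult_span {f. smooth1 f} {g. smooth1 g}"
 thus "\<exists>h'\<in>mult_span {f. smooth1 f} {g. smooth1 g}. \<forall>x. (h has_der h' x) (at x)"
 proof induction
  case (prod f g)
  obtain f' where f': "smooth1 f'" "\<And>x. (f has_der f' x) (at x)" using smooth1_deriv prod(1) by blast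
  obtain g' where g': "smooth1 g'" "\<And>x. (g has_der g' x) (at x)" using smooth1_deriv prod(2) by blast
  have "(\<lambda>x. f' x * g x + f x * g' x) \<in> mult_span {f. smooth1 f} {g. smooth1 g}"
   using prod f'(1) g'(1) by (intro mult_span.add mult_span.prod) auto
  moreover have "((\<lambda>x. f x * g x) has_der f' x * g x + f x * g' x) (at x)" for x
   using DERIV_mult[OF f'(2)[of x] g'(2)[of x]] by (simp add: mult.commute)
  ultimately show ?case by (intro bexI[of _ "\<lambda>x. f' x * g x + f x * g' x"] allI)
 next
  case (add f g)
  then obtain f' g' where "f' \<in> mult_span {f. smooth1 f} {g. smooth1 g}" "\<And>x. (f has_der f' x) (at x)"
   "g' \<in> mult_span {f. smooth1 f} {g. smooth1 g}" "\<And>x. (g has_der g' x) (at x)" by blast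
  thus ?case by (intro bexI[of _ "\<lambda>x. f' x + g' x"] allI DERIV_add mult_span.add) auto
 qed
qed

lemma smooth1_diff:
 assumes "smooth1 f" "smooth1 g"
 shows "smooth1 (\<lambda>x. f x - g x)"
proof -
 obtain D where D: "D 0 = f" "\<And>i x. (D i has_der D (Suc i) x) (at x)" using assms(1) unfolding smooth1_def by metis
 obtain E where E: "E 0 = g" "\<And>i x. (E i has_der E (Suc i) x) (at x)" using assms(2) unfolding smooth1_def by metis
 show ?thesis unfolding smooth1_def
  by (rule exI[of _ "\<lambda>i x. D i x - E i x"]) (use D E in \<open>auto intro!: DERIV_diff\<close>)
qed

lemma smooth1_cmult:
 assumes "smooth1 f"
 shows "smooth1 (\<lambda>x. c * f x)"
proof -
 obtain D where D: "D 0 = f" "\<And>i x. (D i has_der D (Suc i) x) (at x)" using assms(1) unfolding smooth1_def by metis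
 show ?thesis unfolding smooth1_def
  by (rule exI[of _ "\<lambda>i x. c * D i x"]) (use D in \<open>auto intro!: DERIV_cmult\<close>)
qed

lemma smooth1_affine:
 assumes "smooth1 f"
 shows "smooth1 (\<lambda>x. f (c * x + d))"
proof -
 obtain D where D: "D 0 = f" "\<And>i x. (D i has_der D (Suc i) x) (at x)" using assms(1) unfolding smooth1_def by metis
 have "((\<lambda>x. c ^ i * D i (c * x + d)) has_der c ^ Suc i * D (Suc i) (c * x + d)) (at x)" for i x
 proof -
  have "((\<lambda>x. c * x + d) has_der c) (at x)" by (auto intro!: derivative_eq_intros)
  from DERIV_chain2[OF D(2)[of i "c * x + d"] this] have "((\<lambda>x. D i (c * x + d)) has_der D (Suc i) (c * x + d) * c) (at x)" .
  from DERIV_cmult[OF this, of "c ^ i"] show ?thesis by (simp add: mult_ac)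
 qed
 thus ?thesis unfolding smooth1_def by (intro exI[of _ "\<lambda>i x. c ^ i * D i (c * x + d)"]) (use D(1) in auto)
qed

section \<open>Smooth cut-off functions built from \<open>exp (- (1 / x))\<close>\<close>

definition flat :: "real poly => rfun" where
 "flat P x = (if x > 0 then poly P (1 / x) * exp (- (1 / x)) else 0)"

lemma poly_exp_tendsto_0: "((\<lambda>y. y ^ k * poly P y * exp (- y)) \<longlongrightarrow> 0) at_top" for P :: "real poly"
proof (induction P arbitrary: k)
 case (pCons a P)
 have "((\<lambda>y. a * (y ^ k / exp y) + y ^ Suc k * poly P y * exp (- y)) \<longlongrightarrow> a * 0 + 0) at_top"
  by (intro tendsto_intros tendsto_power_div_exp_0 pCons.IH)
 moreover have "(\<lambda>y. a * (y ^ k / exp y) + y ^ Suc k * poly P y * exp (- y)) = (\<lambda>y. y ^ k * poly (pCons a P) y * exp (- y))"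
  by (auto simp: exp_minus field_simps)
 ultimately show ?case by simp
qed simp

text \<open>In the variable y = 1/x differentiation maps P(y) exp(-y) to y^2 (P - P') exp(-y), so
  these functions are closed under differentiation. At 0 both one-sided quotients tend to 0,
  exponential decay beating every polynomial.\<close>

lemma flat_deriv: "(flat P has_der flat (monom 1 2 * (P - pderiv P)) x) (at x)"
proof -
 consider "x > 0" | "x < 0" | "x = 0" by linarith
 thus ?thesis
 proof cases
  case 1
  have "((\<lambda>x. poly P (1 / x) * exp (- (1 / x))) has_real_derivative
    poly (pderiv P) (1 / x) * (- (1 / x\<^sup>2)) * exp (- (1 / x)) + exp (- (1 / x)) * (1 / x\<^sup>2) * poly P (1 / x)) (at x)"
   using 1 by (auto intro!: derivative_eq_intros simp: power2_eq_square field_simps)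
  moreover have "poly (pderiv P) (1 / x) * (- (1 / x\<^sup>2)) * exp (- (1 / x)) + exp (- (1 / x)) * (1 / x\<^sup>2) * poly P (1 / x)
    = flat (monom 1 2 * (P - pderiv P)) x" using 1 by (simp add: flat_def poly_monom power_one_over algebra_simps)
  ultimately have "((\<lambda>x. poly P (1 / x) * exp (- (1 / x))) has_der flat (monom 1 2 * (P - pderiv P)) x) (at x)" by simp
  thus ?thesis
   by (rule has_field_derivative_transform_within_open[of _ _ _ "{0<..}"]) (use 1 in \<open>auto simp: flat_def\<close>)
 next
  case 2
  have "((\<lambda>x. 0) has_der 0) (at x)" by simp
  hence "(flat P has_der 0) (at x)"
   by (rule has_field_derivative_transform_within_open[of _ _ _ "{..<0}"]) (use 2 in \<open>auto simp: flat_def\<close>)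
  thus ?thesis using 2 by (simp add: flat_def)
 next
  case 3
  have r: "((\<lambda>h. (flat P (0 + h) - flat P 0) / h) \<longlongrightarrow> 0) (at_right 0)"
  proof -
   have "((\<lambda>y. y ^ 1 * poly P y * exp (- y)) \<longlongrightarrow> 0) at_top" by (rule poly_exp_tendsto_0)
   hence "((\<lambda>h. inverse h ^ 1 * poly P (inverse h) * exp (- inverse h)) \<longlongrightarrow> 0) (at_right 0)"
    by (rule filterlim_compose[OF _ filterlim_inverse_at_top_right])
   moreover have "\<forall>\<^sub>F h in at_right 0. inverse h ^ 1 * poly P (inverse h) * exp (- inverse h) = (flat P (0 + h) - flat P 0) / h"
    by (rule eventually_at_right_less[THEN eventually_mono]) (auto simp: flat_def divide_inverse)
   ultimately show ?thesis by (rule Lim_transform_eventually)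
  qed
  have l: "((\<lambda>h. (flat P (0 + h) - flat P 0) / h) \<longlongrightarrow> 0) (at_left 0)"
  proof (rule tendsto_eventually)
   show "\<forall>\<^sub>F h in at_left 0. (flat P (0 + h) - flat P 0) / h = 0"
    unfolding eventually_at_left_field by (intro exI[of _ "-1"]) (auto simp: flat_def)
  qed
  show ?thesis using filterlim_split_at[OF l r] 3 by (simp add: DERIV_def flat_def)
 qed
qed

lemma smooth1_flat: "smooth1 (flat P)" by (rule smooth1I[of "range flat"]) (use flat_deriv in blast)+

lemma smooth_primitive:
 assumes f: "smooth1 f" and z: "\<And>x. x \<notin> {c<..<d} ==> f x = 0"
 obtains A where "smooth1 A" "\<And>x. (A has_der f x) (at x)" "\<And>x. x \<le> c ==> A x = 0" "\<And>x. x \<ge> d ==> A x = A d"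
proof -
 have "isCont f x" for x using smooth1_continuous[OF f, of UNIV] by (simp add: continuous_on_eq_continuous_at)
 then obtain F where F: "\<And>x. (F has_der f x) (at x)"
  using einterval_antiderivative[of "-\<infinity>" "\<infinity>" f] by (auto simp: has_real_derivative_iff_has_vector_derivative)
 have cst: "F x = F y" if "convex S" "\<And>x. x \<in> S ==> f x = 0" "x \<in> S" "y \<in> S" for S x y
 proof -
  have "\<exists>k. \<forall>x\<in>S. F x = k"
   by (rule has_field_derivative_zero_constant[OF that(1)]) (use F that(2) in \<open>metis has_field_derivative_at_within\<close>)
  thus ?thesis using that by auto
 qed
 show thesis
 proof (rule that[of "\<lambda>x. F x - F c"])
  show d: "((\<lambda>x. F x - F c) has_der f x) (at x)" for x by (auto intro!: derivative_eq_intros F)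
  show "smooth1 (\<lambda>x. F x - F c)" by (rule smooth1_of_deriv[OF f d])
  show "F x - F c = 0" if "x \<le> c" for x using cst[of "{..c}" x c] z that by auto
  show "F x - F c = F d - F c" if "x \<ge> d" for x using cst[of "{d..}" x d] z that by auto
 qed
qed

lemma smooth_step:
 assumes "r < s"
 obtains \<sigma> where "smooth1 \<sigma>" "\<And>x. 0 \<le> \<sigma> x" "\<And>x. \<sigma> x \<le> 1" "\<And>x. x \<le> r ==> \<sigma> x = 0" "\<And>x. x \<ge> s ==> \<sigma> x = 1"
proof -
 define \<rho> where "\<rho> \<equiv> \<lambda>x. flat 1 (1 * x + (- r)) * flat 1 ((-1) * x + s)"
 have sm: "smooth1 \<rho>" unfolding \<rho>_def by (intro smooth1_mult smooth1_affine smooth1_flat)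
 have nn: "0 \<le> \<rho> x" for x by (simp add: \<rho>_def flat_def)
 have pos: "0 < \<rho> x" if "r < x" "x < s" for x using that by (simp add: \<rho>_def flat_def)
 have z: "\<rho> x = 0" if "x \<notin> {r<..<s}" for x using that by (auto simp: \<rho>_def flat_def)
 obtain I where sI: "smooth1 I" and dI: "\<And>x. (I has_der \<rho> x) (at x)"
  and Ir: "\<And>x. x \<le> r ==> I x = 0" and Is: "\<And>x. x \<ge> s ==> I x = I s"
  by (rule smooth_primitive[where c=r and d=s, OF sm z]) (assumption, rule that)
 have mono: "I x \<le> I y" if "x \<le> y" for x y using DERIV_nonneg_imp_nondecreasing[OF that] dI nn by blast
 have Ipos: "I s > 0"
 proof -
  have "\<exists>c>r. c < s \<and> I s - I r = (s - r) * \<rho> c" using MVT2[OF assms, of I \<rho>] dI by blast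
  thus ?thesis using Ir[of r] assms pos by (metis diff_gt_0_iff_gt diff_zero mult_pos_pos order_refl)
 qed
 show thesis
 proof (rule that[of "\<lambda>x. (1 / I s) * I x"])
  show "smooth1 (\<lambda>x. (1 / I s) * I x)" by (rule smooth1_cmult[OF sI])
  show "0 \<le> (1 / I s) * I x" for x using Ipos Ir[of r] mono[of r x] Ir[of x] by (cases "x \<le> r") auto
  show "(1 / I s) * I x \<le> 1" for x using Ipos mono[of x s] Is[of x] by (cases "x \<le> s") (auto simp: field_simps)
  show "(1 / I s) * I x = 0" if "x \<le> r" for x using Ir[OF that] by simp
  show "(1 / I s) * I x = 1" if "x \<ge> s" for x using Is[OF that] Ipos by simp
 qed
qed

lemma smooth_plateau:
 assumes "c < c'" "c' \<le> d'" "d' < d"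
 obtains f where "smooth1 f" "\<And>x. 0 \<le> f x" "\<And>x. f x \<le> 1" "\<And>x. x \<notin> {c<..<d} ==> f x = 0" "\<And>x. x \<in> {c'..d'} ==> f x = 1"
proof -
 obtain \<sigma> where s: "smooth1 \<sigma>" "\<And>x. 0 \<le> \<sigma> x" "\<And>x. \<sigma> x \<le> 1" "\<And>x. x \<le> c ==> \<sigma> x = 0" "\<And>x. x \<ge> c' ==> \<sigma> x = 1"
  using smooth_step[OF assms(1)] by blast
 obtain \<tau> where t: "smooth1 \<tau>" "\<And>x. 0 \<le> \<tau> x" "\<And>x. \<tau> x \<le> 1" "\<And>x. x \<le> d' ==> \<tau> x = 0" "\<And>x. x \<ge> d ==> \<tau> x = 1"
  using smooth_step[OF assms(3)] by blast
 show thesis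
 proof (rule that[of "\<lambda>x. \<sigma> x - \<tau> x"])
  show "smooth1 (\<lambda>x. \<sigma> x - \<tau> x)" by (intro smooth1_diff s t)
  show "0 \<le> \<sigma> x - \<tau> x" for x
   using s(2)[of x] s(5)[of x] t(3)[of x] t(4)[of x] assms by (cases "x \<le> d'") auto
  show "\<sigma> x - \<tau> x \<le> 1" for x using s(3)[of x] t(2)[of x] by linarith
  show "\<sigma> x - \<tau> x = 0" if "x \<notin> {c<..<d}" for x
   using s(4)[of x] s(5)[of x] t(4)[of x] t(5)[of x] that assms by (cases "x \<le> c") auto
  show "\<sigma> x - \<tau> x = 1" if "x \<in> {c'..d'}" for x using s(5)[of x] t(4)[of x] that by auto
 qed
qed

section \<open>The variational lemmas on (0,T)\<close>

definition test1 :: "real => rfun => bool" where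
 "test1 T f \<longleftrightarrow> smooth1 f \<and> (\<exists>c d. 0 < c \<and> c < d \<and> d < T \<and> (\<forall>x. x \<notin> {c<..<d} --> f x = 0))"

text \<open>Plateau functions converge boundedly to the indicator of (c,d), so all integrals of
  \<open>g\<close> over inner intervals vanish; its primitive is constant on (0,T), and the
  differentiation theorem gives \<open>g = 0\<close> almost everywhere.\<close>

lemma fundamental_lemma:
 fixes g :: rfun
 assumes g: "integrable (leb T) g"
  and z: "\<And>f. test1 T f ==> (LINT x|leb T. g x * f x) = 0"
 shows "AE x in leb T. g x = 0"
proof -
 have ga: "g AI {0..T}" using g by (simp add: integrable_on_iff)
 have int0: "integral {c..d} g = 0" if cd: "0 < c" "c < d" "d < T" for c d
 proof -
  \<comment> \<open>The width of the two flanks of the plateau: at most half of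
    \<open>d - c\<close>, so that the plateau is nonempty, and tending to 0.\<close>
  define \<delta> where "\<delta> \<equiv> \<lambda>n::nat. (d - c) / (2 * (real n + 2))"
  have \<delta>: "\<delta> n > 0" "c + \<delta> n \<le> d - \<delta> n" for n
  proof -
   show "\<delta> n > 0" using cd by (simp add: \<delta>_def)
   have "\<delta> n \<le> (d - c) / 2" unfolding \<delta>_def by (rule divide_left_mono) (use cd in auto)
   thus "c + \<delta> n \<le> d - \<delta> n" by simp
  qed
  have "\<exists>f. smooth1 f \<and> (\<forall>x. 0 \<le> f x \<and> f x \<le> 1) \<and> (\<forall>x. x \<notin> {c<..<d} --> f x = 0) \<and> (\<forall>x\<in>{c + \<delta> n..d - \<delta> n}. f x = 1)" for n
   using smooth_plateau[of c "c + \<delta> n" "d - \<delta> n" d] \<delta>[of n] by (metis less_add_same_cancel1 diff_less_eq)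
  then obtain f where f: "\<And>n. smooth1 (f n)" "\<And>n x. 0 \<le> f n x" "\<And>n x. f n x \<le> 1" "\<And>n x. x \<notin> {c<..<d} ==> f n x = 0"
    "\<And>n x. x \<in> {c + \<delta> n..d - \<delta> n} ==> f n x = 1" by metis
  have tf: "test1 T (f n)" for n unfolding test1_def using f(1,4) cd by blast
  have "(\<lambda>n. LINT x|leb T. g x * f n x) \<longlonglongrightarrow> (LINT x|leb T. indicator {c<..<d} x * g x)"
  proof (rule integral_dominated_convergence[where w = "\<lambda>x. \<bar>g x\<bar>"])
   show "integrable (leb T) (\<lambda>x. \<bar>g x\<bar>)" using g by simp
   have gm: "g \<in> meas T" using g by simp
   show "(\<lambda>x. indicator {c<..<d} x * g x) \<in> meas T"
    by (intro borel_measurable_times borel_measurable_indicator gm) (use cd in \<open>auto simp: sets_restrict_space_iff\<close>)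
   show "(\<lambda>x. g x * f n x) \<in> meas T" for n
    by (intro borel_measurable_times gm continuous_imp_measurable_on_sets_lebesgue smooth1_continuous[OF f(1)]) auto
   show "AE x in leb T. norm (g x * f n x) \<le> \<bar>g x\<bar>" for n
   proof (rule AE_I2)
    fix x show "norm (g x * f n x) \<le> \<bar>g x\<bar>"
     using f(2,3)[of n x] mult_left_le[of "f n x" "\<bar>g x\<bar>"] by (simp add: abs_mult)
   qed
   show "AE x in leb T. (\<lambda>n. g x * f n x) \<longlonglongrightarrow> indicator {c<..<d} x * g x"
   proof (rule AE_I2)
    fix x
    show "(\<lambda>n. g x * f n x) \<longlonglongrightarrow> indicator {c<..<d} x * g x"
    proof (cases "x \<in> {c<..<d}")
     case True
     have "\<delta> \<longlonglongrightarrow> 0" unfolding \<delta>_def by real_asymp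
     hence "\<forall>\<^sub>F n in sequentially. \<delta> n < min (x - c) (d - x)" using True by (intro order_tendstoD(2)) auto
     hence "\<forall>\<^sub>F n in sequentially. g x * f n x = indicator {c<..<d} x * g x"
      by eventually_elim (use True f(5) in auto)
     thus ?thesis by (rule tendsto_eventually)
    qed (use f(4) in auto)
   qed
  qed
  hence "(LINT x|leb T. indicator {c<..<d} x * g x) = 0" unfolding z[OF tf] by (simp add: LIMSEQ_const_iff)
  moreover have "(LINT x|leb T. indicator {c<..<d} x * g x) = (LINT x:{c<..<d}|lebesgue. g x)"
   unfolding LINT_on_eq set_lebesgue_integral_def by (rule LINT_cong) (use cd in \<open>auto simp: indicator_def\<close>)
  moreover have o: "g AI {c<..<d}" by (rule set_integrable_subset[OF ga]) (use cd in auto)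
  ultimately show ?thesis using set_lebesgue_integral_eq_integral(2)[OF o] by (simp add: integral_open_interval_real)
 qed
 define N where "N = {x \<in> {0<..<T}. \<not> ((\<lambda>x. integral {0..x} g) has_der g x) (at x)}"
 have neg: "negligible N" unfolding N_def by (intro negligible_not_derivable hk ga)
 show ?thesis unfolding AE_on_eq
 proof (rule negligible_AE[OF neg], intro impI)
  fix x assume nN: "x \<notin> N" and x: "x \<in> {0<..<T}"
  have "integral {0..y} g = integral {0..x} g" if y: "y \<in> {0<..<T}" for y
  proof -
   have "integral {0..a} g + integral {a..b} g = integral {0..b} g" if "a \<in> {0<..<T}" "b \<in> {a<..<T}" for a b
    by (rule hk_combine) (use that hk[OF abs_int_sub[OF ga, of 0 b]] in auto)
   thus ?thesis using int0[of x y] int0[of y x] x y by (cases x y rule: linorder_cases) force+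
  qed
  moreover have "((\<lambda>x. integral {0..x} g) has_der g x) (at x)" using nN x by (auto simp: N_def)
  ultimately have "((\<lambda>y. integral {0..x} g) has_der g x) (at x)"
   by (rule has_field_derivative_transform_within_open[OF _ open_greaterThanLessThan x, rotated])
  thus "g x = 0" using DERIV_const DERIV_unique by blast
 qed
qed

text \<open>\<open>F\<close> minus the primitive of \<open>G\<close> has zero weak derivative.
  Testing it against arbitrary functions, corrected by a multiple of a fixed bump to have mean zero,
  shows that it is constant, first almost everywhere and then, by continuity, on [0,T].\<close>

lemma du_Bois_Reymond:
 fixes F G :: rfun
 assumes T: "T > 0" and F: "cont T F" and G: "G AI {0..T}"
  and z: "\<And>a a'. test1 T a ==> smooth1 a' ==> (\<And>x. (a has_der a' x) (at x)) ==>
   integral {0..T} (\<lambda>t. F t * a' t) = - integral {0..T} (\<lambda>t. G t * a t)"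
 shows "t \<in> {0..T} ==> F t = F 0 + integral {0..t} G"
proof -
 define W where "W \<equiv> \<lambda>t. F t - integral {0..t} G"
 have cW: "cont T W" unfolding W_def by (intro continuous_intros F indefinite_continuous G)
 have Wz: "integral {0..T} (\<lambda>t. W t * a' t) = 0"
  if a: "test1 T a" "smooth1 a'" "\<And>x. (a has_der a' x) (at x)" for a a'
 proof -
  have ca: "continuous_on S a'" "continuous_on S a" for S using a smooth1_continuous by (auto simp: test1_def)
  have aT: "a T = 0" "a 0 = 0" using a(1) by (auto simp: test1_def)
  have a'i: "a' AI {0..T}" by (intro absolutely_integrable_continuous_real ca)
  have aF: "a t = a 0 + integral {0..t} a'" if "t \<in> {0..T}" for t
   by (rule deriv_imp_integral[OF _ that]) (rule DERIV_subset[OF a(3)], simp)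
  have "integral {0..T} (\<lambda>s. G s * a s + integral {0..s} G * a' s) = integral {0..T} G * a T - integral {0..0} G * a 0"
   by (rule integral_parts(1)[OF G a'i _ aF, where F = "\<lambda>s. integral {0..s} G"]) (use T in auto)
  moreover have "integral {0..T} (\<lambda>s. G s * a s + integral {0..s} G * a' s)
    = integral {0..T} (\<lambda>s. G s * a s) + integral {0..T} (\<lambda>s. integral {0..s} G * a' s)"
   by (intro hk_add hk abs_int_mult_continuous G a'i
     ca indefinite_continuous)
  moreover have "integral {0..T} (\<lambda>t. W t * a' t) = integral {0..T} (\<lambda>t. F t * a' t) - integral {0..T} (\<lambda>s. integral {0..s} G * a' s)"
  proof -
   have "(\<lambda>t. W t * a' t) = (\<lambda>t. F t * a' t - integral {0..t} G * a' t)" by (simp add: W_def left_diff_distrib)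
   thus ?thesis by (simp only:) (intro hk_diff hk
      abs_int_mult_continuous a'i F indefinite_continuous G)
  qed
  ultimately show ?thesis using z[OF a] aT by simp
 qed
 obtain \<rho> where \<rho>: "smooth1 \<rho>" "\<And>x. 0 \<le> \<rho> x" "\<And>x. \<rho> x \<le> 1" "\<And>x. x \<notin> {T/4<..<3*T/4} ==> \<rho> x = 0"
  "\<And>x. x \<in> {T/3..T/2} ==> \<rho> x = 1" using smooth_plateau[of "T/4" "T/3" "T/2" "3*T/4"] T by auto
 have cc: "continuous_on S \<rho>" for S by (rule smooth1_continuous[OF \<rho>(1)])
 define m where "m = integral {0..T} \<rho>"
 have m: "m > 0"
 proof -
  have "integral {T/3..T/2} (\<lambda>x. 1) = integral {T/3..T/2} \<rho>" by (rule integral_cong) (use \<rho>(5) in auto)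
  also have "\<dots> \<le> m" unfolding m_def by (rule integral_subset_le) (use T \<rho>(2) cc in \<open>auto intro!: integrable_continuous_real\<close>)
  finally show ?thesis using T by simp
 qed
 define K where "K = integral {0..T} (\<lambda>t. W t * \<rho> t) / m"
 have "AE t in leb T. W t - K = 0"
 proof (rule fundamental_lemma)
  have "cont T (\<lambda>t. W t - K)" by (intro continuous_intros cW)
  thus "integrable (leb T) (\<lambda>t. W t - K)" by (simp add: integrable_on_iff absolutely_integrable_continuous_real)
  fix \<psi> assume \<psi>: "test1 T \<psi>"
  hence c\<psi>: "continuous_on S \<psi>" for S using smooth1_continuous by (auto simp: test1_def)
  obtain c d where cd: "0 < c" "c < d" "d < T" "\<And>x. x \<notin> {c<..<d} ==> \<psi> x = 0" using \<psi> unfolding test1_def by blast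
  \<comment> \<open>Subtracting \<open>k\<close> times the bump gives \<open>a'\<close> mean zero;
    only then does its primitive \<open>a\<close> vanish to the right of the support and become a
    test function.\<close>
  define k where "k = integral {0..T} \<psi> / m"
  define a' where "a' \<equiv> \<lambda>x. \<psi> x - k * \<rho> x"
  have sa': "smooth1 a'" unfolding a'_def using \<psi> \<rho>(1) by (intro smooth1_diff smooth1_cmult) (auto simp: test1_def)
  have ca': "continuous_on S a'" for S by (rule smooth1_continuous[OF sa'])
  define c1 d1 where "c1 = min c (T/4)" and "d1 = max d (3*T/4)"
  have cd1: "0 < c1" "c1 < d1" "d1 < T" using cd T by (auto simp: c1_def d1_def)
  have a'z: "a' x = 0" if "x \<notin> {c1<..<d1}" for x
   using that cd(4)[of x] \<rho>(4)[of x] by (auto simp: a'_def c1_def d1_def min_def max_def split: if_splits)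
  have tot: "integral {0..T} a' = 0"
  proof -
   have "integral {0..T} a' = integral {0..T} \<psi> - k * m" unfolding a'_def m_def
    by (subst hk_diff) (auto intro!: integrable_continuous_real c\<psi> cc continuous_intros)
   thus ?thesis using m by (simp add: k_def)
  qed
  obtain a where sa: "smooth1 a" and da: "\<And>x. (a has_der a' x) (at x)"
   and az: "\<And>x. x \<le> c1 ==> a x = 0" "\<And>x. x \<ge> d1 ==> a x = a d1" by (rule smooth_primitive[where c=c1 and d=d1, OF sa' a'z]) (assumption, rule that)
  have "a T = a 0 + integral {0..T} a'" by (rule deriv_imp_integral) (use T has_field_derivative_at_within[OF da] in auto)
  hence "a d1 = 0" using az(1)[of 0] az(2)[of T] cd1 tot by simp
  hence az': "a x = 0" if "x \<notin> {c1<..<d1}" for x using az[of x] that by force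
  have ta: "test1 T a" unfolding test1_def using sa cd1 az' by blast
  have W0: "integral {0..T} (\<lambda>t. W t * a' t) = 0" by (rule Wz[OF ta sa' da])
  have wi: "(\<lambda>t. W t * \<psi> t) integrable_on {0..T}" "(\<lambda>t. W t * \<rho> t) integrable_on {0..T}"
   by (intro integrable_continuous_real continuous_intros cW c\<psi> cc)+
  have "integral {0..T} (\<lambda>t. W t * a' t) = integral {0..T} (\<lambda>t. W t * \<psi> t) - k * integral {0..T} (\<lambda>t. W t * \<rho> t)"
  proof -
   have "(\<lambda>t. W t * a' t) = (\<lambda>t. W t * \<psi> t - k * (W t * \<rho> t))" by (simp add: a'_def algebra_simps)
   thus ?thesis
    by (simp only:) (rule integral_unique, intro has_integral_diff has_integral_mult_right integrable_integral wi)
  qed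
  hence eq: "integral {0..T} (\<lambda>t. W t * \<psi> t) = K * integral {0..T} \<psi>" using W0 by (simp add: k_def K_def)
  have "integrable (leb T) (\<lambda>t. (W t - K) * \<psi> t)"
   by (subst integrable_on_iff) (intro absolutely_integrable_continuous_real continuous_intros cW c\<psi>)
  hence "(LINT t|leb T. (W t - K) * \<psi> t) = integral {0..T} (\<lambda>t. (W t - K) * \<psi> t)"
   by (rule LINT_eq_integral)
  also have "\<dots> = integral {0..T} (\<lambda>t. W t * \<psi> t - K * \<psi> t)" by (simp add: left_diff_distrib)
  also have "\<dots> = integral {0..T} (\<lambda>t. W t * \<psi> t) - K * integral {0..T} \<psi>" by (rule integral_unique)
    (intro has_integral_diff has_integral_mult_right integrable_integral wi integrable_continuous_real c\<psi>)
  also have "\<dots> = 0" using eq by simp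
  finally show "(LINT t|leb T. (W t - K) * \<psi> t) = 0" .
 qed
 hence "AE t in lebesgue. t \<in> {0<..<T} --> W t = K" by (simp add: AE_on_eq)
 hence WK: "W t = K" if "t \<in> {0<..<T}" for t
  by (rule AE_const_imp_const[rotated 2, OF _ that]) (auto intro: continuous_on_subset[OF cW])
 have WK': "W t = K" if t: "t \<in> {0..T}" for t
 proof (rule continuous_constant_on_closure[of "{0<..<T}" W K])
  show "continuous_on (closure {0<..<T}) W" using cW T by simp
  show "t \<in> closure {0<..<T}" using t T by simp
 qed (rule WK)
 show "F t = F 0 + integral {0..t} G" if "t \<in> {0..T}" using WK'[OF that] WK'[of 0] T by (simp add: W_def)
qed

instance l2 :: banach ..

abbreviation sq :: "(nat => real) => bool" where "sq a \<equiv> summable (\<lambda>n. (a n)\<^sup>2)"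

text \<open>The converse of Cauchy-Schwarz, by the choice \<open>h = x\<close>. Bounds uniform in
  the number of modes become l2 bounds in this way.\<close>

lemma sq_dual:
 assumes B: "B \<ge> 0" and le: "\<And>N h. \<bar>\<Sum>n<N. h n * x n\<bar> \<le> B * sqrt (\<Sum>n<N. (h n)\<^sup>2)"
 shows "sq x" "(\<Sum>n. (x n)\<^sup>2) \<le> B\<^sup>2"
proof -
 have *: "(\<Sum>n<N. (x n)\<^sup>2) \<le> B\<^sup>2" for N
 proof -
  let ?s = "\<Sum>n<N. (x n)\<^sup>2"
  have s0: "?s \<ge> 0" by (intro sum_nonneg) simp
  have "sqrt ?s * sqrt ?s \<le> B * sqrt ?s" using le[of x N] s0 by (simp add: power2_eq_square)
  hence "sqrt ?s \<le> B" using B s0 mult_right_le_imp_le[of "sqrt ?s" "sqrt ?s" B] by (cases "?s = 0") auto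
  thus ?thesis using s0 real_le_lsqrt sqrt_le_D by blast
 qed
 show "sq x" by (rule summableI_nonneg_bounded[of _ "B\<^sup>2"]) (use * in auto)
 thus "(\<Sum>n. (x n)\<^sup>2) \<le> B\<^sup>2" using * by (intro suminf_le_const) auto
qed

section \<open>Curves in function spaces\<close>

lemma measurable_AE_limit:
 fixes f :: "nat => rfun"
 assumes f: "\<And>n. f n \<in> meas T" and ae: "AE t in leb T. (\<lambda>n. f n t) \<longlonglongrightarrow> g t"
 shows "g \<in> meas T"
proof -
 let ?F = "\<lambda>n t. indicator {0<..<T} t * f n t"
 have "(\<lambda>t. lim (\<lambda>n. ?F n t)) \<in> borel_measurable lebesgue"
  using f by (intro borel_measurable_lim_metric) (simp add: measurable_on_eq)
 moreover have "AE t in lebesgue. lim (\<lambda>n. ?F n t) = indicator {0<..<T} t * g t" using ae unfolding AE_on_eq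
 proof eventually_elim
  case (elim t)
  thus ?case by (cases "t \<in> {0<..<T}") (simp_all add: limI lim_const)
 qed
 ultimately show ?thesis unfolding measurable_on_eq by (rule borel_measurable_AE)
qed

lemma sums_LINT:
 fixes f :: "nat => rfun"
 assumes f: "\<And>n. f n \<in> meas T" and G: "integrable (leb T) G"
  and ae: "AE t in leb T. (\<lambda>n. f n t) sums r t \<and> (\<forall>N. \<bar>\<Sum>n<N. f n t\<bar> \<le> G t)"
 shows "integrable (leb T) r" "(\<lambda>n. LINT t|leb T. f n t) sums (LINT t|leb T. r t)"
proof -
 let ?S = "\<lambda>N t. \<Sum>n<N. f n t"
 have S: "?S N \<in> meas T" for N by (intro borel_measurable_sum f)
 have iS: "integrable (leb T) (?S N)" for N
  by (rule LINT_able_bound[OF G S]) (use ae in \<open>eventually_elim, auto intro: order.trans[OF _ abs_ge_self]\<close>)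
 have i: "integrable (leb T) (f n)" for n using LINT_able_diff[OF iS[of "Suc n"] iS[of n]] by simp
 have lim: "AE t in leb T. (\<lambda>N. ?S N t) \<longlonglongrightarrow> r t" using ae by eventually_elim (simp add: sums_def)
 have r: "r \<in> meas T" by (rule measurable_AE_limit[OF S lim])
 have bd: "AE t in leb T. norm (?S N t) \<le> G t" for N using ae by eventually_elim auto
 show "integrable (leb T) r" by (rule integrable_dominated_convergence[OF r S G lim bd])
 have "(\<lambda>N. LINT t|leb T. ?S N t) \<longlonglongrightarrow> (LINT t|leb T. r t)"
  by (rule integral_dominated_convergence[OF r S G lim bd])
 thus "(\<lambda>n. LINT t|leb T. f n t) sums (LINT t|leb T. r t)" unfolding sums_def by (subst (asm) LINT_sum) (rule i)
qed

lemma sum_mult_le: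
 assumes "sq a" "sq c"
 shows "\<bar>\<Sum>n<N. a n * c n\<bar> \<le> sqrt (\<Sum>n. (a n)\<^sup>2) * sqrt (\<Sum>n. (c n)\<^sup>2)"
proof -
 have "\<bar>\<Sum>n<N. a n * c n\<bar> \<le> (\<Sum>n<N. \<bar>a n\<bar> * \<bar>c n\<bar>)"
  using sum_abs[of "\<lambda>n. a n * c n" "{..<N}"] by (simp add: abs_mult)
 also have "\<dots> \<le> sqrt (\<Sum>n<N. (a n)\<^sup>2) * sqrt (\<Sum>n<N. (c n)\<^sup>2)"
  using L2_set_mult_ineq[of a c "{..<N}"] by (simp add: L2_set_def)
 also have "\<dots> \<le> sqrt (\<Sum>n. (a n)\<^sup>2) * sqrt (\<Sum>n. (c n)\<^sup>2)"
  using assms by (intro mult_mono real_sqrt_le_mono sum_le_suminf) (auto intro: sum_nonneg suminf_nonneg)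
 finally show ?thesis .
qed

lemma simple_function_leb:
 "simple_function (leb T) s \<longleftrightarrow> finite (s ` {0<..<T}) \<and> (\<forall>v. {t \<in> {0<..<T}. s t = v} \<in> sets lebesgue)"
proof -
 have "s -` {v} \<inter> {0<..<T} = {t \<in> {0<..<T}. s t = v}" for v by auto
 moreover have "{t \<in> {0<..<T}. s t = v} \<subseteq> {0<..<T}" for v by blast
 moreover have "(\<forall>v\<in>s ` {0<..<T}. {t \<in> {0<..<T}. s t = v} \<in> sets lebesgue) \<longleftrightarrow> (\<forall>v. {t \<in> {0<..<T}. s t = v} \<in> sets lebesgue)"
 proof (intro iffI allI ballI)
  fix v assume a: "\<forall>v\<in>s ` {0<..<T}. {t \<in> {0<..<T}. s t = v} \<in> sets lebesgue"
  show "{t \<in> {0<..<T}. s t = v} \<in> sets lebesgue"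
  proof (cases "v \<in> s ` {0<..<T}")
   case False
   hence "{t \<in> {0<..<T}. s t = v} = {}" by blast
   thus ?thesis by (simp only: sets.empty_sets)
  qed (use a in blast)
 qed blast
 ultimately show ?thesis
  unfolding simple_function_def by (simp only: sets_restrict_space_iff space_lebesgue_on sets.Int_space_eq2 lmeasurable_open open_greaterThanLessThan) (auto simp: sets_restrict_space_iff)
qed

text \<open>Converts strong measurability into measurability of scalar functions; it is applied to
  mode coefficients and to norms, both Lipschitz for \<open>N\<close>.\<close>

lemma Bochner_functional:
 assumes f: "strongly_measurable_into V N T f" "AE t in leb T. f t \<in> V"
  and c: "\<And>u v. u \<in> V ==> v \<in> V ==> \<bar>c u - c v\<bar> \<le> N (\<lambda>x. u x - v x)"
 shows "(\<lambda>t. c (f t)) \<in> meas T"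
proof -
 obtain s where s: "\<And>n. finite (s n ` {0<..<T}) \<and> s n ` {0<..<T} \<subseteq> V \<and> (\<forall>v. {t \<in> {0<..<T}. s n t = v} \<in> sets lebesgue)"
  and lim: "AE t in leb T. (\<lambda>n. N (\<lambda>x. s n t x - f t x)) \<longlonglongrightarrow> 0"
  using f(1) unfolding strongly_measurable_into_def by blast
 show ?thesis
 proof (rule measurable_AE_limit)
  have "simple_function (leb T) (c \<circ> s n)" for n
   by (rule simple_function_compose) (use s[of n] simple_function_leb in blast)
  thus "(\<lambda>t. c (s n t)) \<in> meas T" for n
   using borel_measurable_simple_function[of "leb T" "c \<circ> s n"] by (simp add: comp_def)
  show "AE t in leb T. (\<lambda>n. c (s n t)) \<longlonglongrightarrow> c (f t)" using lim f(2) AE_space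
  proof eventually_elim
   case (elim t)
   have "(\<lambda>n. c (s n t) - c (f t)) \<longlonglongrightarrow> 0"
   proof (rule Lim_null_comparison[OF always_eventually elim(1)], rule allI)
    fix n
    have "s n t \<in> V" using s[of n] elim(3) by auto
    thus "norm (c (s n t) - c (f t)) \<le> N (\<lambda>x. s n t x - f t x)" using c elim(2) by simp
   qed
   thus ?case by (rule LIM_zero_cancel)
  qed
 qed
qed

lemma bounded_Icc: "cont T f ==> \<exists>B\<ge>0. \<forall>t\<in>{0..T}. \<bar>f t\<bar> \<le> B" for f :: rfun
 using compact_imp_bounded[OF compact_continuous_image[of "{0..T}" f]]
 by (auto simp: bounded_iff) (metis abs_ge_zero order.trans linear)

text \<open>Puts the separated functions \<open>q t * u x\<close> into the Bochner spaces, both as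
  test functions and as sources.\<close>

lemma Bochner_scalar:
 fixes q :: rfun
 assumes q: "cont T q" and V: "\<And>r::real. (\<lambda>x. r * u x) \<in> V" and N: "\<And>r. N (\<lambda>x. r * u x) = \<bar>r\<bar> * N u"
 shows "(\<lambda>t x. q t * u x) \<in> Bochner_Lp p V N T"
proof -
 \<comment> \<open>Rounding \<open>q\<close> down to a multiple of \<open>1 / Suc n\<close> leaves
   finitely many values, \<open>q\<close> being bounded, and an error of at most
   \<open>1 / Suc n\<close>.\<close>
 define m where "m \<equiv> \<lambda>(n::nat) t. \<lfloor>real (Suc n) * q t\<rfloor>"
 define h where "h \<equiv> \<lambda>n i x. real_of_int i / real (Suc n) * u x"
 have qm: "q \<in> meas T" by (rule continuous_imp_measurable_on_sets_lebesgue[OF continuous_on_subset[OF q]]) auto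
 obtain B where B: "\<And>t. t \<in> {0..T} ==> \<bar>q t\<bar> \<le> B" using bounded_Icc[OF q] by blast
 have sm: "simple_function (leb T) (m n)" for n unfolding simple_function_def
 proof
  have "m n t \<in> {- \<lceil>real (Suc n) * B\<rceil>..\<lceil>real (Suc n) * B\<rceil>}" if "t \<in> {0<..<T}" for t
  proof -
   have "\<bar>real (Suc n) * q t\<bar> \<le> real (Suc n) * B"
    using B[of t] that by (simp only: abs_mult abs_of_nat, intro mult_left_mono) auto
   hence "- \<lceil>real (Suc n) * B\<rceil> \<le> m n t" "m n t \<le> \<lceil>real (Suc n) * B\<rceil>"
    using floor_mono[of "- (real (Suc n) * B)" "real (Suc n) * q t"] floor_mono[of "real (Suc n) * q t" "real (Suc n) * B"]
     floor_le_ceiling[of "real (Suc n) * B"] unfolding m_def ceiling_def by linarith+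
   thus ?thesis by simp
  qed
  thus "finite (m n ` space (leb T))" by (auto intro: finite_subset[of _ "{- \<lceil>real (Suc n) * B\<rceil>..\<lceil>real (Suc n) * B\<rceil>}"])
  have "m n \<in> measurable (leb T) (count_space UNIV)" unfolding m_def using qm by measurable
  thus "\<forall>i\<in>m n ` space (leb T). m n -` {i} \<inter> space (leb T) \<in> sets (leb T)"
   by (intro ballI measurable_sets[of _ _ "count_space UNIV"]) (simp_all add: sets_count_space)
 qed
 have "strongly_measurable_into V N T (\<lambda>t x. q t * u x)" unfolding strongly_measurable_into_def
 proof (intro exI[of _ "\<lambda>n t. h n (m n t)"] conjI allI)
  fix n
  have "simple_function (leb T) (h n \<circ> m n)" by (rule simple_function_compose[OF sm])
  hence *: "finite ((h n \<circ> m n) ` {0<..<T}) \<and> (\<forall>v. {t \<in> {0<..<T}. (h n \<circ> m n) t = v} \<in> sets lebesgue)"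
   by (simp only: simple_function_leb simp_thms)
  show "finite ((\<lambda>t. h n (m n t)) ` {0<..<T})" using * unfolding comp_def by blast
  show "{t \<in> {0<..<T}. h n (m n t) = v} \<in> sets lebesgue" for v using * unfolding comp_def by blast
  show "(\<lambda>t. h n (m n t)) ` {0<..<T} \<subseteq> V" unfolding h_def using V by blast
 next
  have "(\<lambda>n. N (\<lambda>x. h n (m n t) x - q t * u x)) \<longlonglongrightarrow> 0" for t
  proof (rule Lim_null_comparison)
   have "\<bar>real_of_int (m n t) / real (Suc n) - q t\<bar> \<le> 1 / real (Suc n)" for n
   proof -
    have "\<bar>real_of_int (m n t) - real (Suc n) * q t\<bar> \<le> 1" unfolding m_def by linarith
    moreover have "real_of_int (m n t) / real (Suc n) - q t = (real_of_int (m n t) - real (Suc n) * q t) / real (Suc n)"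
     by (simp add: field_simps)
    ultimately show ?thesis by (simp only: abs_divide abs_of_nat) (intro divide_right_mono, auto)
   qed
   moreover have "(\<lambda>x. h n (m n t) x - q t * u x) = (\<lambda>x. (real_of_int (m n t) / real (Suc n) - q t) * u x)" for n
    by (simp add: h_def algebra_simps)
   ultimately have "norm (N (\<lambda>x. h n (m n t) x - q t * u x)) \<le> 1 / real (Suc n) * \<bar>N u\<bar>" for n
    by (simp only: N real_norm_def abs_mult abs_abs) (intro mult_right_mono, auto)
   thus "\<forall>\<^sub>F n in sequentially. norm (N (\<lambda>x. h n (m n t) x - q t * u x)) \<le> 1 / real (Suc n) * \<bar>N u\<bar>" by simp
   show "(\<lambda>n. 1 / real (Suc n) * \<bar>N u\<bar>) \<longlonglongrightarrow> 0"
    using tendsto_mult_left_zero[OF LIMSEQ_inverse_real_of_nat, of "\<bar>N u\<bar>"] by (simp add: inverse_eq_divide)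
  qed
  thus "AE t in leb T. (\<lambda>n. N (\<lambda>x. h n (m n t) x - q t * u x)) \<longlonglongrightarrow> 0" by simp
 qed
 moreover have "integrable (leb T) (\<lambda>t. N (\<lambda>x. q t * u x) ^ p)"
  unfolding N integrable_on_iff by (intro absolutely_integrable_continuous_real continuous_intros q)
 ultimately show ?thesis using V by (simp add: Bochner_Lp_def)
qed

lemma reflect:
 fixes h :: rfun
 assumes h: "h AI {0..T}"
 shows "(\<lambda>s. h (T - s)) AI {0..T}"
  "t \<in> {0..T} ==> integral {0..t} (\<lambda>s. h (T - s)) = integral {T-t..T} h"
proof -
 have *: "((\<lambda>s. g (T - s)) has_integral integral {T-t..T} g) {0..t}"
  if "g integrable_on {T-t..T}" "t \<in> {0..T}" for t and g :: rfun
 proof -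
  have "(\<lambda>x. T - x) ` {T-t..T} = {0..t}" by (auto simp: image_iff intro!: bexI[of _ "T - _"])
  thus ?thesis using has_integral_affinity[of g "integral {T-t..T} g" "T-t" T "-1" T] integrable_integral[OF that(1)]
   by (simp add: image_image)
 qed
 show "integral {0..t} (\<lambda>s. h (T - s)) = integral {T-t..T} h" if "t \<in> {0..T}"
  by (rule integral_unique, rule *) (use that hk[OF abs_int_sub[OF h]] in auto)
 show "(\<lambda>s. h (T - s)) AI {0..T}"
 proof (cases "T \<ge> 0")
  case True
  have "h integrable_on {0..T}" "(\<lambda>x. \<bar>h x\<bar>) integrable_on {0..T}"
   using hk[OF h] hk[OF absolutely_integrable_norm[OF h]] by (simp_all add: comp_def)
  thus ?thesis using *[of h T] *[of "\<lambda>x. \<bar>h x\<bar>" T] True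
   by (intro absolutely_integrable_onI) (auto intro: has_integral_integrable)
 qed (simp add: set_integrable_def)
qed

lemma AE_reflect: "AE t in leb T. P t ==> AE t in leb T. P (T - t)"
proof -
 assume "AE t in leb T. P t"
 hence "negligible {x. \<not> (x \<in> {0<..<T} --> P x)}" unfolding AE_on_eq by (rule AE_negligible)
 hence n: "negligible ((\<lambda>x. T - x) ` {x. \<not> (x \<in> {0<..<T} --> P x)})"
  by (intro negligible_differentiable_image_negligible derivative_intros) auto
 have m: "x \<in> {0<..<T} --> P (T - x)" if "x \<notin> (\<lambda>x. T - x) ` {x. \<not> (x \<in> {0<..<T} --> P x)}" for x
 proof
  assume x: "x \<in> {0<..<T}"
  show "P (T - x)"
  proof (rule ccontr)
   assume "\<not> P (T - x)"
   with x have "x \<in> (\<lambda>x. T - x) ` {x. \<not> (x \<in> {0<..<T} --> P x)}" by (intro image_eqI[of _ _ "T - x"]) auto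
   with that show False by blast
  qed
 qed
 show ?thesis unfolding AE_on_eq by (rule negligible_AE[OF n m])
qed

lemma cont_into_functional:
 assumes y: "cont_into V N T y" and c: "\<And>u v. u \<in> V ==> v \<in> V ==> \<bar>c u - c v\<bar> \<le> N (\<lambda>x. u x - v x)"
 shows "cont T (\<lambda>t. c (y t))" unfolding continuous_on_def
proof
 fix t assume t: "t \<in> {0..T}"
 have V: "s \<in> {0..T} ==> y s \<in> V" for s using y by (simp add: cont_into_def)
 have "((\<lambda>s. N (\<lambda>x. y s x - y t x)) \<longlongrightarrow> 0) (at t within {0..T})" using y t by (simp add: cont_into_def)
 hence "((\<lambda>s. c (y s) - c (y t)) \<longlongrightarrow> 0) (at t within {0..T})"
  by (rule Lim_null_comparison[rotated]) (use c V t in \<open>auto simp: eventually_at_filter intro!: always_eventually\<close>)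
 thus "((\<lambda>s. c (y s)) \<longlongrightarrow> c (y t)) (at t within {0..T})" by (rule LIM_zero_cancel)
qed

lemma L2_norm_lipschitz: "u \<in> L2_space L ==> v \<in> L2_space L ==> \<bar>L2_norm L u - L2_norm L v\<bar> \<le> L2_norm L (\<lambda>x. u x - v x)"
 by (simp flip: norm_emb add: emb_diff L2_diff norm_triangle_ineq3)

lemma has_vector_derivative_quotient:
 fixes f :: "real => 'a::real_normed_vector"
 assumes "(f has_vector_derivative D) (at t within S)"
 shows "((\<lambda>s. norm ((f s - f t) /\<^sub>R (s - t) - D)) \<longlongrightarrow> 0) (at t within S)"
proof -
 have "((\<lambda>s. norm ((1 / norm (s - t)) *\<^sub>R (f s - f t - (s - t) *\<^sub>R D))) \<longlongrightarrow> 0) (at t within S)"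
  using assms unfolding has_vector_derivative_def has_derivative_within by (intro tendsto_norm_zero) (simp add: algebra_simps)
 thus ?thesis
 proof (rule Lim_transform_eventually)
  have "norm ((1 / norm (s - t)) *\<^sub>R (f s - f t - (s - t) *\<^sub>R D)) = norm ((f s - f t) /\<^sub>R (s - t) - D)" if "s \<noteq> t" for s
  proof -
   have "(f s - f t) /\<^sub>R (s - t) - D = (1 / (s - t)) *\<^sub>R (f s - f t - (s - t) *\<^sub>R D)"
    using that by (simp add: scaleR_diff_right inverse_eq_divide)
   thus ?thesis by simp
  qed
  thus "\<forall>\<^sub>F s in at t within S. norm ((1 / norm (s - t)) *\<^sub>R (f s - f t - (s - t) *\<^sub>R D)) = norm ((f s - f t) /\<^sub>R (s - t) - D)"
   by (auto simp: eventually_at_filter intro: always_eventually)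
 qed
qed

lemma tail_vec:
 assumes a: "sq a"
 shows "(\<lambda>N. sqrt (\<Sum>n. (if n < N then 0 else a n)\<^sup>2)) \<longlonglongrightarrow> 0" "sq (\<lambda>n. if n < N then 0 else a n)"
  "sqrt (\<Sum>n. (if n < N then 0 else a n)\<^sup>2) \<le> sqrt (\<Sum>n. (a n)\<^sup>2)"
proof -
 have sN: "(\<lambda>n. (if n < N then 0 else a n)\<^sup>2) sums ((\<Sum>n. (a n)\<^sup>2) - (\<Sum>n<N. (a n)\<^sup>2))" for N
 proof -
  have "(\<lambda>n. if n < N then (a n)\<^sup>2 else 0) sums (\<Sum>n<N. (a n)\<^sup>2)"
   using sums_finite[of "{..<N}" "\<lambda>n. if n < N then (a n)\<^sup>2 else 0"] by simp
  from sums_diff[OF summable_sums[OF a] this] show ?thesis by (rule back_subst[of "\<lambda>f. f sums _"]) auto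
 qed
 have "(\<lambda>N. sqrt ((\<Sum>n. (a n)\<^sup>2) - (\<Sum>n<N. (a n)\<^sup>2))) \<longlonglongrightarrow> sqrt ((\<Sum>n. (a n)\<^sup>2) - (\<Sum>n. (a n)\<^sup>2))"
  by (intro tendsto_intros summable_LIMSEQ a)
 thus "(\<lambda>N. sqrt (\<Sum>n. (if n < N then 0 else a n)\<^sup>2)) \<longlonglongrightarrow> 0" by (simp add: sums_unique[OF sN, symmetric])
 show "sq (\<lambda>n. if n < N then 0 else a n)" by (rule sums_summable[OF sN])
 show "sqrt (\<Sum>n. (if n < N then 0 else a n)\<^sup>2) \<le> sqrt (\<Sum>n. (a n)\<^sup>2)"
  unfolding sums_unique[OF sN, symmetric] by (simp add: sum_nonneg)
qed

section \<open>Test functions\<close>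

lemma LINT_abs_le:
 fixes f g :: "'a => real"
 assumes "integrable M f" "integrable M g" "AE t in M. \<bar>f t\<bar> \<le> g t"
 shows "\<bar>LINT t|M. f t\<bar> \<le> (LINT t|M. g t)"
 using integral_abs_bound[of M f] integral_mono_AE[OF integrable_abs[OF assms(1)] assms(2,3)] by linarith

lemma smooth2_product:
 assumes "smooth1 a" "smooth1 b"
 shows "smooth2 (\<lambda>t x. a t * b x)"
proof -
 obtain A B where A: "A 0 = a" "\<And>i x. (A i has_der A (Suc i) x) (at x)"
  and B: "B 0 = b" "\<And>i x. (B i has_der B (Suc i) x) (at x)" using assms unfolding smooth1_def by metis
 have c: "continuous_on UNIV (A i)" "continuous_on UNIV (B i)" for i
  using A(2) B(2) by (auto intro!: continuous_at_imp_continuous_on DERIV_isCont)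
 show ?thesis unfolding smooth2_def
 proof (intro exI[of _ "\<lambda>i j t x. A i t * B j x"] conjI allI)
  show "continuous_on UNIV (\<lambda>(t, x). A i t * B j x)" for i j
   unfolding split_beta by (intro continuous_intros continuous_on_compose2[OF c(1)] continuous_on_compose2[OF c(2)]) auto
  show "((\<lambda>s. A i s * B j x) has_der A (Suc i) t * B j x) (at t)" for i j t x by (rule DERIV_cmult_right[OF A(2)])
  show "((\<lambda>z. A i t * B j z) has_der A i t * B (Suc j) x) (at x)" for i j t x by (rule DERIV_cmult[OF B(2)])
 qed (simp add: A(1) B(1))
qed

lemma smooth2E:
 assumes "smooth2 \<phi>"
 obtains D where "D 0 0 = \<phi>" "\<And>i j. continuous_on UNIV (\<lambda>(t, x). D i j t x)"
  "\<And>i j t x. ((\<lambda>s. D i j s x) has_der D (Suc i) j t x) (at t)"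
  "\<And>i j t x. ((\<lambda>z. D i j t z) has_der D i (Suc j) t x) (at x)"
proof -
 obtain D where "D 0 0 = \<phi> \<and> (\<forall>i j. continuous_on UNIV (\<lambda>(t, x). D i j t x) \<and>
   (\<forall>t x. ((\<lambda>s. D i j s x) has_der D (Suc i) j t x) (at t) \<and> ((\<lambda>z. D i j t z) has_der D i (Suc j) t x) (at x)))"
  using assms unfolding smooth2_def by blast
 thus thesis by (intro that[of D]) blast+
qed

lemma smooth_compact_supportI:
 assumes "smooth2 \<phi>" "compact K" "K \<subseteq> S" "\<And>t x. (t, x) \<in> S ==> \<phi> t x \<noteq> 0 ==> (t, x) \<in> K"
 shows "smooth_compact_support_in S \<phi>"
proof -
 have "{(t, x) \<in> S. \<phi> t x \<noteq> 0} \<subseteq> K" by (rule subsetI, clarify, rule assms(4))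
 hence c: "closure {(t, x) \<in> S. \<phi> t x \<noteq> 0} \<subseteq> K" by (rule closure_minimal[OF _ compact_imp_closed[OF assms(2)]])
 have "compact (K \<inter> closure {(t, x) \<in> S. \<phi> t x \<noteq> 0})" by (rule compact_Int_closed[OF assms(2) closed_closure])
 hence "compact (closure {(t, x) \<in> S. \<phi> t x \<noteq> 0})" unfolding Int_absorb1[OF c] .
 thus ?thesis unfolding smooth_compact_support_in_def using assms(1) order.trans[OF c assms(3)] by (intro conjI)
qed

text \<open>The support is closed only relative to \<open>S\<close>. A nonzero value at a limit
  point outside \<open>S\<close> would persist nearby inside \<open>S\<close> and put that point
  into the closure of the support, which is contained in \<open>S\<close>.\<close>

lemma smooth_support_boundary:
 assumes \<phi>: "smooth_compact_support_in S \<phi>" and p: "(t, x) \<in> closure S" "(t, x) \<notin> S"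
 shows "\<phi> t x = 0"
proof (rule ccontr)
 assume n: "\<phi> t x \<noteq> 0"
 obtain D where D: "D 0 0 = \<phi>" "\<And>i j. continuous_on UNIV (\<lambda>(t, x). D i j t x)"
  by (rule smooth2E[OF \<phi>[unfolded smooth_compact_support_in_def, THEN conjunct1]]) (rule that)
 have "continuous_on UNIV (\<lambda>p. \<phi> (fst p) (snd p))" using D(2)[of 0 0] by (simp add: D(1) case_prod_unfold)
 hence "open ((\<lambda>p. \<phi> (fst p) (snd p)) -` (- {0}))" by (intro open_vimage) auto
 from open_Int_closure_subset[OF this, of S]
 have "(t, x) \<in> closure ((\<lambda>p. \<phi> (fst p) (snd p)) -` (- {0}) \<inter> S)" using n p(1) by auto
 also have "(\<lambda>p. \<phi> (fst p) (snd p)) -` (- {0}) \<inter> S = {(t, x) \<in> S. \<phi> t x \<noteq> 0}" by auto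
 finally show False using \<phi> p(2) unfolding smooth_compact_support_in_def by blast
qed

text \<open>The second time derivative is bounded on a compact box, so the Taylor remainder is at
  most \<open>M\<close> times the squared increment, uniformly in x. Against an integrable
  \<open>u\<close> the remainder of the integral is quadratic as well.\<close>

lemma derivative_under_LINT:
 fixes D :: "nat => real => rfun"
 assumes c: "\<And>i. continuous_on UNIV (\<lambda>(t, x). D i t x)"
  and d: "\<And>i t x. ((\<lambda>s. D i s x) has_der D (Suc i) t x) (at t)" and u: "u \<in> L2_space L" and L: "L > 0"
 shows "((\<lambda>t. LINT x|leb L. D i t x * u x) has_der (LINT x|leb L. D (Suc i) t x * u x)) (at t)"
proof -
 have cx: "continuous_on A (\<lambda>x. D i t x)" for i t A
  using continuous_on_compose2[OF c[of i], of A "\<lambda>x. (t, x)"] by (simp add: continuous_on_Pair)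
 have "(\<lambda>x. D i t x) \<in> L2_space L" for i t by (rule continuous_interval_L2[OF cx])
 hence int: "integrable (leb L) (\<lambda>x. D i t x * u x)" for i t using L2_mult_integrable u by blast
 have "compact ((\<lambda>(t, x). D (Suc (Suc i)) t x) ` ({t-1..t+1} \<times> {0..L}))"
  by (intro compact_continuous_image compact_Times continuous_on_subset[OF c]) auto
 then obtain M where M: "\<And>s x. s \<in> {t-1..t+1} ==> x \<in> {0..L} ==> \<bar>D (Suc (Suc i)) s x\<bar> \<le> M"
  using compact_imp_bounded by (fastforce simp: bounded_iff)
 have est: "\<bar>(D i s x - D i t x) - (s - t) * D (Suc i) t x\<bar> \<le> M * \<bar>s - t\<bar>\<^sup>2" if s: "\<bar>s - t\<bar> \<le> 1" and x: "x \<in> {0..L}" for s x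
 proof -
  let ?S = "closed_segment t s"
  have S: "r \<in> {t-1..t+1}" "\<bar>r - t\<bar> \<le> \<bar>s - t\<bar>" if "r \<in> ?S" for r
   using that s by (auto simp: closed_segment_eq_real_ivl split: if_splits)
  have 1: "\<bar>D (Suc i) r x - D (Suc i) t x\<bar> \<le> M * \<bar>r - t\<bar>" if r: "r \<in> ?S" for r
  proof -
   have "norm (D (Suc i) r x - D (Suc i) t x) \<le> M * norm (r - t)"
    by (rule field_differentiable_bound[of ?S "\<lambda>r. D (Suc i) r x" "\<lambda>r. D (Suc (Suc i)) r x"])
     (use M S x r d in \<open>auto intro: has_field_derivative_at_within\<close>)
   thus ?thesis by simp
  qed
  have M0: "M \<ge> 0" using M[of t x] x by force
  have "norm ((D i s x - s * D (Suc i) t x) - (D i t x - t * D (Suc i) t x)) \<le> (M * \<bar>s - t\<bar>) * norm (s - t)"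
  proof (rule field_differentiable_bound[of ?S "\<lambda>r. D i r x - r * D (Suc i) t x" "\<lambda>r. D (Suc i) r x - D (Suc i) t x"])
   show "((\<lambda>r. D i r x - r * D (Suc i) t x) has_der D (Suc i) r x - D (Suc i) t x) (at r within ?S)" for r
    by (rule has_field_derivative_at_within) (auto intro!: derivative_eq_intros d)
   show "norm (D (Suc i) r x - D (Suc i) t x) \<le> M * \<bar>s - t\<bar>" if "r \<in> ?S" for r
    using order.trans[OF 1[OF that] mult_left_mono[OF S(2)[OF that] M0]] by simp
  qed auto
  thus ?thesis by (simp add: power2_eq_square algebra_simps)
 qed
 let ?Z = "\<lambda>i t. LINT x|leb L. D i t x * u x"
 have iu: "integrable (leb L) (\<lambda>x. \<bar>u x\<bar>)" by (intro integrable_abs L2_integrable u)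
 define K where "K = M * (LINT x|leb L. \<bar>u x\<bar>)"
 have est2: "\<bar>(?Z i s - ?Z i t) - (s - t) * ?Z (Suc i) t\<bar> \<le> K * \<bar>s - t\<bar>\<^sup>2" if s: "\<bar>s - t\<bar> \<le> 1" for s
 proof -
  have "(?Z i s - ?Z i t) - (s - t) * ?Z (Suc i) t = (LINT x|leb L. ((D i s x - D i t x) - (s - t) * D (Suc i) t x) * u x)"
   using int by (simp add: left_diff_distrib mult.assoc LINT_diff)
  also have "\<bar>\<dots>\<bar> \<le> (LINT x|leb L. M * \<bar>s - t\<bar>\<^sup>2 * \<bar>u x\<bar>)"
  proof (rule LINT_abs_le)
   show "integrable (leb L) (\<lambda>x. ((D i s x - D i t x) - (s - t) * D (Suc i) t x) * u x)"
    using int by (simp add: left_diff_distrib mult.assoc)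
   show "AE x in leb L. \<bar>((D i s x - D i t x) - (s - t) * D (Suc i) t x) * u x\<bar> \<le> M * \<bar>s - t\<bar>\<^sup>2 * \<bar>u x\<bar>"
   proof (rule AE_I2)
    fix x assume "x \<in> space (leb L)"
    thus "\<bar>((D i s x - D i t x) - (s - t) * D (Suc i) t x) * u x\<bar> \<le> M * \<bar>s - t\<bar>\<^sup>2 * \<bar>u x\<bar>"
     using est[OF s, of x] unfolding abs_mult by (intro mult_right_mono) auto
   qed
  qed (intro integrable_mult_right iu)
  also have "\<dots> = K * \<bar>s - t\<bar>\<^sup>2" by (simp add: K_def)
  finally show ?thesis .
 qed
 have "((\<lambda>s. (?Z i s - ?Z i t) / (s - t) - ?Z (Suc i) t) \<longlongrightarrow> 0) (at t)"
 proof (rule Lim_null_comparison)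
  have "norm ((?Z i s - ?Z i t) / (s - t) - ?Z (Suc i) t) \<le> K * \<bar>s - t\<bar>" if "s \<noteq> t" "\<bar>s - t\<bar> < 1" for s
  proof -
   have "(?Z i s - ?Z i t) / (s - t) - ?Z (Suc i) t = ((?Z i s - ?Z i t) - (s - t) * ?Z (Suc i) t) / (s - t)"
    using that by (simp add: field_simps)
   hence "norm ((?Z i s - ?Z i t) / (s - t) - ?Z (Suc i) t) = \<bar>(?Z i s - ?Z i t) - (s - t) * ?Z (Suc i) t\<bar> / \<bar>s - t\<bar>" by simp
   also have "\<dots> \<le> K * \<bar>s - t\<bar>\<^sup>2 / \<bar>s - t\<bar>" using est2[of s] that by (intro divide_right_mono) auto
   also have "\<dots> = K * \<bar>s - t\<bar>"
   proof -
    have "K * r\<^sup>2 / r = K * r" for r :: real by (simp add: power2_eq_square)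
    thus ?thesis .
   qed
   finally show ?thesis .
  qed
  thus "\<forall>\<^sub>F s in at t. norm ((?Z i s - ?Z i t) / (s - t) - ?Z (Suc i) t) \<le> K * \<bar>s - t\<bar>"
   unfolding eventually_at by (intro exI[of _ 1]) (auto simp: dist_real_def)
  have "((\<lambda>s. K * \<bar>s - t\<bar>) \<longlongrightarrow> K * \<bar>t - t\<bar>) (at t)" by (intro tendsto_intros)
  thus "((\<lambda>s. K * \<bar>s - t\<bar>) \<longlongrightarrow> 0) (at t)" by simp
 qed
 thus ?thesis unfolding has_field_derivative_iff by (rule LIM_zero_cancel)
qed

lemma integrable_AE_eq:
 fixes g h :: rfun
 assumes g: "integrable (leb T) g" and ae: "AE t in leb T. g t = h t"
 shows "integrable (leb T) h"
proof (rule LINT_able_bound[OF g])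
 show "h \<in> meas T"
  by (rule measurable_AE_limit[of "\<lambda>n. g"]) (use g ae in \<open>auto elim: eventually_mono\<close>)
qed (use ae in auto)

section \<open>The degenerate operator\<close>

locale degenerate =
 fixes \<alpha> L :: real
 assumes L_pos: "0 < L" and \<alpha>_pos: "0 < \<alpha>" and \<alpha>_less: "\<alpha> < 2"
begin

abbreviation "HA \<equiv> H1_space \<alpha> L"
abbreviation "NA \<equiv> H1_norm \<alpha> L"
abbreviation "HD \<equiv> Hdual_space \<alpha> L"
abbreviation "ND \<equiv> Hdual_norm \<alpha> L"
abbreviation "LL \<equiv> L2_space L"
abbreviation "NL \<equiv> L2_norm L"
abbreviation "backward T \<xi> \<equiv> backward_weak_solution \<alpha> L T \<xi> (\<lambda>x. 0) (\<lambda>x. 0)"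

text \<open>This factor turns the weighted gradient into the derivative. It is integrable on (0,L)
  because \<alpha> < 2, but square integrable only for \<alpha> < 1; the two boundary conditions at
  0 reflect this difference.\<close>

definition \<kappa> :: rfun where "\<kappa> s = s powr (- \<alpha> / 2)"

lemma \<kappa>_measurable [measurable]: "\<kappa> \<in> borel_measurable lebesgue"
 unfolding \<kappa>_def by (rule measurable_powr)

lemma \<kappa>_nonneg [simp]: "0 \<le> \<kappa> s" by (simp add: \<kappa>_def)

lemma \<kappa>_pos: "s > 0 ==> 0 < \<kappa> s" by (simp add: \<kappa>_def)

lemma \<kappa>_mono: "0 < x ==> x \<le> s ==> \<kappa> s \<le> \<kappa> x"
 unfolding \<kappa>_def using \<alpha>_pos by (intro powr_mono2') auto

lemma \<kappa>_sq: "(\<kappa> s)\<^sup>2 = s powr (- \<alpha>)" by (simp add: \<kappa>_def power2_eq_square flip: powr_add)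

definition c0 :: real where "c0 = (LINT s|lebesgue. indicator {0<..<L} s * \<kappa> s)"

lemma \<kappa>_integrable: "integrable lebesgue (\<lambda>s. indicator {0<..<L} s * \<kappa> s)"
 unfolding \<kappa>_def using \<alpha>_less L_pos by (intro integrable_powr) auto

lemma c0_nonneg: "0 \<le> c0" unfolding c0_def by (intro LINT_nonneg) auto

text \<open>The representer of evaluation at x: the inner product of the weighted gradient with
  \<open>kk x\<close> is u(x). The sign is due to integrating from x up to L, where u
  vanishes.\<close>

definition kfun :: "real => rfun" where "kfun x s = - (indicator {x<..<L} s * \<kappa> s)"
definition kk :: "real => l2" where "kk x = abs_l2 (kfun x)"

lemma kfun_measurable: "kfun x \<in> borel_measurable lebesgue"
 unfolding kfun_def by (intro borel_measurable_uminus borel_measurable_times borel_measurable_indicator \<kappa>_measurable) auto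

lemma kfun_square_integrable: "x > 0 ==> kfun x \<in> square_integrable"
 by (rule bounded_interval_square_integrable[OF kfun_measurable, of L _ "\<kappa> x"])
  (auto simp: kfun_def indicator_def \<kappa>_mono)

text \<open>One factor \<open>\<kappa> s\<close> is at most \<open>\<kappa> x\<close>, by
  monotonicity, and the other one integrates to at most \<open>c0\<close>. The bound is meaningful
  for every \<alpha> < 2, although \<open>\<kappa>\<close> itself need not be square integrable near
  0.\<close>

lemma norm_kk: "x > 0 ==> (norm (kk x))\<^sup>2 \<le> c0 * \<kappa> x"
proof -
 assume x: "x > 0"
 have "(norm (kk x))\<^sup>2 = (LINT s|lebesgue. (kfun x s)\<^sup>2)"
  unfolding kk_def by (rule norm_abs_l2[OF kfun_square_integrable[OF x]])
 also have "\<dots> \<le> (LINT s|lebesgue. \<kappa> x * (indicator {0<..<L} s * \<kappa> s))"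
 proof (rule integral_mono)
  show "integrable lebesgue (\<lambda>s. (kfun x s)\<^sup>2)" using kfun_square_integrable[OF x] by (simp add: square_integrable_def)
  show "integrable lebesgue (\<lambda>s. \<kappa> x * (indicator {0<..<L} s * \<kappa> s))" by (intro integrable_mult_right \<kappa>_integrable)
  fix s show "(kfun x s)\<^sup>2 \<le> \<kappa> x * (indicator {0<..<L} s * \<kappa> s)"
   using x \<kappa>_mono[of x s] by (auto simp: kfun_def indicator_def power2_eq_square intro!: mult_right_mono)
 qed
 also have "\<dots> = c0 * \<kappa> x" by (simp add: c0_def)
 finally show ?thesis .
qed

lemma norm_kk_diff: "0 < x ==> x \<le> y ==> (norm (kk y - kk x))\<^sup>2 \<le> (\<kappa> x)\<^sup>2 * (y - x)"
proof -
 assume x: "0 < x" "x \<le> y"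
 let ?d = "\<lambda>s. kfun y s - kfun x s"
 have d: "?d \<in> square_integrable" using x by (intro square_integrable_diff kfun_square_integrable) auto
 have "(norm (kk y - kk x))\<^sup>2 = (LINT s|lebesgue. (?d s)\<^sup>2)"
  unfolding kk_def using x norm_abs_l2[OF d] by (simp add: abs_l2_diff kfun_square_integrable)
 also have "\<dots> \<le> (LINT s|lebesgue. (\<kappa> x)\<^sup>2 * indicator {x..y} s)"
 proof (rule integral_mono)
  show "integrable lebesgue (\<lambda>s. (?d s)\<^sup>2)" using d by (simp add: square_integrable_def)
  show "integrable lebesgue (\<lambda>s. (\<kappa> x)\<^sup>2 * indicator {x..y} s)" by (intro integrable_mult_right) (simp add: integrable_indicator_iff emeasure_lborel_Icc_eq)
  fix s show "(?d s)\<^sup>2 \<le> (\<kappa> x)\<^sup>2 * indicator {x..y} s"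
   using x \<kappa>_mono[of x s] by (auto simp: kfun_def indicator_def intro!: power_mono)
 qed
 also have "\<dots> = (\<kappa> x)\<^sup>2 * (y - x)" using x by simp
 finally show ?thesis .
qed

text \<open>For \<alpha> \<ge> 1 there is no condition at 0 to encode. The value 0 makes the
  correction term in \<open>P\<close> vanish, so that one formula covers both cases.\<close>

definition kap :: l2 where "kap = (if \<alpha> < 1 then emb L \<kappa> else 0)"

lemma \<kappa>_L2: "\<alpha> < 1 ==> \<kappa> \<in> LL" unfolding L2_space_iff
proof (rule square_integrableI)
 assume "\<alpha> < 1"
 thus "integrable lebesgue (\<lambda>x. (indicator {0<..<L} x * \<kappa> x)\<^sup>2)"
  unfolding indicator_sq \<kappa>_sq using L_pos by (intro integrable_powr) auto
qed (auto intro!: borel_measurable_times borel_measurable_indicator)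

section \<open>The projections and the primitive operator R\<close>

definition E :: "l2 => l2" where "E h = emb L (rep_l2 h)"

lemma E_linear: "bounded_linear E" unfolding E_def by (rule bounded_linear_emb_rep)
lemma E_E [simp]: "E (E h) = E h" by (simp add: E_def)
lemma E_emb [simp]: "u \<in> LL ==> E (emb L u) = emb L u" by (simp add: E_def)
lemma inner_E: "inner (E a) b = inner a (E b)"
 using inner_emb_rep[OF rep_l2_L2, of L a b] inner_emb_rep[OF rep_l2_L2, of L b a] by (simp add: E_def inner_commute)
lemma E_kap: "E kap = kap" using \<kappa>_L2 bounded_linear.linear[OF E_linear] by (auto simp: kap_def linear_0)

text \<open>Orthogonal projection onto the classes on (0,L) that are orthogonal to
  \<open>kap\<close>: these are exactly the possible weighted gradients. If \<open>kap = 0\<close>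
  the quotient is a division by 0 and multiplies the zero vector.\<close>

definition P :: "l2 => l2" where "P q = E q - (inner q kap / inner kap kap) *\<^sub>R kap"

lemma P_linear: "bounded_linear P" unfolding P_def by (intro bounded_linear_sub E_linear bounded_linear_scaleR_const
   bounded_linear_compose[OF bounded_linear_divide bounded_linear_inner_left])

lemma P_P [simp]: "P (P q) = P q"
proof -
 interpret E: bounded_linear E by (rule E_linear)
 have "inner (E q) kap = inner q kap" by (simp add: inner_E E_kap)
 thus ?thesis unfolding P_def by (simp add: E.diff E.scaleR E_kap inner_diff_left)
qed

lemma inner_P: "inner (P a) b = inner a (P b)"
 by (simp add: P_def inner_diff_left inner_diff_right inner_E inner_commute[of kap b] mult.commute)

lemma norm_P: "norm (P q) \<le> norm q"
proof -
 have "norm (P q) * norm (P q) = inner q (P q)"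
  using power2_norm_eq_inner[of "P q"] inner_P[of q "P q"] by (simp add: power2_eq_square)
 also have "\<dots> \<le> norm q * norm (P q)" by (rule norm_cauchy_schwarz)
 finally show ?thesis by (cases "norm (P q) = 0") (auto dest: mult_right_le_imp_le)
qed

lemma E_P [simp]: "E (P q) = P q"
proof -
 interpret E: bounded_linear E by (rule E_linear)
 show ?thesis by (simp add: P_def E.diff E.scaleR E_kap)
qed

lemma inner_P_kap: "inner (P q) kap = 0" by (cases "kap = 0") (simp_all add: P_def inner_diff_left inner_E E_kap)

text \<open>A function rather than a class, so that derivatives and boundary values make sense
  pointwise. The value 0 at x = 0 is the boundary value required for \<alpha> < 1.\<close>

definition Rfun :: "l2 => rfun" where "Rfun q x = (if x \<le> 0 then 0 else inner (P q) (kk x))"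

lemma Rfun_add: "Rfun (q + r) x = Rfun q x + Rfun r x"
 by (simp add: Rfun_def bounded_linear.linear[OF P_linear] linear_add inner_add_left)

lemma Rfun_scaleR: "Rfun (c *\<^sub>R q) x = c * Rfun q x"
 by (simp add: Rfun_def bounded_linear.linear[OF P_linear] linear_cmul)

lemma Rfun_bound: "x > 0 ==> \<bar>Rfun q x\<bar> \<le> norm q * sqrt (c0 * \<kappa> x)"
proof -
 assume x: "x > 0"
 have "norm (kk x) \<le> sqrt (c0 * \<kappa> x)" by (rule real_le_rsqrt[OF norm_kk[OF x]])
 hence "norm (P q) * norm (kk x) \<le> norm q * sqrt (c0 * \<kappa> x)" by (intro mult_mono norm_P) auto
 thus ?thesis using x Cauchy_Schwarz_ineq2[of "P q" "kk x"] by (simp add: Rfun_def)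
qed

lemma Rfun_diff: "0 < x ==> x \<le> y ==> \<bar>Rfun q y - Rfun q x\<bar> \<le> norm q * (\<kappa> x * sqrt (y - x))"
proof -
 assume x: "0 < x" "x \<le> y"
 have "norm (kk y - kk x) \<le> sqrt ((\<kappa> x)\<^sup>2 * (y - x))" by (rule real_le_rsqrt[OF norm_kk_diff[OF x]])
 hence "norm (P q) * norm (kk y - kk x) \<le> norm q * (\<kappa> x * sqrt (y - x))"
  by (intro mult_mono norm_P) (auto simp: real_sqrt_mult)
 thus ?thesis using x Cauchy_Schwarz_ineq2[of "P q" "kk y - kk x"] by (simp add: Rfun_def inner_diff_right)
qed

lemma Rfun_L: "Rfun q L = 0"
proof -
 have "kfun L = (\<lambda>s. 0)" by (auto simp: kfun_def)
 hence "kk L = 0" by (simp add: kk_def zero_l2_def)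
 thus ?thesis by (simp add: Rfun_def)
qed

lemma Rfun_continuous: "continuous_on {0<..} (Rfun q)"
proof (rule continuous_at_imp_continuous_on, rule ballI)
 fix x :: real assume "x \<in> {0<..}"
 hence x: "x > 0" by simp
 have "((\<lambda>y. Rfun q y - Rfun q x) \<longlongrightarrow> 0) (at x)"
 proof (rule Lim_null_comparison)
  have "\<forall>\<^sub>F y in at x. y > x / 2" using x by (intro order_tendstoD(1)[OF tendsto_ident_at]) simp
  thus "\<forall>\<^sub>F y in at x. norm (Rfun q y - Rfun q x) \<le> norm q * (\<kappa> (x / 2) * sqrt \<bar>y - x\<bar>)"
  proof eventually_elim
   case (elim y)
   have m: "norm q * (\<kappa> z * r) \<le> norm q * (\<kappa> (x / 2) * r)" if "z \<ge> x / 2" "r \<ge> 0" for z r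
    using that x \<kappa>_mono[of "x / 2" z] by (intro mult_left_mono mult_right_mono) auto
   show ?case
   proof (cases "x \<le> y")
    case True
    thus ?thesis using Rfun_diff[of x y q] m[of x "sqrt (y - x)"] x by simp
   next
    case False
    thus ?thesis using Rfun_diff[of y x q] m[of y "sqrt (x - y)"] x elim by (simp add: abs_minus_commute)
   qed
  qed
  have "((\<lambda>y. norm q * (\<kappa> (x / 2) * sqrt \<bar>y - x\<bar>)) \<longlongrightarrow> norm q * (\<kappa> (x / 2) * sqrt \<bar>x - x\<bar>)) (at x)"
   by (intro tendsto_intros)
  thus "((\<lambda>y. norm q * (\<kappa> (x / 2) * sqrt \<bar>y - x\<bar>)) \<longlongrightarrow> 0) (at x)" by simp
 qed
 thus "isCont (Rfun q) x" unfolding isCont_def by (rule LIM_zero_cancel)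
qed

lemma Rfun_measurable: "Rfun q \<in> meas L"
 by (intro continuous_imp_measurable_on_sets_lebesgue continuous_on_subset[OF Rfun_continuous]) auto

text \<open>The pointwise majorant of R on the unit ball. It behaves like
  \<open>x powr (- \<alpha> / 4)\<close>, hence is square integrable for every \<alpha> < 2.\<close>

definition bfun :: rfun where "bfun x = sqrt (c0 * \<kappa> x)"

lemma bfun_L2: "bfun \<in> LL"
 and bfun_norm: "NL bfun = c0"
proof -
 have sq: "(indicator {0<..<L} x * bfun x)\<^sup>2 = c0 * (indicator {0<..<L} x * \<kappa> x)" for x
  by (simp add: indicator_sq bfun_def c0_nonneg indicator_def)
 have "integrable lebesgue (\<lambda>x. (indicator {0<..<L} x * bfun x)\<^sup>2)"
  unfolding sq by (intro integrable_mult_right \<kappa>_integrable)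
 moreover have "(\<lambda>x. indicator {0<..<L} x * bfun x) \<in> borel_measurable lebesgue"
 proof (intro borel_measurable_times borel_measurable_indicator)
  show "bfun \<in> borel_measurable lebesgue" unfolding bfun_def
   by (rule borel_measurable_continuous_on[of sqrt]) (auto intro!: continuous_intros borel_measurable_times)
 qed simp
 ultimately show "bfun \<in> LL" unfolding L2_space_iff by (intro square_integrableI)
 have "(LINT x|leb L. (bfun x)\<^sup>2) = (LINT x|lebesgue. c0 * (indicator {0<..<L} x * \<kappa> x))"
  unfolding LINT_on_eq by (intro LINT_cong) (auto simp: bfun_def c0_nonneg)
 also have "\<dots> = c0\<^sup>2" by (simp add: c0_def power2_eq_square)
 finally show "NL bfun = c0" by (simp add: L2_norm_def c0_nonneg)
qed

lemma L2_bound: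
 assumes g: "g \<in> LL" and f: "f \<in> meas L"
  and le: "\<And>x. x \<in> {0<..<L} ==> \<bar>f x\<bar> \<le> \<bar>g x\<bar>"
 shows "f \<in> LL" "NL f \<le> NL g"
proof -
 have le': "\<bar>indicator {0<..<L} x * f x\<bar> \<le> \<bar>indicator {0<..<L} x * g x\<bar>" for x
  using le[of x] by (auto simp: indicator_def)
 show fL: "f \<in> LL" unfolding L2_space_iff by (rule square_integrable_bound[of "\<lambda>x. indicator {0<..<L} x * g x"])
   (use g f le' in \<open>auto simp: L2_space_iff measurable_on_eq simp del: abs_mult\<close>)
 show "NL f \<le> NL g" unfolding L2_norm_def
 proof (rule real_sqrt_le_mono, rule integral_mono)
  fix x assume "x \<in> space (leb L)"
  thus "(f x)\<^sup>2 \<le> (g x)\<^sup>2" using le[of x] by (simp add: abs_le_square_iff)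
 qed (use fL g in \<open>auto simp: L2_space_def\<close>)
qed

lemma Rfun_L2: "Rfun q \<in> LL" and norm_Rfun: "NL (Rfun q) \<le> norm q * c0"
proof -
 have "(\<lambda>x. norm q * bfun x) \<in> LL" by (intro L2_cmult bfun_L2)
 moreover have "\<bar>Rfun q x\<bar> \<le> \<bar>norm q * bfun x\<bar>" if "x \<in> {0<..<L}" for x
  using Rfun_bound[of x q] that by (simp add: bfun_def abs_mult c0_nonneg)
 ultimately show "Rfun q \<in> LL" "NL (Rfun q) \<le> norm q * c0"
  using L2_bound[OF _ Rfun_measurable, of "\<lambda>x. norm q * bfun x" q] by (auto simp: L2_norm_cmult bfun_L2 bfun_norm)
qed

definition Rop :: "l2 => l2" where "Rop q = emb L (Rfun q)"

lemma Rop_linear: "bounded_linear Rop"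
proof (rule bounded_linear_intro[where K = c0])
 fix q r :: l2 and c :: real
 show "Rop (q + r) = Rop q + Rop r" unfolding Rop_def Rfun_add[abs_def] by (rule emb_add) (rule Rfun_L2)+
 show "Rop (c *\<^sub>R q) = c *\<^sub>R Rop q" unfolding Rop_def Rfun_scaleR[abs_def] by (rule emb_cmult) (rule Rfun_L2)
 show "norm (Rop q) \<le> norm q * c0" unfolding Rop_def norm_emb[OF Rfun_L2] by (rule norm_Rfun)
qed

subsection \<open>The adjoint\<close>

definition hh :: "real => l2" where "hh s = abs_l2 (indicator {0<..<s})"

lemma hh_si: "indicator {0<..<s} \<in> square_integrable" for s :: real
 by (rule bounded_interval_square_integrable[OF borel_measurable_indicator, of _ s 1]) (auto simp: indicator_def)

lemma norm_hh: "s \<ge> 0 ==> norm (hh s) = sqrt s"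
proof -
 assume s: "s \<ge> 0"
 have "(norm (hh s))\<^sup>2 = (LINT x|lebesgue. indicator {0<..<s} x)"
 proof -
  have "(indicator {0<..<s} x :: real)\<^sup>2 = indicator {0<..<s} x" for x :: real by (simp add: indicator_def)
  thus ?thesis unfolding hh_def norm_abs_l2[OF hh_si] by (simp only:)
 qed
 hence "(norm (hh s))\<^sup>2 = s" using s by simp
 thus ?thesis using real_sqrt_unique norm_ge_zero by metis
qed

lemma norm_hh_diff: "0 \<le> s ==> s \<le> t ==> norm (hh t - hh s) \<le> sqrt (t - s)"
proof -
 assume s: "0 \<le> s" "s \<le> t"
 let ?d = "\<lambda>x. indicator {0<..<t} x - indicator {0<..<s} x :: real"
 have d: "?d \<in> square_integrable" by (intro square_integrable_diff hh_si)
 have "(norm (hh t - hh s))\<^sup>2 = (LINT x|lebesgue. (?d x)\<^sup>2)"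
  unfolding hh_def using norm_abs_l2[OF d] by (simp add: abs_l2_diff hh_si)
 also have "\<dots> \<le> (LINT x|lebesgue. indicator {s..t} x)"
 proof (rule integral_mono)
  show "integrable lebesgue (\<lambda>x. (?d x)\<^sup>2)" using d by (simp add: square_integrable_def)
  show "(?d x)\<^sup>2 \<le> indicator {s..t} x" for x using s by (auto simp: indicator_def)
 qed (simp add: integrable_indicator_iff emeasure_lborel_Icc_eq)
 also have "\<dots> = t - s" using s by simp
 finally show ?thesis by (rule real_le_rsqrt)
qed

lemma inner_hh: "inner f (hh s) = (LINT x|lebesgue. indicator {0<..<s} x * rep_l2 f x)"
 unfolding hh_def by (subst inner_rep_abs[OF hh_si]) (simp add: mult.commute)

text \<open>The formal adjoint of integration from x to L: exchanging the integrals leaves the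
  primitive of \<open>f\<close> from 0, which is the inner product with \<open>hh s\<close>, times
  \<open>- \<kappa> s\<close>. Applying \<open>P\<close> afterwards gives the adjoint of R.\<close>

definition Gfun :: "l2 => rfun" where "Gfun f s = - (\<kappa> s * inner f (hh s))"

lemma inner_hh_continuous: "continuous_on {0..} (\<lambda>s. inner f (hh s))"
proof -
 have "continuous_on {0..} hh" unfolding continuous_on_iff
 proof (intro ballI allI impI)
  fix s e :: real assume s: "s \<in> {0..}" and e: "e > 0"
  have "dist (hh t) (hh s) < e" if t: "t \<in> {0..}" "dist t s < e\<^sup>2" for t
  proof -
   have "norm (hh t - hh s) \<le> sqrt \<bar>t - s\<bar>"
    using norm_hh_diff[of s t] norm_hh_diff[of t s] s t(1) by (cases "s \<le> t") (auto simp: norm_minus_commute)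
   also have "\<dots> < e" using t(2) e by (intro real_less_lsqrt) (auto simp: dist_real_def)
   finally show ?thesis by (simp add: dist_norm)
  qed
  thus "\<exists>d>0. \<forall>x'\<in>{0..}. dist x' s < d --> dist (hh x') (hh s) < e" using e by (intro exI[of _ "e\<^sup>2"]) auto
 qed
 thus ?thesis by (intro continuous_intros)
qed

lemma Gfun_L2: "Gfun f \<in> LL" and norm_Gfun: "\<exists>C. \<forall>f. NL (Gfun f) \<le> norm f * C"
proof -
 \<comment> \<open>By Cauchy-Schwarz the primitive of \<open>f\<close> at s is at most
   \<open>norm f * sqrt s\<close>, so this is a majorant. Its square is
   \<open>s powr (1 - \<alpha>)\<close>, integrable because \<alpha> < 2.\<close>
 define g where "g \<equiv> \<lambda>s. \<kappa> s * sqrt s"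
 have gm: "g \<in> borel_measurable lebesgue"
  unfolding g_def by (intro borel_measurable_times \<kappa>_measurable measurable_completion) simp
 have g: "g \<in> LL" unfolding L2_space_iff
 proof (rule square_integrableI)
  have "(indicator {0<..<L} x * g x)\<^sup>2 = indicator {0<..<L} x * x powr (1 - \<alpha>)" for x
   by (auto simp: indicator_def g_def power_mult_distrib \<kappa>_sq powr_diff powr_minus divide_inverse mult.commute)
  thus "integrable lebesgue (\<lambda>x. (indicator {0<..<L} x * g x)\<^sup>2)"
   using integrable_powr[of "1 - \<alpha>" L] \<alpha>_less L_pos by simp
  show "(\<lambda>x. indicator {0<..<L} x * g x) \<in> borel_measurable lebesgue"
   using gm by (intro borel_measurable_times borel_measurable_indicator) auto
 qed
 have Gm: "Gfun f \<in> meas L" for f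
 proof -
  have "(\<lambda>s. inner f (hh s)) \<in> meas L"
   by (intro continuous_imp_measurable_on_sets_lebesgue continuous_on_subset[OF inner_hh_continuous]) auto
  moreover have "\<kappa> \<in> meas L" by (intro measurable_restrict_space1 \<kappa>_measurable)
  ultimately show ?thesis unfolding Gfun_def by measurable
 qed
 have le: "\<bar>Gfun f s\<bar> \<le> \<bar>norm f * g s\<bar>" if "s \<in> {0<..<L}" for f s
 proof -
  have "\<bar>inner f (hh s)\<bar> \<le> norm f * sqrt s" using Cauchy_Schwarz_ineq2[of f "hh s"] that by (simp add: norm_hh)
  hence "\<kappa> s * \<bar>inner f (hh s)\<bar> \<le> \<kappa> s * (norm f * sqrt s)" by (intro mult_left_mono) auto
  thus ?thesis using that by (simp add: Gfun_def g_def abs_mult mult_ac)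
 qed
 have gq: "(\<lambda>s. norm f * g s) \<in> LL" for f :: l2 by (intro L2_cmult g)
 show "Gfun f \<in> LL" by (rule L2_bound(1)[OF gq Gm le])
 have "NL (Gfun f) \<le> norm f * NL g" for f using L2_bound(2)[OF gq Gm le, of f] by (simp add: L2_norm_cmult g)
 thus "\<exists>C. \<forall>f. NL (Gfun f) \<le> norm f * C" by blast
qed

definition Rs :: "l2 => l2" where "Rs f = P (emb L (Gfun f))"

lemma Rs_linear: "bounded_linear Rs"
proof -
 obtain C where C: "\<And>f. NL (Gfun f) \<le> norm f * C" using norm_Gfun by blast
 have "bounded_linear (\<lambda>f. emb L (Gfun f))"
 proof (rule bounded_linear_intro[where K = C])
  fix f g :: l2 and c :: real
  have "Gfun (f + g) = (\<lambda>s. Gfun f s + Gfun g s)" by (auto simp: Gfun_def inner_add_left algebra_simps)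
  thus "emb L (Gfun (f + g)) = emb L (Gfun f) + emb L (Gfun g)" by (simp add: emb_add Gfun_L2)
  have "Gfun (c *\<^sub>R f) = (\<lambda>s. c * Gfun f s)" by (auto simp: Gfun_def)
  thus "emb L (Gfun (c *\<^sub>R f)) = c *\<^sub>R emb L (Gfun f)" by (simp add: emb_cmult Gfun_L2)
  show "norm (emb L (Gfun f)) \<le> norm f * C" using C by (simp add: norm_emb Gfun_L2)
 qed
 thus ?thesis unfolding Rs_def by (rule bounded_linear_compose[OF P_linear])
qed

lemma P_Rs [simp]: "P (Rs f) = Rs f" by (simp add: Rs_def)

definition gg :: "l2 => rfun" where "gg q s = \<kappa> s * rep_l2 (P q) s"

lemma gg_measurable: "gg q \<in> borel_measurable lebesgue"
 unfolding gg_def by (intro borel_measurable_times \<kappa>_measurable square_integrable_measurable) simp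

text \<open>At x = 0 with \<alpha> < 1 the formula expresses that \<open>P q\<close> is orthogonal
  to \<open>kap\<close>, in agreement with the value 0 built into \<open>Rfun\<close>.\<close>

lemma gg_integrable: "x > 0 \<or> x = 0 \<and> \<alpha> < 1 ==> integrable lebesgue (\<lambda>s. indicator {x<..<L} s * gg q s)"
 and Rfun_eq: "x > 0 \<or> x = 0 \<and> \<alpha> < 1 ==> Rfun q x = - (LINT s|lebesgue. indicator {x<..<L} s * gg q s)"
proof -
 assume x: "x > 0 \<or> x = 0 \<and> \<alpha> < 1"
 have eq: "(\<lambda>s. indicator {x<..<L} s * gg q s) = (\<lambda>s. - (rep_l2 (P q) s * kfun x s))"
  by (auto simp: gg_def kfun_def)
 have ks: "kfun x \<in> square_integrable"
 proof (cases "x > 0")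
  case False
  hence x0: "x = 0" "\<alpha> < 1" using x by auto
  hence "(\<lambda>s. indicator {0<..<L} s * \<kappa> s) \<in> square_integrable" using \<kappa>_L2 by (simp only: L2_space_iff)
  thus ?thesis unfolding kfun_def x0 by (rule square_integrable_uminus)
 qed (rule kfun_square_integrable)
 thus "integrable lebesgue (\<lambda>s. indicator {x<..<L} s * gg q s)"
  unfolding eq by (intro integrable_minus square_integrable_mult) simp
 have "(LINT s|lebesgue. indicator {x<..<L} s * gg q s) = - inner (P q) (abs_l2 (kfun x))"
  unfolding eq by (simp add: inner_rep_abs ks)
 moreover have "inner (P q) (abs_l2 (kfun 0)) = 0" if "\<alpha> < 1"
 proof -
  have "kfun 0 = (\<lambda>s. (-1) * (indicator {0<..<L} s * \<kappa> s))" by (auto simp: kfun_def)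
  hence "abs_l2 (kfun 0) = (-1) *\<^sub>R kap"
   using \<kappa>_L2[OF that] that by (simp only: L2_space_iff abs_l2_scaleR kap_def emb_def if_True)
  thus ?thesis by (simp add: inner_P_kap)
 qed
 ultimately show "Rfun q x = - (LINT s|lebesgue. indicator {x<..<L} s * gg q s)" using x by (auto simp: Rfun_def kk_def)
qed

text \<open>Both sides are iterated integrals of the same integrand over the triangle 0 < x < s <
  L.\<close>

lemma adjoint: "inner (Rop q) f = inner q (Rs f)"
proof -
 define a where "a \<equiv> \<lambda>x. indicator {0<..<L} x * rep_l2 f x"
 define b where "b \<equiv> \<lambda>s. - (indicator {0<..<L} s * gg q s)"
 have aL: "integrable lebesgue a" using L2_integrable[OF rep_l2_L2, of L f] unfolding a_def by (simp only: integrable_on_eq)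
 \<comment> \<open>With the absolute value of \<open>f\<close> in place of \<open>f\<close>, the
   absolute integrability over the triangle is the product of two L2 functions, one of them
   \<open>Gfun f'\<close>.\<close>
 define f' where "f' = emb L (\<lambda>x. \<bar>rep_l2 f x\<bar>)"
 have absL: "(\<lambda>x. \<bar>rep_l2 f x\<bar>) \<in> LL"
  using square_integrable_abs[OF rep_l2_L2[where h = f and L = L, unfolded L2_space_iff]] by (simp add: L2_space_iff abs_mult)
 have f'a: "AE x in lebesgue. rep_l2 f' x = \<bar>a x\<bar>"
  using rep_abs_l2[of "\<lambda>x. indicator {0<..<L} x * \<bar>rep_l2 f x\<bar>"] absL
  unfolding f'_def emb_def L2_space_iff a_def by (simp add: abs_mult)
 have f'_int: "inner f' (hh s) = (LINT x|lebesgue. indicator {..<s} x * \<bar>a x\<bar>)" for s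
 proof -
  have "AE x in lebesgue. indicator {0<..<s} x * rep_l2 f' x = indicator {..<s} x * \<bar>a x\<bar>"
   using f'a by eventually_elim (auto simp: indicator_def a_def)
  moreover have "(\<lambda>x. indicator {0<..<s} x * rep_l2 f' x) \<in> borel_measurable lebesgue"
   by (intro borel_measurable_times borel_measurable_indicator square_integrable_measurable) auto
  moreover have "(\<lambda>x. indicator {..<s} x * \<bar>a x\<bar>) \<in> borel_measurable lebesgue"
   using aL by (intro borel_measurable_times borel_measurable_indicator) auto
  ultimately show ?thesis unfolding inner_hh by (intro integral_cong_AE)
 qed
 have int: "integrable lebesgue (\<lambda>s. \<bar>b s\<bar> * (LINT x|lebesgue. indicator {..<s} x * \<bar>a x\<bar>))"
 proof -
  have "integrable (leb L) (\<lambda>s. \<bar>rep_l2 (P q) s * Gfun f' s\<bar>)"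
   by (intro integrable_abs L2_mult_integrable rep_l2_L2 Gfun_L2)
  hence i: "integrable lebesgue (\<lambda>s. indicator {0<..<L} s * \<bar>rep_l2 (P q) s * Gfun f' s\<bar>)"
   by (simp only: integrable_on_eq)
  have nn: "0 \<le> inner f' (hh s)" for s unfolding f'_int by (intro LINT_nonneg) auto
  have "indicator {0<..<L} s * \<bar>rep_l2 (P q) s * Gfun f' s\<bar> = \<bar>b s\<bar> * (LINT x|lebesgue. indicator {..<s} x * \<bar>a x\<bar>)" for s
   unfolding f'_int[symmetric] using nn[of s] by (simp add: b_def gg_def Gfun_def abs_mult mult_ac)
  thus ?thesis using i by simp
 qed
 have fub: "(LINT x|lebesgue. a x * (LINT s|lebesgue. indicator {x<..} s * b s))
    = (LINT s|lebesgue. b s * (LINT x|lebesgue. indicator {..<s} x * a x))" by (rule fubini_triangle[OF aL _ int])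
   (auto simp: b_def intro!: borel_measurable_uminus borel_measurable_times borel_measurable_indicator gg_measurable)
 have "inner (Rop q) f = inner (Rop q) (emb L (rep_l2 f))"
  using inner_E[of "Rop q" f] by (simp add: Rop_def Rfun_L2 flip: E_def)
 also have "\<dots> = (LINT x|lebesgue. indicator {0<..<L} x * (Rfun q x * rep_l2 f x))"
  unfolding Rop_def by (simp add: inner_emb Rfun_L2 LINT_on_eq)
 also have "\<dots> = (LINT x|lebesgue. a x * (LINT s|lebesgue. indicator {x<..} s * b s))"
 proof (rule LINT_cong[OF refl])
  fix x
  show "indicator {0<..<L} x * (Rfun q x * rep_l2 f x) = a x * (LINT s|lebesgue. indicator {x<..} s * b s)"
  proof (cases "x \<in> {0<..<L}")
   case True
   hence "(\<lambda>s. indicator {x<..} s * b s) = (\<lambda>s. - (indicator {x<..<L} s * gg q s))"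
    by (auto simp: b_def indicator_def)
   thus ?thesis using True Rfun_eq[of x q] by (simp add: a_def)
  qed (simp add: a_def)
 qed
 also have "\<dots> = (LINT s|lebesgue. b s * (LINT x|lebesgue. indicator {..<s} x * a x))" by (rule fub)
 also have "\<dots> = (LINT s|lebesgue. indicator {0<..<L} s * (rep_l2 (P q) s * Gfun f s))"
 proof (rule LINT_cong[OF refl])
  fix s
  show "b s * (LINT x|lebesgue. indicator {..<s} x * a x) = indicator {0<..<L} s * (rep_l2 (P q) s * Gfun f s)"
  proof (cases "s \<in> {0<..<L}")
   case True
   hence "(\<lambda>x. indicator {..<s} x * a x) = (\<lambda>x. indicator {0<..<s} x * rep_l2 f x)"
    by (auto simp: a_def indicator_def)
   thus ?thesis using True by (simp add: b_def gg_def Gfun_def inner_hh)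
  qed (simp add: b_def)
 qed
 also have "\<dots> = inner (emb L (rep_l2 (P q))) (emb L (Gfun f))" by (simp add: inner_emb Gfun_L2 LINT_on_eq)
 also have "\<dots> = inner q (Rs f)" by (simp add: Rs_def inner_P[symmetric] flip: E_def)
 finally show ?thesis .
qed

subsection \<open>Compactness\<close>

text \<open>Functions in the image of a ball may blow up at 0, so Arzela-Ascoli is applied after
  multiplication by x, which makes them equicontinuous up to 0.\<close>

lemma Rop_compact:
 fixes X :: "nat => l2"
 assumes X: "\<And>n. norm (X n) \<le> B"
 shows "\<exists>l r. strict_mono (r :: nat => nat) \<and> (\<lambda>n. Rop (X (r n))) \<longlonglongrightarrow> l"
proof -
 have B0: "B \<ge> 0" using X[of 0] norm_ge_zero order_trans by blast
 define F where "F \<equiv> \<lambda>n x. x * Rfun (X n) x"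
 \<comment> \<open>The two terms of the modulus bound \<open>(x - y) * R(x)\<close>, where the
   growth x^(-\<alpha>/4) is at most the same power of x - y, and \<open>y * (R(x) - R(y))\<close>,
   where y times \<open>\<kappa> y\<close> is at most
   \<open>L powr (1 - \<alpha> / 2)\<close>.\<close>
 define \<omega> where "\<omega> \<equiv> \<lambda>h. B * (sqrt c0 * h powr (1 - \<alpha> / 4) + L powr (1 - \<alpha> / 2) * sqrt h)"
 have RB: "\<bar>Rfun (X n) x\<bar> \<le> B * bfun x" if "x > 0" for n x
  using Rfun_bound[OF that, of "X n"] mult_right_mono[OF X[of n], of "bfun x"] by (simp add: bfun_def c0_nonneg)
 have mod: "\<bar>F n x - F n y\<bar> \<le> \<omega> (x - y)" if xy: "0 \<le> y" "y \<le> x" "x \<le> L" for n x y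
 proof (cases "x = y")
  case False
  hence x0: "x > 0" "x - y > 0" using xy by auto
  have "\<bar>Rfun (X n) x\<bar> \<le> B * (sqrt c0 * (x - y) powr (- \<alpha> / 4))"
  proof (rule order_trans[OF RB[OF x0(1)]])
   have "x powr (- \<alpha> / 4) \<le> (x - y) powr (- \<alpha> / 4)" using x0 xy \<alpha>_pos by (intro powr_mono2') auto
   thus "B * bfun x \<le> B * (sqrt c0 * (x - y) powr (- \<alpha> / 4))"
    using B0 c0_nonneg by (simp add: bfun_def real_sqrt_mult \<kappa>_def powr_powr mult_left_mono flip: powr_half_sqrt)
  qed
  hence "(x - y) * \<bar>Rfun (X n) x\<bar> \<le> (x - y) * (B * (sqrt c0 * (x - y) powr (- \<alpha> / 4)))"
   using x0 by (intro mult_left_mono) auto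
  also have "\<dots> = B * (sqrt c0 * (x - y) powr (1 - \<alpha> / 4))"
   using powr_mult_base[of "x - y" "- \<alpha> / 4"] x0 by (simp add: mult_ac)
  finally have 1: "(x - y) * \<bar>Rfun (X n) x\<bar> \<le> B * (sqrt c0 * (x - y) powr (1 - \<alpha> / 4))" .
  have 2: "y * \<bar>Rfun (X n) x - Rfun (X n) y\<bar> \<le> B * (L powr (1 - \<alpha> / 2) * sqrt (x - y))"
  proof (cases "y = 0")
   case False
   hence y0: "y > 0" using xy by simp
   have "y * \<bar>Rfun (X n) x - Rfun (X n) y\<bar> \<le> y * (B * (\<kappa> y * sqrt (x - y)))"
    using y0 xy by (intro mult_left_mono order_trans[OF Rfun_diff[OF y0 xy(2)]] mult_right_mono X) auto
   also have "\<dots> = B * (y powr (1 - \<alpha> / 2) * sqrt (x - y))"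
    using powr_mult_base[of y "- \<alpha> / 2"] y0 by (simp add: \<kappa>_def mult_ac)
   also have "\<dots> \<le> B * (L powr (1 - \<alpha> / 2) * sqrt (x - y))"
    using xy B0 \<alpha>_less by (intro mult_left_mono mult_right_mono powr_mono2) auto
   finally show ?thesis .
  qed (use B0 xy in simp)
  have "F n x - F n y = (x - y) * Rfun (X n) x + y * (Rfun (X n) x - Rfun (X n) y)" by (simp add: F_def algebra_simps)
  hence "\<bar>F n x - F n y\<bar> \<le> (x - y) * \<bar>Rfun (X n) x\<bar> + y * \<bar>Rfun (X n) x - Rfun (X n) y\<bar>"
   using xy by (metis abs_mult abs_of_nonneg abs_triangle_ineq diff_ge_0_iff_ge)
  thus ?thesis using 1 2 by (simp add: \<omega>_def distrib_left)
 qed (simp add: \<omega>_def)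
 have mod': "norm (F n x - F n y) \<le> \<omega> \<bar>x - y\<bar>" if "x \<in> {0..L}" "y \<in> {0..L}" for n x y
  using mod[of y x n] mod[of x y n] that by (cases "y \<le> x") (auto simp: abs_minus_commute)
 obtain g r where g: "continuous_on {0..L} g" "strict_mono (r :: nat => nat)"
  "\<And>e. 0 < e ==> \<exists>N. \<forall>n x. n \<ge> N \<and> x \<in> {0..L} --> norm (F (r n) x - g x) < e"
 proof (rule Arzela_Ascoli[of "{0..L}" F "\<omega> L"])
  show "norm (F n x) \<le> \<omega> L" if "x \<in> {0..L}" for n x
  proof -
   have "\<omega> x \<le> \<omega> L" unfolding \<omega>_def using that B0 \<alpha>_less c0_nonneg
    by (intro mult_left_mono add_mono powr_mono2) auto
   thus ?thesis using mod[of 0 x n] that by (simp add: F_def)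
  qed
  fix x e :: real assume x: "x \<in> {0..L}" and e: "0 < e"
  have "(\<omega> \<longlongrightarrow> B * (sqrt c0 * 0 powr (1 - \<alpha> / 4) + L powr (1 - \<alpha> / 2) * sqrt 0)) (at_right 0)"
   unfolding \<omega>_def by (intro tendsto_intros) (use \<alpha>_less in \<open>auto simp: eventually_at intro!: exI[of _ 1]\<close>)
  hence "\<forall>\<^sub>F h in at_right 0. \<omega> h < e" using e by (intro order_tendstoD(2)) auto
  then obtain d where d: "d > 0" "\<And>h. h > 0 ==> h < d ==> \<omega> h < e" by (auto simp: eventually_at_right_field)
  have "norm (F n x - F n y) < e" if y: "y \<in> {0..L}" "norm (x - y) < d" for n y
   using mod'[OF x y(1), of n] d(2)[of "\<bar>x - y\<bar>"] y(2) e by (cases "x = y") auto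
  thus "\<exists>d. 0 < d \<and> (\<forall>n y. y \<in> {0..L} \<and> norm (x - y) < d --> norm (F n x - F n y) < e)" using d(1) by blast
 qed auto
 \<comment> \<open>Division by x leaves only pointwise convergence on the open interval; the
   majorant \<open>bfun\<close> raises it to convergence in L2.\<close>
 define u where "u \<equiv> \<lambda>x. g x / x"
 have lim: "(\<lambda>n. Rfun (X (r n)) x) \<longlonglongrightarrow> u x" if "x \<in> {0<..<L}" for x
 proof -
  have "(\<lambda>n. F (r n) x) \<longlonglongrightarrow> g x"
   unfolding LIMSEQ_iff using g(3) that by (metis atLeastAtMost_iff greaterThanLessThan_iff less_imp_le)
  hence "(\<lambda>n. F (r n) x / x) \<longlonglongrightarrow> g x / x" using that by (intro tendsto_intros) auto
  thus ?thesis using that by (simp add: F_def u_def)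
 qed
 have um: "u \<in> meas L"
  by (rule borel_measurable_LIMSEQ_real[of _ "\<lambda>n. Rfun (X (r n))"]) (auto intro: lim Rfun_measurable)
 have uB: "\<bar>u x\<bar> \<le> B * bfun x" if "x \<in> {0<..<L}" for x
  using tendsto_rabs[OF lim[OF that]] RB[of x] that by (intro LIMSEQ_le_const2[of "\<lambda>n. \<bar>Rfun (X (r n)) x\<bar>"]) auto
 have Bb: "(\<lambda>x. B * bfun x) \<in> LL" "(\<lambda>x. 2 * (B * bfun x)) \<in> LL" by (intro L2_cmult bfun_L2)+
 have uL: "u \<in> LL" by (rule L2_bound(1)[OF Bb(1) um]) (use uB abs_ge_self order_trans in blast)
 have "(\<lambda>n. LINT x|leb L. (Rfun (X (r n)) x - u x)\<^sup>2) \<longlonglongrightarrow> (LINT x|leb L. 0)"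
 proof (rule integral_dominated_convergence[where w = "\<lambda>x. (2 * (B * bfun x))\<^sup>2"])
  show "integrable (leb L) (\<lambda>x. (2 * (B * bfun x))\<^sup>2)" using Bb(2) by (simp only: L2_space_def mem_Collect_eq)
  show "(\<lambda>x. (Rfun (X (r n)) x - u x)\<^sup>2) \<in> meas L" for n using um Rfun_measurable by measurable
  show "AE x in leb L. (\<lambda>n. (Rfun (X (r n)) x - u x)\<^sup>2) \<longlonglongrightarrow> 0"
  proof (rule AE_I2)
   fix x assume "x \<in> space (leb L)"
   hence "(\<lambda>n. (Rfun (X (r n)) x - u x)\<^sup>2) \<longlonglongrightarrow> (u x - u x)\<^sup>2" by (intro tendsto_intros lim) simp
   thus "(\<lambda>n. (Rfun (X (r n)) x - u x)\<^sup>2) \<longlonglongrightarrow> 0" by simp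
  qed
  show "AE x in leb L. norm ((Rfun (X (r n)) x - u x)\<^sup>2) \<le> (2 * (B * bfun x))\<^sup>2" for n
  proof (rule AE_I2)
   fix x assume "x \<in> space (leb L)"
   hence "\<bar>Rfun (X (r n)) x - u x\<bar> \<le> \<bar>2 * (B * bfun x)\<bar>" using RB[of x "r n"] uB[of x] by auto
   thus "norm ((Rfun (X (r n)) x - u x)\<^sup>2) \<le> (2 * (B * bfun x))\<^sup>2" by (simp add: abs_le_square_iff)
  qed
 qed auto
 hence "(\<lambda>n. sqrt (LINT x|leb L. (Rfun (X (r n)) x - u x)\<^sup>2)) \<longlonglongrightarrow> sqrt 0"
  by (intro tendsto_real_sqrt) simp
 hence "(\<lambda>n. norm (Rop (X (r n)) - emb L u)) \<longlonglongrightarrow> 0"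
  by (simp add: Rop_def norm_emb Rfun_L2 uL L2_diff L2_norm_def flip: emb_diff)
 hence "(\<lambda>n. Rop (X (r n))) \<longlonglongrightarrow> emb L u" by (rule LIM_zero_cancel[OF tendsto_norm_zero_cancel])
 thus ?thesis using g(2) by blast
qed

sublocale K: compact_positive_operator "\<lambda>f. Rop (Rs f)"
proof (rule compact_positive_operator.intro)
 show "bounded_linear (\<lambda>f. Rop (Rs f))" by (rule bounded_linear_compose[OF Rop_linear Rs_linear])
 show "inner (Rop (Rs x)) y = inner x (Rop (Rs y))" for x y
  using adjoint[of "Rs x" y] adjoint[of "Rs y" x] by (simp add: inner_commute)
 show "0 \<le> inner (Rop (Rs x)) x" for x by (simp add: adjoint)
 fix X :: "nat => l2" assume X: "\<And>n. norm (X n) \<le> 1"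
 obtain C where C: "\<And>x. norm (Rs x) \<le> norm x * C" "C > 0" using bounded_linear.pos_bounded[OF Rs_linear] by blast
 have "norm (Rs (X n)) \<le> C" for n using order_trans[OF C(1)[of "X n"] mult_right_mono[OF X[of n], of C]] C(2) by simp
 from Rop_compact[of "\<lambda>n. Rs (X n)", OF this]
 show "\<exists>l r. strict_mono (r :: nat => nat) \<and> (\<lambda>n. Rop (Rs (X (r n)))) \<longlonglongrightarrow> l" .
qed

section \<open>The range of R is the energy space\<close>

lemma gg_interval:
 assumes x: "x > 0 \<or> x = 0 \<and> \<alpha> < 1" and xy: "x \<le> y" "y \<le> L"
 shows "gg q AI {x..y}" "Rfun q y - Rfun q x = integral {x..y} (gg q)"
proof -
 have *: "gg q AI {z..L} \<and> Rfun q z = - integral {z..L} (gg q)"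
  if z: "z > 0 \<or> z = 0 \<and> \<alpha> < 1" for z
 proof -
  have o: "gg q AI {z<..<L}" using gg_integrable[OF z, of q] by (simp add: set_integrable_def)
  have "gg q AI {z..L}" by (rule absolutely_integrable_spike_set[OF o]) (auto intro: negligible_subset[of "{z, L}"])
  moreover have "Rfun q z = - (LINT s:{z<..<L}|lebesgue. gg q s)"
   using Rfun_eq[OF z, of q] by (simp add: set_lebesgue_integral_def)
  ultimately show ?thesis by (simp add: set_lebesgue_integral_eq_integral(2)[OF o] integral_open_interval_real)
 qed
 have y: "y > 0 \<or> y = 0 \<and> \<alpha> < 1" using x xy by auto
 show "gg q AI {x..y}" by (rule set_integrable_subset[of _ "{x..L}"]) (use *[OF x] xy in auto)
 have "integral {x..y} (gg q) + integral {y..L} (gg q) = integral {x..L} (gg q)" by (rule hk_combine)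
   (use xy hk[OF *[OF x, THEN conjunct1]] in auto)
 thus "Rfun q y - Rfun q x = integral {x..y} (gg q)" using *[OF x] *[OF y] by simp
qed

lemma Rfun_abs_cont:
 assumes a: "a > 0 \<or> a = 0 \<and> \<alpha> < 1" "a \<le> L"
 shows "abs_cont_on a L (Rfun q)"
proof (rule abs_cont_on_cong[OF _ abs_cont_on_integral[OF gg_interval(1)[OF a(1) a(2) order_refl], of "Rfun q a"]])
 fix x assume "x \<in> {a..L}"
 thus "Rfun q a + integral {a..x} (gg q) = Rfun q x" using gg_interval(2)[OF a(1), of x q] by simp
qed

lemma Rfun_has_deriv: "AE x in lebesgue. x \<in> {0<..<L} --> (Rfun q has_der gg q x) (at x)"
proof -
 \<comment> \<open>For \<alpha> \<ge> 1 there may be no primitive starting at 0, so the exceptional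
   sets are collected over left endpoints tending to 0.\<close>
 define a where "a \<equiv> \<lambda>n. L / real (n + 2)"
 have a: "a n > 0" "a n \<le> L" for n using L_pos by (auto simp: a_def field_simps)
 define N where "N \<equiv> \<lambda>n. {x \<in> {a n<..<L}. \<not> ((\<lambda>x. integral {a n..x} (gg q)) has_der gg q x) (at x)}"
 have neg: "negligible (\<Union>n. N n)"
 proof (rule negligible_countable_Union)
  fix S assume "S \<in> range N"
  then obtain n where n: "S = N n" by blast
  have "gg q integrable_on {a n..L}" by (rule hk[OF gg_interval(1)]) (use a[of n] in auto)
  thus "negligible S" unfolding n N_def by (rule negligible_not_derivable)
 qed simp
 show ?thesis
 proof (rule negligible_AE[OF neg], intro impI)
  fix x assume nN: "x \<notin> (\<Union>n. N n)" and x: "x \<in> {0<..<L}"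
  obtain n where n: "L / x < real n" using reals_Archimedean2 by blast
  hence "a n < x" using x L_pos by (simp add: a_def field_simps)
  hence xa: "x \<in> {a n<..<L}" using x by simp
  hence "((\<lambda>x. integral {a n..x} (gg q)) has_der gg q x) (at x)" using nN by (auto simp: N_def)
  hence "((\<lambda>x. Rfun q (a n) + integral {a n..x} (gg q)) has_der 0 + gg q x) (at x)" by (intro DERIV_add DERIV_const)
  moreover have "Rfun q (a n) + integral {a n..y} (gg q) = Rfun q y" if "y \<in> {a n<..<L}" for y
   using gg_interval(2)[of "a n" y q] a[of n] that by simp
  ultimately have "(Rfun q has_der 0 + gg q x) (at x)"
   by (rule has_field_derivative_transform_within_open[OF _ open_greaterThanLessThan xa])
  thus "(Rfun q has_der gg q x) (at x)" by simp
 qed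
qed

lemma powr_\<kappa>: "x > 0 ==> x powr (\<alpha> / 2) * \<kappa> x = 1" by (simp add: \<kappa>_def flip: powr_add)

text \<open>R maps into the energy space, with \<open>P q\<close> as weighted gradient. Agreement on
  (0,L] suffices, since derivatives are taken in the open interval and the value at 0 is prescribed
  only for \<alpha> < 1.\<close>

lemma H1_of_Rfun:
 assumes u: "\<And>x. x \<in> {0<..L} ==> u x = Rfun q x" and u0: "\<alpha> < 1 ==> u 0 = 0"
 shows "u \<in> HA" "emb L (grad \<alpha> u) = P q" "grad \<alpha> u \<in> LL" "u \<in> LL" "emb L u = Rop q"
proof -
 have d: "deriv u x = deriv (Rfun q) x" if x: "x \<in> {0<..<L}" for x
 proof (rule deriv_cong_ev[OF _ refl])
  have "\<forall>\<^sub>F y in nhds x. y \<in> {0<..<L}" by (rule eventually_nhds_in_open) (use x in auto)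
  thus "\<forall>\<^sub>F y in nhds x. u y = Rfun q y" by eventually_elim (simp add: u)
 qed
 have "AE x in lebesgue. x \<in> {0<..<L} --> rep_l2 (P q) x = grad \<alpha> u x" using Rfun_has_deriv[of q]
 proof eventually_elim
  case (elim x)
  show ?case
  proof
   assume x: "x \<in> {0<..<L}"
   hence "deriv u x = gg q x" using elim d[OF x] by (simp add: DERIV_imp_deriv)
   thus "rep_l2 (P q) x = grad \<alpha> u x" using x powr_\<kappa>[of x] by (simp add: grad_def gg_def flip: mult.assoc)
  qed
 qed
 hence ae: "AE x in leb L. rep_l2 (P q) x = grad \<alpha> u x" by (simp only: AE_on_eq)
 show g: "grad \<alpha> u \<in> LL" by (rule L2_cong_AE(1)[OF rep_l2_L2 ae])
 have "emb L (grad \<alpha> u) = E (P q)" unfolding E_def by (rule L2_cong_AE(2)[OF rep_l2_L2 ae])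
 thus "emb L (grad \<alpha> u) = P q" by simp
 have ae2: "AE x in leb L. Rfun q x = u x" by (rule AE_I2) (simp add: u)
 show uL: "u \<in> LL" by (rule L2_cong_AE(1)[OF Rfun_L2 ae2])
 show "emb L u = Rop q" unfolding Rop_def by (rule L2_cong_AE(2)[OF Rfun_L2 ae2])
 have "u L = 0" using u[of L] L_pos by (simp add: Rfun_L)
 moreover have "abs_cont_on a L u" if "0 < a" "a < L" for a
  by (rule abs_cont_on_cong[OF _ Rfun_abs_cont]) (use that u in auto)
 moreover have "abs_cont_on 0 L u" if "\<alpha> < 1"
 proof (rule abs_cont_on_cong[OF _ Rfun_abs_cont])
  fix x assume "x \<in> {0..L}"
  thus "Rfun q x = u x" using u[of x] u0 that by (cases "x = 0") (auto simp: Rfun_def)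
 qed (use that L_pos in auto)
 ultimately show "u \<in> HA" using uL g u0 by (simp add: H1_space_def grad_def[abs_def])
qed

lemma H1_L2: "u \<in> HA ==> u \<in> LL" by (simp add: H1_space_def)

lemma H1_grad: "u \<in> HA ==> grad \<alpha> u \<in> LL" by (simp add: H1_space_def grad_def[abs_def])

text \<open>R is onto the energy space: absolute continuity and u(L) = 0 recover u from its
  derivative. For \<alpha> < 1 the condition u(0) = 0 says that the integral of u' vanishes, that
  is, the weighted gradient is orthogonal to \<open>\<kappa>\<close>.\<close>

lemma H1_rep:
 assumes u: "u \<in> HA"
 shows "P (emb L (grad \<alpha> u)) = emb L (grad \<alpha> u)" (is "P ?q = ?q")
  and "x \<in> {0<..L} ==> u x = Rfun (emb L (grad \<alpha> u)) x"
proof -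
 have g: "grad \<alpha> u \<in> LL" by (rule H1_grad[OF u])
 have uL: "u L = 0" using u by (simp add: H1_space_def)
 have ac: "abs_cont_on a L u" if "a > 0 \<or> a = 0 \<and> \<alpha> < 1" "a \<le> L" for a
 proof (cases "\<alpha> < 1")
  case True
  hence "abs_cont_on 0 L u" using u by (simp add: H1_space_def)
  thus ?thesis by (rule abs_cont_on_subinterval) (use that in auto)
 next
  case False
  show ?thesis
  proof (cases "a < L")
   case True
   thus ?thesis using False u that by (simp add: H1_space_def)
  next
   case False
   have "abs_cont_on (L / 2) L u" using u L_pos \<open>\<not> \<alpha> < 1\<close> by (simp add: H1_space_def)
   thus ?thesis by (rule abs_cont_on_subinterval) (use that \<open>\<not> a < L\<close> L_pos in auto)
  qed
 qed
 have int: "u L - u a = integral {a..L} (deriv u)" "deriv u AI {a..L}"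
  if "a > 0 \<or> a = 0 \<and> \<alpha> < 1" "a \<le> L" for a
  using abs_cont_on_deriv(2,3)[OF ac[OF that] that(2)] that(2) by auto
 have LI: "(LINT s|lebesgue. indicator {a<..<L} s * deriv u s) = u L - u a"
  if a: "a > 0 \<or> a = 0 \<and> \<alpha> < 1" "a \<le> L" for a
 proof -
  have o: "deriv u AI {a<..<L}" by (rule set_integrable_subset[OF int(2)[OF a]]) auto
  show ?thesis using set_lebesgue_integral_eq_integral(2)[OF o] int(1)[OF a]
   by (simp add: set_lebesgue_integral_def integral_open_interval_real)
 qed
 have "inner ?q kap = 0"
 proof (cases "\<alpha> < 1")
  case True
  hence "inner ?q kap = (LINT s|lebesgue. indicator {0<..<L} s * (grad \<alpha> u s * \<kappa> s))"
   using g \<kappa>_L2 by (simp add: kap_def inner_emb LINT_on_eq)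
  also have "\<dots> = (LINT s|lebesgue. indicator {0<..<L} s * deriv u s)"
  proof (rule LINT_cong[OF refl])
   fix s
   show "indicator {0<..<L} s * (grad \<alpha> u s * \<kappa> s) = indicator {0<..<L} s * deriv u s"
    using powr_\<kappa>[of s] by (cases "s \<in> {0<..<L}") (auto simp: grad_def mult_ac)
  qed
  also have "\<dots> = 0" using LI[of 0] True L_pos uL u by (simp add: H1_space_def)
  finally show ?thesis .
 qed (simp add: kap_def)
 thus Pq: "P ?q = ?q" using g by (simp add: P_def)
 assume x: "x \<in> {0<..L}"
 have "AE s in lebesgue. s \<in> {0<..<L} --> rep_l2 ?q s = grad \<alpha> u s" using rep_emb[OF g] by (simp only: AE_on_eq)
 hence "AE s in lebesgue. indicator {x<..<L} s * gg ?q s = indicator {x<..<L} s * deriv u s"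
 proof eventually_elim
  case (elim s)
  show ?case
  proof (cases "s \<in> {x<..<L}")
   case True
   thus ?thesis using elim x powr_\<kappa>[of s] by (simp add: gg_def Pq grad_def mult_ac)
  qed simp
 qed
 hence "(LINT s|lebesgue. indicator {x<..<L} s * gg ?q s) = (LINT s|lebesgue. indicator {x<..<L} s * deriv u s)"
 proof (rule integral_cong_AE[rotated 2])
  show m: "(\<lambda>s. indicator {x<..<L} s * gg ?q s) \<in> borel_measurable lebesgue"
   by (intro borel_measurable_times borel_measurable_indicator gg_measurable) simp
  show "(\<lambda>s. indicator {x<..<L} s * deriv u s) \<in> borel_measurable lebesgue"
  proof -
   have "deriv u AI {x<..<L}" by (rule set_integrable_subset[OF int(2)[of x]]) (use x in auto)
   thus ?thesis by (auto simp: set_integrable_def dest: borel_measurable_integrable)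
  qed
 qed
 thus "u x = Rfun ?q x" using Rfun_eq[of x ?q] LI[of x] x uL by simp
qed

text \<open>\<open>deriv\<close> is additive only where both derivatives exist. Going through R
  avoids handling the exceptional sets.\<close>

lemma H1_add:
 assumes "u \<in> HA" "v \<in> HA"
 shows "(\<lambda>x. u x + v x) \<in> HA" "emb L (grad \<alpha> (\<lambda>x. u x + v x)) = emb L (grad \<alpha> u) + emb L (grad \<alpha> v)"
proof -
 have 1: "u x + v x = Rfun (emb L (grad \<alpha> u) + emb L (grad \<alpha> v)) x" if "x \<in> {0<..L}" for x
  using H1_rep(2)[OF assms(1) that] H1_rep(2)[OF assms(2) that] by (simp add: Rfun_add)
 have 2: "u 0 + v 0 = 0" if "\<alpha> < 1" using assms that by (simp add: H1_space_def)
 show "(\<lambda>x. u x + v x) \<in> HA" by (rule H1_of_Rfun(1)[OF 1 2])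
 have "emb L (grad \<alpha> (\<lambda>x. u x + v x)) = P (emb L (grad \<alpha> u) + emb L (grad \<alpha> v))"
  by (rule H1_of_Rfun(2)[OF 1 2])
 thus "emb L (grad \<alpha> (\<lambda>x. u x + v x)) = emb L (grad \<alpha> u) + emb L (grad \<alpha> v)"
  using H1_rep(1)[OF assms(1)] H1_rep(1)[OF assms(2)] by (simp add: linear_add[OF bounded_linear.linear[OF P_linear]])
qed

lemma H1_cmult:
 assumes "u \<in> HA"
 shows "(\<lambda>x. c * u x) \<in> HA" "emb L (grad \<alpha> (\<lambda>x. c * u x)) = c *\<^sub>R emb L (grad \<alpha> u)"
proof -
 have 1: "c * u x = Rfun (c *\<^sub>R emb L (grad \<alpha> u)) x" if "x \<in> {0<..L}" for x
  using H1_rep(2)[OF assms(1) that] by (simp add: Rfun_scaleR)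
 have 2: "c * u 0 = 0" if "\<alpha> < 1" using assms that by (simp add: H1_space_def)
 show "(\<lambda>x. c * u x) \<in> HA" by (rule H1_of_Rfun(1)[OF 1 2])
 have "emb L (grad \<alpha> (\<lambda>x. c * u x)) = P (c *\<^sub>R emb L (grad \<alpha> u))" by (rule H1_of_Rfun(2)[OF 1 2])
 thus "emb L (grad \<alpha> (\<lambda>x. c * u x)) = c *\<^sub>R emb L (grad \<alpha> u)"
  using H1_rep(1)[OF assms(1)] by (simp add: linear_cmul[OF bounded_linear.linear[OF P_linear]])
qed

lemma H1_diff:
 assumes "u \<in> HA" "v \<in> HA"
 shows "(\<lambda>x. u x - v x) \<in> HA" "emb L (grad \<alpha> (\<lambda>x. u x - v x)) = emb L (grad \<alpha> u) - emb L (grad \<alpha> v)"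
 using H1_add[OF assms(1) H1_cmult(1)[OF assms(2), of "-1"]] H1_cmult(2)[OF assms(2), of "-1"] by simp_all

subsection \<open>The eigenbasis\<close>

text \<open>If \<open>Rs f\<close> vanishes, then \<open>Gfun f\<close> is a multiple of
  \<open>\<kappa>\<close> (zero when \<alpha> \<ge> 1), so the primitive of \<open>f\<close> from 0
  is constant on (0,L) and its derivative \<open>f\<close> is zero.\<close>

lemma K_injective:
 assumes f: "E f = f" and K0: "Rop (Rs f) = 0"
 shows "f = 0"
proof -
 have "inner (Rs f) (Rs f) = 0" using adjoint[of "Rs f" f] K0 by simp
 hence R0: "P (emb L (Gfun f)) = 0" by (simp add: Rs_def)
 define t where "t = inner (emb L (Gfun f)) kap / inner kap kap"
 have "emb L (Gfun f) = t *\<^sub>R kap" using R0 by (simp add: P_def t_def Gfun_L2)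
 moreover have "\<exists>c. t *\<^sub>R kap = emb L (\<lambda>s. c * \<kappa> s) \<and> (\<lambda>s. c * \<kappa> s) \<in> LL"
 proof (cases "\<alpha> < 1")
  case True
  thus ?thesis using \<kappa>_L2 by (intro exI[of _ t]) (simp add: kap_def emb_cmult L2_cmult)
 qed (intro exI[of _ 0], simp add: kap_def)
 ultimately obtain c where c: "emb L (Gfun f) = emb L (\<lambda>s. c * \<kappa> s)" "(\<lambda>s. c * \<kappa> s) \<in> LL" by auto
 have "AE s in lebesgue. s \<in> {0<..<L} --> Gfun f s = c * \<kappa> s"
  using c emb_eq_iff[OF Gfun_L2 c(2)] by (simp only: AE_on_eq)
 hence ae: "AE s in lebesgue. s \<in> {0<..<L} --> inner f (hh s) = - c"
 proof eventually_elim
  case (elim s)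
  show ?case
  proof
   assume s: "s \<in> {0<..<L}"
   hence "\<kappa> s * inner f (hh s) = \<kappa> s * (- c)" using elim by (simp add: Gfun_def mult.commute)
   thus "inner f (hh s) = - c" using \<kappa>_pos[of s] s by (subst (asm) mult_cancel_left) auto
  qed
 qed
 have con: "inner f (hh s) = - c" if "s \<in> {0<..<L}" for s
  by (rule AE_const_imp_const[OF _ _ ae that]) (auto intro: continuous_on_subset[OF inner_hh_continuous])
 have ri: "rep_l2 f AI {0<..<L}" using L2_integrable[OF rep_l2_L2, of L f] by (simp add: integrable_on_eq set_integrable_def)
 have ric: "rep_l2 f AI {0..L}" by (rule absolutely_integrable_spike_set[OF ri]) (auto intro: negligible_subset[of "{0, L}"])
 have Feq: "integral {0..s} (rep_l2 f) = - c" if s: "s \<in> {0<..<L}" for s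
 proof -
  have o: "rep_l2 f AI {0<..<s}" by (rule set_integrable_subset[OF ri]) (use s in auto)
  have "inner f (hh s) = integral {0..s} (rep_l2 f)" using set_lebesgue_integral_eq_integral(2)[OF o]
   by (simp add: inner_hh set_lebesgue_integral_def integral_open_interval_real)
  thus ?thesis using con[OF s] by simp
 qed
 let ?N = "{x \<in> {0<..<L}. \<not> ((\<lambda>x. integral {0..x} (rep_l2 f)) has_der rep_l2 f x) (at x)}"
 have neg: "negligible ?N" by (rule negligible_not_derivable[OF hk[OF ric]])
 have "AE x in lebesgue. x \<in> {0<..<L} --> rep_l2 f x = 0"
 proof (rule negligible_AE[OF neg], intro impI)
  fix x assume "x \<notin> ?N" and x: "x \<in> {0<..<L}"
  hence "((\<lambda>x. integral {0..x} (rep_l2 f)) has_der rep_l2 f x) (at x)" by auto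
  hence "((\<lambda>x. - c) has_der rep_l2 f x) (at x)"
   by (rule has_field_derivative_transform_within_open[OF _ open_greaterThanLessThan x]) (rule Feq)
  thus "rep_l2 f x = 0" using DERIV_const DERIV_unique by blast
 qed
 hence "E f = 0" unfolding E_def using emb_eq_iff[OF rep_l2_L2 L2_zero, of L f] by (simp add: AE_on_eq)
 thus ?thesis using f by simp
qed

lemma E_Rop [simp]: "E (Rop q) = Rop q" by (simp add: Rop_def Rfun_L2)

text \<open>An enumeration by \<open>nat\<close> needs infinitely many eigenvectors. If there were
  only finitely many, injectivity would make the constant 1 a finite combination of them, hence of
  the form \<open>Rfun q\<close> on (0,L); but \<open>Rfun q\<close> is continuous at L and vanishes
  there.\<close>

lemma ex_eigenbasis:
 "\<exists>(b :: nat => l2) \<mu>. (\<forall>m n. inner (b m) (b n) = (if m = n then 1 else 0)) \<and>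
   (\<forall>n. \<mu> n > 0 \<and> Rop (Rs (b n)) = \<mu> n *\<^sub>R b n) \<and> (\<forall>f. E f = f --> (\<forall>n. inner f (b n) = 0) --> f = 0)"
proof -
 obtain B where B: "countable B" "\<And>e. e \<in> B ==> norm e = 1"
  "\<And>e e'. e \<in> B ==> e' \<in> B ==> e \<noteq> e' ==> inner e e' = 0"
  "\<And>e. e \<in> B ==> \<exists>\<mu>>0. Rop (Rs e) = \<mu> *\<^sub>R e"
  "\<And>f. (\<And>e. e \<in> B ==> inner f e = 0) ==> Rop (Rs f) = 0" using K.spectral by blast
 obtain m where m: "\<And>e. e \<in> B ==> m e > 0 \<and> Rop (Rs e) = m e *\<^sub>R e" using B(4) by metis
 have beq: "e = Rop ((1 / m e) *\<^sub>R Rs e)" if "e \<in> B" for e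
  using m[OF that] by (simp add: linear_cmul[OF bounded_linear.linear[OF Rop_linear]])
 have EB: "E e = e" if "e \<in> B" for e using beq[OF that] E_Rop by metis
 have "infinite B"
 proof
  assume fin: "finite B"
  define f1 where "f1 = emb L (\<lambda>x. 1)"
  define y where "y = f1 - (\<Sum>e\<in>B. inner f1 e *\<^sub>R e)"
  have "inner y e = 0" if "e \<in> B" for e
  proof -
   have "(\<Sum>x\<in>B. inner f1 x * inner x e) = (\<Sum>x\<in>{e}. inner f1 x * inner x e)"
    using fin that B(3) by (intro sum.mono_neutral_right) auto
   thus ?thesis using B(2)[OF that] by (simp add: y_def inner_diff_left inner_sum_left norm_eq_1)
  qed
  hence K0: "Rop (Rs y) = 0" by (rule B(5))
  interpret E: bounded_linear E by (rule E_linear)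
  interpret R: bounded_linear Rop by (rule Rop_linear)
  have "E y = y" by (simp add: y_def E.diff E.sum E.scaleR EB f1_def)
  hence "y = 0" by (rule K_injective[OF _ K0])
  hence "f1 = (\<Sum>e\<in>B. inner f1 e *\<^sub>R e)" by (simp add: y_def)
  also have "\<dots> = (\<Sum>e\<in>B. inner f1 e *\<^sub>R Rop ((1 / m e) *\<^sub>R Rs e))" using beq by (intro sum.cong) auto
  also have "\<dots> = Rop (\<Sum>e\<in>B. inner f1 e *\<^sub>R ((1 / m e) *\<^sub>R Rs e))" by (simp add: R.sum R.scaleR)
  finally obtain q where q: "f1 = Rop q" by blast
  hence "AE x in lebesgue. x \<in> {0<..<L} --> Rfun q x = 1"
   using emb_eq_iff[OF Rfun_L2, of "\<lambda>x. 1" q] by (simp add: f1_def Rop_def AE_on_eq)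
  hence one: "Rfun q x = 1" if "x \<in> {0<..<L}" for x
   by (rule AE_const_imp_const[rotated 2, OF _ that]) (auto intro: continuous_on_subset[OF Rfun_continuous])
  have "isCont (Rfun q) L" using continuous_on_eq_continuous_at[of "{0<..}" "Rfun q"] Rfun_continuous L_pos by simp
  hence "(Rfun q \<longlongrightarrow> Rfun q L) (at_left L)"
   unfolding isCont_def by (rule filterlim_mono) (auto simp: at_le)
  moreover have "(Rfun q \<longlongrightarrow> 1) (at_left L)"
  proof (rule tendsto_eventually)
   have "\<forall>\<^sub>F x in at_left L. x \<in> {0<..<L}" using eventually_at_left_real[OF L_pos] .
   thus "\<forall>\<^sub>F x in at_left L. Rfun q x = 1" by eventually_elim (rule one)
  qed
  ultimately have "Rfun q L = 1" by (rule tendsto_unique[rotated]) simp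
  thus False by (simp add: Rfun_L)
 qed
 hence bij: "bij_betw (from_nat_into B) UNIV B" by (rule bij_betw_from_nat_into[OF B(1)])
 let ?b = "from_nat_into B"
 have bB: "?b n \<in> B" for n using bij by (auto simp: bij_betw_def)
 have inj: "?b i = ?b j \<longleftrightarrow> i = j" for i j using bij by (auto simp: bij_betw_def inj_on_def)
 have "\<forall>i j. inner (?b i) (?b j) = (if i = j then 1 else 0)"
  using B(2)[OF bB] B(3)[OF bB bB] inj by (auto simp: norm_eq_1)
 moreover have "\<forall>n. m (?b n) > 0 \<and> Rop (Rs (?b n)) = m (?b n) *\<^sub>R ?b n" using m bB by blast
 moreover have "\<forall>f. E f = f --> (\<forall>n. inner f (?b n) = 0) --> f = 0"
 proof (intro allI impI)
  fix f assume "E f = f" and o: "\<forall>n. inner f (?b n) = 0"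
  have "inner f e = 0" if "e \<in> B" for e
  proof -
   have "\<exists>n. e = ?b n" using bij that by (auto simp: bij_betw_def)
   thus ?thesis using o by blast
  qed
  hence "Rop (Rs f) = 0" by (rule B(5))
  thus "f = 0" using \<open>E f = f\<close> by (rule K_injective[rotated])
 qed
 ultimately show ?thesis by (intro exI[of _ ?b] exI[of _ "\<lambda>n. m (?b n)"] conjI)
qed

section \<open>Eigenfunctions, their gradients and expansions\<close>

definition eigsys :: "(nat => l2) \<times> (nat => real)" where
 "eigsys = (SOME (b, \<mu>). (\<forall>m n. inner (b m) (b n) = (if m = n then 1 else 0)) \<and>
   (\<forall>n. \<mu> n > 0 \<and> Rop (Rs (b n)) = \<mu> n *\<^sub>R b n) \<and> (\<forall>f. E f = f --> (\<forall>n. inner f (b n) = 0) --> f = 0))"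

definition b :: "nat => l2" where "b = fst eigsys"
definition lam :: "nat => real" where "lam n = 1 / snd eigsys n"
text \<open>The weighted gradient of the n-th eigenfunction: R maps it to \<open>b n\<close>,
  because \<open>Rop (Rs (b n))\<close> is \<open>b n\<close> divided by
  \<open>lam n\<close>.\<close>

definition q :: "nat => l2" where "q n = lam n *\<^sub>R Rs (b n)"
text \<open>The representative of the class \<open>b n\<close> that is continuous on the positive
  half line and vanishes at L; pointwise calculus is done with it.\<close>

definition e :: "nat => rfun" where "e n = Rfun (q n)"

lemma eigsys:
 "inner (b m) (b n) = (if m = n then 1 else 0)"
 "lam n > 0" "Rop (Rs (b n)) = (1 / lam n) *\<^sub>R b n"
 "E f = f ==> (\<And>n. inner f (b n) = 0) ==> f = 0"
proof -
 have "case eigsys of (c, \<mu>) => (\<forall>m n. inner (c m) (c n) = (if m = n then 1 else 0)) \<and>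
   (\<forall>n. \<mu> n > 0 \<and> Rop (Rs (c n)) = \<mu> n *\<^sub>R c n) \<and> (\<forall>f. E f = f --> (\<forall>n. inner f (c n) = 0) --> f = 0)"
  unfolding eigsys_def by (rule someI_ex) (use ex_eigenbasis in auto)
 hence *: "(\<forall>m n. inner (b m) (b n) = (if m = n then 1 else 0)) \<and>
   (\<forall>n. snd eigsys n > 0 \<and> Rop (Rs (b n)) = snd eigsys n *\<^sub>R b n) \<and> (\<forall>f. E f = f --> (\<forall>n. inner f (b n) = 0) --> f = 0)"
  by (simp add: b_def case_prod_beta)
 show "inner (b m) (b n) = (if m = n then 1 else 0)" using * by blast
 show "lam n > 0" "Rop (Rs (b n)) = (1 / lam n) *\<^sub>R b n" using * by (simp_all add: lam_def)
 show "E f = f ==> (\<And>n. inner f (b n) = 0) ==> f = 0" using * by blast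
qed

sublocale B: orthonormal_sequence b by unfold_locales (rule eigsys(1))

lemma P_q [simp]: "P (q n) = q n" by (simp add: q_def linear_cmul[OF bounded_linear.linear[OF P_linear]])

lemma Rop_q: "Rop (q n) = b n"
 using eigsys(2)[of n] eigsys(3)[of n] by (simp add: q_def linear_cmul[OF bounded_linear.linear[OF Rop_linear]])

lemma E_b [simp]: "E (b n) = b n" using E_Rop[of "q n"] by (simp add: Rop_q)

lemma e_H1: "e n \<in> HA" and grad_e: "emb L (grad \<alpha> (e n)) = q n" and e_L2: "e n \<in> LL"
 and emb_e: "emb L (e n) = b n" unfolding e_def using H1_of_Rfun[of "Rfun (q n)" "q n"] by (simp_all add: Rfun_def Rop_q)

lemma inner_q: "inner y (q n) = lam n * inner (Rop y) (b n)" by (simp add: q_def adjoint)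

text \<open>The gradients of the eigenfunctions are again orthogonal, with squared norms
  \<open>lam n\<close>; normalised, they are a basis of the range of \<open>P\<close>.\<close>

definition d :: "nat => l2" where "d n = (1 / sqrt (lam n)) *\<^sub>R q n"

lemma inner_d: "inner y (d n) = sqrt (lam n) * inner (Rop y) (b n)"
 using eigsys(2)[of n] by (simp add: d_def inner_q field_simps)

sublocale D: orthonormal_sequence d
proof
 fix m n
 have "inner (d m) (d n) = sqrt (lam n) * (inner (b m) (b n) / sqrt (lam m))"
  unfolding inner_d by (simp add: d_def linear_cmul[OF bounded_linear.linear[OF Rop_linear]] Rop_q)
 thus "inner (d m) (d n) = (if m = n then 1 else 0)" using eigsys(2)[of n] by (simp add: eigsys(1))
qed

lemma Rop_injective:
 assumes "P y = y" "Rop y = 0"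
 shows "y = 0"
proof -
 have "AE x in lebesgue. x \<in> {0<..<L} --> Rfun y x = 0"
  using assms(2) emb_eq_iff[OF Rfun_L2 L2_zero, of y] by (simp add: Rop_def AE_on_eq)
 hence z: "Rfun y x = 0" if "x \<in> {0<..<L}" for x
  by (rule AE_const_imp_const[rotated 2, OF _ that]) (auto intro: continuous_on_subset[OF Rfun_continuous])
 have "AE x in lebesgue. x \<in> {0<..<L} --> rep_l2 (P y) x = 0" using Rfun_has_deriv[of y]
 proof eventually_elim
  case (elim x)
  show ?case
  proof
   assume x: "x \<in> {0<..<L}"
   hence "(Rfun y has_der gg y x) (at x)" using elim by blast
   hence "((\<lambda>x. 0) has_der gg y x) (at x)"
    by (rule has_field_derivative_transform_within_open[OF _ open_greaterThanLessThan x]) (rule z)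
   hence "gg y x = 0" using DERIV_const DERIV_unique by blast
   thus "rep_l2 (P y) x = 0" using \<kappa>_pos[of x] x by (simp add: gg_def)
  qed
 qed
 hence "E (P y) = 0" unfolding E_def using emb_eq_iff[OF rep_l2_L2 L2_zero, of L "P y"] by (simp add: AE_on_eq)
 hence "P y = 0" by (simp only: E_P)
 thus ?thesis using assms(1) by simp
qed

definition cf :: "nat => rfun => real" where
 "cf n u = (LINT x|leb L. u x * e n x)"

lemma cf_emb: "u \<in> LL ==> cf n u = inner (emb L u) (b n)" by (simp add: cf_def inner_emb e_L2 flip: emb_e)

lemma closed_fixed: "bounded_linear T ==> subspace {f. T f = f} \<and> closed {f. T f = f}" for T :: "l2 => l2"
proof
 assume T: "bounded_linear T"
 interpret T: bounded_linear T by (rule T)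
 show "subspace {f. T f = f}" by (auto simp: subspace_def T.add T.scaleR T.zero)
 show "closed {f. T f = f}" by (intro closed_Collect_eq T.continuous_on continuous_on_id)
qed

lemma expansion_b:
 assumes "E f = f"
 shows "(\<lambda>n. inner f (b n) *\<^sub>R b n) sums f"
proof (rule B.expansion[of "{f. E f = f}"])
 show "y = 0" if "y \<in> {f. E f = f}" "\<And>n. inner y (b n) = 0" for y using eigsys(4) that by blast
qed (use closed_fixed[OF E_linear] assms in auto)

lemma expansion_d:
 assumes "P f = f"
 shows "(\<lambda>n. inner f (d n) *\<^sub>R d n) sums f"
proof (rule D.expansion[of "{f. P f = f}"])
 fix y assume y: "y \<in> {f. P f = f}" and o: "\<And>n. inner y (d n) = 0"
 have "inner (Rop y) (b n) = 0" for n using o[of n] eigsys(2)[of n] by (simp add: inner_d)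
 hence "Rop y = 0" by (intro eigsys(4)) auto
 thus "y = 0" using y Rop_injective by blast
next
 show "d n \<in> {f. P f = f}" for n by (simp add: d_def linear_cmul[OF bounded_linear.linear[OF P_linear]])
qed (use closed_fixed[OF P_linear] assms in auto)

lemma parseval:
 assumes "u \<in> LL" "v \<in> LL"
 shows "(\<lambda>n. cf n u * cf n v) sums (LINT x|leb L. u x * v x)"
proof -
 have "(\<lambda>n. inner (inner (emb L u) (b n) *\<^sub>R b n) (emb L v)) sums inner (emb L u) (emb L v)"
  by (rule bounded_linear.sums[OF bounded_linear_inner_left expansion_b]) (simp add: assms)
 thus ?thesis using assms by (simp add: cf_emb inner_emb inner_commute[of "b _"])
qed

lemma Rop_grad: "u \<in> HA ==> Rop (emb L (grad \<alpha> u)) = emb L u"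
proof -
 assume u: "u \<in> HA"
 have 1: "\<alpha> < 1 ==> u 0 = 0" using u by (simp add: H1_space_def)
 show ?thesis by (rule H1_of_Rfun(5)[OF H1_rep(2)[OF u] 1, symmetric]) auto
qed

lemma inner_grad_q: "u \<in> HA ==> inner (emb L (grad \<alpha> u)) (q n) = lam n * cf n u"
 by (simp add: inner_q Rop_grad cf_emb H1_L2)

text \<open>The second factor \<open>r\<close> is any L2 function, not only a gradient of an element
  of \<open>HA\<close>. The boundary trace needs this, its test functions being nonzero at x =
  L.\<close>

lemma grad_expansion:
 assumes u: "u \<in> HA" and r: "r \<in> LL"
 shows "(\<lambda>n. cf n u * (LINT x|leb L. grad \<alpha> (e n) x * r x)) sums
   (LINT x|leb L. grad \<alpha> u x * r x)"
proof -
 have g: "grad \<alpha> u \<in> LL" "grad \<alpha> (e n) \<in> LL" for n using H1_grad u e_H1 by auto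
 have "(\<lambda>n. inner (inner (emb L (grad \<alpha> u)) (d n) *\<^sub>R d n) (emb L r)) sums inner (emb L (grad \<alpha> u)) (emb L r)"
  by (rule bounded_linear.sums[OF bounded_linear_inner_left expansion_d[OF H1_rep(1)[OF u]]])
 moreover have "inner (inner (emb L (grad \<alpha> u)) (d n) *\<^sub>R d n) (emb L r) = cf n u * inner (q n) (emb L r)" for n
 proof -
  have "inner (emb L (grad \<alpha> u)) (d n) = sqrt (lam n) * cf n u"
   by (simp only: inner_d Rop_grad[OF u] cf_emb[OF H1_L2[OF u]])
  moreover have "inner (d n) (emb L r) = inner (q n) (emb L r) / sqrt (lam n)" by (simp add: d_def)
  ultimately show ?thesis using eigsys(2)[of n] by simp
 qed
 ultimately show ?thesis using g r by (simp add: inner_emb flip: grad_e)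
qed

lemma grad_parseval:
 assumes u: "u \<in> HA" and v: "v \<in> HA"
 shows "(\<lambda>n. lam n * cf n u * cf n v) sums (LINT x|leb L. grad \<alpha> u x * grad \<alpha> v x)"
proof -
 have "(LINT x|leb L. grad \<alpha> (e n) x * grad \<alpha> v x) = lam n * cf n v" for n
  using inner_grad_q[OF v, of n] inner_emb[OF H1_grad[OF v] H1_grad[OF e_H1], of n] by (simp add: grad_e mult.commute)
 thus ?thesis using grad_expansion[OF u H1_grad[OF v]] by (simp add: mult_ac)
qed

lemma Riesz_Fischer_H1:
 assumes "summable (\<lambda>n. lam n * (a n)\<^sup>2)"
 obtains u where "u \<in> HA" "\<And>n. cf n u = a n"
proof -
 have sq: "(sqrt (lam n) * a n)\<^sup>2 = lam n * (a n)\<^sup>2" for n using eigsys(2)[of n] by (simp add: power_mult_distrib)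
 let ?y = "\<Sum>n. (sqrt (lam n) * a n) *\<^sub>R d n"
 have "inner ?y (d n) = sqrt (lam n) * a n" for n by (rule D.inner_series) (simp add: sq assms)
 hence eq: "sqrt (lam n) * inner (Rop ?y) (b n) = sqrt (lam n) * a n" for n by (simp only: inner_d)
 have c: "inner (Rop ?y) (b n) = a n" for n using eq[of n] eigsys(2)[of n] by simp
 have "Rfun ?y \<in> HA" by (rule H1_of_Rfun(1)[of _ ?y]) (auto simp: Rfun_def)
 moreover have "cf n (Rfun ?y) = a n" for n using c[of n] by (simp add: cf_emb Rfun_L2 Rop_def)
 ultimately show thesis using that by blast
qed

lemma lam_lower: "\<exists>c>0. \<forall>n. c \<le> lam n"
proof -
 obtain C where C: "C > 0" "\<And>f. norm (Rop (Rs f)) \<le> norm f * C" using bounded_linear.pos_bounded[OF K.lin] by blast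
 have "1 / C \<le> lam n" for n
 proof -
  have "norm (b n) = 1" by (simp add: norm_eq_1 eigsys(1))
  hence "1 / lam n \<le> C" using C(2)[of "b n"] eigsys(2)[of n] by (simp add: eigsys(3))
  thus ?thesis using eigsys(2)[of n] C(1) by (simp add: field_simps)
 qed
 thus ?thesis using C(1) by (intro exI[of _ "1 / C"]) auto
qed

section \<open>The flux of an eigenfunction\<close>

definition tn :: "nat => real" where "tn n = inner (emb L (Gfun (b n))) kap / inner kap kap"
text \<open>The flux \<open>x powr \<alpha>\<close> times the derivative of \<open>e n\<close>,
  written as a primitive so that it is continuous on the closed half line. \<open>tn\<close> is the
  coefficient removed by \<open>P\<close>; it is 0 for \<alpha> \<ge> 1, when the flux vanishes at
  0.\<close>

definition p :: "nat => rfun" where "p n x = - lam n * (inner (b n) (hh x) + tn n)"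

lemma p_continuous: "continuous_on {0..} (p n)" unfolding p_def by (intro continuous_intros inner_hh_continuous)

text \<open>The class \<open>q n\<close> is defined through a projection; this gives it a continuous
  explicit representative on (0,L).\<close>

lemma \<kappa>p_L2: "(\<lambda>x. \<kappa> x * p n x) \<in> LL" and emb_\<kappa>p: "emb L (\<lambda>x. \<kappa> x * p n x) = q n"
proof -
 have t: "tn n *\<^sub>R kap = emb L (\<lambda>s. tn n * \<kappa> s) \<and> (\<lambda>s. tn n * \<kappa> s) \<in> LL"
 proof (cases "\<alpha> < 1")
  case True
  thus ?thesis using \<kappa>_L2 by (simp add: kap_def emb_cmult L2_cmult)
 qed (simp add: tn_def kap_def)
 have eq: "(\<lambda>x. \<kappa> x * p n x) = (\<lambda>x. lam n * (Gfun (b n) x - tn n * \<kappa> x))"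
  by (auto simp: p_def Gfun_def algebra_simps)
 show "(\<lambda>x. \<kappa> x * p n x) \<in> LL" unfolding eq by (intro L2_cmult L2_diff[OF Gfun_L2 t[THEN conjunct2]])
 have "emb L (\<lambda>x. lam n * (Gfun (b n) x - tn n * \<kappa> x)) = lam n *\<^sub>R (emb L (Gfun (b n)) - tn n *\<^sub>R kap)"
  using t by (simp add: emb_cmult emb_diff L2_diff Gfun_L2)
 also have "\<dots> = q n" by (simp add: q_def Rs_def P_def Gfun_L2 tn_def)
 finally show "emb L (\<lambda>x. \<kappa> x * p n x) = q n" unfolding eq .
qed

lemma e_diff:
 assumes "0 < x" "x \<le> y" "y \<le> L"
 shows "e n y - e n x = integral {x..y} (\<lambda>s. s powr (- \<alpha>) * p n s)"
proof -
 have "AE s in leb L. rep_l2 (q n) s = \<kappa> s * p n s" using rep_emb[OF \<kappa>p_L2, of n] by (simp only: emb_\<kappa>p)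
 hence ae: "AE s in lebesgue. s \<in> {0<..<L} --> rep_l2 (q n) s = \<kappa> s * p n s" by (simp only: AE_on_eq)
 then obtain N where N: "negligible N" "\<And>s. s \<notin> N ==> s \<in> {0<..<L} ==> rep_l2 (q n) s = \<kappa> s * p n s"
  using AE_negligible[OF ae] that[of "{s. \<not> (s \<in> {0<..<L} --> rep_l2 (q n) s = \<kappa> s * p n s)}"] by blast
 have "e n y - e n x = integral {x..y} (gg (q n))" unfolding e_def by (rule gg_interval(2)) (use assms in auto)
 also have "\<dots> = integral {x..y} (\<lambda>s. s powr (- \<alpha>) * p n s)"
 proof (rule integral_spike[of "N \<union> {L}"])
  show "negligible (N \<union> {L})" using N(1) by simp
  fix s assume "s \<in> {x..y} - (N \<union> {L})"
  hence "rep_l2 (q n) s = \<kappa> s * p n s" using N(2)[of s] assms by auto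
  hence "gg (q n) s = (\<kappa> s)\<^sup>2 * p n s" by (simp add: gg_def power2_eq_square)
  thus "s powr (- \<alpha>) * p n s = gg (q n) s" by (simp add: \<kappa>_sq)
 qed
 finally show ?thesis .
qed

lemma e_L [simp]: "e n L = 0" by (simp add: e_def Rfun_L)

lemma e_continuous: "continuous_on {0<..} (e n)" unfolding e_def by (rule Rfun_continuous)

lemma e_deriv:
 assumes x: "x \<in> {0<..<L}"
 shows "(e n has_der x powr (- \<alpha>) * p n x) (at x)"
proof -
 let ?a = "x / 2"
 have a: "0 < ?a" "x \<in> {?a<..<L}" using x by auto
 have c: "continuous_on {?a..L} (\<lambda>s. s powr (- \<alpha>) * p n s)"
  using a by (intro continuous_intros continuous_on_subset[OF p_continuous]) auto
 have "((\<lambda>y. integral {?a..y} (\<lambda>s. s powr (- \<alpha>) * p n s)) has_der x powr (- \<alpha>) * p n x) (at x within {?a..L})"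
  by (rule integral_has_real_derivative[OF c]) (use a in auto)
 hence "((\<lambda>y. integral {?a..y} (\<lambda>s. s powr (- \<alpha>) * p n s)) has_der x powr (- \<alpha>) * p n x) (at x)"
  using a by (subst (asm) at_within_Icc_at) auto
 hence "((\<lambda>y. e n ?a + integral {?a..y} (\<lambda>s. s powr (- \<alpha>) * p n s)) has_der 0 + x powr (- \<alpha>) * p n x) (at x)"
  by (intro DERIV_add DERIV_const)
 moreover have "e n ?a + integral {?a..y} (\<lambda>s. s powr (- \<alpha>) * p n s) = e n y" if "y \<in> {?a<..<L}" for y
  using e_diff[of ?a y n] that a by simp
 ultimately have "(e n has_der 0 + x powr (- \<alpha>) * p n x) (at x)"
  by (rule has_field_derivative_transform_within_open[OF _ open_greaterThanLessThan a(2)])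
 thus ?thesis by simp
qed

lemma p_deriv:
 assumes x: "x \<in> {0<..<L}"
 shows "(p n has_der - lam n * e n x) (at x)"
proof -
 let ?a = "x / 2"
 have a: "0 < ?a" "x \<in> {?a<..<L}" using x by auto
 have aeb: "AE s in lebesgue. s \<in> {0<..<L} --> rep_l2 (b n) s = e n s"
  using rep_emb[OF e_L2, of n] by (simp only: emb_e AE_on_eq)
 have h: "inner (b n) (hh y) - inner (b n) (hh ?a) = integral {?a..y} (e n)" if y: "y \<in> {?a<..<L}" for y
 proof -
  have si: "(\<lambda>s. indicator {0<..<r} s * rep_l2 (b n) s) \<in> square_integrable" for r
   using rep_l2_L2[of "b n" r] by (simp only: L2_space_iff)
  have i: "integrable lebesgue (\<lambda>s. indicator {0<..<r} s * rep_l2 (b n) s)" for r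
   using L2_integrable[OF rep_l2_L2, of r "b n"] by (simp only: integrable_on_eq)
  have ei: "e n AI {?a..y}"
   by (intro absolutely_integrable_continuous_real continuous_on_subset[OF e_continuous]) (use a in auto)
  have "inner (b n) (hh y) - inner (b n) (hh ?a)
    = (LINT s|lebesgue. indicator {0<..<y} s * rep_l2 (b n) s - indicator {0<..<?a} s * rep_l2 (b n) s)"
   unfolding inner_hh by (rule LINT_diff[symmetric]) (rule i)+
  also have "\<dots> = (LINT s|lebesgue. indicator {?a..y} s *\<^sub>R e n s)"
  proof (rule integral_cong_AE)
   have "AE s in lebesgue. s \<notin> {?a, y}" by (rule negligible_AE[of "{?a, y}"]) auto
   thus "AE s in lebesgue. indicator {0<..<y} s * rep_l2 (b n) s - indicator {0<..<?a} s * rep_l2 (b n) s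
     = indicator {?a..y} s *\<^sub>R e n s" using aeb
   proof eventually_elim
    case (elim s)
    thus ?case using y a(1) by (auto simp: indicator_def)
   qed
  qed (use i ei in \<open>auto simp: set_integrable_def intro!: borel_measurable_diff borel_measurable_integrable\<close>)
  also have "\<dots> = integral {?a..y} (e n)"
   using set_lebesgue_integral_eq_integral(2)[OF ei] by (simp add: set_lebesgue_integral_def)
  finally show ?thesis .
 qed
 have c: "continuous_on {?a..L} (e n)" by (rule continuous_on_subset[OF e_continuous]) (use a in auto)
 have "((\<lambda>y. integral {?a..y} (e n)) has_der e n x) (at x within {?a..L})"
  by (rule integral_has_real_derivative[OF c]) (use a in auto)
 hence "((\<lambda>y. integral {?a..y} (e n)) has_der e n x) (at x)" using a by (subst (asm) at_within_Icc_at) auto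
 hence "((\<lambda>y. inner (b n) (hh ?a) + integral {?a..y} (e n)) has_der 0 + e n x) (at x)"
  by (intro DERIV_add DERIV_const)
 moreover have "inner (b n) (hh ?a) + integral {?a..y} (e n) = inner (b n) (hh y)" if "y \<in> {?a<..<L}" for y
  using h[OF that] by simp
 ultimately have "((\<lambda>y. inner (b n) (hh y)) has_der 0 + e n x) (at x)"
  by (rule has_field_derivative_transform_within_open[OF _ open_greaterThanLessThan a(2)])
 hence "((\<lambda>y. - lam n * (inner (b n) (hh y) + tn n)) has_der - lam n * (0 + e n x + 0)) (at x)"
  by (intro DERIV_cmult DERIV_add DERIV_const)
 thus ?thesis by (simp add: p_def[abs_def])
qed

lemma grad_e_eq: "x \<in> {0<..<L} ==> grad \<alpha> (e n) x = \<kappa> x * p n x"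
proof -
 assume x: "x \<in> {0<..<L}"
 have "x powr (\<alpha> / 2) * x powr (- \<alpha>) = \<kappa> x" by (simp add: \<kappa>_def flip: powr_add)
 thus ?thesis using DERIV_imp_deriv[OF e_deriv[OF x, of n]] by (simp add: grad_def flip: mult.assoc)
qed

text \<open>The function \<psi> need not vanish at L, and the boundary term
  \<open>p n L * \<psi> L\<close> is the contribution of the mode to the trace. At 0 nothing is left
  because \<psi> vanishes there.\<close>

lemma trace_ibp:
 assumes \<psi>: "\<And>x. x \<in> {0<..<L} ==> (\<psi> has_der \<psi>' x) (at x)"
  and c: "continuous_on {0..L} \<psi>" "continuous_on {0..L} \<psi>'" and \<psi>0: "\<psi> 0 = 0"
 shows "(LINT x|leb L. grad \<alpha> (e n) x * (x powr (\<alpha> / 2) * \<psi>' x))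
  = p n L * \<psi> L + lam n * cf n \<psi>"
proof -
 have pc: "continuous_on {0..L} (p n)" by (rule continuous_on_subset[OF p_continuous]) auto
 have \<psi>L: "\<psi> \<in> LL" "\<psi>' \<in> LL" "p n \<in> LL" using c pc by (auto intro: continuous_interval_L2)
 have i1: "integrable (leb L) (\<lambda>x. p n x * \<psi>' x)" by (rule L2_mult_integrable[OF \<psi>L(3,2)])
 have i2: "integrable (leb L) (\<lambda>x. lam n * (\<psi> x * e n x))"
  by (intro integrable_mult_right L2_mult_integrable \<psi>L e_L2)
 have hi: "((\<lambda>x. p n x * \<psi>' x - lam n * (\<psi> x * e n x)) has_integral (p n L * \<psi> L - p n 0 * \<psi> 0)) {0..L}"
 proof (rule fundamental_theorem_of_calculus_interior)
  show "continuous_on {0..L} (\<lambda>x. p n x * \<psi> x)" by (intro continuous_intros pc c)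
  fix x assume x: "x \<in> {0<..<L}"
  have "((\<lambda>x. p n x * \<psi> x) has_der (- lam n * e n x) * \<psi> x + \<psi>' x * p n x) (at x)"
   by (rule DERIV_mult[OF p_deriv[OF x] \<psi>[OF x]])
  thus "((\<lambda>x. p n x * \<psi> x) has_vector_derivative p n x * \<psi>' x - lam n * (\<psi> x * e n x)) (at x)"
   by (simp add: has_real_derivative_iff_has_vector_derivative algebra_simps)
 qed (use L_pos in simp)
 have "(LINT x|leb L. p n x * \<psi>' x - lam n * (\<psi> x * e n x)) = p n L * \<psi> L"
  using LINT_on_HK[OF LINT_able_diff[OF i1 i2] hi] by (simp add: \<psi>0)
 hence "(LINT x|leb L. p n x * \<psi>' x) = p n L * \<psi> L + lam n * cf n \<psi>" using i1 i2 by (simp add: cf_def)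
 moreover have "(LINT x|leb L. grad \<alpha> (e n) x * (x powr (\<alpha> / 2) * \<psi>' x))
   = (LINT x|leb L. p n x * \<psi>' x)"
 proof (rule LINT_cong[OF refl])
  fix x assume "x \<in> space (leb L)"
  hence x: "x \<in> {0<..<L}" by simp
  thus "grad \<alpha> (e n) x * (x powr (\<alpha> / 2) * \<psi>' x) = p n x * \<psi>' x"
   using powr_\<kappa>[of x] by (simp add: grad_e_eq mult_ac)
 qed
 ultimately show ?thesis by simp
qed

subsection \<open>The multiplier estimate\<close>

definition cm :: real where "cm = L / 2"
text \<open>In terms of the flux p = x^\<alpha> u_x, \<open>mm x * p^2\<close> is (x - cm)
  x^\<alpha> u_x^2. The weight vanishes at \<open>cm\<close> and so isolates the endpoint L.\<close>

definition mm :: rfun where "mm x = (x - cm) * x powr (- \<alpha>)"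
text \<open>The matrix of the integral of (x - cm) times \<open>e m\<close> times the derivative of
  \<open>e n\<close>, the bilinear form of velocity against gradient in the multiplier
  method.\<close>

definition km :: "nat => nat => real" where "km m n = integral {cm..L} (\<lambda>x. mm x * (e m x * p n x))"

lemma cm: "0 < cm" "cm < L" "L - cm = cm" using L_pos by (simp_all add: cm_def)

lemma continuous_ep: "continuous_on {cm..L} (e n)" "continuous_on {cm..L} (p n)" "continuous_on {cm..L} mm"
 using cm unfolding mm_def
 by (auto intro!: continuous_intros continuous_on_subset[OF e_continuous] continuous_on_subset[OF p_continuous])

lemma integral_double_sum:
 assumes F: "finite F"
 shows "integral {cm..L} (\<lambda>x. mm x * ((\<Sum>m\<in>F. \<beta> m * e m x) * (\<Sum>n\<in>F. \<gamma> n * p n x)))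
  = (\<Sum>m\<in>F. \<Sum>n\<in>F. \<beta> m * \<gamma> n * km m n)"
proof -
 have i: "(\<lambda>x. c * (mm x * (e m x * p n x))) integrable_on {cm..L}" for c m n
  by (intro integrable_continuous_real continuous_intros continuous_ep)
 have "(\<lambda>x. mm x * ((\<Sum>m\<in>F. \<beta> m * e m x) * (\<Sum>n\<in>F. \<gamma> n * p n x)))
   = (\<lambda>x. \<Sum>m\<in>F. \<Sum>n\<in>F. (\<beta> m * \<gamma> n) * (mm x * (e m x * p n x)))"
  by (rule ext, unfold sum_product, unfold sum_distrib_left) (simp only: mult_ac)
 hence "integral {cm..L} (\<lambda>x. mm x * ((\<Sum>m\<in>F. \<beta> m * e m x) * (\<Sum>n\<in>F. \<gamma> n * p n x)))
   = (\<Sum>m\<in>F. integral {cm..L} (\<lambda>x. \<Sum>n\<in>F. (\<beta> m * \<gamma> n) * (mm x * (e m x * p n x))))"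
  using F i by (simp only:) (rule integral_sum, auto intro!: integrable_sum)
 also have "\<dots> = (\<Sum>m\<in>F. \<Sum>n\<in>F. \<beta> m * \<gamma> n * km m n)"
  using F i by (intro sum.cong refl, subst integral_sum) (auto simp: km_def)
 finally show ?thesis .
qed

lemma integral_square_le:
 assumes f: "f \<in> LL" and c: "continuous_on {cm..L} f"
 shows "integral {cm..L} (\<lambda>x. (f x)\<^sup>2) \<le> (norm (emb L f))\<^sup>2"
proof -
 have i: "integrable (leb L) (\<lambda>x. (f x)\<^sup>2)" using f by (simp add: L2_space_def)
 hence ii: "(\<lambda>x. (f x)\<^sup>2) integrable_on {0<..<L}" by (rule integrable_on_lebesgue_on) simp
 hence i3: "(\<lambda>x. (f x)\<^sup>2) integrable_on {0..L}" by (simp add: integrable_on_open_interval_real)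
 have "integral {cm..L} (\<lambda>x. (f x)\<^sup>2) \<le> integral {0..L} (\<lambda>x. (f x)\<^sup>2)"
 proof (rule integral_subset_le)
  show "(\<lambda>x. (f x)\<^sup>2) integrable_on {cm..L}" by (intro integrable_continuous_real continuous_intros c)
 qed (use cm i3 in auto)
 also have "\<dots> = (LINT x|leb L. (f x)\<^sup>2)"
  by (subst lebesgue_integral_eq_integral[OF i]) (auto simp: integral_open_interval_real)
 also have "\<dots> = (norm (emb L f))\<^sup>2" using f by (simp add: norm_emb L2_norm_sq)
 finally show ?thesis .
qed

lemma emb_sum_e:
 assumes "finite F"
 shows "(\<lambda>x. \<Sum>n\<in>F. \<beta> n * e n x) \<in> LL" "(norm (emb L (\<lambda>x. \<Sum>n\<in>F. \<beta> n * e n x)))\<^sup>2 = (\<Sum>n\<in>F. (\<beta> n)\<^sup>2)"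
proof -
 have *: "(\<lambda>x. \<Sum>n\<in>F. \<beta> n * e n x) \<in> LL \<and> emb L (\<lambda>x. \<Sum>n\<in>F. \<beta> n * e n x) = (\<Sum>n\<in>F. \<beta> n *\<^sub>R b n)"
  using assms by (induction F) (auto simp: emb_add emb_cmult L2_add L2_cmult e_L2 emb_e)
 thus "(\<lambda>x. \<Sum>n\<in>F. \<beta> n * e n x) \<in> LL" "(norm (emb L (\<lambda>x. \<Sum>n\<in>F. \<beta> n * e n x)))\<^sup>2 = (\<Sum>n\<in>F. (\<beta> n)\<^sup>2)"
  using B.norm_sum_sq[OF assms] by simp_all
qed

lemma emb_sum_p:
 assumes "finite F"
 shows "(\<lambda>x. \<kappa> x * (\<Sum>n\<in>F. \<beta> n * p n x)) \<in> LL"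
  "(norm (emb L (\<lambda>x. \<kappa> x * (\<Sum>n\<in>F. \<beta> n * p n x))))\<^sup>2 = (\<Sum>n\<in>F. lam n * (\<beta> n)\<^sup>2)"
proof -
 have eq: "(\<lambda>x. \<kappa> x * (\<Sum>n\<in>F. \<beta> n * p n x)) = (\<lambda>x. \<Sum>n\<in>F. \<beta> n * (\<kappa> x * p n x))"
  by (simp add: sum_distrib_left mult_ac)
 have *: "(\<lambda>x. \<Sum>n\<in>F. \<beta> n * (\<kappa> x * p n x)) \<in> LL \<and> emb L (\<lambda>x. \<Sum>n\<in>F. \<beta> n * (\<kappa> x * p n x)) = (\<Sum>n\<in>F. \<beta> n *\<^sub>R q n)"
  using assms by (induction F) (auto simp: emb_add emb_cmult L2_add L2_cmult \<kappa>p_L2 emb_\<kappa>p)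
 have "\<beta> n *\<^sub>R q n = (sqrt (lam n) * \<beta> n) *\<^sub>R d n" for n using eigsys(2)[of n] by (simp add: d_def)
 hence "(norm (\<Sum>n\<in>F. \<beta> n *\<^sub>R q n))\<^sup>2 = (\<Sum>n\<in>F. (sqrt (lam n) * \<beta> n)\<^sup>2)" using D.norm_sum_sq[OF assms] by simp
 also have "\<dots> = (\<Sum>n\<in>F. lam n * (\<beta> n)\<^sup>2)" using eigsys(2) by (simp add: power_mult_distrib less_imp_le)
 finally show "(\<lambda>x. \<kappa> x * (\<Sum>n\<in>F. \<beta> n * p n x)) \<in> LL"
  "(norm (emb L (\<lambda>x. \<kappa> x * (\<Sum>n\<in>F. \<beta> n * p n x))))\<^sup>2 = (\<Sum>n\<in>F. lam n * (\<beta> n)\<^sup>2)"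
  using * unfolding eq by simp_all
qed

lemma integral_squares:
 assumes F: "finite F"
 shows "integral {cm..L} (\<lambda>x. (\<Sum>n\<in>F. \<beta> n * e n x)\<^sup>2) \<le> (\<Sum>n\<in>F. (\<beta> n)\<^sup>2)"
  and "integral {cm..L} (\<lambda>x. x powr (- \<alpha>) * (\<Sum>n\<in>F. \<gamma> n * p n x)\<^sup>2) \<le> (\<Sum>n\<in>F. lam n * (\<gamma> n)\<^sup>2)"
proof -
 show "integral {cm..L} (\<lambda>x. (\<Sum>n\<in>F. \<beta> n * e n x)\<^sup>2) \<le> (\<Sum>n\<in>F. (\<beta> n)\<^sup>2)"
  using integral_square_le[OF emb_sum_e(1)[OF F, of \<beta>]] emb_sum_e(2)[OF F, of \<beta>]
  by (simp add: continuous_intros continuous_ep)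
 have "continuous_on {cm..L} (\<lambda>x. \<kappa> x * (\<Sum>n\<in>F. \<gamma> n * p n x))"
  unfolding \<kappa>_def using cm by (intro continuous_intros continuous_ep) auto
 from integral_square_le[OF emb_sum_p(1)[OF F] this] emb_sum_p(2)[OF F, of \<gamma>]
 show "integral {cm..L} (\<lambda>x. x powr (- \<alpha>) * (\<Sum>n\<in>F. \<gamma> n * p n x)\<^sup>2) \<le> (\<Sum>n\<in>F. lam n * (\<gamma> n)\<^sup>2)"
  by (simp add: power_mult_distrib \<kappa>_sq)
qed

text \<open>On [cm,L] the weight \<open>x powr (- \<alpha>)\<close> is at most
  \<open>cm powr (- \<alpha>)\<close>. The additional 1 makes the constant at least 1, so that it
  absorbs both squares.\<close>

lemma multiplier_bound:
 assumes F: "finite F"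
 shows "\<bar>\<Sum>m\<in>F. \<Sum>n\<in>F. \<beta> m * \<gamma> n * km m n\<bar> \<le> L * (1 + cm powr (- \<alpha>)) * (\<Sum>n\<in>F. (\<beta> n)\<^sup>2 + lam n * (\<gamma> n)\<^sup>2)"
proof -
 let ?B = "\<lambda>x. \<Sum>m\<in>F. \<beta> m * e m x" and ?P = "\<lambda>x. \<Sum>n\<in>F. \<gamma> n * p n x"
 let ?c = "1 + cm powr (- \<alpha>)"
 have cont: "continuous_on {cm..L} ?B" "continuous_on {cm..L} ?P" "continuous_on {cm..L} (\<lambda>x. x powr (- \<alpha>))"
  using cm by (auto intro!: continuous_intros continuous_ep)
 have c1: "1 \<le> ?c" by simp
 have "\<bar>integral {cm..L} (\<lambda>x. mm x * (?B x * ?P x))\<bar>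
   \<le> integral {cm..L} (\<lambda>x. L * ?c * ((?B x)\<^sup>2 + x powr (- \<alpha>) * (?P x)\<^sup>2))"
  unfolding real_norm_def[symmetric]
 proof (rule integral_norm_bound_integral)
  show "(\<lambda>x. mm x * (?B x * ?P x)) integrable_on {cm..L}"
   by (intro integrable_continuous_real continuous_intros continuous_ep)
  show "(\<lambda>x. L * ?c * ((?B x)\<^sup>2 + x powr (- \<alpha>) * (?P x)\<^sup>2)) integrable_on {cm..L}"
   by (intro integrable_continuous_real continuous_on_mult continuous_on_add continuous_on_power continuous_on_const cont)
  fix x assume x: "x \<in> {cm..L}"
  let ?w = "x powr (- \<alpha>)"
  have w: "0 \<le> ?w" "?w \<le> ?c"
  proof -
   have "?w \<le> cm powr (- \<alpha>)" using x cm \<alpha>_pos by (intro powr_mono2') auto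
   thus "?w \<le> ?c" by simp
  qed simp
  have "2 * (\<bar>?B x\<bar> * \<bar>?P x\<bar>) \<le> (?B x)\<^sup>2 + (?P x)\<^sup>2" using sum_squares_bound[of "\<bar>?B x\<bar>" "\<bar>?P x\<bar>"] by simp
  hence "\<bar>?B x\<bar> * \<bar>?P x\<bar> \<le> (?B x)\<^sup>2 + (?P x)\<^sup>2"
   using mult_nonneg_nonneg[OF abs_ge_zero[of "?B x"] abs_ge_zero[of "?P x"]] by linarith
  hence "?w * (\<bar>?B x\<bar> * \<bar>?P x\<bar>) \<le> ?w * (?B x)\<^sup>2 + ?w * (?P x)\<^sup>2"
   using mult_left_mono[OF _ w(1)] by (simp add: distrib_left[symmetric])
  also have "\<dots> \<le> ?c * (?B x)\<^sup>2 + ?c * (?w * (?P x)\<^sup>2)"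
   using mult_right_mono[OF w(2), of "(?B x)\<^sup>2"] mult_right_mono[OF c1, of "?w * (?P x)\<^sup>2"] by simp
  finally have 1: "?w * (\<bar>?B x\<bar> * \<bar>?P x\<bar>) \<le> ?c * ((?B x)\<^sup>2 + ?w * (?P x)\<^sup>2)" by (simp add: distrib_left)
  have "norm (mm x * (?B x * ?P x)) = (x - cm) * (?w * (\<bar>?B x\<bar> * \<bar>?P x\<bar>))"
   using x by (simp add: mm_def abs_mult mult.assoc)
  also have "\<dots> \<le> L * (?c * ((?B x)\<^sup>2 + ?w * (?P x)\<^sup>2))"
   by (rule mult_mono[OF _ 1]) (use x cm(1) L_pos w(1) in auto)
  finally show "norm (mm x * (?B x * ?P x)) \<le> L * ?c * ((?B x)\<^sup>2 + ?w * (?P x)\<^sup>2)" by (simp add: mult.assoc)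
 qed
 also have "\<dots> = L * ?c * (integral {cm..L} (\<lambda>x. (?B x)\<^sup>2) + integral {cm..L} (\<lambda>x. x powr (- \<alpha>) * (?P x)\<^sup>2))"
  by (subst hk_add[symmetric]) (auto intro!: integrable_continuous_real continuous_on_mult continuous_on_power cont)
 also have "\<dots> \<le> L * ?c * ((\<Sum>n\<in>F. (\<beta> n)\<^sup>2) + (\<Sum>n\<in>F. lam n * (\<gamma> n)\<^sup>2))"
  using integral_squares[OF F] L_pos c1 by (intro mult_left_mono add_mono) auto
 finally show ?thesis using integral_double_sum[OF F, of \<beta> \<gamma>] by (simp add: sum.distrib)
qed

text \<open>Integrates the derivative of \<open>mm P^2 + (x - cm) B^2\<close> over [cm,L], where P
  is the flux and B the velocity. At \<open>cm\<close> both weights vanish and at L the velocity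
  vanishes, so only the squared flux at L remains. The double sum is the time derivative of the form
  with matrix \<open>km\<close>.\<close>

lemma multiplier_identity:
 assumes F: "finite F"
 shows "cm * L powr (- \<alpha>) * (\<Sum>n\<in>F. \<gamma> n * p n L)\<^sup>2
  \<le> 2 * (\<Sum>m\<in>F. \<Sum>n\<in>F. (\<beta> m * \<beta> n - lam m * \<gamma> m * \<gamma> n) * km m n) + 3 * (\<Sum>n\<in>F. (\<beta> n)\<^sup>2 + lam n * (\<gamma> n)\<^sup>2)"
proof -
 let ?B = "\<lambda>x. \<Sum>m\<in>F. \<beta> m * e m x" and ?P = "\<lambda>x. \<Sum>n\<in>F. \<gamma> n * p n x" and ?Q = "\<lambda>x. \<Sum>n\<in>F. \<beta> n * p n x"
  and ?A = "\<lambda>x. \<Sum>m\<in>F. (lam m * \<gamma> m) * e m x"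
 let ?w = "\<lambda>x. x powr (- \<alpha>)"
 define m' where "m' \<equiv> \<lambda>x. ?w x - \<alpha> * (x - cm) * x powr (- \<alpha> - 1)"
 have cont: "continuous_on {cm..L} ?B" "continuous_on {cm..L} ?P" "continuous_on {cm..L} ?Q" "continuous_on {cm..L} ?A"
  "continuous_on {cm..L} ?w" "continuous_on {cm..L} m'"
  using cm unfolding m'_def by (auto intro!: continuous_intros continuous_ep)
 have dP: "(?P has_der - ?A x) (at x)" if "x \<in> {cm<..<L}" for x
 proof -
  have "(?P has_der (\<Sum>n\<in>F. \<gamma> n * (- lam n * e n x))) (at x)"
   by (intro DERIV_sum DERIV_cmult p_deriv) (use that cm in auto)
  thus ?thesis by (simp add: sum_negf[symmetric] mult_ac)
 qed
 have dB: "(?B has_der ?w x * ?Q x) (at x)" if "x \<in> {cm<..<L}" for x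
 proof -
  have "(?B has_der (\<Sum>n\<in>F. \<beta> n * (?w x * p n x))) (at x)"
   by (intro DERIV_sum DERIV_cmult e_deriv) (use that cm in auto)
  thus ?thesis by (simp add: sum_distrib_left mult_ac)
 qed
 have dm: "(mm has_der m' x) (at x)" if "x \<in> {cm<..<L}" for x
 proof -
  have "x > 0" using that cm by auto
  hence "((\<lambda>x. x powr (- \<alpha>)) has_der (- \<alpha>) * x powr (- \<alpha> - 1)) (at x)"
   by (rule has_real_derivative_powr)
  moreover have "((\<lambda>x. x - cm) has_der 1) (at x)" by (auto intro!: derivative_eq_intros)
  ultimately have "((\<lambda>x. (x - cm) * x powr (- \<alpha>)) has_der 1 * x powr (- \<alpha>) + (- \<alpha>) * x powr (- \<alpha> - 1) * (x - cm)) (at x)"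
   by (rule DERIV_mult[rotated])
  thus ?thesis by (simp add: mm_def[abs_def] m'_def algebra_simps)
 qed
 let ?f = "\<lambda>x. mm x * (?P x)\<^sup>2 + (x - cm) * (?B x)\<^sup>2"
 let ?f' = "\<lambda>x. (m' x * (?P x)\<^sup>2 + (?B x)\<^sup>2) + 2 * (mm x * (?B x * ?Q x) - mm x * (?A x * ?P x))"
 have "(?f' has_integral (?f L - ?f cm)) {cm..L}"
 proof (rule fundamental_theorem_of_calculus_interior)
  show "continuous_on {cm..L} ?f"
   by (intro continuous_on_add continuous_on_mult continuous_on_power continuous_on_diff continuous_on_id continuous_on_const cont continuous_ep)
  fix x assume x: "x \<in> {cm<..<L}"
  have "((\<lambda>x. mm x * (?P x * ?P x)) has_der m' x * (?P x * ?P x) + ((- ?A x) * ?P x + (- ?A x) * ?P x) * mm x) (at x)"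
   by (intro DERIV_mult dm dP x)
  moreover have "((\<lambda>x. (x - cm) * (?B x * ?B x)) has_der 1 * (?B x * ?B x) + ((?w x * ?Q x) * ?B x + (?w x * ?Q x) * ?B x) * (x - cm)) (at x)"
   by (intro DERIV_mult dB x) (auto intro!: derivative_eq_intros)
  ultimately have "(?f has_der (m' x * (?P x * ?P x) + ((- ?A x) * ?P x + (- ?A x) * ?P x) * mm x)
    + (1 * (?B x * ?B x) + ((?w x * ?Q x) * ?B x + (?w x * ?Q x) * ?B x) * (x - cm))) (at x)"
   unfolding power2_eq_square by (rule DERIV_add)
  moreover have "(m' x * (?P x * ?P x) + ((- ?A x) * ?P x + (- ?A x) * ?P x) * mm x)
    + (1 * (?B x * ?B x) + ((?w x * ?Q x) * ?B x + (?w x * ?Q x) * ?B x) * (x - cm)) = ?f' x" unfolding mm_def by algebra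
  ultimately have "(?f has_der ?f' x) (at x)" by (simp only:)
  thus "(?f has_vector_derivative ?f' x) (at x)" by (simp only: has_real_derivative_iff_has_vector_derivative)
 qed (use cm in simp)
 moreover have "?f L - ?f cm = cm * L powr (- \<alpha>) * (?P L)\<^sup>2" using cm by (simp add: mm_def)
 ultimately have *: "integral {cm..L} ?f' = cm * L powr (- \<alpha>) * (?P L)\<^sup>2" by (simp add: integral_unique)
 have i1: "(\<lambda>x. m' x * (?P x)\<^sup>2 + (?B x)\<^sup>2) integrable_on {cm..L}"
  by (intro integrable_continuous_real continuous_on_add continuous_on_mult continuous_on_power cont)
 have i2: "(\<lambda>x. mm x * (?B x * ?Q x)) integrable_on {cm..L}" "(\<lambda>x. mm x * (?A x * ?P x)) integrable_on {cm..L}"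
  by (intro integrable_continuous_real continuous_on_mult cont continuous_ep)+
 have h1: "integral {cm..L} ?f' = integral {cm..L} (\<lambda>x. m' x * (?P x)\<^sup>2 + (?B x)\<^sup>2)
   + 2 * (integral {cm..L} (\<lambda>x. mm x * (?B x * ?Q x)) - integral {cm..L} (\<lambda>x. mm x * (?A x * ?P x)))"
  by (rule integral_unique) (intro has_integral_add has_integral_mult_right has_integral_diff integrable_integral i1 i2)
 have h2: "integral {cm..L} (\<lambda>x. mm x * (?B x * ?Q x)) - integral {cm..L} (\<lambda>x. mm x * (?A x * ?P x))
   = (\<Sum>m\<in>F. \<Sum>n\<in>F. (\<beta> m * \<beta> n - lam m * \<gamma> m * \<gamma> n) * km m n)"
  unfolding integral_double_sum[OF F] by (simp add: sum_subtractf left_diff_distrib)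
 have h3: "integral {cm..L} (\<lambda>x. m' x * (?P x)\<^sup>2 + (?B x)\<^sup>2) \<le> integral {cm..L} (\<lambda>x. 3 * (?w x * (?P x)\<^sup>2) + 3 * (?B x)\<^sup>2)"
 proof (rule integral_le[OF i1])
  show "(\<lambda>x. 3 * (?w x * (?P x)\<^sup>2) + 3 * (?B x)\<^sup>2) integrable_on {cm..L}"
   by (intro integrable_continuous_real continuous_on_add continuous_on_mult continuous_on_power continuous_on_const cont)
  fix x assume x: "x \<in> {cm..L}"
  \<comment> \<open>The subtracted term of the derivative of the weight is nonnegative on [cm,L], so
    the remaining integrand is controlled by the energy density.\<close>
  have "m' x \<le> ?w x" unfolding m'_def using x \<alpha>_pos by simp
  hence "m' x * (?P x)\<^sup>2 \<le> ?w x * (?P x)\<^sup>2" by (intro mult_right_mono) auto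
  moreover have "0 \<le> ?w x * (?P x)\<^sup>2" by simp
  ultimately show "m' x * (?P x)\<^sup>2 + (?B x)\<^sup>2 \<le> 3 * (?w x * (?P x)\<^sup>2) + 3 * (?B x)\<^sup>2"
   using zero_le_power2[of "?B x"] by linarith
 qed
 have h4: "integral {cm..L} (\<lambda>x. 3 * (?w x * (?P x)\<^sup>2) + 3 * (?B x)\<^sup>2)
   = 3 * integral {cm..L} (\<lambda>x. ?w x * (?P x)\<^sup>2) + 3 * integral {cm..L} (\<lambda>x. (?B x)\<^sup>2)"
  by (subst hk_add) (auto intro!: integrable_continuous_real continuous_on_mult continuous_on_power continuous_on_const cont)
 have h5: "integral {cm..L} (\<lambda>x. ?w x * (?P x)\<^sup>2) \<le> (\<Sum>n\<in>F. lam n * (\<gamma> n)\<^sup>2)"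
  "integral {cm..L} (\<lambda>x. (?B x)\<^sup>2) \<le> (\<Sum>n\<in>F. (\<beta> n)\<^sup>2)"
  by (rule integral_squares[OF F])+
 have h6: "(\<Sum>n\<in>F. (\<beta> n)\<^sup>2 + lam n * (\<gamma> n)\<^sup>2) = (\<Sum>n\<in>F. (\<beta> n)\<^sup>2) + (\<Sum>n\<in>F. lam n * (\<gamma> n)\<^sup>2)"
  by (rule sum.distrib)
 have arith: "x \<le> 2 * s + 3 * (v + u)" if "x = i1 + 2 * (i2 - i3)" "i2 - i3 = s" "i1 \<le> i4"
  "i4 = 3 * y + 3 * z" "y \<le> u" "z \<le> v" for x i1 i2 i3 s i4 y z u v :: real
 proof -
  have "x = i1 + 2 * s" using that(1) unfolding that(2) .
  moreover have "3 * y + 3 * z \<le> 3 * u + 3 * v" using that(5,6) by simp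
  ultimately show ?thesis using that(3,4) by (simp add: distrib_left)
 qed
 show ?thesis unfolding h6 by (rule arith[OF h1[unfolded *] h2 h3 h4 h5])
qed

text \<open>The multiplier form enters doubled and at both ends of [0,T], hence the factor 4; the
  energy term 3 is integrated over time; the denominator is the weight at L.\<close>

definition hidden_const :: rfun where
 "hidden_const T = (4 * (L * (1 + cm powr (- \<alpha>))) + 3 * T) / (cm * L powr (- \<alpha>))"

lemma hidden_const_nonneg: "T \<ge> 0 ==> hidden_const T \<ge> 0"
 unfolding hidden_const_def using cm L_pos by (intro divide_nonneg_nonneg add_nonneg_nonneg mult_nonneg_nonneg) auto

text \<open>The energy of a free motion is constant, so the multiplier inequality reads: weighted
  squared flux at L is at most \<open>2 * M' t + 3 * En 0\<close>. Integration in time leaves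
  \<open>M\<close> at the ends, bounded by the energy. The constant does not depend on the set of
  modes.\<close>

lemma hidden_regularity:
 assumes F: "finite F" and T: "T \<ge> 0"
  and a: "\<And>n t. n \<in> F ==> (a n has_der a' n t) (at t)"
  and a': "\<And>n t. n \<in> F ==> (a' n has_der - lam n * a n t) (at t)"
 shows "integral {0..T} (\<lambda>t. (\<Sum>n\<in>F. a n t * p n L)\<^sup>2) \<le> hidden_const T * (\<Sum>n\<in>F. (a' n 0)\<^sup>2 + lam n * (a n 0)\<^sup>2)"
proof -
 define En where "En \<equiv> \<lambda>t. \<Sum>n\<in>F. (a' n t)\<^sup>2 + lam n * (a n t)\<^sup>2"
 define M where "M \<equiv> \<lambda>t. \<Sum>m\<in>F. \<Sum>n\<in>F. a' m t * a n t * km m n"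
 define M' where "M' \<equiv> \<lambda>t. \<Sum>m\<in>F. \<Sum>n\<in>F. (a' m t * a' n t - lam m * a m t * a n t) * km m n"
 have ca: "continuous_on UNIV (a n)" "continuous_on UNIV (a' n)" if "n \<in> F" for n
  using DERIV_isCont[OF a[OF that]] DERIV_isCont[OF a'[OF that]] by (auto intro: continuous_at_imp_continuous_on)
 have ca': "cont T (a n)" "cont T (a' n)" if "n \<in> F" for n using ca[OF that] continuous_on_subset by blast+
 have "(En has_der 0) (at t)" for t
 proof -
  have "(En has_der (\<Sum>n\<in>F. (of_nat 2 * (- lam n * a n t * a' n t ^ (2 - Suc 0))) + lam n * (of_nat 2 * (a' n t * a n t ^ (2 - Suc 0))))) (at t)"
   unfolding En_def by (intro DERIV_sum DERIV_add DERIV_cmult DERIV_power a a')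
  moreover have "(\<Sum>n\<in>F. (of_nat 2 * (- lam n * a n t * a' n t ^ (2 - Suc 0))) + lam n * (of_nat 2 * (a' n t * a n t ^ (2 - Suc 0)))) = 0"
   by (intro sum.neutral) auto
  ultimately show ?thesis by simp
 qed
 hence En: "En t = En 0" for t using DERIV_isconst_all[of En t 0] by blast
 have dM: "(M has_der M' t) (at t)" for t
 proof -
  have "(M has_der (\<Sum>m\<in>F. \<Sum>n\<in>F. ((- lam m * a m t) * a n t + a' n t * a' m t) * km m n)) (at t)"
   unfolding M_def by (intro DERIV_sum DERIV_cmult_right DERIV_mult a a')
  thus ?thesis by (simp add: M'_def mult_ac)
 qed
 have M'i: "(M' has_integral (M T - M 0)) {0..T}" by (rule fundamental_theorem_of_calculus[OF T])
   (use dM in \<open>auto simp: has_real_derivative_iff_has_vector_derivative[symmetric] intro: has_field_derivative_at_within\<close>)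
 let ?k = "cm * L powr (- \<alpha>)"
 have k0: "?k > 0" using cm L_pos by simp
 have Mb: "\<bar>M t\<bar> \<le> L * (1 + cm powr (- \<alpha>)) * En 0" for t
  using multiplier_bound[OF F, of "\<lambda>n. a' n t" "\<lambda>n. a n t"] En[of t] by (simp add: M_def En_def)
 have pw: "?k * (\<Sum>n\<in>F. a n t * p n L)\<^sup>2 \<le> 2 * M' t + 3 * En 0" for t
  using multiplier_identity[OF F, of "\<lambda>n. a n t" "\<lambda>n. a' n t"] En[of t] by (simp add: M'_def En_def)
 have i: "(\<lambda>t. ?k * (\<Sum>n\<in>F. a n t * p n L)\<^sup>2) integrable_on {0..T}"
  by (intro integrable_continuous_real continuous_intros) (use ca' in auto)
 have i2: "((\<lambda>t. 2 * M' t + 3 * En 0) has_integral (2 * (M T - M 0) + T * (3 * En 0))) {0..T}"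
  using has_integral_add[OF has_integral_mult_right[OF M'i, of 2] has_integral_const_real[of "3 * En 0" 0 T]] T by simp
 have "integral {0..T} (\<lambda>t. ?k * (\<Sum>n\<in>F. a n t * p n L)\<^sup>2) \<le> 2 * (M T - M 0) + T * (3 * En 0)"
  by (rule has_integral_le[OF integrable_integral[OF i] i2]) (rule pw)
 also have "\<dots> \<le> (4 * (L * (1 + cm powr (- \<alpha>))) + 3 * T) * En 0"
  using Mb[of T] Mb[of 0] by (simp add: algebra_simps abs_if split: if_splits)
 finally have "?k * integral {0..T} (\<lambda>t. (\<Sum>n\<in>F. a n t * p n L)\<^sup>2) \<le> (4 * (L * (1 + cm powr (- \<alpha>))) + 3 * T) * En 0"
  by simp
 hence "integral {0..T} (\<lambda>t. (\<Sum>n\<in>F. a n t * p n L)\<^sup>2) \<le> ((4 * (L * (1 + cm powr (- \<alpha>))) + 3 * T) * En 0) / ?k"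
  unfolding pos_le_divide_eq[OF k0] by (simp only: mult.commute)
 also have "\<dots> = hidden_const T * En 0" by (simp add: hidden_const_def)
 finally show ?thesis by (simp only: En_def)
qed

subsection \<open>Oscillators\<close>

definition vec :: "(nat => real) => l2" where "vec a = (\<Sum>n. a n *\<^sub>R b n)"

lemma inner_vec: "sq a ==> inner (vec a) (b n) = a n" unfolding vec_def by (rule B.inner_series)

lemma E_vec: "sq a ==> E (vec a) = vec a"
proof -
 assume a: "sq a"
 have "(\<lambda>n. E (a n *\<^sub>R b n)) sums E (vec a)"
  unfolding vec_def by (rule bounded_linear.sums[OF E_linear summable_sums[OF B.summable_series[OF a]]])
 hence "(\<lambda>n. a n *\<^sub>R b n) sums E (vec a)" by (simp add: linear_cmul[OF bounded_linear.linear[OF E_linear]])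
 thus ?thesis unfolding vec_def by (simp add: sums_unique)
qed

lemma E_fixed_eqI: "E f = f ==> E g = g ==> (\<And>n. inner f (b n) = inner g (b n)) ==> f = g"
 using eigsys(4)[of "f - g"] linear_diff[OF bounded_linear.linear[OF E_linear], of f g] by (simp add: inner_diff_left)

lemma inner_E_fixed: "E f = f ==> (\<lambda>n. inner f (b n) * inner g (b n)) sums inner f g"
 using bounded_linear.sums[OF bounded_linear_inner_left expansion_b, of f g] by (simp add: inner_commute)

lemma norm_vec: "sq a ==> (norm (vec a))\<^sup>2 = (\<Sum>n. (a n)\<^sup>2)"
proof -
 assume a: "sq a"
 have "(\<lambda>n. (a n)\<^sup>2) sums inner (vec a) (vec a)"
  using inner_E_fixed[OF E_vec[OF a], of "vec a"] by (simp only: inner_vec[OF a] power2_eq_square)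
 thus ?thesis by (simp only: power2_norm_eq_inner sums_unique)
qed

lemma sq_inner: "sq (\<lambda>n. inner f (b n))" by (rule B.Bessel_summable)

lemma sq_cf: "u \<in> LL ==> sq (\<lambda>n. cf n u)" using sq_inner[of "emb L u"] by (simp add: cf_emb)

lemma vec_inner: "E f = f ==> vec (\<lambda>n. inner f (b n)) = f"
 by (rule E_fixed_eqI) (simp_all add: E_vec inner_vec sq_inner)

lemma vec_cf: "u \<in> LL ==> vec (\<lambda>n. cf n u) = emb L u" using vec_inner[of "emb L u"] by (simp add: cf_emb)

lemma vec_lin:
 assumes "sq a" "sq c"
 shows "sq (\<lambda>n. s * a n + t * c n)" "vec (\<lambda>n. s * a n + t * c n) = s *\<^sub>R vec a + t *\<^sub>R vec c"
proof -
 let ?v = "s *\<^sub>R vec a + t *\<^sub>R vec c"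
 have eq: "inner ?v (b n) = s * a n + t * c n" for n by (simp add: inner_add_left inner_vec assms)
 show "sq (\<lambda>n. s * a n + t * c n)" using sq_inner[of ?v] unfolding eq .
 have "vec (\<lambda>n. inner ?v (b n)) = ?v"
  by (rule vec_inner) (simp add: E_vec assms linear_add linear_cmul bounded_linear.linear[OF E_linear])
 thus "vec (\<lambda>n. s * a n + t * c n) = ?v" unfolding eq .
qed

lemma vec_diff: "sq a ==> sq c ==> sq (\<lambda>n. a n - c n) \<and> vec (\<lambda>n. a n - c n) = vec a - vec c"
 using vec_lin[of a c 1 "-1"] by simp

lemma vec_bounded_mult:
 assumes "sq a" "\<And>n. \<bar>m n\<bar> \<le> B"
 shows "sq (\<lambda>n. m n * a n)" "norm (vec (\<lambda>n. m n * a n)) \<le> B * norm (vec a)"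
proof -
 have B0: "B \<ge> 0" using assms(2)[of 0] by simp
 have le: "(m n * a n)\<^sup>2 \<le> B\<^sup>2 * (a n)\<^sup>2" for n
  using power_mono[OF assms(2) abs_ge_zero, of n 2] by (simp add: power_mult_distrib mult_right_mono)
 show s: "sq (\<lambda>n. m n * a n)"
  by (rule summable_comparison_test[OF _ summable_mult[OF assms(1), of "B\<^sup>2"]]) (use le in auto)
 have "(norm (vec (\<lambda>n. m n * a n)))\<^sup>2 \<le> B\<^sup>2 * (norm (vec a))\<^sup>2"
  unfolding norm_vec[OF s] norm_vec[OF assms(1)] suminf_mult[OF assms(1), symmetric]
  by (rule suminf_le[OF le s summable_mult[OF assms(1)]])
 thus "norm (vec (\<lambda>n. m n * a n)) \<le> B * norm (vec a)"
  using B0 power2_le_imp_le[of "norm (vec (\<lambda>n. m n * a n))" "B * norm (vec a)"] by (simp only: power_mult_distrib mult_nonneg_nonneg norm_ge_zero simp_thms)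
qed

lemma norm_vec_dual:
 assumes "B \<ge> 0" "\<And>N h. \<bar>\<Sum>n<N. h n * x n\<bar> \<le> B * sqrt (\<Sum>n<N. (h n)\<^sup>2)"
 shows "sq x" "norm (vec x) \<le> B"
 using sq_dual[OF assms] norm_vec[of x] power2_le_imp_le[of "norm (vec x)" B] assms(1) by auto

text \<open>A continuous curve of square summable sequences, seen in the Hilbert space. Square
  summability is demanded explicitly, because \<open>vec\<close> represents a sequence only
  then.\<close>

definition sqcurve :: "real => (real => nat => real) => bool" where
 "sqcurve T a \<longleftrightarrow> (\<forall>t\<in>{0..T}. sq (a t)) \<and> cont T (\<lambda>t. vec (a t))"

lemma sqcurve_lin:
 assumes "sqcurve T a" "sqcurve T c"
 shows "sqcurve T (\<lambda>t n. r * a t n + s * c t n)"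
proof -
 have "cont T (\<lambda>t. r *\<^sub>R vec (a t) + s *\<^sub>R vec (c t))"
  using assms by (intro continuous_intros) (auto simp: sqcurve_def)
 hence "cont T (\<lambda>t. vec (\<lambda>n. r * a t n + s * c t n))"
  by (rule continuous_on_eq) (use assms vec_lin(2) in \<open>auto simp: sqcurve_def\<close>)
 thus ?thesis using assms vec_lin(1) by (auto simp: sqcurve_def)
qed

lemma sqcurve_const: "sq a ==> sqcurve T (\<lambda>t. a)" by (simp add: sqcurve_def)

text \<open>The way back from the rotating frame. The multipliers are continuous in t for each n but
  not uniformly in n; acting on one fixed square summable sequence they are handled by dominated
  convergence of the series (Tannery).\<close>

lemma sqcurve_mult:
 assumes a: "sqcurve T a" and m: "\<And>t n. \<bar>m t n\<bar> \<le> 1" and mc: "\<And>n. cont T (\<lambda>t. m t n)"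
 shows "sqcurve T (\<lambda>t n. m t n * a t n)" unfolding sqcurve_def
proof (intro conjI ballI)
 have sa: "sq (a t)" if "t \<in> {0..T}" for t using a that by (simp add: sqcurve_def)
 show sma: "sq (\<lambda>n. m t n * a t n)" if "t \<in> {0..T}" for t by (rule vec_bounded_mult(1)[OF sa[OF that] m])
 show "cont T (\<lambda>t. vec (\<lambda>n. m t n * a t n))" unfolding continuous_on_def
 proof
  fix t assume t: "t \<in> {0..T}"
  let ?F = "at t within {0..T}"
  \<comment> \<open>The increment of \<open>a\<close> is taken under the bounded multiplier at s,
    and the increment of the multiplier acts on the fixed sequence \<open>a t\<close>.\<close>
  have le: "norm (vec (\<lambda>n. m s n * a s n) - vec (\<lambda>n. m t n * a t n))
    \<le> norm (vec (a s) - vec (a t)) + sqrt (\<Sum>n. ((m s n - m t n) * a t n)\<^sup>2)" if s: "s \<in> {0..T}" for s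
  proof -
   have d: "\<bar>m s n - m t n\<bar> \<le> 2" for n using m[of s n] m[of t n] by linarith
   have d1: "sq (\<lambda>n. a s n - a t n)" using vec_diff sa s t by blast
   have s1: "sq (\<lambda>n. m s n * (a s n - a t n))" "sq (\<lambda>n. (m s n - m t n) * a t n)"
    using vec_bounded_mult(1)[OF d1 m] vec_bounded_mult(1)[OF sa[OF t] d] by auto
   have "vec (\<lambda>n. m s n * a s n) - vec (\<lambda>n. m t n * a t n) = vec (\<lambda>n. m s n * (a s n - a t n)) + vec (\<lambda>n. (m s n - m t n) * a t n)"
    using vec_lin(2)[OF s1, of 1 1] vec_diff[OF sma[OF s] sma[OF t]] by (simp add: algebra_simps)
   hence "norm (vec (\<lambda>n. m s n * a s n) - vec (\<lambda>n. m t n * a t n))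
     \<le> norm (vec (\<lambda>n. m s n * (a s n - a t n))) + norm (vec (\<lambda>n. (m s n - m t n) * a t n))"
    by (simp add: norm_triangle_ineq)
   moreover have "norm (vec (\<lambda>n. m s n * (a s n - a t n))) \<le> norm (vec (a s) - vec (a t))"
    using vec_bounded_mult(2)[OF d1 m[of s]] vec_diff[OF sa[OF s] sa[OF t]] by simp
   moreover have "norm (vec (\<lambda>n. (m s n - m t n) * a t n)) = sqrt (\<Sum>n. ((m s n - m t n) * a t n)\<^sup>2)"
    using norm_vec[OF s1(2)] by (metis norm_ge_zero real_sqrt_unique)
   ultimately show ?thesis by linarith
  qed
  have "((\<lambda>s. \<Sum>n. ((m s n - m t n) * a t n)\<^sup>2) \<longlongrightarrow> (\<Sum>n. ((m t n - m t n) * a t n)\<^sup>2)) ?F"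
  proof (cases "?F = bot")
   case False
   show ?thesis
   proof (rule tannerys_theorem[THEN conjunct2, THEN conjunct2])
    show "((\<lambda>s. ((m s n - m t n) * a t n)\<^sup>2) \<longlongrightarrow> ((m t n - m t n) * a t n)\<^sup>2) ?F" for n
     using mc[of n] t by (intro tendsto_intros) (auto simp: continuous_on_def)
    have "norm (((m s n - m t n) * a t n)\<^sup>2) \<le> 4 * (a t n)\<^sup>2" for s n
    proof -
     have "\<bar>m s n - m t n\<bar> \<le> 2" using m[of s n] m[of t n] by linarith
     from power_mono[OF this abs_ge_zero, of 2] show ?thesis by (simp add: power_mult_distrib mult_right_mono)
    qed
    thus "\<forall>\<^sub>F (n, s) in sequentially \<times>\<^sub>F ?F. norm (((m s n - m t n) * a t n)\<^sup>2) \<le> 4 * (a t n)\<^sup>2"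
     by (intro always_eventually) (simp add: split_beta)
    show "summable (\<lambda>n. 4 * (a t n)\<^sup>2)" by (intro summable_mult sa t)
   qed (rule False)
  qed simp
  hence "((\<lambda>s. norm (vec (a s) - vec (a t)) + sqrt (\<Sum>n. ((m s n - m t n) * a t n)\<^sup>2)) \<longlongrightarrow> norm (vec (a t) - vec (a t)) + sqrt (\<Sum>n. ((m t n - m t n) * a t n)\<^sup>2)) ?F"
   using a t by (intro tendsto_intros) (auto simp: sqcurve_def continuous_on_def)
  hence "((\<lambda>s. norm (vec (a s) - vec (a t)) + sqrt (\<Sum>n. ((m s n - m t n) * a t n)\<^sup>2)) \<longlongrightarrow> 0) ?F" by simp
  hence "((\<lambda>s. vec (\<lambda>n. m s n * a s n) - vec (\<lambda>n. m t n * a t n)) \<longlongrightarrow> 0) ?F"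
   by (rule Lim_null_comparison[rotated]) (use le in \<open>auto simp: eventually_at_filter intro!: always_eventually\<close>)
  thus "((\<lambda>s. vec (\<lambda>n. m s n * a s n)) \<longlongrightarrow> vec (\<lambda>n. m t n * a t n)) ?F" by (rule LIM_zero_cancel)
 qed
qed

lemma sqcurve_coeff: "sqcurve T a ==> cont T (\<lambda>t. a t n)"
proof -
 assume a: "sqcurve T a"
 hence "cont T (\<lambda>t. inner (vec (a t)) (b n))" by (intro continuous_intros) (simp add: sqcurve_def)
 thus ?thesis by (rule continuous_on_eq) (use a in \<open>simp add: sqcurve_def inner_vec\<close>)
qed

text \<open>The primitive is formed in the Hilbert space and compared with \<open>Z\<close>
  coefficient by coefficient; this makes coordinatewise primitives differentiable in norm.\<close>

lemma sqcurve_derivative: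
 assumes z: "sqcurve T z" and Z0: "sq (Z 0)"
  and d: "\<And>t n. t \<in> {0..T} ==> Z t n = Z 0 n + integral {0..t} (\<lambda>s. z s n)" and t: "t \<in> {0..T}"
 shows "sq (Z t)" "((\<lambda>s. vec (Z s)) has_vector_derivative vec (z t)) (at t within {0..T})" "sqcurve T Z"
proof -
 have cz: "cont T (\<lambda>t. vec (z t))" and sz: "\<And>t. t \<in> {0..T} ==> sq (z t)" using z by (auto simp: sqcurve_def)
 define W where "W \<equiv> \<lambda>t. vec (Z 0) + integral {0..t} (\<lambda>s. vec (z s))"
 have iz: "(\<lambda>s. vec (z s)) integrable_on {0..s}" if "s \<le> T" for s
  by (rule integrable_continuous_real) (rule continuous_on_subset[OF cz], use that in auto)
 have W: "inner (W s) (b n) = Z s n" "E (W s) = W s" if s: "s \<in> {0..T}" for s n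
 proof -
  have "integral {0..s} ((\<lambda>x. inner x (b n)) \<circ> (\<lambda>s. vec (z s))) = inner (integral {0..s} (\<lambda>s. vec (z s))) (b n)"
   by (rule integral_linear[OF iz bounded_linear_inner_left]) (use s in simp)
  moreover have "integral {0..s} ((\<lambda>x. inner x (b n)) \<circ> (\<lambda>s. vec (z s))) = integral {0..s} (\<lambda>s. z s n)"
   by (rule integral_cong) (use s sz in \<open>auto simp: inner_vec\<close>)
  ultimately show "inner (W s) (b n) = Z s n" using d[OF s, of n] by (simp add: W_def inner_add_left inner_vec Z0)
  have "integral {0..s} (E \<circ> (\<lambda>s. vec (z s))) = E (integral {0..s} (\<lambda>s. vec (z s)))"
   by (rule integral_linear[OF iz E_linear]) (use s in simp)
  moreover have "integral {0..s} (E \<circ> (\<lambda>s. vec (z s))) = integral {0..s} (\<lambda>s. vec (z s))"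
   by (rule integral_cong) (use s sz in \<open>auto simp: E_vec\<close>)
  ultimately show "E (W s) = W s" by (simp add: W_def linear_add[OF bounded_linear.linear[OF E_linear]] E_vec Z0)
 qed
 have eq: "sq (Z s) \<and> vec (Z s) = W s" if s: "s \<in> {0..T}" for s
  using sq_inner[of "W s"] vec_inner[OF W(2)[OF s]] W(1)[OF s] by simp
 show "sq (Z t)" using eq[OF t] by blast
 have "((\<lambda>s. vec (Z 0) + integral {0..s} (\<lambda>s. vec (z s))) has_vector_derivative 0 + vec (z t)) (at t within {0..T})"
  by (intro has_vector_derivative_add has_vector_derivative_const integral_has_vector_derivative[OF cz t])
 hence "(W has_vector_derivative vec (z t)) (at t within {0..T})" by (simp add: W_def)
 thus "((\<lambda>s. vec (Z s)) has_vector_derivative vec (z t)) (at t within {0..T})"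
  by (rule has_vector_derivative_transform[OF t, rotated]) (use eq in simp)
 have "cont T W" unfolding W_def by (intro continuous_intros indefinite_integral_continuous_1 iz) simp
 hence "cont T (\<lambda>s. vec (Z s))" by (rule continuous_on_eq) (use eq in simp)
 thus "sqcurve T Z" using eq by (simp add: sqcurve_def)
qed

lemma sqcurveI_dual:
 fixes H r :: rfun
 assumes H: "cont T H" and r: "continuous_on UNIV r" "r 0 = 0" "\<And>x. x \<ge> 0 ==> r x \<ge> (0::real)" and Z0: "sq (Z 0)"
  and le: "\<And>s t N h. 0 \<le> s ==> s \<le> t ==> t \<le> T ==>
   \<bar>\<Sum>n<N. h n * (Z t n - Z s n)\<bar> \<le> r \<bar>H t - H s\<bar> * sqrt (\<Sum>n<N. (h n)\<^sup>2)"
 shows "sqcurve T Z"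
proof -
 have d: "sq (\<lambda>n. Z t n - Z s n)" "norm (vec (\<lambda>n. Z t n - Z s n)) \<le> r \<bar>H t - H s\<bar>" if "0 \<le> s" "s \<le> t" "t \<le> T" for s t
  using norm_vec_dual[OF r(3)[OF abs_ge_zero] le[OF that]] by auto
 have s: "sq (Z t)" if "t \<in> {0..T}" for t using vec_lin(1)[OF d(1)[of 0 t] Z0, of 1 1] that by simp
 have d': "norm (vec (Z t) - vec (Z s)) \<le> r \<bar>H t - H s\<bar>" if "s \<in> {0..T}" "t \<in> {0..T}" for s t
  using d(2)[of s t] d(2)[of t s] vec_diff[OF s s, of t s] vec_diff[OF s s, of s t] that
  by (cases "s \<le> t") (auto simp: norm_minus_commute abs_minus_commute)
 have "cont T (\<lambda>t. vec (Z t))" unfolding continuous_on_def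
 proof
  fix t assume t: "t \<in> {0..T}"
  have "((\<lambda>s. \<bar>H s - H t\<bar>) \<longlongrightarrow> \<bar>H t - H t\<bar>) (at t within {0..T})"
   using H t by (intro tendsto_intros) (auto simp: continuous_on_def)
  hence "((\<lambda>s. r \<bar>H s - H t\<bar>) \<longlongrightarrow> r \<bar>H t - H t\<bar>) (at t within {0..T})"
   by (rule continuous_on_tendsto_compose[OF r(1)]) auto
  hence "((\<lambda>s. r \<bar>H s - H t\<bar>) \<longlongrightarrow> 0) (at t within {0..T})" by (simp add: r(2))
  hence "((\<lambda>s. vec (Z s) - vec (Z t)) \<longlongrightarrow> 0) (at t within {0..T})"
   by (rule Lim_null_comparison[rotated]) (use d' t in \<open>auto simp: eventually_at_filter intro!: always_eventually\<close>)
  thus "((\<lambda>s. vec (Z s)) \<longlongrightarrow> vec (Z t)) (at t within {0..T})" by (rule LIM_zero_cancel)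
 qed
 thus ?thesis using s by (simp add: sqcurve_def)
qed

section \<open>Variation of constants for a single mode\<close>

definition om :: "nat => real" where "om n = sqrt (lam n)"

lemma om: "om n > 0" "(om n)\<^sup>2 = lam n" "om n * om n = lam n" using eigsys(2)[of n] by (simp_all add: om_def)

lemma om_lower: "\<exists>c>0. \<forall>n. 1 / om n \<le> c"
proof -
 obtain c where c: "c > 0" "\<And>n. c \<le> lam n" using lam_lower by blast
 have "1 / om n \<le> 1 / sqrt c" for n using c om(1)[of n] by (intro divide_left_mono) (auto simp: om_def)
 thus ?thesis using c(1) by (intro exI[of _ "1 / sqrt c"]) auto
qed

text \<open>Coordinates in the rotating frame for k'' + \<omega>^2 k = g with data
  \<open>k0\<close>, \<open>k1\<close>: \<open>oa\<close> and \<open>oc\<close> are primitives of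
  the forcing. Rotating them back gives the displacement \<open>ok\<close> and the velocity divided
  by \<omega>, \<open>od\<close>.\<close>

definition oa :: "real => real => rfun => rfun" where
 "oa \<omega> k0 g t = k0 - integral {0..t} (\<lambda>s. sin (\<omega> * s) * g s) / \<omega>"
definition oc :: "real => real => rfun => rfun" where
 "oc \<omega> k1 g t = k1 / \<omega> + integral {0..t} (\<lambda>s. cos (\<omega> * s) * g s) / \<omega>"
definition ok :: "real => real => real => rfun => rfun" where
 "ok \<omega> k0 k1 g t = cos (\<omega> * t) * oa \<omega> k0 g t + sin (\<omega> * t) * oc \<omega> k1 g t"
definition od :: "real => real => real => rfun => rfun" where
 "od \<omega> k0 k1 g t = - sin (\<omega> * t) * oa \<omega> k0 g t + cos (\<omega> * t) * oc \<omega> k1 g t"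

lemma oscillator:
 assumes \<omega>: "\<omega> > 0" and g: "g AI {0..T}" and t: "t \<in> {0..T}"
 shows "ok \<omega> k0 k1 g t = k0 + integral {0..t} (\<lambda>s. \<omega> * od \<omega> k0 k1 g s)"
  "\<omega> * od \<omega> k0 k1 g t = k1 + integral {0..t} (\<lambda>s. g s - \<omega>\<^sup>2 * ok \<omega> k0 k1 g s)"
  "cont T (ok \<omega> k0 k1 g)" "cont T (od \<omega> k0 k1 g)"
proof -
 let ?s = "\<lambda>t. sin (\<omega> * t)" and ?c = "\<lambda>t. cos (\<omega> * t)" and ?a = "oa \<omega> k0 g" and ?e = "oc \<omega> k1 g"
 have cs: "continuous_on S ?s" "continuous_on S ?c" for S by (intro continuous_intros)+
 have gs: "(\<lambda>s. ?s s * g s) AI {0..T}" "(\<lambda>s. ?c s * g s) AI {0..T}"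
  by (rule abs_int_mult_continuous(2)[OF g cs(1)], rule abs_int_mult_continuous(2)[OF g cs(2)])
 have ia: "(\<lambda>s. - (?s s * g s) / \<omega>) AI {0..T}" "(\<lambda>s. (?c s * g s) / \<omega>) AI {0..T}"
  using set_integrable_mult_right[of "- inverse \<omega>", OF gs(1)] set_integrable_mult_right[of "inverse \<omega>", OF gs(2)]
  by (simp_all add: divide_inverse mult_ac)
 have A: "?a t = ?a 0 + integral {0..t} (\<lambda>s. - (?s s * g s) / \<omega>)" for t by (simp add: oa_def)
 have C: "?e t = ?e 0 + integral {0..t} (\<lambda>s. (?c s * g s) / \<omega>)" for t by (simp add: oc_def)
 have ist: "(\<lambda>s. \<omega> * ?c s) AI {0..T}" "(\<lambda>s. - (\<omega> * ?s s)) AI {0..T}"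
  by (intro absolutely_integrable_continuous_real continuous_intros)+
 have S: "?s t = ?s 0 + integral {0..t} (\<lambda>s. \<omega> * ?c s)" if "t \<in> {0..T}" for t
  by (rule deriv_imp_integral[OF _ that]) (auto intro!: derivative_eq_intros)
 have Co: "?c t = ?c 0 + integral {0..t} (\<lambda>s. - (\<omega> * ?s s))" if "t \<in> {0..T}" for t
  by (rule deriv_imp_integral[OF _ that]) (auto intro!: derivative_eq_intros)
 have a0: "?a 0 = k0" "?e 0 = k1 / \<omega>" by (simp_all add: oa_def oc_def)
 note p1 = integral_parts[OF ist(2) ia(1) Co A t] and p2 = integral_parts[OF ist(1) ia(2) S C t]
  and p3 = integral_parts[OF ist(1) ia(1) S A t] and p4 = integral_parts[OF ist(2) ia(2) Co C t]
 have i: "(\<lambda>s. - (\<omega> * ?s s) * ?a s + ?c s * (- (?s s * g s) / \<omega>)) integrable_on {0..t}"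
  "(\<lambda>s. \<omega> * ?c s * ?e s + ?s s * ((?c s * g s) / \<omega>)) integrable_on {0..t}"
  "(\<lambda>s. \<omega> * ?c s * ?a s + ?s s * (- (?s s * g s) / \<omega>)) integrable_on {0..t}"
  "(\<lambda>s. - (\<omega> * ?s s) * ?e s + ?c s * ((?c s * g s) / \<omega>)) integrable_on {0..t}"
  using t by (intro hk abs_int_sub[OF p1(2)] abs_int_sub[OF p2(2)] abs_int_sub[OF p3(2)] abs_int_sub[OF p4(2)]; simp)+
 have "ok \<omega> k0 k1 g t - k0 = integral {0..t} (\<lambda>s. (- (\<omega> * ?s s) * ?a s + ?c s * (- (?s s * g s) / \<omega>)) + (\<omega> * ?c s * ?e s + ?s s * ((?c s * g s) / \<omega>)))"
  using p1(1) p2(1) a0 unfolding hk_add[OF i(1,2)] by (simp add: ok_def)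
 also have "\<dots> = integral {0..t} (\<lambda>s. \<omega> * od \<omega> k0 k1 g s)"
  by (rule integral_cong) (simp add: od_def algebra_simps)
 finally show "ok \<omega> k0 k1 g t = k0 + integral {0..t} (\<lambda>s. \<omega> * od \<omega> k0 k1 g s)" by simp
 have "od \<omega> k0 k1 g t - k1 / \<omega> = integral {0..t} (\<lambda>s. (- (\<omega> * ?s s) * ?e s + ?c s * ((?c s * g s) / \<omega>)) - (\<omega> * ?c s * ?a s + ?s s * (- (?s s * g s) / \<omega>)))"
  using p3(1) p4(1) a0 unfolding hk_diff[OF i(4,3)] by (simp add: od_def)
 also have "\<dots> = integral {0..t} (\<lambda>s. (1 / \<omega>) * (g s - \<omega>\<^sup>2 * ok \<omega> k0 k1 g s))"
 proof (rule integral_cong)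
  fix s
  \<comment> \<open>The derivatives of the two coordinates combine through sin^2 + cos^2 = 1, which
    restores the forcing \<open>g\<close>.\<close>
  have "?c s * ((?c s * g s) / \<omega>) + ?s s * ((?s s * g s) / \<omega>) = ((?s s)\<^sup>2 + (?c s)\<^sup>2) * g s / \<omega>"
   by (simp only: power2_eq_square divide_inverse algebra_simps)
  also have "\<dots> = g s / \<omega>" by simp
  finally have *: "?c s * ((?c s * g s) / \<omega>) + ?s s * ((?s s * g s) / \<omega>) = g s / \<omega>" .
  have "(- (\<omega> * ?s s) * ?e s + ?c s * ((?c s * g s) / \<omega>)) - (\<omega> * ?c s * ?a s + ?s s * (- (?s s * g s) / \<omega>))
    = (?c s * ((?c s * g s) / \<omega>) + ?s s * ((?s s * g s) / \<omega>)) - \<omega> * ok \<omega> k0 k1 g s"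
   by (simp add: ok_def algebra_simps)
  also have "\<dots> = (1 / \<omega>) * (g s - \<omega>\<^sup>2 * ok \<omega> k0 k1 g s)"
   unfolding * using \<omega> by (simp add: field_simps power2_eq_square)
  finally show "(- (\<omega> * ?s s) * ?e s + ?c s * ((?c s * g s) / \<omega>)) - (\<omega> * ?c s * ?a s + ?s s * (- (?s s * g s) / \<omega>))
    = (1 / \<omega>) * (g s - \<omega>\<^sup>2 * ok \<omega> k0 k1 g s)" .
 qed
 finally have "\<omega> * (od \<omega> k0 k1 g t - k1 / \<omega>) = \<omega> * ((1 / \<omega>) * integral {0..t} (\<lambda>s. g s - \<omega>\<^sup>2 * ok \<omega> k0 k1 g s))"
  by simp
 thus "\<omega> * od \<omega> k0 k1 g t = k1 + integral {0..t} (\<lambda>s. g s - \<omega>\<^sup>2 * ok \<omega> k0 k1 g s)"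
  using \<omega> by (simp add: algebra_simps)
 show "cont T (ok \<omega> k0 k1 g)" "cont T (od \<omega> k0 k1 g)"
  unfolding ok_def od_def using p1(4) p2(4) by (intro continuous_intros; simp)+
qed

section \<open>Curves of coefficients in the rotating frame\<close>

lemma sqcurve_rotate:
 assumes "sqcurve T a" "sqcurve T c"
 shows "sqcurve T (\<lambda>t n. cos (om n * t) * a t n + sin (om n * t) * c t n)"
  "sqcurve T (\<lambda>t n. - sin (om n * t) * a t n + cos (om n * t) * c t n)"
proof -
 have 1: "sqcurve T (\<lambda>t n. cos (om n * t) * v t n)" "sqcurve T (\<lambda>t n. sin (om n * t) * v t n)" if "sqcurve T v" for v
  by (intro sqcurve_mult that continuous_intros; simp)+
 show "sqcurve T (\<lambda>t n. cos (om n * t) * a t n + sin (om n * t) * c t n)"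
  using sqcurve_lin[OF 1(1)[OF assms(1)] 1(2)[OF assms(2)], of 1 1] by simp
 show "sqcurve T (\<lambda>t n. - sin (om n * t) * a t n + cos (om n * t) * c t n)"
  using sqcurve_lin[OF 1(2)[OF assms(1)] 1(1)[OF assms(2)], of "-1" 1] by simp
qed

text \<open>For each \<open>n\<close> the two components are those of a rotation of \<open>(a n, c n)\<close>.\<close>

lemma norm_rotate:
 fixes x :: "nat => real"
 assumes "sq a" "sq c"
 shows "norm (vec (\<lambda>n. cos (x n) * a n + sin (x n) * c n)) \<le> norm (vec a) + norm (vec c)"
  "norm (vec (\<lambda>n. - sin (x n) * a n + cos (x n) * c n)) \<le> norm (vec a) + norm (vec c)"
proof -
 have *: "norm (vec (\<lambda>n. m n * a n + l n * c n)) \<le> norm (vec a) + norm (vec c)"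
  if "\<And>n. \<bar>m n\<bar> \<le> 1" "\<And>n. \<bar>l n\<bar> \<le> 1" for m l :: "nat => real"
 proof -
  note m = vec_bounded_mult[where m=m, OF assms(1) that(1)] and l = vec_bounded_mult[where m=l, OF assms(2) that(2)]
  show ?thesis using vec_lin(2)[OF m(1) l(1), where s=1 and t=1] m(2) l(2)
    norm_triangle_ineq[of "vec (\<lambda>n. m n * a n)" "vec (\<lambda>n. l n * c n)"] by simp
 qed
 show "norm (vec (\<lambda>n. cos (x n) * a n + sin (x n) * c n)) \<le> norm (vec a) + norm (vec c)"
  "norm (vec (\<lambda>n. - sin (x n) * a n + cos (x n) * c n)) \<le> norm (vec a) + norm (vec c)" by (rule *; simp)+
qed

text \<open>One argument for both kinds of forcing: \<open>r\<close> is the identity and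
  \<open>X\<close> the norm for a distributed source, while \<open>r\<close> is a multiple of the
  square root and \<open>X\<close> is \<open>\<theta>^2\<close> for a boundary control.\<close>

lemma integral_curves:
 fixes X r :: rfun
 assumes f: "\<And>n. f n AI {0..T}" and X: "X AI {0..T}" "\<And>t. X t \<ge> 0"
  and r: "continuous_on UNIV r" "r 0 = 0" "\<And>x y. 0 \<le> x ==> x \<le> y ==> r x \<le> r y"
  and le: "\<And>s t N h. 0 \<le> s ==> s \<le> t ==> t \<le> T ==>
   \<bar>integral {s..t} (\<lambda>x. \<Sum>n<N. h n * f n x)\<bar> \<le> r (integral {s..t} X) * sqrt (\<Sum>n<N. (h n)\<^sup>2)"
 shows "sqcurve T (\<lambda>t n. integral {0..t} (f n))"
  and "t \<in> {0..T} ==> norm (vec (\<lambda>n. integral {0..t} (f n))) \<le> r (integral {0..T} X)"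
proof -
 let ?Z = "\<lambda>t n. integral {0..t} (f n)"
 have comb: "integral {0..s} g + integral {s..t} g = integral {0..t} g"
  if "g AI {0..T}" "0 \<le> s" "s \<le> t" "t \<le> T" for g :: rfun and s t
  by (rule hk_combine) (use that hk[OF abs_int_sub[OF that(1), of 0 t]] in auto)
 have X0: "integral {s..t} X \<ge> 0" if "0 \<le> s" "t \<le> T" for s t
  by (rule hk_nonneg) (use X(2) hk[OF abs_int_sub[OF X(1)]] that in auto)
 have r0: "0 \<le> r x" if "0 \<le> x" for x using r(2) r(3)[of 0 x] that by simp
 have key: "\<bar>\<Sum>n<N. h n * (?Z t n - ?Z s n)\<bar> \<le> r (integral {s..t} X) * sqrt (\<Sum>n<N. (h n)\<^sup>2)"
  if st: "0 \<le> s" "s \<le> t" "t \<le> T" for s t h and N :: nat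
 proof -
  have "(\<Sum>n<N. h n * (?Z t n - ?Z s n)) = (\<Sum>n<N. integral {s..t} (\<lambda>x. h n * f n x))"
   by (intro sum.cong refl) (simp add: comb[OF f st, symmetric])
  also have "\<dots> = integral {s..t} (\<lambda>x. \<Sum>n<N. h n * f n x)"
   by (rule integral_sum[symmetric]) (auto intro!: integrable_on_mult_right hk abs_int_sub[OF f] st)
  finally show ?thesis using le[OF st] by simp
 qed
 show "sqcurve T ?Z"
 proof (rule sqcurveI_dual[OF indefinite_continuous[OF X(1)], of "\<lambda>x. r \<bar>x\<bar>"])
  show "continuous_on UNIV (\<lambda>x. r \<bar>x\<bar>)" by (rule continuous_on_compose2[OF r(1)]) (auto intro!: continuous_intros)
  fix s t h and N :: nat assume st: "0 \<le> s" "s \<le> t" "t \<le> T"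
  have "integral {s..t} X = \<bar>integral {0..t} X - integral {0..s} X\<bar>" using comb[OF X(1) st] X0[OF st(1,3)] by simp
  thus "\<bar>\<Sum>n<N. h n * (?Z t n - ?Z s n)\<bar> \<le> r \<bar>\<bar>integral {0..t} X - integral {0..s} X\<bar>\<bar> * sqrt (\<Sum>n<N. (h n)\<^sup>2)"
   using key[OF st] by simp
 qed (use r r0 in simp_all)
 show "norm (vec (?Z t)) \<le> r (integral {0..T} X)" if t: "t \<in> {0..T}"
 proof (rule norm_vec_dual(2)[OF r0])
  fix N :: nat and h
  have "r (integral {0..t} X) \<le> r (integral {0..T} X)" using comb[OF X(1), of t T] X0[of t T] X0[of 0 t] t by (intro r(3)) auto
  hence "r (integral {0..t} X) * sqrt (\<Sum>n<N. (h n)\<^sup>2) \<le> r (integral {0..T} X) * sqrt (\<Sum>n<N. (h n)\<^sup>2)"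
   by (intro mult_right_mono) (auto intro: sum_nonneg)
  thus "\<bar>\<Sum>n<N. h n * ?Z t n\<bar> \<le> r (integral {0..T} X) * sqrt (\<Sum>n<N. (h n)\<^sup>2)"
   using key[of 0 t h N] t by simp
 qed (use X0[of 0 T] in simp)
qed

lemma source_curves:
 assumes f: "\<And>n. f n AI {0..T}" and X: "X AI {0..T}"
  and le: "\<And>t. t \<in> {0..T} ==> sq (\<lambda>n. f n t) \<and> (\<Sum>n. (f n t)\<^sup>2) \<le> (X t)\<^sup>2" "\<And>t. X t \<ge> 0"
  and c: "\<And>n. cont T (c n)" "\<And>n t. \<bar>c n t\<bar> \<le> 1"
 shows "sqcurve T (\<lambda>t n. integral {0..t} (\<lambda>s. c n s * f n s))"
proof (rule integral_curves(1)[OF _ X le(2) continuous_on_id])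
 show cf: "(\<lambda>s. c n s * f n s) AI {0..T}" for n by (rule abs_int_mult_continuous(2)[OF f c(1)])
 fix s t h and N :: nat assume st: "0 \<le> s" "s \<le> t" "t \<le> T"
 have "norm (integral {s..t} (\<lambda>r. \<Sum>n<N. h n * (c n r * f n r))) \<le> integral {s..t} (\<lambda>r. X r * sqrt (\<Sum>n<N. (h n)\<^sup>2))"
 proof (rule integral_norm_bound_integral)
  show "(\<lambda>r. \<Sum>n<N. h n * (c n r * f n r)) integrable_on {s..t}"
   by (intro integrable_sum integrable_on_mult_right hk abs_int_sub[OF cf] st) auto
  show "(\<lambda>r. X r * sqrt (\<Sum>n<N. (h n)\<^sup>2)) integrable_on {s..t}"
   by (intro integrable_on_mult_left hk abs_int_sub[OF X] st)
  fix r assume "r \<in> {s..t}"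
  hence r: "r \<in> {0..T}" using st by auto
  have "norm (\<Sum>n<N. h n * (c n r * f n r)) \<le> (\<Sum>n<N. \<bar>h n\<bar> * \<bar>f n r\<bar>)"
  proof (rule sum_norm_le)
   fix n show "norm (h n * (c n r * f n r)) \<le> \<bar>h n\<bar> * \<bar>f n r\<bar>"
    using mult_right_mono[OF c(2)[of n r], of "\<bar>h n\<bar> * \<bar>f n r\<bar>"] by (simp add: abs_mult mult_ac)
  qed
  also have "\<dots> \<le> sqrt (\<Sum>n<N. (h n)\<^sup>2) * sqrt (\<Sum>n<N. (f n r)\<^sup>2)"
   using L2_set_mult_ineq[of h "\<lambda>n. f n r" "{..<N}"] by (simp add: L2_set_def)
  also have "\<dots> \<le> sqrt (\<Sum>n<N. (h n)\<^sup>2) * X r"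
  proof (intro mult_left_mono real_le_lsqrt le(2))
   have "(\<Sum>n<N. (f n r)\<^sup>2) \<le> (\<Sum>n. (f n r)\<^sup>2)" using le(1)[OF r] by (intro sum_le_suminf) auto
   thus "(\<Sum>n<N. (f n r)\<^sup>2) \<le> (X r)\<^sup>2" using le(1)[OF r] by simp
  qed (auto intro: sum_nonneg)
  finally show "norm (\<Sum>n<N. h n * (c n r * f n r)) \<le> X r * sqrt (\<Sum>n<N. (h n)\<^sup>2)" by (simp only: mult.commute)
 qed
 thus "\<bar>integral {s..t} (\<lambda>x. \<Sum>n<N. h n * (c n x * f n x))\<bar> \<le> integral {s..t} X * sqrt (\<Sum>n<N. (h n)\<^sup>2)" by simp
qed simp_all

text \<open>Duality in time: testing with \<open>h\<close> pairs \<theta> with the flux at L of a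
  free motion whose energy is the sum of the \<open>(h n)^2\<close>, and that flux is bounded in
  L2(0,T) by hidden regularity.\<close>

lemma boundary_curves:
 assumes T: "T \<ge> 0" and \<theta>: "\<theta> \<in> L2_space T"
  and c: "\<And>h N. integral {0..T} (\<lambda>t. (\<Sum>n<N. h n * (c n t * p n L))\<^sup>2) \<le> hidden_const T * (\<Sum>n<N. (h n)\<^sup>2)"
   "\<And>n. cont T (c n)"
 shows "sqcurve T (\<lambda>t n. integral {0..t} (\<lambda>s. c n s * (\<theta> s * p n L)))"
  and "t \<in> {0..T} ==> norm (vec (\<lambda>n. integral {0..t} (\<lambda>s. c n s * (\<theta> s * p n L)))) \<le> sqrt (hidden_const T) * L2_norm T \<theta>"
proof -
 let ?C = "sqrt (hidden_const T)"
 have th: "\<theta> AI {0..T}" using L2_integrable[OF \<theta>] by (simp add: integrable_on_iff)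
 have th2: "(\<lambda>t. (\<theta> t)\<^sup>2) AI {0..T}" using \<theta> by (simp add: L2_space_def integrable_on_iff)
 have cf: "(\<lambda>s. c n s * (\<theta> s * p n L)) AI {0..T}" for n
  using abs_int_mult_continuous(2)[OF th continuous_on_mult[OF c(2) continuous_on_const], of n "p n L"] by (simp add: mult_ac)
 have C0: "?C \<ge> 0" using hidden_const_nonneg[OF T] by simp
 have key: "\<bar>integral {s..t} (\<lambda>r. \<Sum>n<N. h n * (c n r * (\<theta> r * p n L)))\<bar> \<le> ?C * sqrt (integral {s..t} (\<lambda>r. (\<theta> r)\<^sup>2)) * sqrt (\<Sum>n<N. (h n)\<^sup>2)"
  if st: "0 \<le> s" "s \<le> t" "t \<le> T" for s t N h
 proof -
  let ?g = "\<lambda>r. \<Sum>n<N. h n * (c n r * p n L)"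
  have cg: "cont T ?g" by (intro continuous_intros c(2))
  have "?g \<in> meas T" by (intro continuous_imp_measurable_on_sets_lebesgue continuous_on_subset[OF cg]) auto
  hence gL: "?g \<in> L2_space T"
   unfolding L2_space_def integrable_on_iff by (auto intro!: absolutely_integrable_continuous_real continuous_intros c(2))
  \<comment> \<open>Truncating the control to [s,t], not the flux, gives smallness in t - s while
    the trace bound is used on all of [0,T].\<close>
  define \<theta>' where "\<theta>' \<equiv> \<lambda>r. indicator {s..t} r * \<theta> r"
  have t'm: "\<theta>' \<in> meas T" unfolding \<theta>'_def using L2_measurable[OF \<theta>]
   by (intro borel_measurable_times measurable_restrict_space1[OF borel_measurable_indicator]) auto
  have "integrable (leb T) (\<lambda>r. (\<theta>' r)\<^sup>2)"
   by (rule LINT_able_bound[of _ "\<lambda>r. (\<theta> r)\<^sup>2"])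
    (use \<theta> t'm in \<open>auto simp: L2_space_def \<theta>'_def indicator_def\<close>)
  with t'm have tL: "\<theta>' \<in> L2_space T" by (simp add: L2_space_def)
  have restrict: "integral {s..t} k = integral {0..T} (\<lambda>r. indicator {s..t} r * k r)" for k :: rfun
  proof -
   have "{0..T} \<inter> {s..t} = {s..t}" "(\<lambda>r. indicator {s..t} r * k r) = (\<lambda>r. if r \<in> {s..t} then k r else 0)" using st by auto
   thus ?thesis using integral_restrict_Int[of "{0..T}" "{s..t}" k] by (simp only: Int_commute)
  qed
  have "integral {s..t} (\<lambda>r. \<Sum>n<N. h n * (c n r * (\<theta> r * p n L))) = integral {0..T} (\<lambda>r. \<theta>' r * ?g r)"
   unfolding restrict \<theta>'_def by (rule integral_cong) (simp add: sum_distrib_left mult_ac)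
  also have "\<dots> = (LINT r|leb T. \<theta>' r * ?g r)"
   by (rule LINT_eq_integral[symmetric]) (rule L2_mult_integrable[OF tL gL])
  finally have *: "\<bar>integral {s..t} (\<lambda>r. \<Sum>n<N. h n * (c n r * (\<theta> r * p n L)))\<bar> \<le> L2_norm T \<theta>' * L2_norm T ?g"
   using L2_Cauchy_Schwarz[OF tL gL] by simp
  have "L2_norm T \<theta>' = sqrt (integral {s..t} (\<lambda>r. (\<theta> r)\<^sup>2))"
  proof -
   have "(\<lambda>r. (\<theta>' r)\<^sup>2) = (\<lambda>r. indicator {s..t} r * (\<theta> r)\<^sup>2)" by (auto simp: \<theta>'_def indicator_def)
   moreover have "(LINT r|leb T. (\<theta>' r)\<^sup>2) = integral {0..T} (\<lambda>r. (\<theta>' r)\<^sup>2)"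
    by (rule LINT_eq_integral) (use tL in \<open>simp add: L2_space_def\<close>)
   ultimately show ?thesis unfolding restrict L2_norm_def by simp
  qed
  moreover have "L2_norm T ?g \<le> ?C * sqrt (\<Sum>n<N. (h n)\<^sup>2)"
   using gL c(1)[of h N] unfolding L2_norm_def real_sqrt_mult[symmetric]
   by (intro real_sqrt_le_mono) (simp add: L2_space_def LINT_eq_integral)
  ultimately have "L2_norm T \<theta>' * L2_norm T ?g \<le> sqrt (integral {s..t} (\<lambda>r. (\<theta> r)\<^sup>2)) * (?C * sqrt (\<Sum>n<N. (h n)\<^sup>2))"
   using mult_left_mono[OF _ L2_norm_ge_0, of "L2_norm T ?g" _ T \<theta>'] by (simp only:)
  with * show ?thesis by (simp only: mult_ac)
 qed
 have r: "continuous_on UNIV (\<lambda>x. ?C * sqrt x)" "\<And>x y. 0 \<le> x ==> x \<le> y ==> ?C * sqrt x \<le> ?C * sqrt y"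
  using C0 by (auto intro!: continuous_intros mult_left_mono)
 show "sqcurve T (\<lambda>t n. integral {0..t} (\<lambda>s. c n s * (\<theta> s * p n L)))"
  by (rule integral_curves(1)[where r="\<lambda>x. ?C * sqrt x", OF cf th2 _ r(1) _ r(2) key]) auto
 have "L2_norm T \<theta> = sqrt (integral {0..T} (\<lambda>r. (\<theta> r)\<^sup>2))" unfolding L2_norm_def LINT_eq_integral[OF th2[folded integrable_on_iff]] ..
 moreover have "norm (vec (\<lambda>n. integral {0..t} (\<lambda>s. c n s * (\<theta> s * p n L)))) \<le> ?C * sqrt (integral {0..T} (\<lambda>r. (\<theta> r)\<^sup>2))" if "t \<in> {0..T}"
  by (rule integral_curves(2)[where r="\<lambda>x. ?C * sqrt x", OF cf th2 _ r(1) _ r(2) key that]) auto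
 ultimately show "t \<in> {0..T} ==> norm (vec (\<lambda>n. integral {0..t} (\<lambda>s. c n s * (\<theta> s * p n L)))) \<le> ?C * L2_norm T \<theta>" by simp
qed

text \<open>These are free motions started with \<open>a n = h n / om n\<close> at rest,
  respectively from 0 with velocity \<open>h n\<close>; division by \<open>om n\<close> normalises
  the energy of each mode to \<open>(h n)^2\<close>.\<close>

lemma trig_hidden:
 assumes T: "T \<ge> 0"
 shows "integral {0..T} (\<lambda>t. (\<Sum>n<N. h n * (cos (om n * t) / om n * p n L))\<^sup>2) \<le> hidden_const T * (\<Sum>n<N. (h n)\<^sup>2)"
  "integral {0..T} (\<lambda>t. (\<Sum>n<N. h n * (sin (om n * t) / om n * p n L))\<^sup>2) \<le> hidden_const T * (\<Sum>n<N. (h n)\<^sup>2)"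
proof -
 have o: "om n \<noteq> 0" for n using om(1)[of n] by simp
 have "integral {0..T} (\<lambda>t. (\<Sum>n\<in>{..<N}. (h n * cos (om n * t) / om n) * p n L)\<^sup>2)
   \<le> hidden_const T * (\<Sum>n\<in>{..<N}. (- h n * sin (om n * 0))\<^sup>2 + lam n * (h n * cos (om n * 0) / om n)\<^sup>2)"
  by (rule hidden_regularity[OF _ T]) (use o in \<open>auto intro!: derivative_eq_intros simp: om(3)[symmetric] field_simps\<close>)
 thus "integral {0..T} (\<lambda>t. (\<Sum>n<N. h n * (cos (om n * t) / om n * p n L))\<^sup>2) \<le> hidden_const T * (\<Sum>n<N. (h n)\<^sup>2)"
  using o by (simp add: mult.assoc power_divide flip: om(2))
 have "integral {0..T} (\<lambda>t. (\<Sum>n\<in>{..<N}. (h n * sin (om n * t) / om n) * p n L)\<^sup>2)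
   \<le> hidden_const T * (\<Sum>n\<in>{..<N}. (h n * cos (om n * 0))\<^sup>2 + lam n * (h n * sin (om n * 0) / om n)\<^sup>2)"
  by (rule hidden_regularity[OF _ T]) (use o in \<open>auto intro!: derivative_eq_intros simp: om(3)[symmetric] field_simps\<close>)
 thus "integral {0..T} (\<lambda>t. (\<Sum>n<N. h n * (sin (om n * t) / om n * p n L))\<^sup>2) \<le> hidden_const T * (\<Sum>n<N. (h n)\<^sup>2)"
  by (simp add: mult.assoc)
qed

section \<open>Coefficients in the energy space and its dual\<close>

lemma norm_b: "norm (b n) = 1" by (simp add: norm_eq_sqrt_inner B.orthonormal)

lemma cf_lipschitz: "u \<in> LL ==> v \<in> LL ==> \<bar>cf n u - cf n v\<bar> \<le> NL (\<lambda>x. u x - v x)"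
 using Cauchy_Schwarz_ineq2[of "emb L u - emb L v" "b n"] norm_emb[OF L2_diff, of u L v]
 by (simp add: cf_emb emb_diff inner_diff_left norm_b)

lemma H1_lipschitz: "u \<in> HA ==> v \<in> HA ==> \<bar>NA u - NA v\<bar> \<le> NA (\<lambda>x. u x - v x)"
 using L2_norm_lipschitz[OF H1_L2 H1_L2, of u v] norm_triangle_ineq3[of "emb L (grad \<alpha> u)" "emb L (grad \<alpha> v)"]
  norm_emb[OF H1_grad, of u] norm_emb[OF H1_grad, of v] norm_emb[OF H1_grad[OF H1_diff(1)], of u v] H1_diff(2)[of u v]
 unfolding H1_norm_eq by auto

lemma H1_coeffs:
 assumes u: "u \<in> HA"
 shows "sq (\<lambda>n. om n * cf n u)" "NL (grad \<alpha> u) = norm (vec (\<lambda>n. om n * cf n u))"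
  "NA u = norm (vec (\<lambda>n. cf n u)) + norm (vec (\<lambda>n. om n * cf n u))"
proof -
 have s: "(\<lambda>n. (om n * cf n u)\<^sup>2) sums (NL (grad \<alpha> u))\<^sup>2"
  unfolding L2_norm_sq power_mult_distrib om(2) using grad_parseval[OF u u] by (simp only: power2_eq_square mult.assoc)
 thus sq: "sq (\<lambda>n. om n * cf n u)" by (rule sums_summable)
 have "(NL (grad \<alpha> u))\<^sup>2 = (norm (vec (\<lambda>n. om n * cf n u)))\<^sup>2" using sums_unique[OF s] norm_vec[OF sq] by simp
 thus g: "NL (grad \<alpha> u) = norm (vec (\<lambda>n. om n * cf n u))" by (rule power2_eq_imp_eq) simp_all
 show "NA u = norm (vec (\<lambda>n. cf n u)) + norm (vec (\<lambda>n. om n * cf n u))"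
  unfolding H1_norm_eq g using norm_emb[OF H1_L2[OF u]] vec_cf[OF H1_L2[OF u]] by simp
qed

definition fn :: "(nat => real) => rfun" where "fn a = rep_l2 (vec a)"

lemma fn: "fn a \<in> LL" "sq a ==> emb L (fn a) = vec a" "sq a ==> cf n (fn a) = a n"
 using E_vec[of a] by (simp_all add: fn_def cf_emb inner_vec E_def)

lemma cf_lin:
 assumes "u \<in> LL" "v \<in> LL"
 shows "cf n (\<lambda>x. u x + v x) = cf n u + cf n v" "cf n (\<lambda>x. u x - v x) = cf n u - cf n v"
 using assms by (simp_all add: cf_emb L2_add L2_diff emb_add emb_diff inner_add_left inner_diff_left)

lemma cf_cmult: "u \<in> LL ==> cf n (\<lambda>x. c * u x) = c * cf n u" by (simp add: cf_emb L2_cmult emb_cmult)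

lemma cf_eq_AE: "u \<in> LL ==> v \<in> LL ==> (\<And>n. cf n u = cf n v) ==> AE x in leb L. u x = v x"
 using E_fixed_eqI[of "emb L u" "emb L v"] by (simp add: cf_emb emb_eq_iff E_def)

lemma cf_e: "cf m (e n) = (if m = n then 1 else 0)" by (simp add: cf_emb e_L2 emb_e B.orthonormal)

definition comb :: "(nat => real) => nat => rfun" where "comb x N y = (\<Sum>n<N. x n * e n y)"

lemma comb:
 shows comb_H1: "comb x N \<in> HA" and cf_comb: "cf m (comb x N) = (if m < N then x m else 0)"
  and dual_comb: "F \<in> HD ==> F (comb x N) = (\<Sum>n<N. x n * F (e n))"
proof -
 have "comb x N \<in> HA \<and> cf m (comb x N) = (if m < N then x m else 0)
  \<and> (F \<in> HD --> F (comb x N) = (\<Sum>n<N. x n * F (e n)))"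
 proof (induction N)
  case 0
  have z: "comb x 0 = (\<lambda>y. 0 * e 0 y)" by (simp add: comb_def fun_eq_iff)
  have "F (\<lambda>y. 0 * e 0 y) = 0 * F (e 0)" if "F \<in> HD" using that e_H1[of 0] unfolding Hdual_space_def by blast
  moreover have "cf m (\<lambda>y. 0 * e 0 y) = 0 * cf m (e 0)" by (rule cf_cmult[OF e_L2])
  ultimately show ?case unfolding z using H1_cmult(1)[OF e_H1, of 0 0] by simp
 next
  case (Suc N)
  have z: "comb x (Suc N) = (\<lambda>y. comb x N y + x N * e N y)" by (simp add: comb_def fun_eq_iff)
  note h = H1_cmult(1)[OF e_H1, of "x N" N]
  have "F (\<lambda>y. comb x N y + x N * e N y) = F (comb x N) + x N * F (e N)" if "F \<in> HD"
   using that e_H1[of N] h Suc unfolding Hdual_space_def by auto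
  moreover have "cf m (\<lambda>y. comb x N y + x N * e N y) = cf m (comb x N) + x N * cf m (e N)"
   using cf_lin(1)[OF H1_L2 H1_L2[OF h], of "comb x N" m] cf_cmult[OF e_L2, of m "x N" N] Suc by simp
  ultimately show ?case unfolding z using H1_add(1)[OF _ h, of "comb x N"] Suc by (auto simp: cf_e less_Suc_eq)
 qed
 thus "comb x N \<in> HA" "cf m (comb x N) = (if m < N then x m else 0)"
  "F \<in> HD ==> F (comb x N) = (\<Sum>n<N. x n * F (e n))" by auto
qed

text \<open>When the seminorm of \<open>u\<close> is 0 no normalisation is possible; the bound
  contained in the definition of the dual then gives \<open>F u = 0\<close> directly.\<close>

lemma Hdual_le:
 assumes F: "F \<in> HD" and u: "u \<in> HA"
 shows "\<bar>F u\<bar> \<le> ND F * NA u"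
proof -
 obtain B where B: "\<And>u. u \<in> HA ==> \<bar>F u\<bar> \<le> B * NA u" using F unfolding Hdual_space_def by blast
 let ?n = "NA u"
 have n0: "?n \<ge> 0" by (simp add: H1_norm_eq)
 show ?thesis
 proof (cases "?n = 0")
  case False
  hence n: "?n > 0" using n0 by simp
  let ?v = "\<lambda>x. (1 / ?n) * u x"
  have v: "?v \<in> HA" by (rule H1_cmult(1)[OF u])
  have "NL (grad \<alpha> ?v) = (1 / ?n) * NL (grad \<alpha> u)"
   using norm_emb[OF H1_grad[OF v]] norm_emb[OF H1_grad[OF u]] H1_cmult(2)[OF u, of "1 / ?n"] n by simp
  hence "NA ?v = (1 / ?n) * (NL u + NL (grad \<alpha> u))"
   using H1_norm_eq[where u="?v"] L2_norm_cmult[OF H1_L2[OF u], of "1 / ?n"] n by (simp add: distrib_left)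
  hence "NA ?v \<le> 1" using n by (simp flip: H1_norm_eq)
  moreover have "bdd_above ((\<lambda>u. \<bar>F u\<bar>) ` {u \<in> HA. NA u \<le> 1})"
  proof (rule bdd_aboveI2)
   fix w assume w: "w \<in> {u \<in> HA. NA u \<le> 1}"
   have "0 \<le> NA w" by (simp add: H1_norm_eq)
   hence "B * NA w \<le> \<bar>B\<bar> * 1" using w by (intro mult_mono) auto
   thus "\<bar>F w\<bar> \<le> \<bar>B\<bar>" using B[of w] w by auto
  qed
  ultimately have "\<bar>F ?v\<bar> \<le> ND F" unfolding Hdual_norm_def using v by (intro cSUP_upper) auto
  moreover have "F ?v = (1 / ?n) * F u" using F u unfolding Hdual_space_def by blast
  ultimately have "\<bar>(1 / ?n) * F u\<bar> \<le> ND F" by (simp only:)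
  thus ?thesis using n by (simp add: abs_mult field_simps)
 qed (use B[OF u] in simp)
qed

lemma H1_zero: "(\<lambda>x. 0) \<in> HA" using H1_cmult(1)[OF e_H1, of 0 0] by simp

lemma Hdual_norm_cong: "(\<And>u. u \<in> HA ==> F u = G u) ==> ND F = ND G"
 unfolding Hdual_norm_def by (intro SUP_cong) auto

lemma Hdual_norm_least:
 assumes B: "B \<ge> 0" "\<And>u. u \<in> HA ==> \<bar>F u\<bar> \<le> B * NA u"
 shows "ND F \<le> B" unfolding Hdual_norm_def
proof (rule cSUP_least)
 have "NA (\<lambda>x. 0) = 0" using H1_coeffs(3)[OF H1_zero] norm_vec[of "\<lambda>n. 0"] by (simp add: cf_def)
 thus "{u \<in> HA. NA u \<le> 1} \<noteq> {}" using H1_zero by fastforce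
 fix u assume u: "u \<in> {u \<in> HA. NA u \<le> 1}"
 hence "B * NA u \<le> B * 1" using B(1) by (intro mult_left_mono) auto
 thus "\<bar>F u\<bar> \<le> B" using B(2)[of u] u by auto
qed

text \<open>The functional with value \<open>om n * x n\<close> on \<open>e n\<close>. It models the
  dual space by square summable sequences, with dual norm at most the l2 norm of
  \<open>x\<close>.\<close>

definition dl :: "(nat => real) => rfun => real" where
 "dl x u = inner (vec x) (vec (\<lambda>n. om n * cf n u))"

lemma dl:
 assumes "u \<in> HA"
 shows dl_sums: "sq x ==> (\<lambda>n. om n * x n * cf n u) sums dl x u"
  and dl_le: "\<bar>dl x u\<bar> \<le> norm (vec x) * NA u"
proof -
 show "(\<lambda>n. om n * x n * cf n u) sums dl x u" if "sq x"
  using inner_E_fixed[OF E_vec[OF that], of "vec (\<lambda>n. om n * cf n u)"]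
  by (simp add: dl_def inner_vec that H1_coeffs[OF assms] mult_ac)
 have "norm (vec x) * norm (vec (\<lambda>n. om n * cf n u)) \<le> norm (vec x) * NA u"
  unfolding H1_coeffs(3)[OF assms] by (intro mult_left_mono) auto
 thus "\<bar>dl x u\<bar> \<le> norm (vec x) * NA u" unfolding dl_def using Cauchy_Schwarz_ineq2 order.trans by blast
qed

lemma dl_Hdual: "dl x \<in> HD"
proof -
 have "dl x (\<lambda>y. u y + v y) = dl x u + dl x v" if "u \<in> HA" "v \<in> HA" for u v
  using vec_lin(2)[OF H1_coeffs(1) H1_coeffs(1), OF that, of 1 1]
  by (simp add: dl_def cf_lin H1_L2 that distrib_left inner_add_right)
 moreover have "dl x (\<lambda>y. c * u y) = c * dl x u" if "u \<in> HA" for c u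
  using vec_lin(2)[OF H1_coeffs(1) H1_coeffs(1), OF that that, of c 0] by (simp add: dl_def cf_cmult H1_L2 that mult_ac)
 ultimately show ?thesis unfolding Hdual_space_def using dl_le[where x=x] by blast
qed

lemma Hdual_norm_dl: "ND (dl x) \<le> norm (vec x)" by (rule Hdual_norm_least) (auto intro: dl_le)

lemma Hdual_norm_nonneg: assumes F: "F \<in> HD" shows "ND F \<ge> 0"
proof -
 have "NA (e 0) > 0" using vec_cf[OF e_L2[of 0]] H1_coeffs(3)[OF e_H1[of 0]] by (simp add: emb_e norm_b add_pos_nonneg)
 thus ?thesis using order.trans[OF abs_ge_zero Hdual_le[OF F e_H1[of 0]]] by (simp add: zero_le_mult_iff)
qed

text \<open>Testing \<open>F\<close> on finite combinations of eigenfunctions and using duality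
  makes \<open>F (e n) / om n\<close> square summable. The series for \<open>F u\<close> converges
  because the truncations of \<open>u\<close> converge in the energy norm.\<close>

lemma Hdual_coeffs: "\<exists>C\<ge>0. \<forall>F\<in>HD. sq (\<lambda>n. F (e n) / om n) \<and>
  norm (vec (\<lambda>n. F (e n) / om n)) \<le> C * ND F \<and> (\<forall>u\<in>HA. (\<lambda>n. F (e n) * cf n u) sums F u)"
proof -
 obtain c where c: "c > 0" "\<And>n. 1 / om n \<le> c" using om_lower by blast
 have o: "om n \<noteq> 0" for n using om(1)[of n] by simp
 have "sq (\<lambda>n. F (e n) / om n) \<and> norm (vec (\<lambda>n. F (e n) / om n)) \<le> (c + 1) * ND F \<and>
  (\<forall>u\<in>HA. (\<lambda>n. F (e n) * cf n u) sums F u)" if F: "F \<in> HD" for F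
 proof -
  note N0 = Hdual_norm_nonneg[OF F]
  have key: "\<bar>\<Sum>n<N. h n * (F (e n) / om n)\<bar> \<le> ((c + 1) * ND F) * sqrt (\<Sum>n<N. (h n)\<^sup>2)" for h N
  proof -
   \<comment> \<open>Dividing by \<open>om n\<close> makes the gradient part of the norm equal to
     that of \<open>h\<close>; the L2 part is at most \<open>c\<close> times it, whence the constant
     \<open>c + 1\<close>.\<close>
   let ?x = "\<lambda>n. h n / om n" and ?a = "\<lambda>n. if n < N then h n else 0"
   have fin: "(\<lambda>n. (?a n)\<^sup>2) sums (\<Sum>n<N. (h n)\<^sup>2)"
    using sums_finite[of "{..<N}" "\<lambda>n. (?a n)\<^sup>2"] by simp
   hence na: "sq ?a" "norm (vec ?a) = sqrt (\<Sum>n<N. (h n)\<^sup>2)"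
    using norm_vec[OF sums_summable[OF fin]] sums_unique[OF fin] by (auto simp: sums_summable real_sqrt_unique)
   have 1: "(\<lambda>n. om n * cf n (comb ?x N)) = ?a" "(\<lambda>n. cf n (comb ?x N)) = (\<lambda>n. (1 / om n) * ?a n)"
    using o by (auto simp: cf_comb)
   have "norm (vec (\<lambda>n. (1 / om n) * ?a n)) \<le> c * norm (vec ?a)"
    by (rule vec_bounded_mult(2)[OF na(1)]) (use c(2) om(1) in \<open>simp add: less_imp_le\<close>)
   hence "NA (comb ?x N) \<le> (c + 1) * sqrt (\<Sum>n<N. (h n)\<^sup>2)"
    unfolding H1_coeffs(3)[OF comb_H1] 1 na(2) by (simp add: algebra_simps)
   hence "ND F * NA (comb ?x N) \<le> ND F * ((c + 1) * sqrt (\<Sum>n<N. (h n)\<^sup>2))" using N0 by (rule mult_left_mono)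
   moreover have "F (comb ?x N) = (\<Sum>n<N. h n * (F (e n) / om n))" by (simp add: dual_comb[OF F])
   ultimately show ?thesis using Hdual_le[OF F comb_H1, of ?x N] by (simp add: mult_ac)
  qed
  have C0: "0 \<le> (c + 1) * ND F" using c N0 by simp
  have s: "sq (\<lambda>n. F (e n) / om n)" "norm (vec (\<lambda>n. F (e n) / om n)) \<le> (c + 1) * ND F"
   by (rule norm_vec_dual[OF C0 key])+
  have "(\<lambda>n. F (e n) * cf n u) sums F u" if u: "u \<in> HA" for u
  proof -
   have "(\<lambda>N. F u - F (comb (\<lambda>n. cf n u) N)) \<longlonglongrightarrow> 0"
   proof (rule Lim_null_comparison)
    let ?r = "\<lambda>N x. u x - comb (\<lambda>n. cf n u) N x"
    have lin: "F u = F (?r N) + F (comb (\<lambda>n. cf n u) N)" for N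
    proof -
     have add: "\<And>u v. u \<in> HA ==> v \<in> HA ==> F (\<lambda>x. u x + v x) = F u + F v"
      using F unfolding Hdual_space_def by blast
     have "F (\<lambda>x. ?r N x + comb (\<lambda>n. cf n u) N x) = F (?r N) + F (comb (\<lambda>n. cf n u) N)"
      by (rule add[OF H1_diff(1)[OF u comb_H1] comb_H1])
     thus ?thesis by simp
    qed
    have "norm (F u - F (comb (\<lambda>n. cf n u) N)) \<le> ND F * NA (?r N)" for N
     using Hdual_le[OF F H1_diff(1)[OF u comb_H1]] lin[of N] by simp
    thus "\<forall>\<^sub>F N in sequentially. norm (F u - F (comb (\<lambda>n. cf n u) N)) \<le> ND F * NA (?r N)" by simp
    have tail: "(\<lambda>N. norm (vec (\<lambda>n. if n < N then 0 else a n))) \<longlonglongrightarrow> 0" if a: "sq a" for a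
     unfolding real_sqrt_unique[OF norm_vec[OF tail_vec(2)[OF a]] norm_ge_zero, symmetric] by (rule tail_vec(1)[OF a])
    have "(\<lambda>n. cf n (?r N)) = (\<lambda>n. if n < N then 0 else cf n u)" "(\<lambda>n. om n * cf n (?r N)) = (\<lambda>n. if n < N then 0 else om n * cf n u)" for N
     by (auto simp: cf_lin(2)[OF H1_L2[OF u] H1_L2[OF comb_H1]] cf_comb)
    hence "NA (?r N) = norm (vec (\<lambda>n. if n < N then 0 else cf n u)) + norm (vec (\<lambda>n. if n < N then 0 else om n * cf n u))" for N
     unfolding H1_coeffs(3)[OF H1_diff(1)[OF u comb_H1]] by simp
    thus "(\<lambda>N. ND F * NA (?r N)) \<longlonglongrightarrow> 0"
     using tendsto_add[OF tail[OF sq_cf[OF H1_L2[OF u]]] tail[OF H1_coeffs(1)[OF u]]] by (simp add: tendsto_mult_right_zero)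
   qed
   hence "(\<lambda>N. F (comb (\<lambda>n. cf n u) N)) \<longlonglongrightarrow> F u"
    using tendsto_diff[OF tendsto_const[of "F u"]] by fastforce
   thus ?thesis unfolding sums_def dual_comb[OF F] by (simp add: mult.commute)
  qed
  with s show ?thesis by blast
 qed
 thus ?thesis using c(1) by (intro exI[of _ "c + 1"]) auto
qed

lemma cf_le: "u \<in> LL ==> \<bar>cf n u\<bar> \<le> NL u" using cf_lipschitz[of u "\<lambda>x. 0" n] by (simp add: cf_def)

lemma sqrt_cf: "u \<in> LL ==> sqrt (\<Sum>n. (cf n u)\<^sup>2) = NL u"
 using norm_vec[OF sq_cf, of u] vec_cf[of u] by (simp add: norm_emb real_sqrt_unique)

section \<open>Parseval over Q and separated test functions\<close>

lemma parseval_Q: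
 assumes ae: "AE t in leb T. y t \<in> LL \<and> z t \<in> LL \<and> NL (y t) * NL (z t) \<le> G t"
  and G: "integrable (leb T) G"
  and m: "\<And>n. (\<lambda>t. cf n (y t)) \<in> meas T" "\<And>n. (\<lambda>t. cf n (z t)) \<in> meas T"
 shows "(\<lambda>n. LINT t|leb T. cf n (y t) * cf n (z t)) sums integral_Q L T (\<lambda>t x. y t x * z t x)"
  "integrable (leb T) (\<lambda>t. LINT x|leb L. y t x * z t x)" "integrable (leb T) (\<lambda>t. cf n (y t) * cf n (z t))"
proof -
 have *: "AE t in leb T. (\<lambda>n. cf n (y t) * cf n (z t)) sums (LINT x|leb L. y t x * z t x) \<and> (\<forall>N. \<bar>\<Sum>n<N. cf n (y t) * cf n (z t)\<bar> \<le> G t)"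
  using ae
 proof eventually_elim
  case (elim t)
  thus ?case using parseval[of "y t" "z t"] sum_mult_le[OF sq_cf sq_cf, of "y t" "z t"]
   by (auto simp: sqrt_cf intro: order.trans)
 qed
 note s = sums_LINT[OF borel_measurable_times[OF m] G *]
 show "(\<lambda>n. LINT t|leb T. cf n (y t) * cf n (z t)) sums integral_Q L T (\<lambda>t x. y t x * z t x)"
  unfolding integral_Q_def by (rule s(2))
 show "integrable (leb T) (\<lambda>t. LINT x|leb L. y t x * z t x)" by (rule s(1))
 show "integrable (leb T) (\<lambda>t. cf n (y t) * cf n (z t))"
 proof (rule LINT_able_bound[OF G borel_measurable_times[OF m]])
  show "AE t in leb T. norm (cf n (y t) * cf n (z t)) \<le> norm (G t)" using ae
  proof eventually_elim
   case (elim t)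
   hence "\<bar>cf n (y t)\<bar> * \<bar>cf n (z t)\<bar> \<le> NL (y t) * NL (z t)" by (intro mult_mono cf_le) auto
   with elim show ?case unfolding real_norm_def abs_mult by linarith
  qed
 qed
qed

text \<open>The modes of \<open>\<eta>(t) e\<^sub>n(x)\<close> isolate one coefficient of a weak solution.\<close>

lemma mode_test_function:
 assumes T: "T > 0" and d: "\<And>t. t \<in> {0..T} ==> (\<eta> has_der \<eta>' t) (at t within {0..T})"
  and c: "cont T \<eta>'" and \<eta>T: "\<eta> T = 0"
 shows "test_function \<alpha> L T (\<lambda>t x. \<eta> t * e n x) (\<lambda>t x. \<eta>' t * e n x)"
proof -
 have ce: "cont T \<eta>" using d by (intro DERIV_continuous_on)
 have NH: "NA (\<lambda>x. r * e n x) = \<bar>r\<bar> * NA (e n)" for r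
 proof -
  have "norm (emb L (grad \<alpha> (\<lambda>x. r * e n x))) = \<bar>r\<bar> * norm (emb L (grad \<alpha> (e n)))"
   by (simp add: H1_cmult(2)[OF e_H1])
  hence "NL (grad \<alpha> (\<lambda>x. r * e n x)) = \<bar>r\<bar> * NL (grad \<alpha> (e n))"
   using norm_emb[OF H1_grad[OF H1_cmult(1)[OF e_H1]]] norm_emb[OF H1_grad[OF e_H1]] by simp
  thus ?thesis by (simp add: H1_norm_eq L2_norm_cmult e_L2 distrib_left)
 qed
 have "weak_time_deriv L T (\<lambda>t x. \<eta> t * e n x) (\<lambda>t x. \<eta>' t * e n x)" unfolding weak_time_deriv_def
 proof (intro allI impI)
  fix \<zeta> assume z: "smooth_compact_support_in ({0<..<T} \<times> {0<..<L}) \<zeta>"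
  hence "smooth2 \<zeta>" by (simp add: smooth_compact_support_in_def)
  then obtain D where D: "D 0 0 = \<zeta>" "\<And>i j. continuous_on UNIV (\<lambda>(t, x). D i j t x)"
   "\<And>i j t x. ((\<lambda>s. D i j s x) has_der D (Suc i) j t x) (at t)" by (rule smooth2E) (rule that)
  let ?Z = "\<lambda>i t. LINT x|leb L. D i 0 t x * e n x"
  have dz: "(?Z i has_der ?Z (Suc i) t) (at t)" for i t
   by (rule derivative_under_LINT[where D="\<lambda>i. D i 0", OF D(2,3) e_L2 L_pos])
  have cz: "continuous_on A (?Z i)" for A i by (intro continuous_at_imp_continuous_on ballI DERIV_isCont[OF dz])
  have dd: "deriv (\<lambda>s. \<zeta> s x) t = D 1 0 t x" for t x using D(3)[of 0 0 x t] by (intro DERIV_imp_deriv) (simp add: D(1))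
  \<comment> \<open>The support is compact in the open rectangle, but the function is smooth on the
    plane, so it vanishes on the sides t = 0 and t = T and there are no boundary terms in
    time.\<close>
  have Z0: "?Z 0 t = 0" if "t = 0 \<or> t = T" for t
  proof -
   have "D 0 0 t x * e n x = 0" if x: "x \<in> {0<..<L}" for x
   proof -
    have "(t, x) \<in> closure ({0<..<T} \<times> {0<..<L})"
     unfolding closure_Times using x T L_pos \<open>t = 0 \<or> t = T\<close> by auto
    thus ?thesis using smooth_support_boundary[OF z, of t x] \<open>t = 0 \<or> t = T\<close> by (auto simp: D(1))
   qed
   hence "?Z 0 t = (LINT x|leb L. 0)" by (intro LINT_cong) auto
   thus ?thesis by simp
  qed
  have i1: "(\<lambda>t. \<eta> t * ?Z 1 t) AI {0..T}" "(\<lambda>t. \<eta>' t * ?Z 0 t) AI {0..T}"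
   by (intro absolutely_integrable_continuous_real continuous_intros ce c cz)+
  have "integral {0..T} (\<lambda>t. \<eta>' t * ?Z 0 t + \<eta> t * ?Z 1 t) = \<eta> T * ?Z 0 T - \<eta> 0 * ?Z 0 0"
  proof (rule integral_parts(1))
   show "\<eta> t = \<eta> 0 + integral {0..t} \<eta>'" if "t \<in> {0..T}" for t using deriv_imp_integral[OF d that] .
   show "?Z 0 t = ?Z 0 0 + integral {0..t} (?Z 1)" if "t \<in> {0..T}" for t
    using deriv_imp_integral[OF has_field_derivative_at_within[OF dz] that, of 0] by simp
  qed (use T in \<open>auto intro!: absolutely_integrable_continuous_real c cz\<close>)
  hence "integral {0..T} (\<lambda>t. \<eta> t * ?Z 1 t) = - integral {0..T} (\<lambda>t. \<eta>' t * ?Z 0 t)"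
   using Z0[of 0] Z0[of T] hk_add[OF hk[OF i1(2)] hk[OF i1(1)]] by simp
  hence "(LINT t|leb T. \<eta> t * ?Z 1 t) = - (LINT t|leb T. \<eta>' t * ?Z 0 t)"
   using i1 by (simp add: LINT_eq_integral flip: integrable_on_iff)
  moreover have "(LINT x|leb L. \<eta> t * e n x * deriv (\<lambda>s. \<zeta> s x) t) = \<eta> t * ?Z 1 t" for t
   unfolding dd by (subst integral_mult_right_zero[symmetric]) (simp add: mult_ac)
  moreover have "(LINT x|leb L. \<eta>' t * e n x * \<zeta> t x) = \<eta>' t * ?Z 0 t" for t
   unfolding D(1) by (subst integral_mult_right_zero[symmetric]) (simp add: mult_ac)
  ultimately show "integral_Q L T (\<lambda>t x. \<eta> t * e n x * deriv (\<lambda>s. \<zeta> s x) t) = - integral_Q L T (\<lambda>t x. \<eta>' t * e n x * \<zeta> t x)"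
   by (simp add: integral_Q_def)
 qed
 moreover have "cont_into (LL) (NL) T (\<lambda>t x. \<eta> t * e n x)" unfolding cont_into_def
 proof (intro ballI conjI L2_cmult e_L2)
  fix t assume t: "t \<in> {0..T}"
  have "((\<lambda>s. \<bar>\<eta> s - \<eta> t\<bar> * NL (e n)) \<longlongrightarrow> \<bar>\<eta> t - \<eta> t\<bar> * NL (e n)) (at t within {0..T})"
   using ce t by (intro tendsto_intros) (auto simp: continuous_on_def)
  thus "((\<lambda>s. NL (\<lambda>x. \<eta> s * e n x - \<eta> t * e n x)) \<longlongrightarrow> 0) (at t within {0..T})"
   by (simp add: L2_norm_cmult e_L2 flip: left_diff_distrib)
 qed
 moreover have "(\<lambda>t x. \<eta> t * e n x) \<in> Bochner_Lp 2 (HA) (NA) T"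
  by (rule Bochner_scalar[where u="e n", OF ce H1_cmult(1)[OF e_H1] NH])
 moreover have "(\<lambda>t x. \<eta>' t * e n x) \<in> Bochner_Lp 2 (LL) (NL) T"
  by (rule Bochner_scalar[where u="e n", OF c L2_cmult[OF e_L2] L2_norm_cmult[OF e_L2]])
 ultimately show ?thesis unfolding test_function_def by (simp add: \<eta>T)
qed

section \<open>Coefficients of general test functions\<close>

lemma square_integrable_imp: "f \<in> meas T ==> integrable (leb T) (\<lambda>t. (f t)\<^sup>2) ==> integrable (leb T) f"
 for f :: rfun by (rule L2_integrable) (simp add: L2_space_def)

lemma test_function_props:
 assumes \<phi>: "test_function \<alpha> L T \<phi> \<phi>'"
 shows "AE t in leb T. \<phi> t \<in> HA" "AE t in leb T. \<phi>' t \<in> LL"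
  "integrable (leb T) (\<lambda>t. NA (\<phi> t))" "integrable (leb T) (\<lambda>t. NL (\<phi>' t))"
  "cont T (\<lambda>t. cf n (\<phi> t))" "cont T (\<lambda>t. NL (\<phi> t))"
  "(\<lambda>t. cf n (\<phi>' t)) \<in> meas T" "\<And>t. t \<in> {0..T} ==> \<phi> t \<in> LL" "T \<ge> 0 ==> cf n (\<phi> T) = 0"
proof -
 have B: "strongly_measurable_into (HA) (NA) T \<phi>" "AE t in leb T. \<phi> t \<in> HA" "integrable (leb T) (\<lambda>t. (NA (\<phi> t))\<^sup>2)"
   "strongly_measurable_into (LL) (NL) T \<phi>'" "AE t in leb T. \<phi>' t \<in> LL" "integrable (leb T) (\<lambda>t. (NL (\<phi>' t))\<^sup>2)"
   and C: "cont_into (LL) (NL) T \<phi>" and A: "AE x in leb L. \<phi> T x = 0"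
  using \<phi> unfolding test_function_def Bochner_Lp_def by auto
 show "AE t in leb T. \<phi> t \<in> HA" "AE t in leb T. \<phi>' t \<in> LL" by (rule B)+
 show "integrable (leb T) (\<lambda>t. NA (\<phi> t))"
  by (rule square_integrable_imp[OF _ B(3)], rule Bochner_functional[OF B(1,2) H1_lipschitz])
 show "integrable (leb T) (\<lambda>t. NL (\<phi>' t))"
  by (rule square_integrable_imp[OF _ B(6)], rule Bochner_functional[OF B(4,5) L2_norm_lipschitz])
 show "cont T (\<lambda>t. cf n (\<phi> t))" by (rule cont_into_functional[OF C cf_lipschitz])
 show "cont T (\<lambda>t. NL (\<phi> t))" by (rule cont_into_functional[OF C L2_norm_lipschitz])
 show "(\<lambda>t. cf n (\<phi>' t)) \<in> meas T" by (rule Bochner_functional[OF B(4,5) cf_lipschitz])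
 show m: "\<phi> t \<in> LL" if "t \<in> {0..T}" for t using C that by (simp add: cont_into_def)
 show "cf n (\<phi> T) = 0" if "T \<ge> 0"
 proof -
  have "emb L (\<lambda>x. 0) = emb L (\<phi> T)" by (rule L2_cong_AE(2)[symmetric]) (use m[of T] that A in auto)
  thus ?thesis using m[of T] that by (simp add: cf_emb del: emb_zero) simp
 qed
qed

lemma continuous_measurable: "cont T f ==> f \<in> meas T" for f :: rfun
 by (rule continuous_imp_measurable_on_sets_lebesgue[OF continuous_on_subset]) auto

text \<open>Replaces the vector-valued integral of \<open>f t * z t\<close>: its would-be
  coefficients are square summable, by duality, and pair with any \<open>u\<close> as the integral
  would.\<close>

lemma weighted_cf:
 assumes f: "cont T f" and z: "AE t in leb T. z t \<in> LL" "\<And>n. (\<lambda>t. cf n (z t)) \<in> meas T"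
  "integrable (leb T) (\<lambda>t. NL (z t))"
 shows "u \<in> LL ==> (\<lambda>n. (LINT t|leb T. f t * cf n (z t)) * cf n u) sums (LINT t|leb T. f t * (LINT x|leb L. z t x * u x))"
  "sq (\<lambda>n. LINT t|leb T. f t * cf n (z t))" "integrable (leb T) (\<lambda>t. f t * cf n (z t))"
proof -
 obtain B where B: "B \<ge> 0" "\<And>t. t \<in> {0..T} ==> \<bar>f t\<bar> \<le> B" using bounded_Icc[OF f] by blast
 let ?X = "\<lambda>t. NL (z t)"
 have m: "(\<lambda>t. f t * cf n (z t)) \<in> meas T" for n by (intro borel_measurable_times z continuous_measurable f)
 have G: "integrable (leb T) (\<lambda>t. B * ?X t)" by (intro integrable_mult_right z)
 show i: "integrable (leb T) (\<lambda>t. f t * cf n (z t))" for n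
 proof (rule LINT_able_bound[OF G m])
  show "AE t in leb T. norm (f t * cf n (z t)) \<le> norm (B * ?X t)" using z(1) AE_space
  proof eventually_elim
   case (elim t)
   hence "\<bar>f t\<bar> * \<bar>cf n (z t)\<bar> \<le> B * ?X t" using B(1) by (intro mult_mono cf_le B) auto
   thus ?case using B(1) by (simp add: abs_mult)
  qed
 qed
 show "(\<lambda>n. (LINT t|leb T. f t * cf n (z t)) * cf n u) sums (LINT t|leb T. f t * (LINT x|leb L. z t x * u x))" if u: "u \<in> LL"
 proof -
  have "AE t in leb T. (\<lambda>n. f t * cf n (z t) * cf n u) sums (f t * (LINT x|leb L. z t x * u x)) \<and>
    (\<forall>N. \<bar>\<Sum>n<N. f t * cf n (z t) * cf n u\<bar> \<le> B * ?X t * NL u)" using z(1) AE_space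
  proof eventually_elim
   case (elim t)
   have s: "(\<Sum>n<N. f t * cf n (z t) * cf n u) = f t * (\<Sum>n<N. cf n (z t) * cf n u)" for N
    by (simp add: sum_distrib_left mult.assoc)
   have "\<bar>f t * (\<Sum>n<N. cf n (z t) * cf n u)\<bar> \<le> B * (?X t * NL u)" for N
    unfolding abs_mult using B(2)[of t] elim sum_mult_le[OF sq_cf sq_cf, of "z t" u N] u
    by (intro mult_mono) (auto simp: sqrt_cf)
   thus ?case using sums_mult[OF parseval[OF elim(1) u], of "f t"] unfolding s by (simp add: mult.assoc)
  qed
  from sums_LINT(2)[OF _ integrable_mult_left[OF G] this] show ?thesis using m by (simp add: borel_measurable_times)
 qed
 show "sq (\<lambda>n. LINT t|leb T. f t * cf n (z t))"
 proof (rule norm_vec_dual(1))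
  show "0 \<le> (LINT t|leb T. B * ?X t)" using B(1) by (intro LINT_nonneg) simp
  fix N :: nat and h :: "nat => real"
  let ?s = "sqrt (\<Sum>n<N. (h n)\<^sup>2)"
  have "(\<Sum>n<N. h n * (LINT t|leb T. f t * cf n (z t))) = (LINT t|leb T. (\<Sum>n<N. h n * (f t * cf n (z t))))"
   using i by (subst LINT_sum) auto
  also have "\<bar>\<dots>\<bar> \<le> (LINT t|leb T. B * ?X t * ?s)"
  proof (rule LINT_abs_le)
   show "AE t in leb T. \<bar>\<Sum>n<N. h n * (f t * cf n (z t))\<bar> \<le> B * ?X t * ?s" using z(1) AE_space
   proof eventually_elim
    case (elim t)
    have "\<bar>\<Sum>n<N. h n * cf n (z t)\<bar> \<le> (\<Sum>n<N. \<bar>h n\<bar> * \<bar>cf n (z t)\<bar>)"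
     using sum_abs[of "\<lambda>n. h n * cf n (z t)" "{..<N}"] by (simp add: abs_mult)
    also have "\<dots> \<le> ?s * sqrt (\<Sum>n<N. (cf n (z t))\<^sup>2)"
     using L2_set_mult_ineq[of h "\<lambda>n. cf n (z t)" "{..<N}"] by (simp add: L2_set_def)
    also have "\<dots> \<le> ?s * ?X t" unfolding sqrt_cf[OF elim(1), symmetric]
     by (intro mult_left_mono real_sqrt_le_mono sum_le_suminf sq_cf elim) (auto intro: sum_nonneg)
    finally have "\<bar>f t\<bar> * \<bar>\<Sum>n<N. h n * cf n (z t)\<bar> \<le> B * (?s * ?X t)"
     using B elim by (intro mult_mono B(2)) auto
    moreover have "(\<Sum>n<N. h n * (f t * cf n (z t))) = f t * (\<Sum>n<N. h n * cf n (z t))"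
     by (simp add: sum_distrib_left mult_ac)
    ultimately show ?case by (simp add: abs_mult mult_ac)
   qed
  qed (use i G in auto)
  also have "\<dots> = (LINT t|leb T. B * ?X t) * ?s" by simp
  finally show "\<bar>\<Sum>n<N. h n * (LINT t|leb T. f t * cf n (z t))\<bar> \<le> (LINT t|leb T. B * ?X t) * ?s" .
 qed
qed

text \<open>The eigenfunctions are not compactly supported in (0,L) and cannot be inserted into the
  distributional time derivative. Products \<open>a t * b x\<close> are inserted instead: the
  function with coefficients \<open>h n\<close> vanishes against every \<open>b\<close>, so each
  \<open>h n\<close> is 0. Then du Bois-Reymond applies to each coefficient.\<close>

lemma test_function_modes:
 assumes T: "T > 0" and \<phi>: "test_function \<alpha> L T \<phi> \<phi>'"
 shows "(\<lambda>t. cf n (\<phi>' t)) AI {0..T}"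
  "t \<in> {0..T} ==> cf n (\<phi> t) = cf n (\<phi> 0) + integral {0..t} (\<lambda>t. cf n (\<phi>' t))"
proof -
 note tp = test_function_props[OF \<phi>]
 show i': "(\<lambda>t. cf n (\<phi>' t)) AI {0..T}" for n unfolding integrable_on_iff[symmetric]
  by (rule LINT_able_bound[OF tp(4) tp(7)]) (use tp(2) in \<open>eventually_elim, simp add: cf_le\<close>)
 have key: "integral {0..T} (\<lambda>t. cf n (\<phi> t) * a' t) = - integral {0..T} (\<lambda>t. cf n (\<phi>' t) * a t)"
  if a: "test1 T a" "smooth1 a'" "\<And>x. (a has_der a' x) (at x)" for a a'
 proof -
  have ca: "continuous_on S a" "continuous_on S a'" for S using a by (auto intro: smooth1_continuous simp: test1_def)
  have iX: "integrable (leb T) (\<lambda>t. NL (\<phi> t))"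
   unfolding integrable_on_iff by (rule absolutely_integrable_continuous_real[OF tp(6)])
  have \<phi>L: "AE t in leb T. \<phi> t \<in> LL" using AE_space by eventually_elim (auto intro: tp(8))
  note z = \<phi>L continuous_measurable[OF tp(5)] iX and z' = tp(2,7,4)
  define h where "h \<equiv> \<lambda>n. (LINT t|leb T. a' t * cf n (\<phi> t)) + (LINT t|leb T. a t * cf n (\<phi>' t))"
  have sqh: "sq h" using vec_lin(1)[OF weighted_cf(2)[OF ca(2) z] weighted_cf(2)[OF ca(1) z'], of 1 1] by (simp add: h_def)
  have "LINT x|leb L. fn h x * b x = 0" if b: "test1 L b" for b
  proof -
   have cb: "continuous_on S b" for S using b by (auto intro: smooth1_continuous simp: test1_def)
   have bL: "b \<in> LL" by (rule continuous_interval_L2[OF cb])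
   obtain c d c' d' where s: "0 < c" "d < T" "\<And>t. t \<notin> {c<..<d} ==> a t = 0" "0 < c'" "d' < L" "\<And>x. x \<notin> {c'<..<d'} ==> b x = 0"
    using a(1) b unfolding test1_def by blast
   have sm: "smooth_compact_support_in ({0<..<T} \<times> {0<..<L}) (\<lambda>t x. a t * b x)"
   proof (rule smooth_compact_supportI)
    show "smooth2 (\<lambda>t x. a t * b x)" using a b by (intro smooth2_product) (auto simp: test1_def)
    show "compact ({c..d} \<times> {c'..d'})" by (intro compact_Times compact_Icc)
    show "{c..d} \<times> {c'..d'} \<subseteq> {0<..<T} \<times> {0<..<L}" using s by auto
    show "(t, x) \<in> {c..d} \<times> {c'..d'}" if "a t * b x \<noteq> 0" for t x
     using s(3)[of t] s(6)[of x] that by (cases "t \<in> {c<..<d}"; cases "x \<in> {c'<..<d'}") auto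
   qed
   have dv: "deriv (\<lambda>s. a s * b x) t = a' t * b x" for t x by (intro DERIV_imp_deriv DERIV_cmult_right a)
   have li: "(LINT x|leb L. v x * (r * b x)) = r * (LINT x|leb L. v x * b x)" for r and v :: rfun
    by (subst integral_mult_right_zero[symmetric]) (simp add: mult_ac)
   have "(\<lambda>n. h n * cf n b) sums ((LINT t|leb T. a' t * (LINT x|leb L. \<phi> t x * b x)) + (LINT t|leb T. a t * (LINT x|leb L. \<phi>' t x * b x)))"
    unfolding h_def distrib_right by (intro sums_add weighted_cf(1)[OF ca(2) z bL] weighted_cf(1)[OF ca(1) z' bL])
   moreover have "(LINT t|leb T. a' t * (LINT x|leb L. \<phi> t x * b x)) + (LINT t|leb T. a t * (LINT x|leb L. \<phi>' t x * b x)) = 0"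
    using \<phi> sm unfolding test_function_def weak_time_deriv_def integral_Q_def by (auto simp: dv li)
   moreover have "(\<lambda>n. h n * cf n b) sums (LINT x|leb L. fn h x * b x)"
    using parseval[OF fn(1) bL, of h] by (simp add: fn(3)[OF sqh])
   ultimately show ?thesis using sums_unique2 by metis
  qed
  hence "AE x in leb L. fn h x = 0" by (intro fundamental_lemma L2_integrable fn)
  hence "emb L (fn h) = emb L (\<lambda>x. 0)" by (intro L2_cong_AE(2)[symmetric] fn)  simp
  hence "h n = 0" using fn(3)[OF sqh, of n] by (simp add: cf_emb fn(1))
  moreover have "(LINT t|leb T. a' t * cf n (\<phi> t)) = integral {0..T} (\<lambda>t. a' t * cf n (\<phi> t))"
   by (intro LINT_eq_integral weighted_cf(3)[OF ca(2) z])
  moreover have "(LINT t|leb T. a t * cf n (\<phi>' t)) = integral {0..T} (\<lambda>t. a t * cf n (\<phi>' t))"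
   by (intro LINT_eq_integral weighted_cf(3)[OF ca(1) z'])
  ultimately show ?thesis by (simp add: h_def mult.commute)
 qed
 show "cf n (\<phi> t) = cf n (\<phi> 0) + integral {0..t} (\<lambda>t. cf n (\<phi>' t))" if "t \<in> {0..T}"
  by (rule du_Bois_Reymond[OF T tp(5) i' _ that]) (rule key)
qed

subsection \<open>Weak solutions\<close>

text \<open>A partial sum is the pairing of \<open>r\<close> with the gradient of a truncation of
  \<open>y\<close>, whose energy does not exceed that of \<open>y\<close>. This is the majorant for
  exchanging sum and time integral.\<close>

lemma grad_partial:
 assumes y: "y \<in> HA" and r: "r \<in> LL"
 shows "\<bar>\<Sum>n<N. cf n y * (LINT x|leb L. grad \<alpha> (e n) x * r x)\<bar> \<le> NL (grad \<alpha> y) * NL r"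
proof -
 let ?c = "comb (\<lambda>n. cf n y) N" and ?g = "\<lambda>n. LINT x|leb L. grad \<alpha> (e n) x * r x"
 have eq: "(\<lambda>n. cf n ?c * ?g n) = (\<lambda>n. if n < N then cf n y * ?g n else 0)" by (auto simp: cf_comb)
 have "(\<lambda>n. if n < N then cf n y * ?g n else 0) sums (\<Sum>n<N. cf n y * ?g n)"
  using sums_finite[of "{..<N}" "\<lambda>n. if n < N then cf n y * ?g n else 0"] by simp
 moreover have "(\<lambda>n. if n < N then cf n y * ?g n else 0) sums (LINT x|leb L. grad \<alpha> ?c x * r x)"
  using grad_expansion[OF comb_H1 r, of "\<lambda>n. cf n y" N] unfolding eq .
 ultimately have "(\<Sum>n<N. cf n y * ?g n) = (LINT x|leb L. grad \<alpha> ?c x * r x)" by (rule sums_unique2)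
 hence "\<bar>\<Sum>n<N. cf n y * ?g n\<bar> \<le> NL (grad \<alpha> ?c) * NL r"
  using L2_Cauchy_Schwarz[OF H1_grad[OF comb_H1] r] by simp
 moreover have "NL (grad \<alpha> ?c) \<le> NL (grad \<alpha> y)"
 proof -
  have "(\<lambda>n. om n * cf n ?c) = (\<lambda>n. (if n < N then 1 else 0) * (om n * cf n y))" by (auto simp: cf_comb)
  thus ?thesis unfolding H1_coeffs(2)[OF comb_H1] H1_coeffs(2)[OF y]
   using vec_bounded_mult(2)[OF H1_coeffs(1)[OF y], of "\<lambda>n. if n < N then 1 else 0" 1] by simp
 qed
 ultimately show ?thesis using mult_right_mono[OF _ L2_norm_ge_0] order.trans by blast
qed

text \<open>The pairing of gradients is left open as \<open>g n t\<close> to serve two cases: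
  \<open>lam n * cf n (\<phi> t)\<close> for admissible test functions, and the same with a boundary
  term at L for the trace.\<close>

lemma weak_form:
 assumes ae: "AE t in leb T. y' t \<in> LL \<and> \<phi>' t \<in> LL \<and> y t \<in> HA \<and> grad \<alpha> (\<phi> t) \<in> LL \<and>
   (\<forall>n. (LINT x|leb L. grad \<alpha> (e n) x * grad \<alpha> (\<phi> t) x) = g n t) \<and>
   NL (y' t) * NL (\<phi>' t) + NL (grad \<alpha> (y t)) * NL (grad \<alpha> (\<phi> t)) \<le> G t"
  and G: "integrable (leb T) G"
  and m: "\<And>n. (\<lambda>t. cf n (y' t)) \<in> meas T" "\<And>n. (\<lambda>t. cf n (\<phi>' t)) \<in> meas T"
   "\<And>n. (\<lambda>t. cf n (y t)) \<in> meas T" "\<And>n. g n \<in> meas T"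
 shows "(\<lambda>n. LINT t|leb T. - cf n (y' t) * cf n (\<phi>' t) + cf n (y t) * g n t) sums
  integral_Q L T (\<lambda>t x. - y' t x * \<phi>' t x + x powr \<alpha> * deriv (y t) x * deriv (\<phi> t) x)"
 unfolding integral_Q_def
proof (rule sums_LINT(2)[OF _ G])
 show "(\<lambda>t. - cf n (y' t) * cf n (\<phi>' t) + cf n (y t) * g n t) \<in> meas T" for n using m by measurable
 show "AE t in leb T. (\<lambda>n. - cf n (y' t) * cf n (\<phi>' t) + cf n (y t) * g n t) sums
   (LINT x|leb L. - y' t x * \<phi>' t x + x powr \<alpha> * deriv (y t) x * deriv (\<phi> t) x) \<and>
   (\<forall>N. \<bar>\<Sum>n<N. - cf n (y' t) * cf n (\<phi>' t) + cf n (y t) * g n t\<bar> \<le> G t)" using ae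
 proof eventually_elim
  case (elim t)
  hence y': "y' t \<in> LL" and \<phi>': "\<phi>' t \<in> LL" and y: "y t \<in> HA" and \<phi>: "grad \<alpha> (\<phi> t) \<in> LL"
   and g: "\<And>n. (LINT x|leb L. grad \<alpha> (e n) x * grad \<alpha> (\<phi> t) x) = g n t"
   and le: "NL (y' t) * NL (\<phi>' t) + NL (grad \<alpha> (y t)) * NL (grad \<alpha> (\<phi> t)) \<le> G t" by auto
  have "(LINT x|leb L. - y' t x * \<phi>' t x + x powr \<alpha> * deriv (y t) x * deriv (\<phi> t) x)
    = (LINT x|leb L. - (y' t x * \<phi>' t x) + grad \<alpha> (y t) x * grad \<alpha> (\<phi> t) x)"
  proof (rule LINT_cong)
   fix x assume "x \<in> space (leb L)"
   hence "x powr \<alpha> = x powr (\<alpha> / 2) * x powr (\<alpha> / 2)" by (simp flip: powr_add)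
   thus "- y' t x * \<phi>' t x + x powr \<alpha> * deriv (y t) x * deriv (\<phi> t) x = - (y' t x * \<phi>' t x) + grad \<alpha> (y t) x * grad \<alpha> (\<phi> t) x"
    by (simp add: grad_def mult_ac)
  qed simp
  also have "\<dots> = - (LINT x|leb L. y' t x * \<phi>' t x) + (LINT x|leb L. grad \<alpha> (y t) x * grad \<alpha> (\<phi> t) x)"
   using L2_mult_integrable[OF y' \<phi>'] L2_mult_integrable[OF H1_grad[OF y] \<phi>] by simp
  finally have eq: "(LINT x|leb L. - y' t x * \<phi>' t x + x powr \<alpha> * deriv (y t) x * deriv (\<phi> t) x) = \<dots>" .
  have "(\<lambda>n. - (cf n (y' t) * cf n (\<phi>' t)) + cf n (y t) * g n t) sums (- (LINT x|leb L. y' t x * \<phi>' t x) + (LINT x|leb L. grad \<alpha> (y t) x * grad \<alpha> (\<phi> t) x))"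
   unfolding g[symmetric] by (intro sums_add sums_minus parseval y' \<phi>' grad_expansion y \<phi>)
  moreover have "\<bar>\<Sum>n<N. - cf n (y' t) * cf n (\<phi>' t) + cf n (y t) * g n t\<bar> \<le> G t" for N
  proof -
   have "(\<Sum>n<N. - cf n (y' t) * cf n (\<phi>' t) + cf n (y t) * g n t) = - (\<Sum>n<N. cf n (y' t) * cf n (\<phi>' t)) + (\<Sum>n<N. cf n (y t) * g n t)"
    by (simp add: sum_subtractf)
   moreover have "\<bar>\<Sum>n<N. cf n (y' t) * cf n (\<phi>' t)\<bar> \<le> NL (y' t) * NL (\<phi>' t)"
    using sum_mult_le[OF sq_cf sq_cf, OF y' \<phi>'] by (simp add: sqrt_cf y' \<phi>')
   moreover have "\<bar>\<Sum>n<N. cf n (y t) * g n t\<bar> \<le> NL (grad \<alpha> (y t)) * NL (grad \<alpha> (\<phi> t))"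
    unfolding g[symmetric] by (rule grad_partial[OF y \<phi>])
   ultimately show ?thesis using le by linarith
  qed
  ultimately show ?case unfolding eq by simp
 qed
qed

lemma cf_lipschitz_H1: "u \<in> HA ==> v \<in> HA ==> \<bar>cf n u - cf n v\<bar> \<le> NA (\<lambda>x. u x - v x)"
 using cf_lipschitz[OF H1_L2 H1_L2, of u v n] by (simp add: H1_norm_eq add_increasing2)

lemma weak_form_test:
 assumes y: "cont_into (HA) (NA) T y" "cont_into (LL) (NL) T y'"
  and \<phi>: "test_function \<alpha> L T \<phi> \<phi>'"
 shows "(\<lambda>n. LINT t|leb T. - cf n (y' t) * cf n (\<phi>' t) + cf n (y t) * (lam n * cf n (\<phi> t))) sums
  integral_Q L T (\<lambda>t x. - y' t x * \<phi>' t x + x powr \<alpha> * deriv (y t) x * deriv (\<phi> t) x)"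
proof -
 note tp = test_function_props[OF \<phi>]
 have V: "t \<in> {0..T} ==> y t \<in> HA" "t \<in> {0..T} ==> y' t \<in> LL" for t using y by (auto simp: cont_into_def)
 obtain M where M: "M \<ge> 0" "\<And>t. t \<in> {0..T} ==> \<bar>NA (y t)\<bar> \<le> M"
  using bounded_Icc[OF cont_into_functional[OF y(1) H1_lipschitz]] by blast
 obtain M' where M': "M' \<ge> 0" "\<And>t. t \<in> {0..T} ==> \<bar>NL (y' t)\<bar> \<le> M'"
  using bounded_Icc[OF cont_into_functional[OF y(2) L2_norm_lipschitz]] by blast
 show ?thesis
 proof (rule weak_form)
  show "integrable (leb T) (\<lambda>t. M' * NL (\<phi>' t) + M * NA (\<phi> t))"
   by (intro LINT_able_add integrable_mult_right tp)
  show "(\<lambda>t. cf n (y t)) \<in> meas T" for n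
   by (rule continuous_measurable[OF cont_into_functional[OF y(1) cf_lipschitz_H1]])
  show "(\<lambda>t. cf n (y' t)) \<in> meas T" for n
   by (rule continuous_measurable[OF cont_into_functional[OF y(2) cf_lipschitz]])
  show "(\<lambda>t. lam n * cf n (\<phi> t)) \<in> meas T" for n by (intro continuous_measurable continuous_intros tp)
  show "AE t in leb T. y' t \<in> LL \<and> \<phi>' t \<in> LL \<and> y t \<in> HA \<and> grad \<alpha> (\<phi> t) \<in> LL \<and>
   (\<forall>n. (LINT x|leb L. grad \<alpha> (e n) x * grad \<alpha> (\<phi> t) x) = lam n * cf n (\<phi> t)) \<and>
   NL (y' t) * NL (\<phi>' t) + NL (grad \<alpha> (y t)) * NL (grad \<alpha> (\<phi> t))
    \<le> M' * NL (\<phi>' t) + M * NA (\<phi> t)" using tp(1,2) AE_space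
  proof eventually_elim
   case (elim t)
   hence t: "t \<in> {0..T}" by auto
   have "NL (grad \<alpha> (y t)) \<le> M" using M(2)[OF t] L2_norm_ge_0[of L "y t"] unfolding H1_norm_eq by linarith
   moreover have "NL (grad \<alpha> (\<phi> t)) \<le> NA (\<phi> t)" by (simp add: H1_norm_eq)
   ultimately have "NL (grad \<alpha> (y t)) * NL (grad \<alpha> (\<phi> t)) \<le> M * NA (\<phi> t)"
    using M(1) by (intro mult_mono) auto
   moreover have "NL (y' t) * NL (\<phi>' t) \<le> M' * NL (\<phi>' t)" using M'(2)[OF t] by (intro mult_right_mono) auto
   moreover have "(LINT x|leb L. grad \<alpha> (e n) x * grad \<alpha> (\<phi> t) x) = lam n * cf n (\<phi> t)" for n
    using inner_grad_q[OF elim(1), of n] inner_emb[OF H1_grad[OF e_H1] H1_grad[OF elim(1)], of n]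
    by (simp add: grad_e inner_commute)
   ultimately show ?case using elim V[OF t] H1_grad by auto
  qed
 qed (rule tp)
qed

text \<open>The consequences of Bochner integrability on which the mode calculus rests. They pass to
  the time-reversed source without rebuilding approximating simple functions.\<close>

definition src :: "real => (real => rfun) => bool" where
 "src T F \<longleftrightarrow> (AE t in leb T. F t \<in> LL) \<and> integrable (leb T) (\<lambda>t. NL (F t)) \<and>
   (\<forall>n. (\<lambda>t. cf n (F t)) \<in> meas T)"

lemma src_Bochner: "\<xi> \<in> Bochner_Lp 1 (LL) (NL) T ==> src T \<xi>"
proof -
 assume "\<xi> \<in> Bochner_Lp 1 (LL) (NL) T"
 hence a: "strongly_measurable_into (LL) (NL) T \<xi>" "AE t in leb T. \<xi> t \<in> LL" "integrable (leb T) (\<lambda>t. NL (\<xi> t))"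
  by (auto simp: Bochner_Lp_def)
 have "(\<lambda>t. cf n (\<xi> t)) \<in> meas T" for n by (rule Bochner_functional[OF a(1,2)]) (rule cf_lipschitz)
 with a show ?thesis by (simp add: src_def)
qed

lemma src_abs_int: "src T F ==> (\<lambda>t. cf n (F t)) AI {0..T}" unfolding integrable_on_iff[symmetric] src_def
 by (elim conjE, rule LINT_able_bound[of _ "\<lambda>t. NL (F t)"]) (auto simp: cf_le elim: eventually_mono)

lemma src_reflect:
 assumes F: "src T F"
 shows "src T (\<lambda>t. F (T - t))"
proof -
 have "integrable (leb T) (\<lambda>t. NL (F (T - t)))" "integrable (leb T) (\<lambda>t. cf n (F (T - t)))" for n
  using reflect(1)[where h="\<lambda>t. NL (F t)"] reflect(1)[OF src_abs_int[OF F], of n] F by (simp_all add: src_def integrable_on_iff)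
 thus ?thesis using AE_reflect[where P="\<lambda>t. F t \<in> LL"] F unfolding src_def by auto
qed

lemma cont_into_L2I:
 assumes a: "sqcurve T a" and y: "\<And>t. t \<in> {0..T} ==> y t \<in> LL" "\<And>t n. t \<in> {0..T} ==> cf n (y t) = a t n"
 shows "cont_into (LL) (NL) T y"
  and "\<And>t. t \<in> {0..T} ==> ((\<lambda>s. norm (vec (a s) - vec (a t))) \<longlongrightarrow> 0) (at t within {0..T})"
proof -
 have v: "vec (a t) = emb L (y t)" if "t \<in> {0..T}" for t using vec_cf[OF y(1)[OF that]] y(2)[OF that] by simp
 show l: "((\<lambda>s. norm (vec (a s) - vec (a t))) \<longlongrightarrow> 0) (at t within {0..T})" if t: "t \<in> {0..T}" for t
  using a t unfolding sqcurve_def continuous_on_def by (metis LIM_zero tendsto_norm_zero)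
 show "cont_into (LL) (NL) T y" unfolding cont_into_def
 proof (intro ballI conjI y)
  fix t assume t: "t \<in> {0..T}"
  show "((\<lambda>s. NL (\<lambda>x. y s x - y t x)) \<longlongrightarrow> 0) (at t within {0..T})"
   by (rule Lim_transform_eventually[OF l[OF t]])
    (use t y in \<open>auto simp: eventually_at_filter v emb_diff norm_emb[symmetric] L2_diff intro!: always_eventually\<close>)
 qed
qed

lemma has_time_deriv_L2I:
 assumes y: "\<And>t. t \<in> {0..T} ==> y t \<in> LL \<and> emb L (y t) = vec (Z t)" "\<And>t. t \<in> {0..T} ==> y' t \<in> LL \<and> emb L (y' t) = vec (z t)"
  and d: "\<And>t. t \<in> {0..T} ==> ((\<lambda>s. vec (Z s)) has_vector_derivative vec (z t)) (at t within {0..T})"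
 shows "has_time_deriv (NL) T y y'" unfolding has_time_deriv_def
proof
 fix t assume t: "t \<in> {0..T}"
 have eq: "NL (\<lambda>x. (y s x - y t x) / (s - t) - y' t x) = norm ((vec (Z s) - vec (Z t)) /\<^sub>R (s - t) - vec (z t))" if s: "s \<in> {0..T}" for s
 proof -
  note L = L2_cmult[OF L2_diff[OF y(1)[THEN conjunct1, OF s] y(1)[THEN conjunct1, OF t]], of "inverse (s - t)"]
  have "emb L (\<lambda>x. inverse (s - t) * (y s x - y t x) - y' t x) = (vec (Z s) - vec (Z t)) /\<^sub>R (s - t) - vec (z t)"
   using y s t by (simp add: emb_diff[OF L] emb_cmult L2_diff emb_diff)
  moreover have "NL (\<lambda>x. inverse (s - t) * (y s x - y t x) - y' t x) = norm (emb L (\<lambda>x. inverse (s - t) * (y s x - y t x) - y' t x))"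
   by (rule norm_emb[symmetric, OF L2_diff[OF L]]) (use y t in simp)
  ultimately show ?thesis by (simp add: divide_inverse mult.commute)
 qed
 show "((\<lambda>s. NL (\<lambda>x. (y s x - y t x) / (s - t) - y' t x)) \<longlongrightarrow> 0) (at t within {0..T})"
  by (rule Lim_transform_eventually[OF has_vector_derivative_quotient[OF d[OF t]]])
   (use eq in \<open>auto simp: eventually_at_filter intro!: always_eventually\<close>)
qed

text \<open>Mode by mode this is integration by parts in time; the boundary terms vanish because the
  velocity is 0 at time 0 and the test function is 0 at time T. The velocity is written
  \<open>- 0\<close>, the form in which the backward problem unfolds.\<close>

lemma weak_solutionI:
 assumes T: "T > 0" and F: "src T F" and y: "cont_into (HA) (NA) T y" "cont_into (LL) (NL) T y'"
  and d: "has_time_deriv (NL) T y y'" and y0: "AE x in leb L. y 0 x = 0"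
  and m: "\<And>n t. t \<in> {0..T} ==> cf n (y' t) = integral {0..t} (\<lambda>s. cf n (F s) - lam n * cf n (y s))"
 shows "weak_solution \<alpha> L T F (\<lambda>x. 0) (\<lambda>x. - 0) y y'" unfolding weak_solution_def
proof (intro conjI allI impI y d y0)
 fix \<phi> \<phi>' assume \<phi>: "test_function \<alpha> L T \<phi> \<phi>'"
 note tp = test_function_props[OF \<phi>] and tm = test_function_modes[OF T \<phi>]
 have cy: "cont T (\<lambda>t. cf n (y t))" for n by (rule cont_into_functional[OF y(1) cf_lipschitz_H1])
 have cy': "cont T (\<lambda>t. cf n (y' t))" for n by (rule cont_into_functional[OF y(2) cf_lipschitz])
 obtain M where M: "M \<ge> 0" "\<And>t. t \<in> {0..T} ==> \<bar>NL (\<phi> t)\<bar> \<le> M" using bounded_Icc[OF tp(6)] by blast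
 have ae: "AE t in leb T. F t \<in> LL \<and> \<phi> t \<in> LL \<and> NL (F t) * NL (\<phi> t) \<le> NL (F t) * M"
  using F[unfolded src_def, THEN conjunct1] AE_space
  by eventually_elim (use M tp(8) in \<open>auto intro!: mult_left_mono\<close>)
 have "(\<lambda>n. LINT t|leb T. cf n (F t) * cf n (\<phi> t)) sums integral_Q L T (\<lambda>t x. F t x * \<phi> t x)"
  by (rule parseval_Q(1)[OF ae]) (use F tp(5) continuous_measurable in \<open>auto simp: src_def\<close>)
 moreover have "(LINT t|leb T. - cf n (y' t) * cf n (\<phi>' t) + cf n (y t) * (lam n * cf n (\<phi> t))) = (LINT t|leb T. cf n (F t) * cf n (\<phi> t))" for n
 proof -
  let ?f = "\<lambda>s. cf n (F s) - lam n * cf n (y s)"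
  have f: "?f AI {0..T}"
   by (intro set_integral_diff(1) src_abs_int[OF F] absolutely_integrable_continuous_real continuous_intros cy)
  have y0': "cf n (y' 0) = 0" using m[of 0 n] T by simp
  have "cf n (y' t) = cf n (y' 0) + integral {0..t} ?f" if "t \<in> {0..T}" for t unfolding y0' m[OF that] by simp
  note p = integral_parts[OF f tm(1) this tm(2), where t=T]
  have i1: "(\<lambda>t. - cf n (y' t) * cf n (\<phi>' t) + cf n (y t) * (lam n * cf n (\<phi> t))) AI {0..T}"
   by (intro set_integral_add(1) abs_int_mult_continuous(2)[OF tm(1)] absolutely_integrable_continuous_real continuous_intros cy cy' tp(5))
  have i2: "(\<lambda>t. cf n (F t) * cf n (\<phi> t)) AI {0..T}"
   by (rule abs_int_mult_continuous(1)[OF src_abs_int[OF F] tp(5)])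
  have "integral {0..T} (\<lambda>t. cf n (F t) * cf n (\<phi> t)) - integral {0..T} (\<lambda>t. - cf n (y' t) * cf n (\<phi>' t) + cf n (y t) * (lam n * cf n (\<phi> t)))
    = integral {0..T} (\<lambda>s. ?f s * cf n (\<phi> s) + cf n (y' s) * cf n (\<phi>' s))"
   unfolding hk_diff[symmetric, OF hk[OF i2] hk[OF i1]] by (intro integral_cong) (simp add: algebra_simps)
  also have "\<dots> = 0" using p(1) y0' tp(9) T by simp
  finally show ?thesis using i1 i2 by (simp add: LINT_eq_integral integrable_on_iff)
 qed
 ultimately have "integral_Q L T (\<lambda>t x. - y' t x * \<phi>' t x + x powr \<alpha> * deriv (y t) x * deriv (\<phi> t) x) = integral_Q L T (\<lambda>t x. F t x * \<phi> t x)"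
  using sums_unique2[OF weak_form_test[OF y \<phi>]] by simp
 thus "integral_Q L T (\<lambda>t x. - y' t x * \<phi>' t x + x powr \<alpha> * deriv (y t) x * deriv (\<phi> t) x)
   - (LINT x|leb L. - 0 * \<phi> 0 x) = integral_Q L T (\<lambda>t x. F t x * \<phi> t x)" by simp
qed

text \<open>The modes are defined by variation of constants. Continuity of the curve with entries
  \<open>om n * k t n\<close> gives continuity in the energy norm, and that of \<open>z\<close>
  gives continuity of the velocity in L2.\<close>

lemma weak_solution_exists:
 assumes T: "T > 0" and F: "src T F"
 shows "\<exists>y y'. weak_solution \<alpha> L T F (\<lambda>x. 0) (\<lambda>x. - 0) y y'"
proof -
 \<comment> \<open>The source lies in L2 only for almost every time; setting it to 0 at the other
   times makes the coefficient bounds hold everywhere.\<close>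
 define f where "f n t = (if F t \<in> LL then cf n (F t) else 0)" for n t
 define X where "X t = (if F t \<in> LL then NL (F t) else 0)" for t
 have FL: "AE t in leb T. F t \<in> LL" using F by (simp add: src_def)
 have f: "f n AI {0..T}" and feq: "AE t in leb T. cf n (F t) = f n t" for n
 proof -
  show "AE t in leb T. cf n (F t) = f n t" using FL by eventually_elim (simp add: f_def)
  thus "f n AI {0..T}"
   using integrable_AE_eq[OF src_abs_int[OF F, folded integrable_on_iff]] by (simp add: integrable_on_iff)
 qed
 have "AE t in leb T. NL (F t) = X t" using FL by eventually_elim (simp add: X_def)
 hence X: "X AI {0..T}" using integrable_AE_eq[of T "\<lambda>t. NL (F t)"] F by (simp add: integrable_on_iff src_def)
 have fX: "sq (\<lambda>n. f n t) \<and> (\<Sum>n. (f n t)\<^sup>2) \<le> (X t)\<^sup>2" for t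
  using sq_cf[of "F t"] sqrt_cf[of "F t"] by (auto simp: f_def X_def suminf_nonneg simp flip: sqrt_cf)
 have X0: "X t \<ge> 0" for t by (simp add: X_def)
 have Zs: "sqcurve T (\<lambda>t n. integral {0..t} (\<lambda>s. sin (om n * s) * f n s))"
  by (rule source_curves(1)[OF f X fX X0]) (auto intro!: continuous_intros)
 have Zc: "sqcurve T (\<lambda>t n. integral {0..t} (\<lambda>s. cos (om n * s) * f n s))"
  by (rule source_curves(1)[OF f X fX X0]) (auto intro!: continuous_intros)
 have Zs': "sqcurve T (\<lambda>t n. - integral {0..t} (\<lambda>s. sin (om n * s) * f n s))"
  using sqcurve_lin[OF Zs Zs, of "-1" 0] by simp
 define k where "k t n = ok (om n) 0 0 (f n) t" for t n
 define z where "z t n = om n * od (om n) 0 0 (f n) t" for t n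
 have o0: "om n \<noteq> 0" for n using om(1)[of n] by simp
 \<comment> \<open>The factor \<open>om n\<close> cancels the division by the frequency in
   \<open>oa\<close> and \<open>oc\<close>, leaving a pure rotation of two continuous
   curves.\<close>
 have K: "sqcurve T (\<lambda>t n. om n * k t n)" and D: "sqcurve T z"
  using sqcurve_rotate[OF Zs' Zc] o0 by (simp_all add: k_def z_def[abs_def] ok_def od_def oa_def oc_def distrib_left algebra_simps)
 note os = oscillator[OF om(1) f, where ?k0.0=0 and ?k1.0=0]
 have Z: "k t n = k 0 n + integral {0..t} (\<lambda>s. z s n)" if "t \<in> {0..T}" for t n
  using os(1)[OF that] os(1)[of 0] T by (simp add: k_def z_def)
 have k0: "k 0 n = 0" for n using os(1)[of 0] T by (simp add: k_def)
 note sd = sqcurve_derivative[OF D _ Z]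
 have sk: "sqcurve T k" "\<And>t. t \<in> {0..T} ==> ((\<lambda>s. vec (k s)) has_vector_derivative vec (z t)) (at t within {0..T})"
  using sd(3)[of 0] sd(2) T by (simp_all add: k0)
 have "\<exists>u. u \<in> HA \<and> (\<forall>n. cf n u = k t n)" if t: "t \<in> {0..T}" for t
 proof -
  have "summable (\<lambda>n. lam n * (k t n)\<^sup>2)" using K t by (simp add: sqcurve_def power_mult_distrib om(2))
  thus ?thesis by (rule Riesz_Fischer_H1) blast
 qed
 then obtain y where y: "\<And>t. t \<in> {0..T} ==> y t \<in> HA" "\<And>t n. t \<in> {0..T} ==> cf n (y t) = k t n" by metis
 define y' where "y' t = fn (z t)" for t
 have sz: "sq (z t)" if "t \<in> {0..T}" for t using D that by (simp add: sqcurve_def)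
 have y': "y' t \<in> LL" "t \<in> {0..T} ==> cf n (y' t) = z t n" for t n by (simp_all add: y'_def fn sz)
 have l: "((\<lambda>s. norm (vec (a s) - vec (a t))) \<longlongrightarrow> 0) (at t within {0..T})" if "sqcurve T a" "t \<in> {0..T}" for a t
  by (rule cont_into_L2I(2)[of T a "\<lambda>t. fn (a t)"]) (use that in \<open>auto simp: fn sqcurve_def\<close>)
 have "cont_into (HA) (NA) T y" unfolding cont_into_def
 proof (intro ballI conjI y(1))
  fix t assume t: "t \<in> {0..T}"
  have lim: "((\<lambda>s. norm (vec (k s) - vec (k t)) + norm (vec (\<lambda>n. om n * k s n) - vec (\<lambda>n. om n * k t n))) \<longlongrightarrow> 0 + 0) (at t within {0..T})"
   by (rule tendsto_add[OF l[OF sk(1) t] l[OF K t]])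
  have eq: "norm (vec (k s) - vec (k t)) + norm (vec (\<lambda>n. om n * k s n) - vec (\<lambda>n. om n * k t n)) = NA (\<lambda>x. y s x - y t x)"
   if s: "s \<in> {0..T}" for s
  proof -
   have c: "cf n (\<lambda>x. y s x - y t x) = k s n - k t n" for n using y s t by (simp add: cf_lin H1_L2)
   have sqs: "sq (k r)" "sq (\<lambda>n. om n * k r n)" if "r \<in> {0..T}" for r using sk(1) K that by (auto simp: sqcurve_def)
   show ?thesis unfolding H1_coeffs(3)[OF H1_diff(1)[OF y(1)[OF s] y(1)[OF t]]] c right_diff_distrib
    using vec_diff[OF sqs(1)[OF s] sqs(1)[OF t]] vec_diff[OF sqs(2)[OF s] sqs(2)[OF t]] by (simp only: simp_thms)
  qed
  have "((\<lambda>s. NA (\<lambda>x. y s x - y t x)) \<longlongrightarrow> 0 + 0) (at t within {0..T})"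
   by (rule Lim_transform_eventually[OF lim]) (simp add: eventually_at_filter eq)
  thus "((\<lambda>s. NA (\<lambda>x. y s x - y t x)) \<longlongrightarrow> 0) (at t within {0..T})" by simp
 qed
 moreover have "cont_into (LL) (NL) T y'" by (rule cont_into_L2I(1)[OF D]) (use y' in auto)
 moreover have "has_time_deriv (NL) T y y'"
 proof (rule has_time_deriv_L2I[OF _ _ sk(2)])
  show "y t \<in> LL \<and> emb L (y t) = vec (k t)" if "t \<in> {0..T}" for t
   using vec_cf[OF H1_L2[OF y(1)[OF that]]] y that by (simp add: H1_L2)
  show "y' t \<in> LL \<and> emb L (y' t) = vec (z t)" if "t \<in> {0..T}" for t
   using y'(1) sz[OF that] by (simp add: y'_def fn)
 qed
 moreover have "AE x in leb L. y 0 x = 0"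
  by (rule cf_eq_AE[of "y 0" "\<lambda>x. 0"]) (use y T k0 H1_L2 in \<open>auto simp: cf_def[of _ "\<lambda>x. 0"]\<close>)
 moreover have "cf n (y' t) = integral {0..t} (\<lambda>s. cf n (F s) - lam n * cf n (y s))" if t: "t \<in> {0..T}" for n t
 proof -
  have "integral {0..t} (\<lambda>s. cf n (F s) - lam n * cf n (y s)) = integral {0..t} (\<lambda>s. f n s - lam n * k s n)"
  proof (rule integral_spike)
   show "negligible ({t. \<not> (t \<in> {0<..<T} --> cf n (F t) = f n t)} \<union> {0, T})"
    using feq[of n] unfolding AE_on_eq by (intro negligible_Un AE_negligible negligible_finite) auto
  qed (use t y(2) in auto)
  thus ?thesis using os(2)[OF t] y' t by (simp add: z_def k_def om(2))
 qed
 ultimately show ?thesis using weak_solutionI[OF T F] by blast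
qed

text \<open>The first equation follows because coefficients are Lipschitz in L2. For the second, let
  \<open>Q\<close> be the defect of the integrated oscillator equation; a test function built from
  \<open>Q\<close> itself turns the weak formulation into the vanishing of the integral of
  \<open>Q^2\<close>.\<close>

lemma weak_solution_modes:
 assumes T: "T > 0" and F: "src T F" and w: "weak_solution \<alpha> L T F (\<lambda>x. 0) (\<lambda>x. - 0) y y'" and t: "t \<in> {0..T}"
 shows "cf n (y t) = integral {0..t} (\<lambda>s. cf n (y' s))"
  "cf n (y' t) = integral {0..t} (\<lambda>s. cf n (F s) - lam n * cf n (y s))"
proof -
 have y: "cont_into (HA) (NA) T y" "cont_into (LL) (NL) T y'"
  and d: "has_time_deriv (NL) T y y'" and y0: "AE x in leb L. y 0 x = 0" using w by (auto simp: weak_solution_def)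
 have V: "t \<in> {0..T} ==> y t \<in> HA" "t \<in> {0..T} ==> y' t \<in> LL" for t using y by (auto simp: cont_into_def)
 have cy: "cont T (\<lambda>t. cf m (y t))" for m by (rule cont_into_functional[OF y(1) cf_lipschitz_H1])
 have cy': "cont T (\<lambda>t. cf m (y' t))" for m by (rule cont_into_functional[OF y(2) cf_lipschitz])
 have "((\<lambda>t. cf n (y t)) has_der cf n (y' t)) (at t within {0..T})" if t: "t \<in> {0..T}" for t
  unfolding has_field_derivative_iff
 proof (rule LIM_zero_cancel, rule Lim_null_comparison)
  show "((\<lambda>s. NL (\<lambda>x. (y s x - y t x) / (s - t) - y' t x)) \<longlongrightarrow> 0) (at t within {0..T})"
   using d t by (simp add: has_time_deriv_def)
  have "norm ((cf n (y s) - cf n (y t)) / (s - t) - cf n (y' t)) \<le> NL (\<lambda>x. (y s x - y t x) / (s - t) - y' t x)"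
   if s: "s \<in> {0..T}" for s
  proof -
   have u: "(\<lambda>x. y s x - y t x) \<in> LL" using V s t by (intro L2_diff H1_L2)
   have "cf n (\<lambda>x. inverse (s - t) * (y s x - y t x)) = inverse (s - t) * (cf n (y s) - cf n (y t))"
    using V s t by (simp add: cf_cmult[OF u] cf_lin(2) H1_L2)
   thus ?thesis using cf_lipschitz[OF L2_cmult[OF u, of "inverse (s - t)"] V(2)[OF t], of n]
    by (simp add: divide_inverse mult.commute)
  qed
  thus "\<forall>\<^sub>F s in at t within {0..T}. norm ((cf n (y s) - cf n (y t)) / (s - t) - cf n (y' t)) \<le> NL (\<lambda>x. (y s x - y t x) / (s - t) - y' t x)"
   by (auto simp: eventually_at_filter intro!: always_eventually)
 qed
 from deriv_imp_integral[OF this t] have "cf n (y t) = cf n (y 0) + integral {0..t} (\<lambda>s. cf n (y' s))" .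
 moreover have "emb L (\<lambda>x. 0) = emb L (y 0)" by (rule L2_cong_AE(2)[symmetric]) (use V(1)[of 0] T y0 H1_L2 in auto)
 ultimately show "cf n (y t) = integral {0..t} (\<lambda>s. cf n (y' s))" using V(1)[of 0] T by (simp add: cf_emb H1_L2 flip: \<open>_ = emb L (y 0)\<close>)
 let ?f = "\<lambda>s. lam n * cf n (y s) - cf n (F s)"
 define G where "G t = integral {0..t} ?f" for t
 define Q where "Q t = cf n (y' t) + G t" for t
 have f: "?f AI {0..T}"
  by (intro set_integral_diff(1) src_abs_int[OF F] absolutely_integrable_continuous_real continuous_intros cy)
 have cG: "cont T G" unfolding G_def by (rule indefinite_continuous[OF f])
 have cQ: "cont T Q" unfolding Q_def by (intro continuous_intros cy' cG)
 \<comment> \<open>Chosen so that the derivative is \<open>- Q\<close> and the value at T is 0.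
   After one integration by parts of the zeroth-order terms, the weak identity is exactly the
   integral of \<open>Q^2\<close>.\<close>
 define \<eta> where "\<eta> t = integral {0..T} Q - integral {0..t} Q" for t
 have d\<eta>: "(\<eta> has_der - Q t) (at t within {0..T})" if "t \<in> {0..T}" for t
  unfolding \<eta>_def using integral_has_real_derivative[OF cQ that] by (auto intro!: derivative_eq_intros)
 have ce: "cont T \<eta>" using d\<eta> by (intro DERIV_continuous_on)
 have cQ': "cont T (\<lambda>t. - Q t)" by (intro continuous_intros cQ)
 have \<eta>T: "\<eta> T = 0" by (simp add: \<eta>_def)
 have \<phi>: "test_function \<alpha> L T (\<lambda>t x. \<eta> t * e n x) (\<lambda>t x. - Q t * e n x)"
  by (rule mode_test_function[OF T d\<eta> cQ' \<eta>T])
 have c: "cf m (\<lambda>x. r * e n x) = (if m = n then r else 0)" for m r by (simp add: cf_cmult e_L2 cf_e)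
 have single: "g n = S" if "g sums S" "\<And>m. m \<noteq> n ==> g m = 0" for g :: "nat => real" and S
  using sums_unique2[OF that(1) sums_finite[of "{n}" g]] that(2) by simp
 have "(LINT t|leb T. - cf n (y' t) * (- Q t) + cf n (y t) * (lam n * \<eta> t))
   = integral_Q L T (\<lambda>t x. - y' t x * (- Q t * e n x) + x powr \<alpha> * deriv (y t) x * deriv (\<lambda>x. \<eta> t * e n x) x)"
 proof -
  have "(\<lambda>m. LINT t|leb T. - cf m (y' t) * (if m = n then - Q t else 0) + cf m (y t) * (lam m * (if m = n then \<eta> t else 0)))
   sums integral_Q L T (\<lambda>t x. - y' t x * (- Q t * e n x) + x powr \<alpha> * deriv (y t) x * deriv (\<lambda>x. \<eta> t * e n x) x)"
   using weak_form_test[OF y \<phi>] by (simp only: c)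
  from single[OF this] show ?thesis by simp
 qed
 also have "\<dots> = integral_Q L T (\<lambda>t x. F t x * (\<eta> t * e n x))"
  using w[unfolded weak_solution_def, THEN conjunct2, THEN conjunct2, THEN conjunct2, THEN conjunct2, rule_format, OF \<phi>] by simp
 also have "\<dots> = (LINT t|leb T. cf n (F t) * \<eta> t)"
 proof -
  obtain M where M: "M \<ge> 0" "\<And>t. t \<in> {0..T} ==> \<bar>\<eta> t\<bar> \<le> M" using bounded_Icc[OF ce] by blast
  have ae: "AE t in leb T. F t \<in> LL \<and> (\<lambda>x. \<eta> t * e n x) \<in> LL \<and>
    NL (F t) * NL (\<lambda>x. \<eta> t * e n x) \<le> NL (F t) * (M * NL (e n))"
   using F[unfolded src_def, THEN conjunct1] AE_space
   by eventually_elim (use M in \<open>auto intro!: mult_left_mono mult_right_mono simp: L2_norm_cmult L2_cmult e_L2\<close>)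
  have m: "(\<lambda>t. cf m (\<lambda>x. \<eta> t * e n x)) \<in> meas T" for m
   unfolding c by (cases "m = n") (auto intro: continuous_measurable ce)
  have "(\<lambda>m. LINT t|leb T. cf m (F t) * cf m (\<lambda>x. \<eta> t * e n x)) sums integral_Q L T (\<lambda>t x. F t x * (\<eta> t * e n x))"
   by (rule parseval_Q(1)[OF ae _ _ m]) (use F in \<open>auto simp: src_def\<close>)
  from single[OF this] show ?thesis by (simp add: c)
 qed
 finally have *: "(LINT t|leb T. - cf n (y' t) * (- Q t) + cf n (y t) * (lam n * \<eta> t)) = (LINT t|leb T. cf n (F t) * \<eta> t)" .
 have i1: "(\<lambda>t. - cf n (y' t) * (- Q t) + cf n (y t) * (lam n * \<eta> t)) AI {0..T}"
  by (intro absolutely_integrable_continuous_real continuous_intros cy cy' cQ ce)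
 have i2: "(\<lambda>t. cf n (F t) * \<eta> t) AI {0..T}" by (rule abs_int_mult_continuous(1)[OF src_abs_int[OF F] ce])
 have "integral {0..T} (\<lambda>t. ?f t * \<eta> t + G t * (- Q t)) = G T * \<eta> T - G 0 * \<eta> 0"
 proof (rule integral_parts(1)[OF f])
  show "\<eta> t = \<eta> 0 + integral {0..t} (\<lambda>t. - Q t)" if "t \<in> {0..T}" for t by (simp add: \<eta>_def)
 qed (use T in \<open>auto simp: G_def intro!: absolutely_integrable_continuous_real cQ'\<close>)
 also have "\<dots> = 0" by (simp add: \<eta>T G_def)
 finally have z: "integral {0..T} (\<lambda>t. ?f t * \<eta> t + G t * (- Q t)) = 0" .
 have i3: "(\<lambda>t. ?f t * \<eta> t + G t * (- Q t)) AI {0..T}"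
  by (intro set_integral_add(1) abs_int_mult_continuous(1)[OF f ce] absolutely_integrable_continuous_real continuous_intros cG cQ)
 have "integral {0..T} (\<lambda>t. (Q t)\<^sup>2) = integral {0..T} (\<lambda>t. (- cf n (y' t) * (- Q t) + cf n (y t) * (lam n * \<eta> t)) - cf n (F t) * \<eta> t - (?f t * \<eta> t + G t * (- Q t)))"
  by (rule integral_cong) (simp add: Q_def power2_eq_square algebra_simps)
 also have "\<dots> = 0" using * z i1 i2 unfolding hk_diff[OF hk_able_diff[OF hk[OF i1] hk[OF i2]] hk[OF i3]]
   hk_diff[OF hk[OF i1] hk[OF i2]] by (simp add: LINT_eq_integral integrable_on_iff)
 finally have "(Q t)\<^sup>2 = 0"
  using integral_eq_0_iff[of 0 T "\<lambda>t. (Q t)\<^sup>2", OF continuous_on_power[OF cQ] T] t by simp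
 moreover have "G t = - integral {0..t} (\<lambda>s. cf n (F s) - lam n * cf n (y s))"
  unfolding G_def hk_neg[symmetric] by simp
 ultimately show "cf n (y' t) = integral {0..t} (\<lambda>s. cf n (F s) - lam n * cf n (y s))" by (simp add: Q_def)
qed

section \<open>The backward problem\<close>

lemma backward_exists:
 assumes T: "T > 0" and \<xi>: "src T \<xi>"
 shows "\<exists>v v'. backward T \<xi> v v'"
proof -
 obtain y y' where "weak_solution \<alpha> L T (\<lambda>t. \<xi> (T - t)) (\<lambda>x. 0) (\<lambda>x. - 0) y y'"
  using weak_solution_exists[OF T src_reflect[OF \<xi>]] by blast
 thus ?thesis unfolding backward_weak_solution_def
  by (intro exI[of _ "\<lambda>t. y (T - t)"] exI[of _ "\<lambda>t x. - y' (T - t) x"]) simp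
qed

text \<open>Time reflection of the forward equations. Integrals over [t,T] are rewritten as a value
  at 0 plus an integral over [0,t], so that integration by parts on [0,T] can be used later.\<close>

lemma backward_modes:
 assumes T: "T > 0" and \<xi>: "src T \<xi>" and v: "backward T \<xi> v v'"
 shows "\<And>t. t \<in> {0..T} ==> v t \<in> HA" "\<And>t. t \<in> {0..T} ==> v' t \<in> LL"
  "cont T (\<lambda>t. NA (v t))" "cont T (\<lambda>t. NL (v' t))"
  "cont T (\<lambda>t. cf n (v' t))"
  "\<And>t. t \<in> {0..T} ==> cf n (v t) = cf n (v 0) + integral {0..t} (\<lambda>s. cf n (v' s))"
  "\<And>t. t \<in> {0..T} ==> cf n (v' t) = cf n (v' 0) + integral {0..t} (\<lambda>s. cf n (\<xi> s) - lam n * cf n (v s))"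
  "cf n (v T) = 0" "cf n (v' T) = 0" "cont T (\<lambda>t. cf n (v t))"
proof -
 define y y' where "y = (\<lambda>t. v (T - t))" and "y' = (\<lambda>t x. - v' (T - t) x)"
 have w: "weak_solution \<alpha> L T (\<lambda>t. \<xi> (T - t)) (\<lambda>x. 0) (\<lambda>x. - 0) y y'" using v by (simp add: backward_weak_solution_def y_def y'_def)
 have y: "cont_into (HA) (NA) T y" "cont_into (LL) (NL) T y'" using w by (auto simp: weak_solution_def)
 have V: "t \<in> {0..T} ==> y t \<in> HA" "t \<in> {0..T} ==> y' t \<in> LL" for t using y by (auto simp: cont_into_def)
 have vy: "v t = y (T - t)" "v' t = (\<lambda>x. (-1) * y' (T - t) x)" for t by (simp_all add: y_def y'_def)
 have r: "T - t \<in> {0..T}" if "t \<in> {0..T}" for t using that by auto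
 show "v t \<in> HA" "v' t \<in> LL" if "t \<in> {0..T}" for t
  unfolding vy using V(1)[OF r[OF that]] L2_cmult[OF V(2)[OF r[OF that]], of "-1"] by auto
 have cr: "cont T (\<lambda>t. f (T - t))" if "cont T f" for f :: rfun
  by (rule continuous_on_compose2[OF that]) (auto intro!: continuous_intros)
 have c': "cf n (v' t) = - cf n (y' (T - t))" if "t \<in> {0..T}" for t n
  unfolding vy using cf_cmult[OF V(2)[OF r[OF that]], of n "-1"] by simp
 show "cont T (\<lambda>t. NA (v t))" unfolding vy by (rule cr[OF cont_into_functional[OF y(1) H1_lipschitz]])
 have "cont T (\<lambda>t. NL (y' (T - t)))" by (rule cr[OF cont_into_functional[OF y(2) L2_norm_lipschitz]])
 thus "cont T (\<lambda>t. NL (v' t))"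
  by (rule continuous_on_eq) (use V r in \<open>simp add: vy L2_norm_cmult[of _ _ "-1", simplified]\<close>)
 have cy: "cont T (\<lambda>t. cf n (y t))" for n by (rule cont_into_functional[OF y(1) cf_lipschitz_H1])
 show cv: "cont T (\<lambda>t. cf n (v t))" for n unfolding vy by (rule cr[OF cy])
 have "cont T (\<lambda>t. - cf n (y' (T - t)))" for n
  by (intro continuous_on_minus cr cont_into_functional[OF y(2) cf_lipschitz])
 thus cv': "cont T (\<lambda>t. cf n (v' t))" for n by (rule continuous_on_eq) (simp add: c')
 have key: "g t = g 0 + integral {0..t} h \<and> g T = 0"
  if h: "h AI {0..T}" and g: "\<And>t. t \<in> {0..T} ==> g t = - integral {0..T - t} (\<lambda>s. h (T - s))" and t: "t \<in> {0..T}" for g h :: rfun and t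
 proof -
  have gh: "g t = - integral {t..T} h" if "t \<in> {0..T}" for t using g[OF that] reflect(2)[OF h r[OF that]] by simp
  have "integral {0..t} h + integral {t..T} h = integral {0..T} h" by (rule hk_combine) (use t hk[OF h] in auto)
  thus ?thesis using gh[OF t] gh[of 0] gh[of T] T by simp
 qed
 note wm = weak_solution_modes[OF T src_reflect[OF \<xi>] w r]
 have i1: "(\<lambda>s. cf n (v' s)) AI {0..T}" by (rule absolutely_integrable_continuous_real[OF cv'])
 have g1: "cf n (v t) = - integral {0..T - t} (\<lambda>s. cf n (v' (T - s)))" if "t \<in> {0..T}" for t
  unfolding vy(1) wm(1)[OF that] hk_neg[symmetric] by (rule integral_cong) (use that in \<open>simp add: c'\<close>)
 show "cf n (v t) = cf n (v 0) + integral {0..t} (\<lambda>s. cf n (v' s))" if "t \<in> {0..T}" for t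
  using key[OF i1 g1 that] by blast
 show "cf n (v T) = 0" using key[OF i1 g1, of T] T by simp
 have i2: "(\<lambda>s. cf n (\<xi> s) - lam n * cf n (v s)) AI {0..T}"
  by (intro set_integral_diff(1) src_abs_int[OF \<xi>] absolutely_integrable_continuous_real continuous_intros cv)
 have g2: "cf n (v' t) = - integral {0..T - t} (\<lambda>s. cf n (\<xi> (T - s)) - lam n * cf n (v (T - s)))" if "t \<in> {0..T}" for t
  unfolding c'[OF that] wm(2)[OF that] by (simp add: vy)
 show "cf n (v' t) = cf n (v' 0) + integral {0..t} (\<lambda>s. cf n (\<xi> s) - lam n * cf n (v s))" if "t \<in> {0..T}" for t
  using key[OF i2 g2 that] by blast
 show "cf n (v' T) = 0" using key[OF i2 g2, of T] T by simp
qed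

subsection \<open>Transposition\<close>

text \<open>Green's identity in time for two scalar oscillators of the same frequency, one forced by
  the control, the other by the source. The \<open>lam n\<close> terms cancel, and the zero data of
  v at T leave only the terms at time 0.\<close>

lemma mode_duality:
 assumes T: "T > 0" and \<xi>: "src T \<xi>" and v: "backward T \<xi> v v'" and \<theta>: "\<theta> \<in> L2_space T"
 shows "(LINT t|leb T. ok (om n) a c (\<lambda>s. - (\<theta> s * p n L)) t * cf n (\<xi> t)) =
  c * cf n (v 0) - a * cf n (v' 0) - (LINT t|leb T. \<theta> t * (p n L * cf n (v t)))"
proof -
 note bm = backward_modes[OF T \<xi> v]
 let ?g = "\<lambda>s. - (\<theta> s * p n L)"
 let ?W = "ok (om n) a c ?g" and ?Z = "\<lambda>t. om n * od (om n) a c ?g t"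
 have th: "\<theta> AI {0..T}" using L2_integrable[OF \<theta>] by (simp add: integrable_on_iff)
 have g: "?g AI {0..T}" using abs_int_mult_continuous(1)[OF th, of "\<lambda>_. - p n L"] by simp
 note os = oscillator[OF om(1) g, where ?k0.0=a and ?k1.0=c]
 have cW: "cont T ?W" and cd: "cont T (od (om n) a c ?g)" using os(3,4)[of T] T by auto
 have cZ: "cont T ?Z" by (intro continuous_intros cd)
 have W: "?W t = ?W 0 + integral {0..t} ?Z" "?Z t = ?Z 0 + integral {0..t} (\<lambda>s. ?g s - lam n * ?W s)" if "t \<in> {0..T}" for t
  using os(1,2)[OF that] os(1,2)[of 0] T by (simp_all add: om(2))
 have W0: "?W 0 = a" "?Z 0 = c" using os(1,2)[of 0] T by simp_all
 note cv = bm(10)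
 have i: "?Z AI {0..T}" "(\<lambda>s. ?g s - lam n * ?W s) AI {0..T}"
  "(\<lambda>s. cf n (\<xi> s) - lam n * cf n (v s)) AI {0..T}" "(\<lambda>s. cf n (v' s)) AI {0..T}"
  by (intro set_integral_diff(1) g src_abs_int[OF \<xi>] absolutely_integrable_continuous_real continuous_intros cv cW cZ bm(5))+
 have TT: "T \<in> {0..T}" using T by simp
 have p1: "integral {0..T} (\<lambda>s. ?Z s * cf n (v' s) + ?W s * (cf n (\<xi> s) - lam n * cf n (v s))) = ?W T * cf n (v' T) - ?W 0 * cf n (v' 0)"
  "(\<lambda>s. ?Z s * cf n (v' s) + ?W s * (cf n (\<xi> s) - lam n * cf n (v s))) AI {0..T}"
  by (rule integral_parts(1)[OF i(1,3) W(1) bm(7) TT], assumption+) (rule integral_parts(2)[OF i(1,3) W(1) bm(7) TT])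
 have p2: "integral {0..T} (\<lambda>s. (?g s - lam n * ?W s) * cf n (v s) + ?Z s * cf n (v' s)) = ?Z T * cf n (v T) - ?Z 0 * cf n (v 0)"
  "(\<lambda>s. (?g s - lam n * ?W s) * cf n (v s) + ?Z s * cf n (v' s)) AI {0..T}"
  by (rule integral_parts(1)[OF i(2,4) W(2) bm(6) TT], assumption+) (rule integral_parts(2)[OF i(2,4) W(2) bm(6) TT])
 have j: "(\<lambda>t. ?W t * cf n (\<xi> t)) AI {0..T}" "(\<lambda>t. \<theta> t * (p n L * cf n (v t))) AI {0..T}"
  by (rule abs_int_mult_continuous(2)[OF src_abs_int[OF \<xi>] cW]) (intro abs_int_mult_continuous(1)[OF th] continuous_intros cv)
 have "integral {0..T} (\<lambda>t. ?W t * cf n (\<xi> t)) + integral {0..T} (\<lambda>t. \<theta> t * (p n L * cf n (v t)))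
   = integral {0..T} (\<lambda>s. (?Z s * cf n (v' s) + ?W s * (cf n (\<xi> s) - lam n * cf n (v s))) - ((?g s - lam n * ?W s) * cf n (v s) + ?Z s * cf n (v' s)))"
  unfolding hk_add[OF hk[OF j(1)] hk[OF j(2)], symmetric] by (rule integral_cong) (simp add: algebra_simps)
 also have "\<dots> = - a * cf n (v' 0) + c * cf n (v 0)" unfolding hk_diff[OF hk[OF p1(2)] hk[OF p2(2)]] p1(1) p2(1)
  using bm(8,9)[of n] W0 by simp
 finally show ?thesis using j by (simp add: LINT_eq_integral integrable_on_iff)
qed

text \<open>The modes of the controlled wave. The forcing \<open>- \<theta> s * p n L\<close> is
  what two integrations by parts against \<open>e n\<close> leave of the boundary value at
  L.\<close>

definition wk :: "(nat => real) => (nat => real) => rfun => real => nat => real" where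
 "wk a c \<theta> t n = ok (om n) (a n) (c n) (\<lambda>s. - (\<theta> s * p n L)) t"
text \<open>Modes of the velocity divided by \<open>om n\<close>: the velocity lies only in the dual
  space, and these are its coordinates there in the sense of \<open>dl\<close>.\<close>

definition wz :: "(nat => real) => (nat => real) => rfun => real => nat => real" where
 "wz a c \<theta> t n = od (om n) (a n) (c n) (\<lambda>s. - (\<theta> s * p n L)) t"

text \<open>Data and control enter the rotating coordinates separately, the control through hidden
  regularity once for the sine and once for the cosine, hence the factor 2 in \<open>B\<close>.
  Dividing by \<open>om n\<close> expresses the L2 curve in dual coordinates, where it is
  differentiable with derivative \<open>wz\<close>.\<close>

lemma wave_curves:
 assumes T: "T > 0" and \<theta>: "\<theta> \<in> L2_space T" and a: "sq a" and c: "sq (\<lambda>n. c n / om n)"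
 defines "B \<equiv> norm (vec a) + norm (vec (\<lambda>n. c n / om n)) + 2 * (sqrt (hidden_const T) * L2_norm T \<theta>)"
 shows "sqcurve T (wk a c \<theta>)" "sqcurve T (wz a c \<theta>)"
  "t \<in> {0..T} ==> norm (vec (wk a c \<theta> t)) \<le> B" "t \<in> {0..T} ==> norm (vec (wz a c \<theta> t)) \<le> B"
  "t \<in> {0..T} ==> ((\<lambda>s. vec (\<lambda>n. wk a c \<theta> s n / om n)) has_vector_derivative vec (wz a c \<theta> t)) (at t within {0..T})"
  "t \<in> {0..T} ==> sq (\<lambda>n. wk a c \<theta> t n / om n)"
proof -
 have T0: "T \<ge> 0" using T by simp
 have o0: "om n \<noteq> 0" for n using om(1)[of n] by simp
 let ?S = "\<lambda>t n. integral {0..t} (\<lambda>s. sin (om n * s) / om n * (\<theta> s * p n L))"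
 let ?C = "\<lambda>t n. integral {0..t} (\<lambda>s. cos (om n * s) / om n * (\<theta> s * p n L))"
 note bs = boundary_curves[OF T0 \<theta> trig_hidden(2)[OF T0]] and bc = boundary_curves[OF T0 \<theta> trig_hidden(1)[OF T0]]
 have cs: "cont T (\<lambda>t. sin (om n * t) / om n)" "cont T (\<lambda>t. cos (om n * t) / om n)" for n
  using o0 by (intro continuous_intros; simp)+
 have S: "sqcurve T ?S" and C: "sqcurve T ?C" using bs(1) bc(1) cs by auto
 have A: "sqcurve T (\<lambda>t n. a n + ?S t n)" using sqcurve_lin[OF sqcurve_const[OF a] S, of 1 1] by simp
 have D: "sqcurve T (\<lambda>t n. c n / om n - ?C t n)" using sqcurve_lin[OF sqcurve_const[OF c] C, of 1 "-1"] by simp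
 have ioa: "oa (om n) (a n) (\<lambda>s. - (\<theta> s * p n L)) t = a n + ?S t n" for t n by (simp add: oa_def hk_neg)
 have ioc: "oc (om n) (c n) (\<lambda>s. - (\<theta> s * p n L)) t = c n / om n - ?C t n" for t n
  by (simp add: oc_def hk_neg)
 have k: "wk a c \<theta> = (\<lambda>t n. cos (om n * t) * (a n + ?S t n) + sin (om n * t) * (c n / om n - ?C t n))"
  and z: "wz a c \<theta> = (\<lambda>t n. - sin (om n * t) * (a n + ?S t n) + cos (om n * t) * (c n / om n - ?C t n))"
  by (auto simp: fun_eq_iff wk_def wz_def ok_def od_def ioa ioc)
 show K: "sqcurve T (wk a c \<theta>)" and Z: "sqcurve T (wz a c \<theta>)" unfolding k z by (rule sqcurve_rotate[OF A D])+
 show "norm (vec (wk a c \<theta> t)) \<le> B" "norm (vec (wz a c \<theta> t)) \<le> B" if t: "t \<in> {0..T}"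
 proof -
  have sA: "sq (\<lambda>n. a n + ?S t n)" and sD: "sq (\<lambda>n. c n / om n - ?C t n)" and sS: "sq (?S t)" and sC: "sq (?C t)"
   using A D S C t by (auto simp: sqcurve_def)
  have "norm (vec (\<lambda>n. a n + ?S t n)) \<le> norm (vec a) + sqrt (hidden_const T) * L2_norm T \<theta>"
   using vec_lin(2)[OF a sS, of 1 1] norm_triangle_ineq[of "vec a" "vec (?S t)"] bs(2)[OF cs(1) t] by simp
  moreover have "norm (vec (\<lambda>n. c n / om n - ?C t n)) \<le> norm (vec (\<lambda>n. c n / om n)) + sqrt (hidden_const T) * L2_norm T \<theta>"
   using vec_lin(2)[OF c sC, of 1 "-1"] norm_triangle_ineq4[of "vec (\<lambda>n. c n / om n)" "vec (?C t)"] bc(2)[OF cs(2) t] by simp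
  ultimately show "norm (vec (wk a c \<theta> t)) \<le> B" "norm (vec (wz a c \<theta> t)) \<le> B"
   using norm_rotate[OF sA sD, of "\<lambda>n. om n * t"] unfolding k z B_def by linarith+
 qed
 obtain cc where cc: "\<And>n. 1 / om n \<le> cc" using om_lower by blast
 have sqW: "sq (\<lambda>n. wk a c \<theta> t n / om n)" if "t \<in> {0..T}" for t
  using vec_bounded_mult(1)[of "wk a c \<theta> t" "\<lambda>n. 1 / om n" cc] K that cc om(1) by (auto simp: sqcurve_def less_imp_le)
 thus "t \<in> {0..T} ==> sq (\<lambda>n. wk a c \<theta> t n / om n)" .
 have th: "\<theta> AI {0..T}" using L2_integrable[OF \<theta>] by (simp add: integrable_on_iff)
 have g: "(\<lambda>s. - (\<theta> s * p n L)) AI {0..T}" for n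
  using abs_int_mult_continuous(1)[OF th, of "\<lambda>_. - p n L"] by simp
 have e: "wk a c \<theta> t n / om n = wk a c \<theta> 0 n / om n + integral {0..t} (\<lambda>s. wz a c \<theta> s n)" if t: "t \<in> {0..T}" for t n
  using oscillator(1)[where ?k0.0="a n" and ?k1.0="c n", OF om(1)[of n] g[of n] t]
   oscillator(1)[where ?k0.0="a n" and ?k1.0="c n" and t=0, OF om(1)[of n] g[of n]] T o0
  by (simp add: wk_def wz_def add_divide_distrib)
 show "((\<lambda>s. vec (\<lambda>n. wk a c \<theta> s n / om n)) has_vector_derivative vec (wz a c \<theta> t)) (at t within {0..T})" if "t \<in> {0..T}"
  by (rule sqcurve_derivative(2)[OF Z _ e that]) (use sqW[of 0] T in auto)
qed

text \<open>By mode duality a block of the trace series tested with \<theta> equals, up to sign, the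
  response to the control \<theta> from rest, paired with the same block of modes of \<xi>. The
  response is bounded by \<theta> uniformly in time, and the tails of \<xi>(t) tend to 0 with the
  norm of \<xi>(t) as integrable majorant.\<close>

lemma trace_tail:
 assumes T: "T > 0" and \<xi>: "src T \<xi>" and v: "backward T \<xi> v v'"
 shows "\<exists>\<rho>. \<rho> \<longlonglongrightarrow> 0 \<and> (\<forall>M N. \<forall>\<theta>\<in>L2_space T. M \<le> N -->
  \<bar>\<Sum>n\<in>{M..<N}. LINT t|leb T. \<theta> t * (p n L * cf n (v t))\<bar> \<le> \<rho> M * L2_norm T \<theta>)"
proof -
 let ?C = "sqrt (hidden_const T)"
 define R where "R M t = sqrt (\<Sum>n. (if n < M then 0 else cf n (\<xi> t))\<^sup>2)" for M t
 have C0: "?C \<ge> 0" using hidden_const_nonneg[of T] T by simp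
 have XL: "AE t in leb T. \<xi> t \<in> LL" and iX: "integrable (leb T) (\<lambda>t. NL (\<xi> t))" and m: "(\<lambda>t. cf n (\<xi> t)) \<in> meas T" for n
  using \<xi> by (auto simp: src_def)
 have Rm: "R M \<in> meas T" for M
 proof (rule measurable_AE_limit)
  show "(\<lambda>t. sqrt (\<Sum>n<N. (if n < M then 0 else cf n (\<xi> t))\<^sup>2)) \<in> meas T" for N
  proof -
   have "(\<lambda>t. (if n < M then 0 else cf n (\<xi> t))\<^sup>2) \<in> meas T" for n using m by (cases "n < M") auto
   thus ?thesis by measurable
  qed
  show "AE t in leb T. (\<lambda>N. sqrt (\<Sum>n<N. (if n < M then 0 else cf n (\<xi> t))\<^sup>2)) \<longlonglongrightarrow> R M t"
   using XL unfolding R_def by eventually_elim (intro tendsto_intros summable_LIMSEQ tail_vec(2) sq_cf)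
 qed
 have Rle: "AE t in leb T. norm (R M t) \<le> NL (\<xi> t)" for M
  using XL by eventually_elim (use tail_vec(3)[OF sq_cf] in \<open>simp add: R_def sqrt_cf[symmetric] suminf_nonneg tail_vec(2) sq_cf\<close>)
 have Rlim: "AE t in leb T. (\<lambda>M. R M t) \<longlonglongrightarrow> 0"
  using XL by eventually_elim (simp add: R_def tail_vec(1) sq_cf)
 have Ri: "integrable (leb T) (R M)" for M
  by (rule LINT_able_bound[OF iX Rm]) (use Rle[of M] in \<open>eventually_elim, simp\<close>)
 have "(\<lambda>M. LINT t|leb T. R M t) \<longlonglongrightarrow> (LINT t|leb T. 0)"
  by (rule integral_dominated_convergence[OF _ Rm iX Rlim Rle]) simp
 hence "(\<lambda>M. 2 * ?C * (LINT t|leb T. R M t)) \<longlonglongrightarrow> 0" using tendsto_mult_right_zero[of _ sequentially "2 * ?C"] by simp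
 moreover have "\<bar>\<Sum>n\<in>{M..<N}. LINT t|leb T. \<theta> t * (p n L * cf n (v t))\<bar> \<le> (2 * ?C * (LINT t|leb T. R M t)) * L2_norm T \<theta>"
  if \<theta>: "\<theta> \<in> L2_space T" and MN: "M \<le> N" for M N \<theta>
 proof -
  have z: "sq (\<lambda>n. 0)" "sq (\<lambda>n. 0 / om n)" "norm (vec (\<lambda>n. 0)) = 0" using norm_vec[of "\<lambda>n. 0"] by auto
  note wc = wave_curves[OF T \<theta> z(1,2)]
  let ?k = "wk (\<lambda>n. 0) (\<lambda>n. 0) \<theta>"
  have ck: "cont T (\<lambda>t. ?k t n)" for n by (rule sqcurve_coeff[OF wc(1)])
  have i: "integrable (leb T) (\<lambda>t. ?k t n * cf n (\<xi> t))" for n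
   unfolding integrable_on_iff by (rule abs_int_mult_continuous(2)[OF src_abs_int[OF \<xi>] ck])
  have "(LINT t|leb T. ?k t n * cf n (\<xi> t)) = - (LINT t|leb T. \<theta> t * (p n L * cf n (v t)))" for n
   using mode_duality[OF T \<xi> v \<theta>, of n 0 0] by (simp add: wk_def)
  hence "(\<Sum>n\<in>{M..<N}. LINT t|leb T. \<theta> t * (p n L * cf n (v t))) = - (LINT t|leb T. (\<Sum>n\<in>{M..<N}. ?k t n * cf n (\<xi> t)))"
   using i by (simp add: LINT_sum sum_negf)
  also have "\<bar>\<dots>\<bar> \<le> (LINT t|leb T. 2 * ?C * L2_norm T \<theta> * R M t)" unfolding abs_minus_cancel
  proof (rule LINT_abs_le)
   show "AE t in leb T. \<bar>\<Sum>n\<in>{M..<N}. ?k t n * cf n (\<xi> t)\<bar> \<le> 2 * ?C * L2_norm T \<theta> * R M t"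
    using XL AE_space
   proof eventually_elim
    case (elim t)
    hence t: "t \<in> {0..T}" by auto
    have sk: "sq (?k t)" using wc(1) t by (simp add: sqcurve_def)
    have "(\<Sum>n\<in>{M..<N}. ?k t n * cf n (\<xi> t)) = (\<Sum>n<N. ?k t n * (if n < M then 0 else cf n (\<xi> t)))"
     by (rule sum.mono_neutral_cong_left) (use MN in auto)
    moreover have "sqrt (\<Sum>n. (?k t n)\<^sup>2) * R M t \<le> 2 * ?C * L2_norm T \<theta> * R M t"
     using wc(3)[OF t] norm_vec[OF sk] z(3)
     by (intro mult_right_mono) (auto simp: R_def suminf_nonneg tail_vec(2) sq_cf elim(1) real_sqrt_unique[OF norm_vec[OF sk] norm_ge_zero])
    ultimately show ?case using sum_mult_le[where a="?k t" and c="\<lambda>n. if n < M then 0 else cf n (\<xi> t)" and N=N, OF sk tail_vec(2)[OF sq_cf[OF elim(1)]]]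
     unfolding R_def[symmetric] by linarith
   qed
  qed (use i Ri in auto)
  also have "\<dots> = (2 * ?C * (LINT t|leb T. R M t)) * L2_norm T \<theta>" by simp
  finally show ?thesis .
 qed
 ultimately show ?thesis by (intro exI[of _ "\<lambda>M. 2 * ?C * (LINT t|leb T. R M t)"]) blast
qed

text \<open>Testing the tail estimate with the difference of two partial sums bounds the norm of
  that difference, so the partial sums are Cauchy in L2(0,T).\<close>

lemma trace_limit:
 assumes T: "T > 0" and \<xi>: "src T \<xi>" and v: "backward T \<xi> v v'"
 obtains G where "G \<in> L2_space T" "\<And>\<theta>. \<theta> \<in> L2_space T ==> (\<lambda>n. LINT t|leb T. \<theta> t * (p n L * cf n (v t))) sums (LINT t|leb T. \<theta> t * G t)"
proof -
 obtain \<rho> where \<rho>: "\<rho> \<longlonglongrightarrow> 0" and tail: "\<And>M N \<theta>. \<theta> \<in> L2_space T ==> M \<le> N ==>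
   \<bar>\<Sum>n\<in>{M..<N}. LINT t|leb T. \<theta> t * (p n L * cf n (v t))\<bar> \<le> \<rho> M * L2_norm T \<theta>"
  using trace_tail[OF T \<xi> v] by blast
 interpret D: degenerate \<alpha> T using T \<alpha>_pos \<alpha>_less by (rule degenerate.intro)
 note bm = backward_modes[OF T \<xi> v]
 note cv = bm(10)
 define g where "g N t = (\<Sum>n<N. p n L * cf n (v t))" for N t
 have pL: "(\<lambda>t. p n L * cf n (v t)) \<in> L2_space T" for n by (intro continuous_interval_L2 continuous_intros cv)
 hence gL: "g N \<in> L2_space T" for N unfolding g_def by (intro L2_sum)
 have LS: "(LINT t|leb T. \<theta> t * g N t) = (\<Sum>n<N. LINT t|leb T. \<theta> t * (p n L * cf n (v t)))" if "\<theta> \<in> L2_space T" for \<theta> N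
  unfolding g_def sum_distrib_left by (rule LINT_sum) (rule L2_mult_integrable[OF that pL])
 have le: "norm (emb T (g N) - emb T (g M)) \<le> \<rho> M" if MN: "M \<le> N" for M N
 proof -
  let ?\<theta> = "\<lambda>t. g N t - g M t" and ?d = "emb T (g N) - emb T (g M)"
  have \<theta>: "?\<theta> \<in> L2_space T" by (intro L2_diff gL)
  have d: "emb T ?\<theta> = ?d" by (rule emb_diff[OF gL gL])
  have "(norm ?d)\<^sup>2 = inner (emb T ?\<theta>) (emb T (g N)) - inner (emb T ?\<theta>) (emb T (g M))"
   by (simp add: d power2_norm_eq_inner inner_diff_right)
  also have "\<dots> = (\<Sum>n<N. LINT t|leb T. ?\<theta> t * (p n L * cf n (v t))) - (\<Sum>n<M. LINT t|leb T. ?\<theta> t * (p n L * cf n (v t)))"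
   unfolding inner_emb[OF \<theta> gL] LS[OF \<theta>] ..
  also have "\<dots> = (\<Sum>n\<in>{M..<N}. LINT t|leb T. ?\<theta> t * (p n L * cf n (v t)))"
   using sum_diff_nat_ivl[of 0 M N "\<lambda>n. LINT t|leb T. ?\<theta> t * (p n L * cf n (v t))"] MN by (simp add: lessThan_atLeast0)
  also have "\<dots> \<le> \<rho> M * norm ?d" using tail[OF \<theta> MN] norm_emb[OF \<theta>] d by simp
  finally have *: "norm ?d * norm ?d \<le> \<rho> M * norm ?d" by (simp add: power2_eq_square)
  show ?thesis
  proof (cases "norm ?d = 0")
   case True
   \<comment> \<open>In the degenerate case the nonnegativity of \<rho> is needed; it follows from
     the tail estimate over an empty block with a control of positive norm.\<close>
   have "0 \<le> \<rho> M * L2_norm T (\<lambda>t. 1)" using tail[of "\<lambda>t. 1" M M] by simp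
   moreover have "L2_norm T (\<lambda>t. 1) > 0" using T by (simp add: L2_norm_def measure_restrict_space)
   ultimately show ?thesis using True by (simp add: zero_le_mult_iff)
  qed (use * in \<open>simp add: mult_le_cancel_right\<close>)
 qed
 have "Cauchy (\<lambda>N. emb T (g N))"
 proof (rule metric_CauchyI)
  fix \<epsilon> :: real assume "\<epsilon> > 0"
  then obtain M0 where M0: "\<And>M. M \<ge> M0 ==> \<bar>\<rho> M\<bar> < \<epsilon>" using LIMSEQ_D[OF \<rho>] by fastforce
  show "\<exists>M0. \<forall>m\<ge>M0. \<forall>n\<ge>M0. dist (emb T (g m)) (emb T (g n)) < \<epsilon>"
  proof (intro exI allI impI)
   fix m n assume "M0 \<le> m" "M0 \<le> n"
   thus "dist (emb T (g m)) (emb T (g n)) < \<epsilon>"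
    using le[of m n] le[of n m] M0[of m] M0[of n] by (cases "m \<le> n") (auto simp: dist_norm norm_minus_commute)
  qed
 qed
 then obtain G where G: "G \<in> L2_space T" "(\<lambda>N. emb T (g N)) \<longlonglongrightarrow> emb T G" by (rule L2_complete[OF gL]) (rule that)
 have "(\<lambda>n. LINT t|leb T. \<theta> t * (p n L * cf n (v t))) sums (LINT t|leb T. \<theta> t * G t)" if \<theta>: "\<theta> \<in> L2_space T" for \<theta>
  unfolding sums_def LS[OF \<theta>, symmetric] inner_emb[OF \<theta> gL, symmetric] inner_emb[OF \<theta> G(1), symmetric]
  by (intro tendsto_intros G)
 with G show thesis using that by blast
qed

section \<open>Identification of the weak boundary trace\<close>

lemma L2_norm_bounded:
 assumes "u \<in> LL" "\<And>x. x \<in> {0<..<L} ==> \<bar>u x\<bar> \<le> B"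
 shows "NL u \<le> NL (\<lambda>x. B)" unfolding L2_norm_def
proof (intro real_sqrt_le_mono integral_mono)
 show "integrable (leb L) (\<lambda>x. (u x)\<^sup>2)" "integrable (leb L) (\<lambda>x. B\<^sup>2)" using assms(1) L2_const[where c=B and L=L] by (simp_all add: L2_space_def)
 show "(u x)\<^sup>2 \<le> B\<^sup>2" if "x \<in> space (leb L)" for x
  using power_mono[OF assms(2)[of x] abs_ge_zero, of 2] that by simp
qed

text \<open>Evaluates the defining expression of the trace mode by mode: the pairing of gradients
  produces the flux term at L, and everything else cancels after integration by parts in
  time.\<close>

lemma trace_sum:
 assumes T: "T > 0" and \<xi>: "src T \<xi>" and v: "backward T \<xi> v v'"
  and \<phi>: "smooth_compact_support_in ({0<..<T} \<times> {0<..L}) \<phi>"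
 shows "(\<lambda>t. \<phi> t L) \<in> L2_space T"
  "(\<lambda>n. LINT t|leb T. \<phi> t L * (p n L * cf n (v t))) sums
   (integral_Q L T (\<lambda>t x. - v' t x * deriv (\<lambda>s. \<phi> s x) t + x powr \<alpha> * deriv (v t) x * deriv (\<phi> t) x)
    - integral_Q L T (\<lambda>t x. \<xi> t x * \<phi> t x))"
proof -
 note bm = backward_modes[OF T \<xi> v]
 interpret D: degenerate \<alpha> T using T \<alpha>_pos \<alpha>_less by (rule degenerate.intro)
 have "smooth2 \<phi>" using \<phi> by (simp add: smooth_compact_support_in_def)
 then obtain D where D0: "D 0 0 = \<phi>" and Dc: "\<And>i j. continuous_on UNIV (\<lambda>(t, x). D i j t x)"
  and Dt: "\<And>i j t x. ((\<lambda>s. D i j s x) has_der D (Suc i) j t x) (at t)"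
  and Dx: "\<And>i j t x. ((\<lambda>z. D i j t z) has_der D i (Suc j) t x) (at x)" by (rule smooth2E) (rule that)
 have dt: "deriv (\<lambda>s. \<phi> s x) t = D 1 0 t x" and dx: "deriv (\<phi> t) x = D 0 1 t x" for t x
  using Dt[of 0 0 x t] Dx[of 0 0 t x] by (auto intro!: DERIV_imp_deriv simp: D0)
 have cx: "continuous_on A (D i j t)" for A i j t by (intro continuous_at_imp_continuous_on ballI DERIV_isCont[OF Dx])
 have ct: "continuous_on A (\<lambda>t. D i j t x)" for A i j x
  by (intro continuous_at_imp_continuous_on ballI DERIV_isCont[OF Dt])
 have DL: "D i j t \<in> LL" for i j t by (rule continuous_interval_L2[OF cx])
 have bd: "\<exists>B\<ge>0. \<forall>t\<in>{0..T}. \<forall>x\<in>{0..L}. \<bar>D i j t x\<bar> \<le> B" for i j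
 proof -
  have "compact ((\<lambda>(t, x). D i j t x) ` ({0..T} \<times> {0..L}))"
   by (intro compact_continuous_image compact_Times continuous_on_subset[OF Dc]) auto
  then obtain B where B: "\<And>t x. t \<in> {0..T} ==> x \<in> {0..L} ==> \<bar>D i j t x\<bar> \<le> B"
   using compact_imp_bounded by (fastforce simp: bounded_iff)
  hence "0 \<le> B" using B[of 0 0] T L_pos by force
  with B show ?thesis by blast
 qed
 have dcf: "((\<lambda>t. cf n (D i 0 t)) has_der cf n (D (Suc i) 0 t)) (at t)" for n i t
  unfolding cf_def by (rule derivative_under_LINT[where D="\<lambda>i. D i 0", OF Dc Dt e_L2 L_pos])
 have ccf: "continuous_on A (\<lambda>t. cf n (D i 0 t))" for A n i
  by (intro continuous_at_imp_continuous_on ballI DERIV_isCont[OF dcf])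
 show \<phi>L: "(\<lambda>t. \<phi> t L) \<in> L2_space T" using ct[of _ 0 0 L] by (intro continuous_interval_L2) (simp add: D0)
 have z0: "D 0 0 t 0 = 0" if "t \<in> {0<..<T}" for t
  using smooth_support_boundary[OF \<phi>, of t 0] that T L_pos by (auto simp: D0 closure_Times)
 have zT: "cf n (D 0 0 t) = 0" if "t = 0 \<or> t = T" for n t
 proof -
  have "D 0 0 t x * e n x = 0" if "x \<in> space (leb L)" for x
   using smooth_support_boundary[OF \<phi>, of t x] that T L_pos \<open>t = 0 \<or> t = T\<close> by (auto simp: D0 closure_Times)
  hence "cf n (D 0 0 t) = (LINT x|leb L. 0)" unfolding cf_def by (intro LINT_cong) auto
  thus ?thesis by simp
 qed
 obtain B0 B1 Bx where B: "\<And>t x. t \<in> {0..T} ==> x \<in> {0..L} ==> \<bar>D 0 0 t x\<bar> \<le> B0"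
  "\<And>t x. t \<in> {0..T} ==> x \<in> {0..L} ==> \<bar>D 1 0 t x\<bar> \<le> B1" "\<And>t x. t \<in> {0..T} ==> x \<in> {0..L} ==> \<bar>D 0 1 t x\<bar> \<le> Bx" "B1 \<ge> 0" "Bx \<ge> 0" "B0 \<ge> 0"
  using bd[of 0 0] bd[of 1 0] bd[of 0 1] by blast
 obtain M where M: "M \<ge> 0" "\<And>t. t \<in> {0..T} ==> \<bar>NA (v t)\<bar> \<le> M" using bounded_Icc[OF bm(3)] by blast
 obtain M' where M': "M' \<ge> 0" "\<And>t. t \<in> {0..T} ==> \<bar>NL (v' t)\<bar> \<le> M'" using bounded_Icc[OF bm(4)] by blast
 let ?c = "\<lambda>B. NL (\<lambda>x. B)"
 have gr: "grad \<alpha> (\<phi> t) = (\<lambda>x. x powr (\<alpha> / 2) * D 0 1 t x)" for t by (simp add: grad_def dx fun_eq_iff)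
 have grL: "grad \<alpha> (\<phi> t) \<in> LL" for t
  unfolding gr by (intro continuous_interval_L2 continuous_on_mult cx continuous_on_powr') (use \<alpha>_pos in \<open>auto intro!: continuous_intros\<close>)
 have grle: "NL (grad \<alpha> (\<phi> t)) \<le> ?c (L powr (\<alpha> / 2) * Bx)" if t: "t \<in> {0..T}" for t
 proof (rule L2_norm_bounded[OF grL])
  fix x assume x: "x \<in> {0<..<L}"
  have "x powr (\<alpha> / 2) \<le> L powr (\<alpha> / 2)" using x \<alpha>_pos by (intro powr_mono2) auto
  thus "\<bar>grad \<alpha> (\<phi> t) x\<bar> \<le> L powr (\<alpha> / 2) * Bx"
   unfolding gr abs_mult using B(3)[OF t, of x] x by (intro mult_mono) auto
 qed
 have s1: "(\<lambda>n. LINT t|leb T. - cf n (v' t) * cf n (D 1 0 t) + cf n (v t) * (p n L * D 0 0 t L + lam n * cf n (D 0 0 t))) sums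
   integral_Q L T (\<lambda>t x. - v' t x * deriv (\<lambda>s. \<phi> s x) t + x powr \<alpha> * deriv (v t) x * deriv (\<phi> t) x)"
  unfolding dt
 proof (rule weak_form)
  show "integrable (leb T) (\<lambda>t. M' * ?c B1 + M * ?c (L powr (\<alpha> / 2) * Bx))"
   unfolding integrable_on_iff by (intro absolutely_integrable_continuous_real continuous_intros)
  show "AE t in leb T. v' t \<in> LL \<and> D 1 0 t \<in> LL \<and> v t \<in> HA \<and> grad \<alpha> (\<phi> t) \<in> LL \<and>
   (\<forall>n. (LINT x|leb L. grad \<alpha> (e n) x * grad \<alpha> (\<phi> t) x) = p n L * D 0 0 t L + lam n * cf n (D 0 0 t)) \<and>
   NL (v' t) * NL (D 1 0 t) + NL (grad \<alpha> (v t)) * NL (grad \<alpha> (\<phi> t))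
    \<le> M' * ?c B1 + M * ?c (L powr (\<alpha> / 2) * Bx)"
  proof (intro AE_I2 conjI allI)
   fix t assume "t \<in> space (leb T)"
   hence t': "t \<in> {0<..<T}" and t: "t \<in> {0..T}" by auto
   show "v' t \<in> LL" "D 1 0 t \<in> LL" "v t \<in> HA" "grad \<alpha> (\<phi> t) \<in> LL"
    using bm(1,2)[OF t] DL grL by auto
   show "(LINT x|leb L. grad \<alpha> (e n) x * grad \<alpha> (\<phi> t) x) = p n L * D 0 0 t L + lam n * cf n (D 0 0 t)" for n
    unfolding gr by (rule trace_ibp) (use Dx[of 0 0 t] cx z0[OF t'] in auto)
   have "NL (grad \<alpha> (v t)) \<le> M" using M(2)[OF t] L2_norm_ge_0[of L "v t"] unfolding H1_norm_eq by linarith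
   moreover have "NL (D 1 0 t) \<le> ?c B1" using B(2)[OF t] by (intro L2_norm_bounded DL) auto
   ultimately show "NL (v' t) * NL (D 1 0 t) + NL (grad \<alpha> (v t)) * NL (grad \<alpha> (\<phi> t))
    \<le> M' * ?c B1 + M * ?c (L powr (\<alpha> / 2) * Bx)"
    using M'(2)[OF t] M(1) M'(1) grle[OF t] by (intro add_mono mult_mono) auto
  qed
  show "(\<lambda>t. p n L * D 0 0 t L + lam n * cf n (D 0 0 t)) \<in> meas T" for n
   by (intro continuous_measurable continuous_intros ct ccf)
 qed (intro continuous_measurable bm ccf)+
 have "AE t in leb T. \<xi> t \<in> LL \<and> D 0 0 t \<in> LL \<and> NL (\<xi> t) * NL (D 0 0 t) \<le> NL (\<xi> t) * ?c B0"
  using \<xi>[unfolded src_def, THEN conjunct1] AE_space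
  by eventually_elim (use B(1) DL in \<open>auto intro!: mult_left_mono L2_norm_bounded\<close>)
 hence s2: "(\<lambda>n. LINT t|leb T. cf n (\<xi> t) * cf n (D 0 0 t)) sums integral_Q L T (\<lambda>t x. \<xi> t x * \<phi> t x)"
  unfolding D0[symmetric] by (rule parseval_Q(1)) (use \<xi> in \<open>auto simp: src_def intro: continuous_measurable ccf\<close>)
 have "(LINT t|leb T. - cf n (v' t) * cf n (D 1 0 t) + cf n (v t) * (p n L * D 0 0 t L + lam n * cf n (D 0 0 t)))
   - (LINT t|leb T. cf n (\<xi> t) * cf n (D 0 0 t)) = (LINT t|leb T. \<phi> t L * (p n L * cf n (v t)))" for n
 proof -
  let ?f = "\<lambda>s. cf n (\<xi> s) - lam n * cf n (v s)"
  have f: "?f AI {0..T}"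
   by (intro set_integral_diff(1) src_abs_int[OF \<xi>] absolutely_integrable_continuous_real continuous_intros bm(10))
  have g: "(\<lambda>t. cf n (D 1 0 t)) AI {0..T}" by (rule absolutely_integrable_continuous_real[OF ccf])
  have \<phi>n: "cf n (D 0 0 t) = cf n (D 0 0 0) + integral {0..t} (\<lambda>t. cf n (D 1 0 t))" if "t \<in> {0..T}" for t
   using deriv_imp_integral[OF has_field_derivative_at_within[OF dcf] that, of n 0] by simp
  have TT: "T \<in> {0..T}" using T by simp
  have z: "integral {0..T} (\<lambda>s. ?f s * cf n (D 0 0 s) + cf n (v' s) * cf n (D 1 0 s)) = cf n (v' T) * cf n (D 0 0 T) - cf n (v' 0) * cf n (D 0 0 0)"
   by (rule integral_parts(1)[OF f g bm(7) \<phi>n TT])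
  have i1: "(\<lambda>t. - cf n (v' t) * cf n (D 1 0 t) + cf n (v t) * (p n L * D 0 0 t L + lam n * cf n (D 0 0 t))) AI {0..T}"
   "(\<lambda>t. D 0 0 t L * (p n L * cf n (v t))) AI {0..T}"
   by (intro absolutely_integrable_continuous_real continuous_intros bm(5,10) ccf ct)+
  have i2: "(\<lambda>t. cf n (\<xi> t) * cf n (D 0 0 t)) AI {0..T}"
   "(\<lambda>s. ?f s * cf n (D 0 0 s) + cf n (v' s) * cf n (D 1 0 s)) AI {0..T}"
   by (rule abs_int_mult_continuous(1)[OF src_abs_int[OF \<xi>] ccf])
    (intro set_integral_add(1) abs_int_mult_continuous(1)[OF f ccf] absolutely_integrable_continuous_real continuous_intros bm(5) ccf)
  have "integral {0..T} (\<lambda>t. - cf n (v' t) * cf n (D 1 0 t) + cf n (v t) * (p n L * D 0 0 t L + lam n * cf n (D 0 0 t)))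
    - integral {0..T} (\<lambda>t. cf n (\<xi> t) * cf n (D 0 0 t))
    = integral {0..T} (\<lambda>t. D 0 0 t L * (p n L * cf n (v t)) - (?f t * cf n (D 0 0 t) + cf n (v' t) * cf n (D 1 0 t)))"
   unfolding hk_diff[OF hk[OF i1(1)] hk[OF i2(1)], symmetric] by (rule integral_cong) (simp add: algebra_simps)
  also have "\<dots> = integral {0..T} (\<lambda>t. D 0 0 t L * (p n L * cf n (v t)))"
   unfolding hk_diff[OF hk[OF i1(2)] hk[OF i2(2)]] z using zT[of 0 n] zT[of T n] by simp
  finally show ?thesis using i1 i2(1) by (simp add: LINT_eq_integral integrable_on_iff D0)
 qed
 with sums_diff[OF s1 s2] show "(\<lambda>n. LINT t|leb T. \<phi> t L * (p n L * cf n (v t))) sums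
   (integral_Q L T (\<lambda>t x. - v' t x * deriv (\<lambda>s. \<phi> s x) t + x powr \<alpha> * deriv (v t) x * deriv (\<phi> t) x)
    - integral_Q L T (\<lambda>t x. \<xi> t x * \<phi> t x))" by simp
qed

text \<open>The limit of the partial sums, divided by \<open>L powr \<alpha>\<close>, is a trace.
  Conversely every trace equals it almost everywhere, so the series formula holds for whichever
  trace is given.\<close>

lemma boundary_trace:
 assumes T: "T > 0" and \<xi>: "src T \<xi>" and v: "backward T \<xi> v v'"
 shows "\<exists>g. is_boundary_trace \<alpha> L T \<xi> v v' g"
  "is_boundary_trace \<alpha> L T \<xi> v v' g ==> \<theta> \<in> L2_space T ==>
   (\<lambda>n. LINT t|leb T. \<theta> t * (p n L * cf n (v t))) sums (L powr \<alpha> * (LINT t|leb T. \<theta> t * g t))"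
proof -
 obtain G where G: "G \<in> L2_space T" and Gs: "\<And>\<theta>. \<theta> \<in> L2_space T ==>
   (\<lambda>n. LINT t|leb T. \<theta> t * (p n L * cf n (v t))) sums (LINT t|leb T. \<theta> t * G t)" using trace_limit[OF T \<xi> v] by blast
 note ts = trace_sum[OF T \<xi> v]
 have L0: "L powr \<alpha> > 0" using L_pos by simp
 have "is_boundary_trace \<alpha> L T \<xi> v v' (\<lambda>t. inverse (L powr \<alpha>) * G t)"
  unfolding is_boundary_trace_def
 proof (intro conjI allI impI)
  fix \<phi> assume \<phi>: "smooth_compact_support_in ({0<..<T} \<times> {0<..L}) \<phi>"
  have "(LINT t|leb T. inverse (L powr \<alpha>) * G t * \<phi> t L) = inverse (L powr \<alpha>) * (LINT t|leb T. \<phi> t L * G t)"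
   by (subst integral_mult_right_zero[symmetric]) (simp add: mult_ac)
  thus "integral_Q L T (\<lambda>t x. - v' t x * deriv (\<lambda>s. \<phi> s x) t + x powr \<alpha> * deriv (v t) x * deriv (\<phi> t) x)
    - integral_Q L T (\<lambda>t x. \<xi> t x * \<phi> t x) = L powr \<alpha> * (LINT t|leb T. inverse (L powr \<alpha>) * G t * \<phi> t L)"
   using sums_unique2[OF ts(2)[OF \<phi>] Gs[OF ts(1)[OF \<phi>]]] L0 by simp
 qed (rule L2_cmult[OF G])
 thus "\<exists>g. is_boundary_trace \<alpha> L T \<xi> v v' g" by blast
 assume g: "is_boundary_trace \<alpha> L T \<xi> v v' g" and \<theta>: "\<theta> \<in> L2_space T"
 have gL: "g \<in> L2_space T" using g by (simp add: is_boundary_trace_def)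
 have dL: "(\<lambda>t. L powr \<alpha> * g t - G t) \<in> L2_space T" by (intro L2_diff L2_cmult gL G)
 have "AE t in leb T. L powr \<alpha> * g t - G t = 0"
 proof (rule fundamental_lemma[OF L2_integrable[OF dL]])
  fix a assume a: "test1 T a"
  hence sa: "smooth1 a" by (simp add: test1_def)
  obtain c d where cd: "0 < c" "d < T" "\<And>t. t \<notin> {c<..<d} ==> a t = 0" using a unfolding test1_def by blast
  have "L / 3 < L / 2" using L_pos by simp
  \<comment> \<open>A cut-off vanishing near 0 and equal to 1 at L, so that \<open>a t * b x\<close>
    has boundary values \<open>a\<close>: every test function in time is attained.\<close>
  then obtain b where b: "smooth1 b" "\<And>x. x \<le> L / 3 ==> b x = 0" "\<And>x. x \<ge> L / 2 ==> b x = 1" by (rule smooth_step) (rule that)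
  have \<phi>: "smooth_compact_support_in ({0<..<T} \<times> {0<..L}) (\<lambda>t x. a t * b x)"
  proof (rule smooth_compact_supportI)
   show "smooth2 (\<lambda>t x. a t * b x)" by (rule smooth2_product[OF sa b(1)])
   show "compact ({c..d} \<times> {L/3..L})" by (intro compact_Times compact_Icc)
   show "{c..d} \<times> {L/3..L} \<subseteq> {0<..<T} \<times> {0<..L}" using cd L_pos by auto
   show "(t, x) \<in> {c..d} \<times> {L/3..L}" if "(t, x) \<in> {0<..<T} \<times> {0<..L}" "a t * b x \<noteq> 0" for t x
    using cd(3)[of t] b(2)[of x] that by (cases "t \<in> {c<..<d}"; cases "x \<le> L / 3") auto
  qed
  have bL: "b L = 1" using b(3)[of L] L_pos by simp
  have aL: "a \<in> L2_space T" using ts(1)[OF \<phi>] by (simp add: bL)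
  have "L powr \<alpha> * (LINT t|leb T. g t * a t) = (LINT t|leb T. a t * G t)"
   using sums_unique2[OF ts(2)[OF \<phi>] Gs[OF ts(1)[OF \<phi>]]] g \<phi> unfolding is_boundary_trace_def by (simp add: bL)
  moreover have "(LINT t|leb T. (L powr \<alpha> * g t - G t) * a t) = L powr \<alpha> * (LINT t|leb T. g t * a t) - (LINT t|leb T. a t * G t)"
   using L2_mult_integrable[OF gL aL] L2_mult_integrable[OF aL G] by (simp add: left_diff_distrib mult.assoc mult.commute[of "G _"])
  ultimately show "(LINT t|leb T. (L powr \<alpha> * g t - G t) * a t) = 0" by simp
 qed
 hence "emb T G = emb T (\<lambda>t. L powr \<alpha> * g t)"
  by (intro L2_cong_AE(2) L2_cmult gL) (auto elim: eventually_mono)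
 hence "inner (emb T \<theta>) (emb T G) = L powr \<alpha> * inner (emb T \<theta>) (emb T g)" by (simp add: emb_cmult gL)
 thus "(\<lambda>n. LINT t|leb T. \<theta> t * (p n L * cf n (v t))) sums (L powr \<alpha> * (LINT t|leb T. \<theta> t * g t))"
  using Gs[OF \<theta>] by (simp add: inner_emb \<theta> gL G)
qed

text \<open>The scalar duality relations are summed over n; each of the terms converges separately,
  by Parseval, by the coefficient series of \<open>w1\<close>, and by the trace series.\<close>

lemma transposition_identity:
 assumes T: "T > 0" and w0: "w0 \<in> LL" and w1: "w1 \<in> HD" and \<theta>: "\<theta> \<in> L2_space T"
  and w: "cont_into (LL) (NL) T w" "\<And>t n. t \<in> {0..T} ==> cf n (w t) = wk (\<lambda>n. cf n w0) (\<lambda>n. w1 (e n)) \<theta> t n"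
 shows "transposition_solution \<alpha> L T w0 w1 \<theta> w" unfolding transposition_solution_def
proof (intro conjI ballI w allI impI)
 fix \<xi> assume "\<xi> \<in> Bochner_Lp 1 (LL) (NL) T"
 hence \<xi>: "src T \<xi>" by (rule src_Bochner)
 show "\<exists>v v' g. backward T \<xi> v v' \<and> is_boundary_trace \<alpha> L T \<xi> v v' g"
  using backward_exists[OF T \<xi>] boundary_trace(1)[OF T \<xi>] by blast
 fix v v' g assume "backward T \<xi> v v' \<and> is_boundary_trace \<alpha> L T \<xi> v v' g"
 hence v: "backward T \<xi> v v'" and g: "is_boundary_trace \<alpha> L T \<xi> v v' g" by auto
 note bm = backward_modes[OF T \<xi> v]
 have T0: "0 \<in> {0..T}" using T by simp
 obtain M where M: "\<And>t. t \<in> {0..T} ==> \<bar>NL (w t)\<bar> \<le> M"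
  using bounded_Icc[OF cont_into_functional[OF w(1) L2_norm_lipschitz]] by blast
 have wL: "w t \<in> LL" if "t \<in> {0..T}" for t using w(1) that by (simp add: cont_into_def)
 have ae: "AE t in leb T. w t \<in> LL \<and> \<xi> t \<in> LL \<and> NL (w t) * NL (\<xi> t) \<le> M * NL (\<xi> t)"
  using \<xi>[unfolded src_def, THEN conjunct1] AE_space
  by eventually_elim (use M wL in \<open>auto intro!: mult_right_mono\<close>)
 have "(\<lambda>n. LINT t|leb T. cf n (w t) * cf n (\<xi> t)) sums integral_Q L T (\<lambda>t x. w t x * \<xi> t x)"
  by (rule parseval_Q(1)[OF ae _ continuous_measurable[OF cont_into_functional[OF w(1) cf_lipschitz]]]) (use \<xi> in \<open>auto simp: src_def\<close>)
 moreover have "(LINT t|leb T. cf n (w t) * cf n (\<xi> t)) = w1 (e n) * cf n (v 0) - cf n w0 * cf n (v' 0) - (LINT t|leb T. \<theta> t * (p n L * cf n (v t)))" for n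
  unfolding mode_duality[OF T \<xi> v \<theta>, symmetric] by (rule LINT_cong) (simp_all add: w(2) wk_def)
 moreover have "(\<lambda>n. w1 (e n) * cf n (v 0) - cf n w0 * cf n (v' 0) - (LINT t|leb T. \<theta> t * (p n L * cf n (v t)))) sums
   (w1 (v 0) - (LINT x|leb L. w0 x * v' 0 x) - L powr \<alpha> * (LINT t|leb T. \<theta> t * g t))"
  using Hdual_coeffs w1 bm(1)[OF T0] by (intro sums_diff parseval w0 bm(2)[OF T0] boundary_trace(2)[OF T \<xi> v g \<theta>]) blast
 ultimately show "integral_Q L T (\<lambda>t x. w t x * \<xi> t x) =
   w1 (v 0) - (LINT x|leb L. w0 x * v' 0 x) - L powr \<alpha> * (LINT t|leb T. \<theta> t * g t)" using sums_unique2 by simp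
qed

text \<open>The right-hand side does not involve the solution. Choosing the source
  \<open>Q t * e n x\<close>, with \<open>Q\<close> the difference of the n-th coefficients of two
  solutions, makes the integral of \<open>Q^2\<close> vanish.\<close>

lemma transposition_unique:
 assumes T: "T > 0" and w: "transposition_solution \<alpha> L T w0 w1 \<theta> w" and z: "transposition_solution \<alpha> L T w0 w1 \<theta> z" and t: "t \<in> {0..T}"
 shows "AE x in leb L. z t x = w t x"
proof -
 have c: "cont_into (LL) (NL) T w" "cont_into (LL) (NL) T z" using w z by (auto simp: transposition_solution_def)
 have V: "w t \<in> LL" "z t \<in> LL" using c t by (auto simp: cont_into_def)
 have "cf n (z t) = cf n (w t)" for n
 proof -
  define Q where "Q t = cf n (w t) - cf n (z t)" for t
  have cw: "cont T (\<lambda>t. cf n (w t))" by (rule cont_into_functional[OF c(1) cf_lipschitz])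
  have cz: "cont T (\<lambda>t. cf n (z t))" by (rule cont_into_functional[OF c(2) cf_lipschitz])
  have cQ: "cont T Q" unfolding Q_def by (intro continuous_intros cw cz)
  let ?\<xi> = "\<lambda>t x. Q t * e n x"
  have \<xi>: "?\<xi> \<in> Bochner_Lp 1 (LL) (NL) T"
   by (rule Bochner_scalar[where u="e n", OF cQ L2_cmult[OF e_L2] L2_norm_cmult[OF e_L2]])
  obtain v v' g where v: "backward T ?\<xi> v v'" "is_boundary_trace \<alpha> L T ?\<xi> v v' g"
   using backward_exists[OF T src_Bochner[OF \<xi>]] boundary_trace(1)[OF T src_Bochner[OF \<xi>]] by blast
  have id: "integral_Q L T (\<lambda>t x. u t x * ?\<xi> t x) = w1 (v 0) - (LINT x|leb L. w0 x * v' 0 x) - L powr \<alpha> * (LINT t|leb T. \<theta> t * g t)"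
   if "transposition_solution \<alpha> L T w0 w1 \<theta> u" for u
   using that[unfolded transposition_solution_def, THEN conjunct2, rule_format, OF \<xi>, THEN conjunct2, rule_format, OF conjI[OF v]] .
  have "integral_Q L T (\<lambda>t x. w t x * (Q t * e n x)) = integral_Q L T (\<lambda>t x. z t x * (Q t * e n x))"
   unfolding id[OF w] id[OF z] ..
  moreover have "(LINT x|leb L. u x * (r * e n x)) = r * cf n u" for u r
   unfolding cf_def by (subst integral_mult_right_zero[symmetric]) (simp add: mult_ac)
  ultimately have "(LINT t|leb T. Q t * cf n (w t)) = (LINT t|leb T. Q t * cf n (z t))" by (simp add: integral_Q_def)
  moreover have i: "integrable (leb T) (\<lambda>t. Q t * cf n (w t))" "integrable (leb T) (\<lambda>t. Q t * cf n (z t))" "integrable (leb T) (\<lambda>t. (Q t)\<^sup>2)"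
   unfolding integrable_on_iff by (intro absolutely_integrable_continuous_real continuous_intros cQ cw cz)+
  ultimately have "(LINT t|leb T. Q t * cf n (w t) - Q t * cf n (z t)) = 0" by simp
  hence "(LINT t|leb T. (Q t)\<^sup>2) = 0" by (simp add: Q_def power2_eq_square right_diff_distrib)
  hence "(Q t)\<^sup>2 = 0"
   using integral_eq_0_iff[of 0 T "\<lambda>t. (Q t)\<^sup>2", OF continuous_on_power[OF cQ] T] t LINT_eq_integral[OF i(3)] by simp
  thus ?thesis by (simp add: Q_def)
 qed
 thus ?thesis by (rule cf_eq_AE[OF V(2,1)])
qed

section \<open>The solution as a curve into the dual space\<close>

lemma L2_embed_dl:
 assumes w: "w \<in> LL" and s: "sq (\<lambda>n. cf n w / om n)" and u: "u \<in> HA"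
 shows "L2_embed L w u = dl (\<lambda>n. cf n w / om n) u"
proof -
 have "om n \<noteq> 0" for n using om(1)[of n] by simp
 hence "(\<lambda>n. cf n w * cf n u) sums dl (\<lambda>n. cf n w / om n) u" using dl_sums[OF u s] by simp
 thus ?thesis unfolding L2_embed_def using parseval[OF w H1_L2[OF u]] by (rule sums_unique2[symmetric])
qed

lemma dl_lin: "sq x ==> sq y ==> dl (\<lambda>n. r * x n + s * y n) u = r * dl x u + s * dl y u"
 by (simp add: dl_def vec_lin inner_add_left)

text \<open>Difference quotients of the embedded curve are functionals \<open>dl\<close> of
  difference quotients in l2, so dual norms are bounded by l2 norms. The second claim is uniqueness
  of limits; it is stated on \<open>HA\<close> because functionals are free elsewhere.\<close>

lemma wave_in_K:
 assumes T: "T > 0" and \<theta>: "\<theta> \<in> L2_space T" and a: "sq a" and c: "sq (\<lambda>n. c n / om n)"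
  and w: "\<And>t. t \<in> {0..T} ==> w t \<in> LL" "\<And>t n. t \<in> {0..T} ==> cf n (w t) = wk a c \<theta> t n"
 shows "in_K \<alpha> L T w (\<lambda>t. dl (wz a c \<theta> t))"
  and "in_K \<alpha> L T w w' ==> t \<in> {0..T} ==> u \<in> HA ==> w' t u = dl (wz a c \<theta> t) u"
proof -
 note wc = wave_curves[OF T \<theta> a c]
 let ?z = "wz a c \<theta>"
 let ?q = "\<lambda>t s n. (cf n (w s) / om n - cf n (w t) / om n) / (s - t)"
 have W: "sq (\<lambda>n. cf n (w t) / om n)" if "t \<in> {0..T}" for t using wc(6)[OF that] w(2)[OF that] by simp
 have Z: "sq (?z t)" if "t \<in> {0..T}" for t using wc(2) that by (simp add: sqcurve_def)
 have q: "sq (?q t s)" "vec (?q t s) = (vec (\<lambda>n. wk a c \<theta> s n / om n) - vec (\<lambda>n. wk a c \<theta> t n / om n)) /\<^sub>R (s - t)"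
  if "s \<in> {0..T}" "t \<in> {0..T}" for s t
  using vec_lin[OF W[OF that(1)] W[OF that(2)], of "inverse (s - t)" "- inverse (s - t)"] that
  by (simp_all add: w(2) divide_inverse[of _ "s - t"] left_diff_distrib mult.commute[of _ "inverse (s - t)"] right_diff_distrib scaleR_diff_right)
 have quot: "(L2_embed L (w s) u - L2_embed L (w t) u) / (s - t) = dl (?q t s) u" if "u \<in> HA" "s \<in> {0..T}" "t \<in> {0..T}" for s t u
  using dl_lin[OF W[OF that(2)] W[OF that(3)], of "inverse (s - t)" "- inverse (s - t)" u] L2_embed_dl[OF w(1)[OF that(2)] W[OF that(2)] that(1)]
   L2_embed_dl[OF w(1)[OF that(3)] W[OF that(3)] that(1)]
  by (simp add: divide_inverse[of _ "s - t"] left_diff_distrib mult.commute[of _ "inverse (s - t)"] right_diff_distrib)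
 have lim: "((\<lambda>s. norm (vec (\<lambda>n. ?q t s n - ?z t n))) \<longlongrightarrow> 0) (at t within {0..T})" if t: "t \<in> {0..T}" for t
  by (rule Lim_transform_eventually[OF has_vector_derivative_quotient[OF wc(5)[OF t]]])
   (use vec_diff[OF q(1)[OF _ t] Z[OF t]] q(2)[OF _ t] in \<open>simp add: eventually_at_filter\<close>)
 have dle: "ND F \<le> norm (vec x) \<and> ND F \<ge> 0" if "\<And>u. u \<in> HA ==> F u = dl x u" for F x
  using Hdual_norm_cong[of F "dl x"] that Hdual_norm_dl Hdual_norm_nonneg[OF dl_Hdual] by simp
 have dd: "dl x u - dl y u = dl (\<lambda>n. x n - y n) u" if "sq x" "sq y" for x y u using dl_lin[OF that, of 1 "-1"] by simp
 show "in_K \<alpha> L T w (\<lambda>t. dl (?z t))" unfolding in_K_def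
 proof (intro conjI)
  show "cont_into (LL) (NL) T w" by (rule cont_into_L2I(1)[OF wc(1) w])
  show "has_time_deriv (ND) T (\<lambda>t. L2_embed L (w t)) (\<lambda>t. dl (?z t))" unfolding has_time_deriv_def
  proof
   fix t assume t: "t \<in> {0..T}"
   have "norm (ND (\<lambda>u. (L2_embed L (w s) u - L2_embed L (w t) u) / (s - t) - dl (?z t) u)) \<le> norm (vec (\<lambda>n. ?q t s n - ?z t n))"
    if s: "s \<in> {0..T}" for s
    using dle[of "\<lambda>u. (L2_embed L (w s) u - L2_embed L (w t) u) / (s - t) - dl (?z t) u" "\<lambda>n. ?q t s n - ?z t n"] quot[OF _ s t] dd[OF q(1)[OF s t] Z[OF t]] by simp
   thus "((\<lambda>s. ND (\<lambda>u. (L2_embed L (w s) u - L2_embed L (w t) u) / (s - t) - dl (?z t) u)) \<longlongrightarrow> 0) (at t within {0..T})"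
    by (intro Lim_null_comparison[OF _ lim[OF t]]) (simp add: eventually_at_filter)
  qed
  show "cont_into (HD) (ND) T (\<lambda>t. dl (?z t))" unfolding cont_into_def
  proof (intro ballI conjI dl_Hdual)
   fix t assume t: "t \<in> {0..T}"
   have l: "((\<lambda>s. norm (vec (?z s) - vec (?z t))) \<longlongrightarrow> 0) (at t within {0..T})"
    by (rule cont_into_L2I(2)[OF wc(2) _ _ t, of "\<lambda>t. fn (?z t)"]) (use Z in \<open>auto simp: fn\<close>)
   have "norm (ND (\<lambda>u. dl (?z s) u - dl (?z t) u)) \<le> norm (vec (?z s) - vec (?z t))" if s: "s \<in> {0..T}" for s
    using dle[of "\<lambda>u. dl (?z s) u - dl (?z t) u" "\<lambda>n. ?z s n - ?z t n"] dd[OF Z[OF s] Z[OF t]] vec_diff[OF Z[OF s] Z[OF t]] by simp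
   thus "((\<lambda>s. ND (\<lambda>u. dl (?z s) u - dl (?z t) u)) \<longlongrightarrow> 0) (at t within {0..T})"
    by (intro Lim_null_comparison[OF _ l]) (simp add: eventually_at_filter)
  qed
 qed
 assume K: "in_K \<alpha> L T w w'" and t: "t \<in> {0..T}" and u: "u \<in> HA"
 have w't: "w' t \<in> HD" using K t by (simp add: in_K_def cont_into_def)
 let ?D = "\<lambda>s u. (L2_embed L (w s) u - L2_embed L (w t) u) / (s - t) - w' t u"
 have lim': "((\<lambda>s. ND (?D s)) \<longlongrightarrow> 0) (at t within {0..T})" using K t by (simp add: in_K_def has_time_deriv_def)
 have "\<bar>w' t u - dl (?z t) u\<bar> \<le> (ND (?D s) + norm (vec (\<lambda>n. ?q t s n - ?z t n))) * NA u" if s: "s \<in> {0..T}" for s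
 proof -
  let ?F = "\<lambda>u. dl (?q t s) u - w' t u"
  \<comment> \<open>Membership in the dual is what allows the dual norm of the difference to bound
    its value at \<open>u\<close>.\<close>
  have "?F \<in> HD"
  proof -
   obtain B1 B2 where B: "\<And>u. u \<in> HA ==> \<bar>dl (?q t s) u\<bar> \<le> B1 * NA u" "\<And>u. u \<in> HA ==> \<bar>w' t u\<bar> \<le> B2 * NA u"
    using dl_Hdual[of "?q t s"] w't unfolding Hdual_space_def by blast
   have "\<bar>?F u\<bar> \<le> (B1 + B2) * NA u" if "u \<in> HA" for u
    using B(1)[OF that] B(2)[OF that] by (simp add: distrib_right)
   thus ?thesis using dl_Hdual[of "?q t s"] w't unfolding Hdual_space_def by (auto simp: right_diff_distrib)
  qed
  from Hdual_le[OF this u] have "\<bar>?F u\<bar> \<le> ND (?D s) * NA u"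
   using Hdual_norm_cong[of "?D s" ?F] quot[OF _ s t] by simp
  moreover have "\<bar>dl (?q t s) u - dl (?z t) u\<bar> \<le> norm (vec (\<lambda>n. ?q t s n - ?z t n)) * NA u"
   unfolding dd[OF q(1)[OF s t] Z[OF t]] by (rule dl_le[OF u])
  ultimately show ?thesis by (simp add: distrib_right)
 qed
 hence ev: "\<forall>\<^sub>F s in at t within {0..T}. \<bar>w' t u - dl (?z t) u\<bar> \<le> (ND (?D s) + norm (vec (\<lambda>n. ?q t s n - ?z t n))) * NA u"
  by (simp add: eventually_at_filter)
 have nt: "at t within {0..T} \<noteq> bot" using T t by (simp add: trivial_limit_within islimpt_Icc)
 have "((\<lambda>s. (ND (?D s) + norm (vec (\<lambda>n. ?q t s n - ?z t n))) * NA u) \<longlongrightarrow> (0 + 0) * NA u) (at t within {0..T})"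
  by (intro tendsto_mult_right tendsto_add lim' lim[OF t])
 from tendsto_lowerbound[OF this ev nt] show "w' t u = dl (?z t) u" by simp
qed

text \<open>The estimate concerns every representation of a solution and of its time derivative, so
  uniqueness of both is used to transfer the bound from the constructed curves.\<close>

lemma wave_solution:
 assumes T: "T > 0"
 shows "\<exists>C>0. \<forall>w0\<in>LL. \<forall>w1\<in>HD. \<forall>\<theta>\<in>L2_space T.
  (\<exists>w w'. transposition_solution \<alpha> L T w0 w1 \<theta> w \<and> in_K \<alpha> L T w w') \<and>
  (\<forall>w w'. transposition_solution \<alpha> L T w0 w1 \<theta> w \<and> in_K \<alpha> L T w w' -->
   K_norm \<alpha> L T w w' \<le> C * (NL w0 + ND w1 + L2_norm T \<theta>))"
proof -
 obtain C1 where C1: "C1 \<ge> 0 \<and> (\<forall>F\<in>HD. sq (\<lambda>n. F (e n) / om n) \<and>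
   norm (vec (\<lambda>n. F (e n) / om n)) \<le> C1 * ND F \<and> (\<forall>u\<in>HA. (\<lambda>n. F (e n) * cf n u) sums F u))"
  using Hdual_coeffs by (elim exE) (rule that)
 have coeffs: "sq (\<lambda>n. F (e n) / om n)" "norm (vec (\<lambda>n. F (e n) / om n)) \<le> C1 * ND F" if "F \<in> HD" for F
  using bspec[OF conjunct2[OF C1] that] by (simp_all only: simp_thms)
 define C2 where "C2 = 2 * sqrt (hidden_const T)"
 have C10: "C1 \<ge> 0" using C1 by (rule conjunct1)
 have C2: "C2 \<ge> 0" using hidden_const_nonneg[of T] T by (simp add: C2_def)
 \<comment> \<open>The factor 2 stands for the two suprema in the norm; \<open>C1\<close> compares
   dual coefficients with the dual norm and \<open>C2\<close> comes from hidden regularity.\<close>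
 define C where "C = 2 * (1 + C1 + C2)"
 have "(\<exists>w w'. transposition_solution \<alpha> L T w0 w1 \<theta> w \<and> in_K \<alpha> L T w w') \<and>
  (\<forall>w w'. transposition_solution \<alpha> L T w0 w1 \<theta> w \<and> in_K \<alpha> L T w w' -->
   K_norm \<alpha> L T w w' \<le> C * (NL w0 + ND w1 + L2_norm T \<theta>))"
  if w0: "w0 \<in> LL" and w1: "w1 \<in> HD" and \<theta>: "\<theta> \<in> L2_space T" for w0 w1 \<theta>
 proof -
  let ?a = "\<lambda>n. cf n w0" and ?c = "\<lambda>n. w1 (e n)"
  have a: "sq ?a" and c: "sq (\<lambda>n. ?c n / om n)" by (rule sq_cf[OF w0], rule coeffs(1)[OF w1])
  note wc = wave_curves[OF T \<theta> a c]
  let ?w = "\<lambda>t. fn (wk ?a ?c \<theta> t)" and ?B = "NL w0 + C1 * ND w1 + C2 * L2_norm T \<theta>"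
  have B: "norm (vec ?a) + norm (vec (\<lambda>n. ?c n / om n)) + 2 * (sqrt (hidden_const T) * L2_norm T \<theta>) \<le> ?B"
   using vec_cf[OF w0] norm_emb[OF w0] coeffs(2)[OF w1] by (simp add: C2_def)
  have sw: "sq (wk ?a ?c \<theta> t)" if "t \<in> {0..T}" for t using wc(1) that by (simp add: sqcurve_def)
  have w: "?w t \<in> LL" "t \<in> {0..T} ==> cf n (?w t) = wk ?a ?c \<theta> t n" for t n by (simp_all add: fn sw)
  have ts: "transposition_solution \<alpha> L T w0 w1 \<theta> ?w"
   by (rule transposition_identity[OF T w0 w1 \<theta> cont_into_L2I(1)[OF wc(1) w] w(2)])
  have "K_norm \<alpha> L T z z' \<le> C * (NL w0 + ND w1 + L2_norm T \<theta>)"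
   if z: "transposition_solution \<alpha> L T w0 w1 \<theta> z" "in_K \<alpha> L T z z'" for z z'
  proof -
   have zL: "z t \<in> LL" if "t \<in> {0..T}" for t using z(2) that by (simp add: in_K_def cont_into_def)
   have ez: "emb L (z t) = vec (wk ?a ?c \<theta> t)" if t: "t \<in> {0..T}" for t
    using L2_cong_AE(2)[OF zL[OF t] transposition_unique[OF T ts z(1) t]] fn(2)[OF sw[OF t]] by simp
   have cz: "cf n (z t) = wk ?a ?c \<theta> t n" if t: "t \<in> {0..T}" for t n
    unfolding cf_emb[OF zL[OF t]] ez[OF t] by (rule inner_vec[OF sw[OF t]])
   have 1: "NL (z t) \<le> ?B" if t: "t \<in> {0..T}" for t using norm_emb[OF zL[OF t]] ez[OF t] wc(3)[OF t] B by simp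
   have 2: "ND (z' t) \<le> ?B" if t: "t \<in> {0..T}" for t
   proof -
    have "ND (z' t) = ND (dl (wz ?a ?c \<theta> t))"
     by (rule Hdual_norm_cong, rule wave_in_K(2)[OF T \<theta> a c zL cz z(2) t])
    thus ?thesis using Hdual_norm_dl[of "wz ?a ?c \<theta> t"] wc(4)[OF t] B by linarith
   qed
   have "(SUP t\<in>{0..T}. NL (z t)) \<le> ?B" "(SUP t\<in>{0..T}. ND (z' t)) \<le> ?B"
    using T by (auto intro!: cSUP_least 1 2)
   hence "K_norm \<alpha> L T z z' \<le> 2 * ?B" by (simp add: K_norm_def)
   also have "\<dots> \<le> C * (NL w0 + ND w1 + L2_norm T \<theta>)"
   proof -
    have "0 \<le> x ==> 0 \<le> y ==> 0 \<le> r ==> 2 * (x + C1 * y + C2 * r) \<le> C * (x + y + r)" for x y r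
     using C10 C2 by (simp add: C_def algebra_simps add_increasing add_increasing2)
    thus ?thesis using Hdual_norm_nonneg[OF w1] by simp
   qed
   finally show ?thesis .
  qed
  thus ?thesis using ts wave_in_K(1)[OF T \<theta> a c w] by blast
 qed
 moreover have "C > 0" using C10 C2 by (simp add: C_def)
 ultimately show ?thesis by blast
qed

end

theorem theorem1p1:
  fixes T L \<alpha> :: real
  assumes "T > 0" and "L > 0" and "0 < \<alpha>" and "\<alpha> < 2"
  shows
    "(\<forall>w0 \<in> L2_space L. \<forall>w1 \<in> Hdual_space \<alpha> L. \<forall>\<theta> \<in> L2_space T.
        \<exists>w. transposition_solution \<alpha> L T w0 w1 \<theta> w \<and>
            (\<exists>w'. in_K \<alpha> L T w w') \<and>
            (\<forall>z. transposition_solution \<alpha> L T w0 w1 \<theta> z \<longrightarrow>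
               (\<forall>t\<in>{0..T}. AE x in lebesgue_on {0<..<L}. z t x = w t x))) \<and>
     (\<exists>C>0. \<forall>w0 \<in> L2_space L. \<forall>w1 \<in> Hdual_space \<alpha> L. \<forall>\<theta> \<in> L2_space T. \<forall>w w'.
        transposition_solution \<alpha> L T w0 w1 \<theta> w \<and> in_K \<alpha> L T w w' \<longrightarrow>
        K_norm \<alpha> L T w w' \<le> C * (L2_norm L w0 + Hdual_norm \<alpha> L w1 + L2_norm T \<theta>))"
proof -
  interpret degenerate \<alpha> L using assms by unfold_locales
  show ?thesis using wave_solution[OF assms(1)] transposition_unique[OF assms(1)] by meson
qed

end
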